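(* Assume that Assumptions 1, 2 and 3 stated in the context hold and that $L_0\in U_{ad}$. For any $\epsilon>0$ and failure probability $\delta>0$, consider the model-free policy gradient method $$L_{k+1}=L_k-\eta\,\widehat{\nabla C}(L_k)$$ with $0<\eta<\eta^*$, where $\widehat{\nabla C}(L_k)$ is generated by the estimation algorithm described in the context with parameters $(N,l,r)$ such that $r\le h_r$, $l\ge h_l$ and $N\ge h_s$, where $$\eta^*=c\,(1+C(L_0))^{-5},\qquad h_r=\mathrm{Poly}\Big(\frac1{1+C(L_0)}\Big)\,\epsilon,\qquad h_l=\mathrm{Poly}(1+C(L_0))\,\frac1{\epsilon r},$$ $$h_s=\mathrm{Poly}(1+C(L_0))^{4l}\,\frac{l^2}{\epsilon^2r^2}\Big(\log\log(1/\epsilon)+\log(1/\delta)+\log(1/\eta)+\log(l)\Big),$$ for a suitable constant $c=c_{A,B,Q,R,\mu}>0$ and suitable polynomials $\mathrm{Poly}$ (conventions in the context). Then, with at least $1-\delta$ probability, at most at the $(k+1)$-th step, we have the performance guarantee $$C(L_{k+1})-C(L^* )<\epsilon,$$ where $$k=\Big\lceil\frac{\|\Sigma_{L^*}\|}{\eta\mu^2\underline\sigma_R}\log\frac{C(L_0)-C(L^* )}{\epsilon}\Big\rceil .$$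
   Context: Discrete-time infinite-horizon linear quadratic problem with random parameters. The state $x_t\in\mathbb{R}^n$ and control $u_t\in\mathbb{R}^m$ satisfy $x_{t+1}=A_{t+1}x_t+B_{t+1}u_t$, $t=0,1,2,\dots$, with $x_0\in\mathbb{R}^n$ drawn from an initial distribution $\mathcal{D}$ with finite second moment; the cost is $\sum_{t\ge0}\big(x_t^\top Q_{t+1}x_t+u_t^\top R_{t+1}u_t\big)$. Write $\Lambda_t=[A_t,\ B_t]\in\mathbb{R}^{n\times(n+m)}$ and let $N_t$ be the block-diagonal matrix with diagonal blocks $Q_t$ ($n\times n$) and $R_t$ ($m\times m$); $N_t$ is symmetric positive semidefinite. The random matrices $[\Lambda_t^\top,N_t]$, $t\ge1$, are independent and identically distributed; $[\Lambda^\top,\mathbf{N}]$ (with blocks $A,B,Q,R$) denotes an independent copy of $[\Lambda_1^\top,N_1]$ (the unsubscripted plain $N$ is the number of samples). $\|\cdot\|$ is the Euclidean norm of vectors and the operator norm of matrices, $\|\cdot\|_F$ the Frobenius norm; $\sigma_{\min}$ is the smallest singular value. Admissible set: for $L\in\mathbb{R}^{m\times n}$ let $\mathcal{F}_L(X)=\mathbb{E}[(A-BL)X(A-BL)^\top]$, a linear map on real symmetric $n\times n$ matrices, and $U_{ad}=\{L\in\mathbb{R}^{m\times n}:\rho(\mathcal{F}_L)<1\}$, where $\rho$ is the spectral radius. $L\in U_{ad}$ is equivalent to the feedback $u_t=-Lx_t$ being mean-square stabilizing, i.e. $\mathbb{E}[x_t^\top x_t]\to0$. Assumption 1: $\mathbb{E}\|x_0\|^2$,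 $\mathbb{E}\|\mathbf{N}\|$ and $\mathbb{E}\|\Lambda\|^2$ are finite, $\mathbb{E}[\mathbf{N}]$ is positive definite, and $(A,B)$ is mean-square stabilizable (there is a matrix $L$ for which $u_t=-Lx_t$ is mean-square stabilizing). Assumption 2: $\Sigma_0:=\mathbb{E}[x_0x_0^\top]$ is positive definite. Assumption 3: $x_0$ is a sub-Gaussian random vector with parameter $\sigma_0$, i.e. $\mathbb{E}\,e^{\lambda\langle u,x_0-\mathbb{E}x_0\rangle}\le e^{\sigma_0^2\lambda^2/2}$ for all $\lambda\in\mathbb{R}$ and all $u\in\mathbb{R}^n$ with $\|u\|=1$; and the random matrix $[\Lambda^\top,\mathbf{N}]$ is almost surely bounded, so that $\|A\|,\|B\|,\|Q\|,\|R\|\le K$ almost surely for some constant $K>0$. For $L\in U_{ad}$, with $x_t$ the state under $u_t=-Lx_t$, i.e. $x_{t+1}=(A_{t+1}-B_{t+1}L)x_t$, put $C(L)=\mathbb{E}\big[\sum_{t\ge0}x_t^\top(Q_{t+1}+L^\top R_{t+1}L)x_t\big]$ and $\Sigma_L=\mathbb{E}\big[\sum_{t\ge0}x_tx_t^\top\big]$. $L^*=\operatorname{argmin}_{L\in U_{ad}}C(L)$. $\mu=\sigma_{\min}(\Sigma_0)$ and $\underline\sigma_R=\sigma_{\min}(\mathbb{E}[R])$. Estimation algorithm. Input: current feedback matrix $L_k$, number of samples $N$, rollout length $l$, exploration radius $r$. For $i=1,\dots,N$: draw $U_i$ uniformly at random over the $m\times n$ matrices with Frobenius norm $r$ (the $U_i$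 being independent and identically distributed); simulate an $l$-step trajectory $(x_t^{(i)},c_t^{(i)})_{t=0}^{l-1}$ of the system under the linear feedback $u_t^{(i)}=-(L_k+U_i)x_t^{(i)}$ with $x_0^{(i)}\sim\mathcal{D}$, where $c_t^{(i)}=(x_t^{(i)})^\top Q_{t+1}^{(i)}x_t^{(i)}+(u_t^{(i)})^\top R_{t+1}^{(i)}u_t^{(i)}$ is the observed stage cost; set $\widehat C_i=\sum_{t=0}^{l-1}c_t^{(i)}$. Output: $$\widehat{\nabla C}(L_k)=\frac1N\sum_{i=1}^N\frac{mn}{r^2}\,\widehat C_i\,U_i .$$ Conventions. Model parameters are quantities only relevant to the intrinsic nature of the problem, such as $m$, $n$, $\mathbb{E}\|A\|^2$, $\mathbb{E}\|B\|^2$, $\mathbb{E}\|Q\|$, $\mathbb{E}\|R\|$, $\mathbb{E}\|x_0\|^2$, $\mu$, $\sigma_{\min}(\mathbb{E}[Q])$, $\sigma_{\min}(\mathbb{E}[R])$, $\|\Sigma_{L^*}\|$, $C(L^* )$, and their reciprocals (in $h_s$ also $\sigma_0$ and $K$). $\mathrm{Poly}(\cdot)$ denotes a polynomial (possibly a different one at each occurrence) depending on the model parameters and on the quantity in parentheses. $c_{A,B,Q,R,\mu}$ is a constant depending only on the model parameters attached to $A,B,Q,R$ and on $\mu$.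
   Formalization: In h_s, log log(1/ε) is replaced by max(0, log log(1/ε)), taken as 0 for ε ≥ 1, where the original is undefined (and tends to −∞ as ε → 1); the polynomials may also use 1/(1+θ) for model parameters θ and are chosen for fixed m, n. *)

theory Defs
  imports "HOL-Probability.Probability"
begin

subsection \<open>Matrices\<close>

text \<open>
  The library norm of \<open>real^'n^'m\<close> is the Frobenius norm; the operator norm is \<open>opnorm\<close>.
\<close>

definition opnorm :: "real^'n^'m \<Rightarrow> real" where
  "opnorm M = onorm ((*v) M)"

definition pos_semidef :: "real^'n^'n \<Rightarrow> bool" where
  "pos_semidef M \<longleftrightarrow> transpose M = M \<and> (\<forall>x. 0 \<le> x \<bullet> (M *v x))"

definition pos_def :: "real^'n^'n \<Rightarrow> bool" where
  "pos_def M \<longleftrightarrow> transpose M = M \<and> (\<forall>x. x \<noteq> 0 \<longrightarrow> 0 < x \<bullet> (M *v x))"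

definition singular_values :: "real^'n^'n \<Rightarrow> real set" where
  "singular_values M =
     {s. 0 \<le> s \<and> (\<exists>v. v \<noteq> 0 \<and> (transpose M ** M) *v v = s\<^sup>2 *\<^sub>R v)}"

definition sigma_min :: "real^'n^'n \<Rightarrow> real" where
  "sigma_min M = Min (singular_values M)"

definition outer :: "real^'n \<Rightarrow> real^'n \<Rightarrow> real^'n^'n" where
  "outer x y = (\<chi> i j. x $ i * y $ j)"

definition sym_matrices :: "(real^'n^'n) set" where
  "sym_matrices = {X. transpose X = X}"

text \<open>
  Complex eigenvalues of a real linear map \<open>F\<close> on a real subspace \<open>S\<close>: \<open>z\<close> is an eigenvalue of the
  complexification of \<open>F\<close>, with eigenvector \<open>X + \<i> Y\<close>, where \<open>X, Y \<in> S\<close>.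
\<close>

definition spectrum_on :: "'a::real_vector set \<Rightarrow> ('a \<Rightarrow> 'a) \<Rightarrow> complex set" where
  "spectrum_on S F =
     {z. \<exists>X\<in>S. \<exists>Y\<in>S. (X \<noteq> 0 \<or> Y \<noteq> 0) \<and>
         F X = Re z *\<^sub>R X - Im z *\<^sub>R Y \<and> F Y = Im z *\<^sub>R X + Re z *\<^sub>R Y}"

definition spectral_radius_on :: "'a::real_vector set \<Rightarrow> ('a \<Rightarrow> 'a) \<Rightarrow> real" where
  "spectral_radius_on S F = Max (cmod ` spectrum_on S F)"


subsection \<open>The linear quadratic problem\<close>

text \<open>
  A problem is given by the law \<open>D\<close> of the initial state and the common law \<open>P\<close> of the quadruples
  \<open>(A\<^sub>t, B\<^sub>t, Q\<^sub>t, R\<^sub>t)\<close>, \<open>t \<ge> 1\<close>.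
\<close>

type_synonym ('n, 'm) params = "(real^'n^'n) \<times> (real^'m^'n) \<times> (real^'n^'n) \<times> (real^'m^'m)"

definition parA :: "('n::finite, 'm::finite) params \<Rightarrow> real^'n^'n" where
  "parA p = fst p"

definition parB :: "('n::finite, 'm::finite) params \<Rightarrow> real^'m^'n" where
  "parB p = fst (snd p)"

definition parQ :: "('n::finite, 'm::finite) params \<Rightarrow> real^'n^'n" where
  "parQ p = fst (snd (snd p))"

definition parR :: "('n::finite, 'm::finite) params \<Rightarrow> real^'m^'m" where
  "parR p = snd (snd (snd p))"

definition Lam :: "('n::finite, 'm::finite) params \<Rightarrow> real^('n + 'm)^'n" where
  "Lam p = (\<chi> i j. case j of Inl a \<Rightarrow> parA p $ i $ a | Inr b \<Rightarrow> parB p $ i $ b)"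

definition Nmat :: "('n::finite, 'm::finite) params \<Rightarrow> real^('n + 'm)^('n + 'm)" where
  "Nmat p = (\<chi> i j. case (i, j) of
       (Inl a, Inl b) \<Rightarrow> parQ p $ a $ b
     | (Inr a, Inr b) \<Rightarrow> parR p $ a $ b
     | _ \<Rightarrow> 0)"

definition lq_problem :: "(real^'n) measure \<Rightarrow> ('n::finite, 'm::finite) params measure \<Rightarrow> bool" where
  "lq_problem D P \<longleftrightarrow>
     prob_space D \<and> sets D = sets borel \<and>
     prob_space P \<and> sets P = sets borel \<and>
     (AE p in P. pos_semidef (Nmat p))"

text \<open>
  An outcome \<open>w = (x\<^sub>0, \<xi>)\<close> consists of an initial state and an independent i.i.d. sequence of
  parameters, where \<open>\<xi> t\<close> is the quadruple with time index \<open>t + 1\<close>.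
\<close>

type_synonym ('n, 'm) outcome = "(real^'n) \<times> (nat \<Rightarrow> ('n, 'm) params)"

definition traj_space ::
  "(real^'n) measure \<Rightarrow> ('n::finite, 'm::finite) params measure \<Rightarrow> ('n, 'm) outcome measure" where
  "traj_space D P = D \<Otimes>\<^sub>M (\<Pi>\<^sub>M t\<in>UNIV. P)"

text \<open>The state \<open>x\<^sub>t\<close> under the feedback \<open>u\<^sub>t = - L x\<^sub>t\<close>.\<close>

primrec state :: "real^'n^'m \<Rightarrow> ('n::finite, 'm::finite) outcome \<Rightarrow> nat \<Rightarrow> real^'n" where
  "state L w 0 = fst w"
| "state L w (Suc t) =
     parA (snd w t) *v state L w t + parB (snd w t) *v (- (L *v state L w t))"

definition ms_stabilizing ::
  "(real^'n) measure \<Rightarrow> ('n::finite, 'm::finite) params measure \<Rightarrow> real^'n^'m \<Rightarrow> bool" where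
  "ms_stabilizing D P L \<longleftrightarrow>
     (\<lambda>t. LINT w|traj_space D P. state L w t \<bullet> state L w t) \<longlonglongrightarrow> 0"

definition cl_map ::
  "('n::finite, 'm::finite) params measure \<Rightarrow> real^'n^'m \<Rightarrow> real^'n^'n \<Rightarrow> real^'n^'n" where
  "cl_map P L X =
     (LINT p|P. (parA p - parB p ** L) ** X ** transpose (parA p - parB p ** L))"

definition U_ad :: "('n::finite, 'm::finite) params measure \<Rightarrow> (real^'n^'m) set" where
  "U_ad P = {L. spectral_radius_on sym_matrices (cl_map P L) < 1}"

text \<open>
  \<open>cost\<close> and \<open>state_cov\<close> are meaningful only for \<open>L \<in> U_ad P\<close>: elsewhere the sums and
  integrals need not converge, and the library operators then return an arbitrary value.
\<close>

definition cost ::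
  "(real^'n) measure \<Rightarrow> ('n::finite, 'm::finite) params measure \<Rightarrow> real^'n^'m \<Rightarrow> real" where
  "cost D P L =
     (LINT w|traj_space D P. (\<Sum>t. state L w t \<bullet>
        ((parQ (snd w t) + transpose L ** parR (snd w t) ** L) *v state L w t)))"

definition state_cov ::
  "(real^'n) measure \<Rightarrow> ('n::finite, 'm::finite) params measure \<Rightarrow> real^'n^'m \<Rightarrow> real^'n^'n" where
  "state_cov D P L = (LINT w|traj_space D P. (\<Sum>t. outer (state L w t) (state L w t)))"

definition L_opt ::
  "(real^'n) measure \<Rightarrow> ('n::finite, 'm::finite) params measure \<Rightarrow> real^'n^'m" where
  "L_opt D P = arg_min_on (cost D P) (U_ad P)"

definition Sigma0 :: "(real^'n) measure \<Rightarrow> real^'n^'n" where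
  "Sigma0 D = (LINT x|D. outer x x)"

definition mu :: "(real^'n) measure \<Rightarrow> real" where
  "mu D = sigma_min (Sigma0 D)"

definition sigma_R :: "('n::finite, 'm::finite) params measure \<Rightarrow> real" where
  "sigma_R P = sigma_min (LINT p|P. parR p)"


subsection \<open>Assumptions\<close>

definition moments_stabilizable ::
  "(real^'n) measure \<Rightarrow> ('n::finite, 'm::finite) params measure \<Rightarrow> bool" where
  "moments_stabilizable D P \<longleftrightarrow>
     integrable D (\<lambda>x. (norm x)\<^sup>2) \<and>
     integrable P (\<lambda>p. opnorm (Nmat p)) \<and>
     integrable P (\<lambda>p. (opnorm (Lam p))\<^sup>2) \<and>
     pos_def (LINT p|P. Nmat p) \<and>
     (\<exists>L. ms_stabilizing D P L)"

text \<open>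
  The exponential moments are written as nonnegative integrals, so that their finiteness is part of
  the condition.
\<close>

definition sub_gaussian :: "(real^'n) measure \<Rightarrow> real \<Rightarrow> bool" where
  "sub_gaussian D \<sigma> \<longleftrightarrow>
     (\<forall>s u. norm u = 1 \<longrightarrow>
        (\<integral>\<^sup>+ x. ennreal (exp (s * (u \<bullet> (x - (LINT y|D. y))))) \<partial>D)
          \<le> ennreal (exp (\<sigma>\<^sup>2 * s\<^sup>2 / 2)))"

definition as_bounded :: "('n::finite, 'm::finite) params measure \<Rightarrow> real \<Rightarrow> bool" where
  "as_bounded P K \<longleftrightarrow>
     (AE p in P. opnorm (parA p) \<le> K \<and> opnorm (parB p) \<le> K \<and>
                 opnorm (parQ p) \<le> K \<and> opnorm (parR p) \<le> K)"


subsection \<open>The estimation algorithm and the policy gradient iteration\<close>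

text \<open>The uniform law on the sphere of radius \<open>r\<close> is the radial projection of the uniform law on
  the unit ball.\<close>

definition uniform_sphere :: "real \<Rightarrow> 'a::euclidean_space measure" where
  "uniform_sphere r = distr (uniform_measure lborel (ball 0 1)) borel (\<lambda>z. r *\<^sub>R sgn z)"

text \<open>A sample \<open>(U, w)\<close> consists of a random direction and an outcome, drawn independently.\<close>

type_synonym ('n, 'm) sample = "(real^'n^'m) \<times> ('n, 'm) outcome"

definition sample_law ::
  "(real^'n) measure \<Rightarrow> ('n::finite, 'm::finite) params measure \<Rightarrow> real \<Rightarrow> ('n, 'm) sample measure"
where
  "sample_law D P r = uniform_sphere r \<Otimes>\<^sub>M traj_space D P"

definition stage_cost :: "real^'n^'m \<Rightarrow> ('n::finite, 'm::finite) outcome \<Rightarrow> nat \<Rightarrow> real" where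
  "stage_cost L w t =
     (let x = state L w t; u = - (L *v x)
      in x \<bullet> (parQ (snd w t) *v x) + u \<bullet> (parR (snd w t) *v u))"

definition rollout_cost :: "real^'n^'m \<Rightarrow> nat \<Rightarrow> ('n::finite, 'm::finite) sample \<Rightarrow> real" where
  "rollout_cost L l s = (\<Sum>t<l. stage_cost (L + fst s) (snd s) t)"

definition grad_est ::
  "nat \<Rightarrow> nat \<Rightarrow> real \<Rightarrow> real^'n^'m \<Rightarrow> (nat \<Rightarrow> ('n::finite, 'm::finite) sample) \<Rightarrow> real^'n^'m" where
  "grad_est N l r L s =
     (1 / real N) *\<^sub>R (\<Sum>i<N.
        (real CARD('m) * real CARD('n) / r\<^sup>2 * rollout_cost L l (s i)) *\<^sub>R fst (s i))"

text \<open>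
  \<open>\<omega> (k, i)\<close> is the \<open>i\<close>-th sample of the \<open>k\<close>-th iteration; fresh samples are drawn at each
  iteration.
\<close>

definition run_space ::
  "(real^'n) measure \<Rightarrow> ('n::finite, 'm::finite) params measure \<Rightarrow> real
     \<Rightarrow> (nat \<times> nat \<Rightarrow> ('n, 'm) sample) measure" where
  "run_space D P r = (\<Pi>\<^sub>M j\<in>UNIV. sample_law D P r)"

primrec iterate ::
  "nat \<Rightarrow> nat \<Rightarrow> real \<Rightarrow> real \<Rightarrow> real^'n^'m \<Rightarrow> (nat \<times> nat \<Rightarrow> ('n::finite, 'm::finite) sample)
     \<Rightarrow> nat \<Rightarrow> real^'n^'m" where
  "iterate N l r \<eta> L0 \<omega> 0 = L0"
| "iterate N l r \<eta> L0 \<omega> (Suc k) =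
     iterate N l r \<eta> L0 \<omega> k
       - \<eta> *\<^sub>R grad_est N l r (iterate N l r \<eta> L0 \<omega> k) (\<lambda>i. \<omega> (k, i))"


subsection \<open>Model parameters and polynomials in them\<close>

datatype model_param =
    Dim_n | Dim_m | Mean_A2 | Mean_B2 | Mean_Q | Mean_R | Sig_Q | Sig_R | Mu
  | Mean_x2 | Cov_opt | Cost_opt | Sub_gauss | Bound_K

instance model_param :: finite
proof
  have "(UNIV :: model_param set) =
      {Dim_n, Dim_m, Mean_A2, Mean_B2, Mean_Q, Mean_R, Sig_Q, Sig_R, Mu,
       Mean_x2, Cov_opt, Cost_opt, Sub_gauss, Bound_K}"
    using model_param.exhaust by blast
  then show "finite (UNIV :: model_param set)"
    by (metis finite.emptyI finite.insertI)
qed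

primrec param_value ::
  "(real^'n) measure \<Rightarrow> ('n::finite, 'm::finite) params measure \<Rightarrow> real \<Rightarrow> real
     \<Rightarrow> model_param \<Rightarrow> real" where
  "param_value D P \<sigma>0 K Dim_n = real CARD('n)"
| "param_value D P \<sigma>0 K Dim_m = real CARD('m)"
| "param_value D P \<sigma>0 K Mean_A2 = (LINT p|P. (opnorm (parA p))\<^sup>2)"
| "param_value D P \<sigma>0 K Mean_B2 = (LINT p|P. (opnorm (parB p))\<^sup>2)"
| "param_value D P \<sigma>0 K Mean_Q = (LINT p|P. opnorm (parQ p))"
| "param_value D P \<sigma>0 K Mean_R = (LINT p|P. opnorm (parR p))"
| "param_value D P \<sigma>0 K Sig_Q = sigma_min (LINT p|P. parQ p)"
| "param_value D P \<sigma>0 K Sig_R = sigma_R P"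
| "param_value D P \<sigma>0 K Mu = mu D"
| "param_value D P \<sigma>0 K Mean_x2 = (LINT x|D. (norm x)\<^sup>2)"
| "param_value D P \<sigma>0 K Cov_opt = opnorm (state_cov D P (L_opt D P))"
| "param_value D P \<sigma>0 K Cost_opt = cost D P (L_opt D P)"
| "param_value D P \<sigma>0 K Sub_gauss = \<sigma>0"
| "param_value D P \<sigma>0 K Bound_K = K"

definition system_params :: "model_param set" where
  "system_params = {Dim_n, Dim_m, Mean_A2, Mean_B2, Mean_Q, Mean_R, Sig_Q, Sig_R, Mu}"

definition intrinsic_params :: "model_param set" where
  "intrinsic_params = UNIV - {Sub_gauss, Bound_K}"

text \<open>Only the parameters in \<open>S\<close> are visible; the others are replaced by 0.\<close>

definition param_vec ::
  "(real^'n) measure \<Rightarrow> ('n::finite, 'm::finite) params measure \<Rightarrow> real \<Rightarrow> real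
     \<Rightarrow> model_param set \<Rightarrow> real^model_param" where
  "param_vec D P \<sigma>0 K S = (\<chi> i. if i \<in> S then param_value D P \<sigma>0 K i else 0)"

text \<open>
  A polynomial depending on the model parameters \<open>\<theta>\<close> and on a quantity \<open>z\<close> is a polynomial function
  with arguments \<open>\<theta>\<^sub>i\<close>, \<open>1 / \<theta>\<^sub>i\<close>, \<open>1 / (1 + \<theta>\<^sub>i)\<close> and \<open>z\<close>. The third group counts \<open>1 + \<theta>\<^sub>i\<close> among
  the model parameters. It is needed where a polynomial serves as a small positive upper bound: a
  Laurent polynomial in \<open>\<theta>\<^sub>i\<close> cannot decay as \<open>\<theta>\<^sub>i \<rightarrow> \<infinity>\<close> and stay bounded as \<open>\<theta>\<^sub>i \<rightarrow> 0\<close>.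
\<close>

type_synonym poly_fun =
  "(real^model_param) \<times> (real^model_param) \<times> (real^model_param) \<times> real \<Rightarrow> real"

definition poly_at :: "poly_fun \<Rightarrow> real^model_param \<Rightarrow> real \<Rightarrow> real" where
  "poly_at q \<theta> z = q (\<theta>, (\<chi> i. 1 / \<theta> $ i), (\<chi> i. 1 / (1 + \<theta> $ i)), z)"


subsection \<open>The thresholds\<close>

text \<open>
  In the sample size the term \<open>log (log (1/\<epsilon>))\<close> is truncated at 0: it is undefined for \<open>\<epsilon> \<ge> 1\<close> and
  tends to \<open>-\<infinity>\<close> as \<open>\<epsilon>\<close> increases to 1.
\<close>

definition h_s_of :: "real \<Rightarrow> real \<Rightarrow> real \<Rightarrow> real \<Rightarrow> real \<Rightarrow> nat \<Rightarrow> real" where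
  "h_s_of q \<epsilon> \<delta> \<eta> r l =
     q ^ (4 * l) * ((real l)\<^sup>2 / (\<epsilon>\<^sup>2 * r\<^sup>2)) *
       (ln (max 1 (ln (1 / \<epsilon>))) + ln (1 / \<delta>) + ln (1 / \<eta>) + ln (real l))"

definition num_steps ::
  "(real^'n) measure \<Rightarrow> ('n::finite, 'm::finite) params measure \<Rightarrow> real^'n^'m \<Rightarrow> real \<Rightarrow> real \<Rightarrow> int"
where
  "num_steps D P L0 \<eta> \<epsilon> =
     \<lceil>opnorm (state_cov D P (L_opt D P)) / (\<eta> * (mu D)\<^sup>2 * sigma_R P) *
        ln ((cost D P L0 - cost D P (L_opt D P)) / \<epsilon>)\<rceil>"

end

theory Submission
  imports Defs
begin

text \<open>
  Admissibility of a feedback matrix is equivalent to a strict Lyapunov inequality, which survives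
  perturbations of size controlled by the cost. Expanding the cost difference of two
  admissible matrices exactly yields both gradient domination and quadratic smoothness on sublevel
  sets. A uniform direction \<open>U\<close> on the sphere of radius \<open>r\<close> has mean 0 and \<open>E (G \<bullet> U) U = (r\<^sup>2 / m n) G\<close>, so
  by smoothness the expectation of the gradient estimate is within \<open>O(r)\<close> of the gradient, up to the
  effect of truncating the rollouts, which is \<open>O(1 / (l r))\<close>. A rollout cost is at most a constant times
  \<open>\<parallel>x\<^sub>0\<parallel>\<^sup>2\<close>, hence sub-exponential, and a Chernoff bound controls the statistical error. Outside an
  event of probability \<open>\<delta>\<close>, given by a union bound over the iterations, every step either contracts
  \<open>C(L) - C(L\<^sup>*)\<close> by a fixed factor or keeps it below \<open>\<epsilon>\<close>.
\<close>

section \<open>Positive semidefinite matrices\<close>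

text \<open>The cost has a meaning only on the admissible set, so no estimate may leave it. All
  constants are therefore expressed through \<open>w\<close>, which dominates the relevant model
  quantities, and an upper bound \<open>c\<close> of the cost; they are uniform on the initial
  sublevel set, and the iteration is shown to stay there. No derivative is taken: \<open>GL\<close>
  enters through the second-order inequality of \<open>smoothness\<close> and through
  \<open>gradient_domination\<close>. The Lyapunov certificate for a perturbed feedback matrix is
  the covariance \<open>Sg\<close> of the unperturbed one. Mean-square stability does not control
  single trajectories, so a rollout is bounded by its worst growth under the almost sure bound
  \<open>K\<close>; this is the origin of the power \<open>4 * l\<close> in the sample size. The
  double logarithm comes from the union bound: the number of iterations is of order
  \<open>ln (1 / \<epsilon>) / \<eta>\<close>, and its logarithm has to be paid for in the exponent
  of the Chernoff bound.\<close>

declare transpose_matrix_vector [simp del]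

lemma bounded_bilinear_matrix_mult:
  "bounded_bilinear ((**) :: real^'n^'m \<Rightarrow> real^'p^'n \<Rightarrow> real^'p^'m)"
  unfolding bilinear_conv_bounded_bilinear[symmetric] bilinear_def linear_iff
  by (auto simp: vec_eq_iff matrix_matrix_mult_def sum.distrib sum_distrib_left algebra_simps)

lemma bounded_bilinear_matrix_vector_mult:
  "bounded_bilinear ((*v) :: real^'n^'m \<Rightarrow> real^'n \<Rightarrow> real^'m)"
  unfolding bilinear_conv_bounded_bilinear[symmetric] bilinear_def linear_iff
  by (auto simp: vec_eq_iff matrix_vector_mult_def sum.distrib sum_distrib_left algebra_simps)

lemmas matrix_mult_simps =
  bounded_bilinear.add_left[OF bounded_bilinear_matrix_mult]
  bounded_bilinear.add_right[OF bounded_bilinear_matrix_mult]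
  bounded_bilinear.diff_left[OF bounded_bilinear_matrix_mult]
  bounded_bilinear.diff_right[OF bounded_bilinear_matrix_mult]
  bounded_bilinear.scaleR_left[OF bounded_bilinear_matrix_mult]
  bounded_bilinear.scaleR_right[OF bounded_bilinear_matrix_mult]
  bounded_bilinear.minus_left[OF bounded_bilinear_matrix_mult]
  bounded_bilinear.minus_right[OF bounded_bilinear_matrix_mult]
  bounded_bilinear.zero_left[OF bounded_bilinear_matrix_mult]
  bounded_bilinear.zero_right[OF bounded_bilinear_matrix_mult]

lemmas matrix_vector_simps =
  bounded_bilinear.add_left[OF bounded_bilinear_matrix_vector_mult]
  bounded_bilinear.add_right[OF bounded_bilinear_matrix_vector_mult]
  bounded_bilinear.diff_left[OF bounded_bilinear_matrix_vector_mult]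
  bounded_bilinear.diff_right[OF bounded_bilinear_matrix_vector_mult]
  bounded_bilinear.scaleR_left[OF bounded_bilinear_matrix_vector_mult]
  bounded_bilinear.scaleR_right[OF bounded_bilinear_matrix_vector_mult]
  bounded_bilinear.minus_left[OF bounded_bilinear_matrix_vector_mult]
  bounded_bilinear.minus_right[OF bounded_bilinear_matrix_vector_mult]
  bounded_bilinear.zero_left[OF bounded_bilinear_matrix_vector_mult]
  bounded_bilinear.zero_right[OF bounded_bilinear_matrix_vector_mult]

lemma linear_transpose: "linear (transpose :: real^'n^'m \<Rightarrow> real^'m^'n)"
  by (auto simp: linear_iff transpose_def vec_eq_iff)

lemma transpose_add: "transpose (X + Y) = transpose X + transpose (Y :: real^'n^'m)"
  and transpose_diff: "transpose (X - Y) = transpose X - transpose (Y :: real^'n^'m)"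
  and transpose_minus: "transpose (- X) = - transpose (X :: real^'n^'m)"
  and transpose_zero: "transpose (0 :: real^'n^'m) = 0"
  by (simp_all add: transpose_def vec_eq_iff)

lemmas transpose_simps = transpose_add transpose_diff transpose_minus transpose_zero
  transpose_scalar matrix_transpose_mul

lemma continuous_on_matrix_mult [continuous_intros]:
  "continuous_on S f \<Longrightarrow> continuous_on S g \<Longrightarrow>
    continuous_on S (\<lambda>x. (f x :: real^'n^'m) ** (g x :: real^'p^'n))"
  by (rule bounded_bilinear.continuous_on[OF bounded_bilinear_matrix_mult])

lemma continuous_on_matrix_vector_mult' [continuous_intros]:
  "continuous_on S f \<Longrightarrow> continuous_on S g \<Longrightarrow>
    continuous_on S (\<lambda>x. (f x :: real^'n^'m) *v (g x :: real^'n))"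
  by (rule bounded_bilinear.continuous_on[OF bounded_bilinear_matrix_vector_mult])

lemma continuous_on_transpose [continuous_intros]:
  "continuous_on S f \<Longrightarrow> continuous_on S (\<lambda>x. transpose (f x :: real^'n^'m))"
  by (rule continuous_on_compose2[OF linear_continuous_on[OF linear_transpose[unfolded linear_conv_bounded_linear]]]) auto

lemma bilinear_outer: "bounded_bilinear (outer :: real^'n \<Rightarrow> real^'n \<Rightarrow> real^'n^'n)"
  unfolding bilinear_conv_bounded_bilinear[symmetric] bilinear_def linear_iff
  by (auto simp: outer_def vec_eq_iff algebra_simps)

lemma continuous_on_outer [continuous_intros]:
  "continuous_on S f \<Longrightarrow> continuous_on S g \<Longrightarrow>
    continuous_on S (\<lambda>x. outer (f x :: real^'n) (g x))"
  by (rule bounded_bilinear.continuous_on[OF bilinear_outer])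

lemma inner_matrix_vector: "x \<bullet> (X *v y) = (transpose X *v x) \<bullet> (y :: real^'n)"
  by (simp add: dot_lmul_matrix transpose_matrix_vector)

lemma inner_matrix_vector': "(X *v y) \<bullet> x = y \<bullet> (transpose X *v (x :: real^'n))"
  by (metis inner_commute inner_matrix_vector)

lemma inner_outer: "X \<bullet> outer x y = x \<bullet> (X *v (y :: real^'n))"
  by (simp add: inner_vec_def outer_def matrix_vector_mult_def sum_distrib_left ac_simps)

lemma inner_transpose: "transpose X \<bullet> transpose Y = X \<bullet> (Y :: real^'n^'m)"
  unfolding inner_vec_def transpose_def by simp (rule sum.swap)

lemma inner_transpose_left: "transpose X \<bullet> Y = X \<bullet> transpose (Y :: real^'n^'m)"
  by (metis inner_transpose transpose_transpose)

lemma norm_transpose: "norm (transpose X) = norm (X :: real^'n^'m)"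
  by (simp add: norm_eq_sqrt_inner inner_transpose)

text \<open>The inner product of matrices is tr(X^T Y). The adjunctions here and in
  \<open>inner_mult_right\<close> take the place of the cyclicity of the trace.\<close>

lemma inner_mult_left: "(X ** Y) \<bullet> Z = Y \<bullet> (transpose X ** (Z :: real^'n^'m))"
  for X :: "real^'p^'m"
proof -
  have "(X ** Y) \<bullet> Z = (\<Sum>i\<in>UNIV. \<Sum>j\<in>UNIV. \<Sum>k\<in>UNIV. X$i$k * Y$k$j * Z$i$j)"
    by (simp add: inner_vec_def matrix_matrix_mult_def sum_distrib_right)
  also have "\<dots> = (\<Sum>k\<in>UNIV. \<Sum>j\<in>UNIV. \<Sum>i\<in>UNIV. X$i$k * Y$k$j * Z$i$j)"
  proof -
    have "(\<Sum>i\<in>UNIV. \<Sum>j\<in>UNIV. \<Sum>k\<in>UNIV. X$i$k * Y$k$j * Z$i$j)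
      = (\<Sum>i\<in>UNIV. \<Sum>k\<in>UNIV. \<Sum>j\<in>UNIV. X$i$k * Y$k$j * Z$i$j)"
      by (intro sum.cong refl sum.swap)
    also have "\<dots> = (\<Sum>k\<in>UNIV. \<Sum>i\<in>UNIV. \<Sum>j\<in>UNIV. X$i$k * Y$k$j * Z$i$j)"
      by (rule sum.swap)
    also have "\<dots> = (\<Sum>k\<in>UNIV. \<Sum>j\<in>UNIV. \<Sum>i\<in>UNIV. X$i$k * Y$k$j * Z$i$j)"
      by (intro sum.cong refl sum.swap)
    finally show ?thesis .
  qed
  also have "\<dots> = Y \<bullet> (transpose X ** Z)"
    by (simp add: inner_vec_def matrix_matrix_mult_def sum_distrib_left transpose_def ac_simps)
  finally show ?thesis .
qed

lemma inner_mult_right: "(X ** Y) \<bullet> Z = X \<bullet> ((Z :: real^'n^'m) ** transpose Y)"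
  for X :: "real^'p^'m"
proof -
  have "(X ** Y) \<bullet> Z = (transpose Y ** transpose X) \<bullet> transpose Z"
    by (metis inner_transpose matrix_transpose_mul)
  also have "\<dots> = transpose X \<bullet> (Y ** transpose Z)"
    by (simp add: inner_mult_left)
  also have "\<dots> = X \<bullet> (Z ** transpose Y)"
    by (simp add: inner_transpose_left transpose_simps)
  finally show ?thesis .
qed

lemma outer_apply: "outer x y *v z = (y \<bullet> z) *\<^sub>R (x :: real^'n)"
  by (simp add: vec_eq_iff outer_def matrix_vector_mult_def inner_vec_def sum_distrib_left ac_simps)

lemma transpose_outer: "transpose (outer x y) = outer y (x :: real^'n)"
  by (simp add: transpose_def outer_def vec_eq_iff)

lemma inner_mat_1: "mat 1 \<bullet> X = trace (X :: real^'n^'n)"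
proof -
  have "(if i = j then 1 else 0) * X$i$j = (if j = i then X$i$j else 0)" for i j by simp
  then show ?thesis
    by (simp add: inner_vec_def mat_def trace_def)
qed

lemma linear_trace: "linear (trace :: real^'n^'n \<Rightarrow> real)"
  by (auto simp: linear_iff trace_def sum.distrib sum_distrib_left)

lemma trace_outer: "trace (outer x y) = x \<bullet> (y :: real^'n)"
  by (simp add: trace_def outer_def inner_vec_def)

lemma norm_matrix_vector_le: "norm (X *v v) \<le> norm X * norm (v :: real^'n)" for X :: "real^'n^'m"
proof -
  have "(norm (X *v v))\<^sup>2 = (\<Sum>i\<in>UNIV. (X$i \<bullet> v)\<^sup>2)"
    unfolding power2_norm_eq_inner inner_vec_def[of "X *v v"]
    by (simp add: matrix_mult_dot power2_eq_square)
  also have "\<dots> \<le> (\<Sum>i\<in>UNIV. (norm (X$i))\<^sup>2 * (norm v)\<^sup>2)"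
    by (intro sum_mono) (metis Cauchy_Schwarz_ineq power2_norm_eq_inner)
  also have "\<dots> = (norm X * norm v)\<^sup>2"
    by (simp add: power_mult_distrib power2_norm_eq_inner inner_vec_def[of X] sum_distrib_right)
  finally show ?thesis
    by (rule power2_le_imp_le) simp
qed

lemma norm_matrix_mult_le: "norm (X ** Y) \<le> norm X * norm (Y :: real^'p^'n)" for X :: "real^'n^'m"
proof -
  have row: "(X ** Y)$i = transpose Y *v X$i" for i
    by (simp add: vec_eq_iff matrix_matrix_mult_def matrix_vector_mult_def transpose_def ac_simps)
  have "(norm (X ** Y))\<^sup>2 = (\<Sum>i\<in>UNIV. (norm ((X ** Y)$i))\<^sup>2)"
    by (simp add: power2_norm_eq_inner inner_vec_def[of "X ** Y"])
  also have "\<dots> \<le> (\<Sum>i\<in>UNIV. (norm Y * norm (X$i))\<^sup>2)"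
    unfolding row
    by (intro sum_mono power_mono) (metis norm_matrix_vector_le norm_transpose, simp)
  also have "\<dots> = (norm X * norm Y)\<^sup>2"
    by (simp add: power_mult_distrib power2_norm_eq_inner inner_vec_def[of X] sum_distrib_left ac_simps)
  finally show ?thesis
    by (rule power2_le_imp_le) simp
qed

lemma opnorm_apply: "norm (X *v v) \<le> opnorm X * norm (v :: real^'n)" for X :: "real^'n^'m"
  unfolding opnorm_def by (intro onorm) (rule matrix_vector_mul_bounded_linear)

lemma opnorm_nonneg: "0 \<le> opnorm (X :: real^'n^'m)"
  unfolding opnorm_def by (intro onorm_pos_le) (rule matrix_vector_mul_bounded_linear)

lemma opnorm_le_norm: "opnorm X \<le> norm (X :: real^'n^'m)"
  unfolding opnorm_def by (intro onorm_le norm_matrix_vector_le)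

lemma opnorm_triangle: "opnorm (X + Y) \<le> opnorm X + opnorm (Y :: real^'n^'m)"
proof -
  have "onorm (\<lambda>v. X *v v + Y *v v) \<le> onorm ((*v) X) + onorm ((*v) Y)"
    by (intro onorm_triangle matrix_vector_mul_bounded_linear)
  moreover have "(*v) (X + Y) = (\<lambda>v. X *v v + Y *v v)"
    by (simp add: fun_eq_iff matrix_vector_simps)
  ultimately show ?thesis by (simp add: opnorm_def)
qed

lemma opnorm_minus: "opnorm (- X) = opnorm (X :: real^'n^'m)"
proof -
  have "(*v) (- X) = (\<lambda>v. - (X *v v))"
    by (simp add: fun_eq_iff matrix_vector_simps)
  then show ?thesis using onorm_neg[of "(*v) X"] by (simp add: opnorm_def)
qed

lemma continuous_on_opnorm [continuous_intros]:
  assumes "continuous_on S f"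
  shows "continuous_on S (\<lambda>x. opnorm (f x :: real^'n^'m))"
proof -
  have "\<bar>opnorm X - opnorm Y\<bar> \<le> 1 * norm (X - Y)" for X Y :: "real^'n^'m"
    using opnorm_triangle[of Y "X - Y"] opnorm_triangle[of X "Y - X"] opnorm_minus[of "X - Y"]
      opnorm_le_norm[of "X - Y"] by simp
  then have "1-lipschitz_on UNIV (opnorm :: real^'n^'m \<Rightarrow> real)"
    by (intro lipschitz_onI) (auto simp: dist_norm)
  then have "continuous_on UNIV (opnorm :: real^'n^'m \<Rightarrow> real)"
    by (rule lipschitz_on_continuous_on)
  from continuous_on_compose2[OF this assms] show ?thesis by simp
qed

text \<open>Column by column: each column is the image of a unit vector. This turns the almost sure
  operator norm bounds into Frobenius bounds, under which the parameters form a bounded set.\<close>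

lemma norm_le_opnorm: "norm X \<le> sqrt (real CARD('n)) * opnorm (X :: real^'n^'m)"
proof -
  have col: "transpose X $ j = X *v axis j 1" for j
    by (simp add: matrix_vector_mult_basis column_def transpose_def)
  have "(norm X)\<^sup>2 = (\<Sum>j\<in>UNIV. (norm (transpose X $ j))\<^sup>2)"
    by (subst norm_transpose[symmetric])
      (simp add: power2_norm_eq_inner inner_vec_def[of "transpose X"])
  also have "\<dots> \<le> (\<Sum>j\<in>(UNIV::'n set). (opnorm X)\<^sup>2)"
    unfolding col
    by (intro sum_mono power_mono) (metis norm_axis_1 mult.right_neutral opnorm_apply, simp)
  also have "\<dots> = (sqrt (real CARD('n)) * opnorm X)\<^sup>2"
    by (simp add: power_mult_distrib)
  finally show ?thesis
    by (rule power2_le_imp_le) (simp add: opnorm_nonneg)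
qed

section \<open>The Loewner order, traces and Frobenius products\<close>

abbreviation psd :: "real^'n^'n \<Rightarrow> bool" where "psd \<equiv> pos_semidef"

lemma psdI: "transpose X = X \<Longrightarrow> (\<And>x. 0 \<le> x \<bullet> (X *v x)) \<Longrightarrow> psd X"
  by (simp add: pos_semidef_def)

lemma psd_sym: "psd X \<Longrightarrow> transpose X = X"
  by (simp add: pos_semidef_def)

lemma psd_ge0: "psd X \<Longrightarrow> 0 \<le> x \<bullet> (X *v x)"
  by (simp add: pos_semidef_def)

lemma psd_zero [simp]: "psd 0"
  by (simp add: pos_semidef_def transpose_simps)

lemma psd_add: "psd X \<Longrightarrow> psd Y \<Longrightarrow> psd (X + Y)"
  by (auto simp: pos_semidef_def transpose_simps matrix_vector_simps inner_add_right)

lemma psd_scaleR: "psd X \<Longrightarrow> 0 \<le> c \<Longrightarrow> psd (c *\<^sub>R X)"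
  by (auto simp: pos_semidef_def transpose_simps matrix_vector_simps)

lemma psd_sum: "(\<And>i. i \<in> I \<Longrightarrow> psd (f i)) \<Longrightarrow> psd (sum f I)"
  by (induction I rule: infinite_finite_induct) (auto intro: psd_add)

lemma psd_mat1: "psd (mat 1)"
  by (auto simp: pos_semidef_def)

lemma psd_outer: "psd (outer v v)"
  by (auto simp: pos_semidef_def transpose_outer outer_apply inner_commute)

lemma psd_congruence: "psd X \<Longrightarrow> psd (M ** X ** transpose M)" for M :: "real^'n^'m"
proof -
  assume X: "psd X"
  have "x \<bullet> ((M ** X ** transpose M) *v x) = (transpose M *v x) \<bullet> (X *v (transpose M *v x))" for x
    by (simp only: matrix_vector_mul_assoc[symmetric] inner_matrix_vector[of x M])
  then show ?thesis
    using psd_ge0[OF X] psd_sym[OF X] by (auto intro!: psdI simp: transpose_simps matrix_mul_assoc)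
qed

lemma psd_congruence': "psd X \<Longrightarrow> psd (transpose M ** X ** M)" for M :: "real^'n^'m"
  using psd_congruence[of X "transpose M"] by simp

lemma psd_diff_trans: "psd (Z - Y) \<Longrightarrow> psd (Y - X) \<Longrightarrow> psd (Z - X)"
  using psd_add[of "Z - Y" "Y - X"] by simp

lemma closed_psd: "closed {X :: real^'n^'n. psd X}"
proof -
  have "{X :: real^'n^'n. psd X} = {X. transpose X = X} \<inter> (\<Inter>x. {X. 0 \<le> x \<bullet> (X *v x)})"
    by (auto simp: pos_semidef_def)
  also have "closed \<dots>"
    by (intro closed_Int closed_INT ballI closed_Collect_eq closed_Collect_le continuous_intros)
  finally show ?thesis .
qed

lemma psd_limit: "(\<And>n. psd (f n)) \<Longrightarrow> f \<longlonglongrightarrow> X \<Longrightarrow> psd X"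
  using closed_sequentially[OF closed_psd, of f X] by simp

lemma psd_form_add_scaleR:
  assumes "psd X"
  shows "(x + t *\<^sub>R y) \<bullet> (X *v (x + t *\<^sub>R y))
    = x \<bullet> (X *v x) + 2 * t * (x \<bullet> (X *v y)) + t\<^sup>2 * (y \<bullet> (X *v y))"
proof -
  have "y \<bullet> (X *v x) = x \<bullet> (X *v y)"
    by (simp add: inner_commute[of y] inner_matrix_vector' psd_sym[OF assms])
  then show ?thesis
    by (simp add: matrix_vector_simps inner_add_left inner_add_right power2_eq_square algebra_simps)
qed

text \<open>The discriminant of the nonnegative quadratic
  \<open>a + 2 * t * b + t\<^sup>2 * c\<close> in \<open>t\<close>.\<close>

lemma psd_Cauchy_Schwarz:
  assumes "psd X"
  shows "(x \<bullet> (X *v y))\<^sup>2 \<le> (x \<bullet> (X *v x)) * (y \<bullet> (X *v y))"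
proof -
  define a b c where "a = x \<bullet> (X *v x)" and "b = x \<bullet> (X *v y)" and "c = y \<bullet> (X *v y)"
  have q: "0 \<le> a + 2 * t * b + t\<^sup>2 * c" for t
    using psd_ge0[OF assms, of "x + t *\<^sub>R y"]
    unfolding psd_form_add_scaleR[OF assms] a_def b_def c_def .
  have "0 \<le> c" using psd_ge0[OF assms] by (simp add: c_def)
  then consider "c = 0" | "0 < c" by linarith
  then have "b\<^sup>2 \<le> a * c"
  proof cases
    case 1
    have "b = 0"
    proof (rule ccontr)
      assume "b \<noteq> 0"
      \<comment> \<open>For \<open>c = 0\<close> the quadratic is affine in \<open>t\<close>; at
        this \<open>t\<close> it equals -1.\<close>
      then show False using q[of "- (a + 1) / (2 * b)"] 1 by (simp add: field_simps)
    qed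
    then show ?thesis using 1 by simp
  next
    case 2
    then show ?thesis using q[of "- b / c"]
      by (simp add: power2_eq_square field_simps)
  qed
  then show ?thesis by (simp add: a_def b_def c_def)
qed

text \<open>Cauchy-Schwarz against the vector \<open>X *v y\<close> itself gives |X y|^4 \<le> 0.
  Schur complements and minimisers of the form rely on it below.\<close>

lemma psd_null: "psd X \<Longrightarrow> y \<bullet> (X *v y) = 0 \<Longrightarrow> X *v y = 0"
  using psd_Cauchy_Schwarz[of X "X *v y" y] by simp

text \<open>
  A positive semidefinite matrix is a sum of matrices \<open>v v\<^sup>T\<close>; this form of the fact, by Schur
  complements with respect to the coordinates, avoids the spectral theorem.
\<close>

lemma psd_linear_nonneg:
  fixes f :: "real^'n^'n \<Rightarrow> real"
  assumes "linear f" and outer: "\<And>v. 0 \<le> f (outer v v)" and "psd X"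
  shows "0 \<le> f X"
proof -
  \<comment> \<open>\<open>J\<close> holds the indices of the columns that may still be nonzero;
    each step clears one of them, and with all columns zero the matrix is 0.\<close>
  have "0 \<le> f Y" if "finite J" "psd Y" "\<forall>i. i \<notin> J \<longrightarrow> Y *v axis i 1 = 0" for J Y
    using that
  proof (induction J arbitrary: Y rule: finite_induct)
    case empty
    then have "Y = 0"
      by (simp add: vec_eq_iff matrix_vector_mult_basis column_def)
    then show ?case using linear_0[OF \<open>linear f\<close>] by simp
  next
    case (insert j J)
    note psdY = insert.prems(1)
    define e where "e = (axis j 1 :: real^'n)"
    define v where "v = Y *v e"
    define c where "c = e \<bullet> v"
    have "0 \<le> c" using psd_ge0[OF psdY] by (simp add: c_def v_def)
    show ?case
    proof (cases "c = 0")
      case True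
      then have "v = 0" using psd_null[OF psdY] by (simp add: c_def v_def)
      then show ?thesis
        using insert.prems by (intro insert.IH) (auto simp: v_def e_def)
    next
      case False
      \<comment> \<open>The Schur complement at \<open>j\<close>: its \<open>j\<close>-th column
        vanishes, and columns that were zero stay zero because \<open>v\<close> is orthogonal to the
        corresponding unit vectors.\<close>
      define Z where "Z = Y - (1 / c) *\<^sub>R outer v v"
      have ve: "v \<bullet> x = e \<bullet> (Y *v x)" for x
        by (simp add: v_def inner_matrix_vector' psd_sym[OF psdY])
      have "psd Z"
      proof (rule psdI)
        show "transpose Z = Z"
          by (simp add: Z_def transpose_simps transpose_outer psd_sym[OF psdY])
        fix x
        have "(v \<bullet> x)\<^sup>2 \<le> (x \<bullet> (Y *v x)) * c"
          using psd_Cauchy_Schwarz[OF psdY, of e x] unfolding ve c_def by (simp only: v_def ac_simps)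
        then have "(v \<bullet> x)\<^sup>2 / c \<le> x \<bullet> (Y *v x)"
          using \<open>0 \<le> c\<close> False by (simp add: field_simps)
        then show "0 \<le> x \<bullet> (Z *v x)"
          by (simp add: Z_def matrix_vector_simps outer_apply inner_diff_right power2_eq_square
              inner_commute)
      qed
      moreover have "\<forall>i. i \<notin> J \<longrightarrow> Z *v axis i 1 = 0"
      proof (intro allI impI)
        fix i assume "i \<notin> J"
        show "Z *v axis i 1 = 0"
        proof (cases "i = j")
          case True
          then show ?thesis using False
            by (simp add: Z_def matrix_vector_simps outer_apply e_def[symmetric] v_def[symmetric])
              (simp add: c_def inner_commute)
        next
          case False
          then have "Y *v axis i 1 = 0" using insert.prems \<open>i \<notin> J\<close> by auto
          then show ?thesis by (simp add: Z_def matrix_vector_simps outer_apply ve)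
        qed
      qed
      ultimately have "0 \<le> f Z" by (rule insert.IH)
      moreover have "f Y = f Z + (1 / c) * f (outer v v)"
        unfolding Z_def using \<open>linear f\<close> by (simp add: linear_diff linear_scale)
      ultimately show ?thesis using outer[of v] \<open>0 \<le> c\<close> by simp
    qed
  qed
  from this[OF finite_class.finite_UNIV \<open>psd X\<close>] show ?thesis by simp
qed

lemma linear_inner_left: "linear (\<lambda>X. X \<bullet> (c::'a::real_inner))"
  and linear_inner_right: "linear (\<lambda>X. (c::'a::real_inner) \<bullet> X)"
  by (simp_all add: linear_iff inner_add_left inner_add_right)

text \<open>Linearity reduces \<open>Y\<close> to \<open>outer v v\<close>, where the inner product
  is the form of \<open>X\<close> at \<open>v\<close>. All order estimates for inner products come
  from here.\<close>

lemma psd_inner_nonneg: "psd X \<Longrightarrow> psd Y \<Longrightarrow> 0 \<le> X \<bullet> Y"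
  by (rule psd_linear_nonneg[OF linear_inner_right[of X]]) (simp_all add: inner_outer psd_ge0)

lemma psd_inner_mono: "psd X \<Longrightarrow> psd (Z - Y) \<Longrightarrow> X \<bullet> Y \<le> X \<bullet> Z"
  using psd_inner_nonneg[of X "Z - Y"] by (simp add: inner_diff_right)

lemma psd_inner_mono_left: "psd X \<Longrightarrow> psd (Z - Y) \<Longrightarrow> Y \<bullet> X \<le> Z \<bullet> X"
  using psd_inner_mono[of X Z Y] by (simp add: inner_commute)

lemma psd_trace_nonneg: "psd X \<Longrightarrow> 0 \<le> trace X"
  using psd_inner_nonneg[OF psd_mat1, of X] by (simp add: inner_mat_1)

lemma psd_trace_mono: "psd (Y - X) \<Longrightarrow> trace X \<le> trace Y"
  using psd_trace_nonneg[of "Y - X"] linear_diff[OF linear_trace, of Y X] by simp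

lemma psd_form_le_trace: "psd X \<Longrightarrow> x \<bullet> (X *v x) \<le> trace X * (norm x)\<^sup>2"
proof -
  assume "psd X"
  have "linear (\<lambda>X. trace X * (norm x)\<^sup>2 - x \<bullet> (X *v x))"
    by (auto simp: linear_iff trace_def sum.distrib sum_distrib_left matrix_vector_simps
        inner_add_right algebra_simps)
  moreover have "0 \<le> trace (outer v v) * (norm x)\<^sup>2 - x \<bullet> (outer v v *v x)" for v
    using Cauchy_Schwarz_ineq[of v x]
    unfolding power2_norm_eq_inner trace_outer outer_apply
    by (simp add: inner_commute power2_eq_square)
  ultimately have "0 \<le> trace X * (norm x)\<^sup>2 - x \<bullet> (X *v x)"
    using \<open>psd X\<close> by (rule psd_linear_nonneg)
  then show ?thesis by simp
qed

lemma psd_le_trace: "psd X \<Longrightarrow> psd (trace X *\<^sub>R mat 1 - X)"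
  using psd_form_le_trace[of X]
  by (intro psdI)
    (auto simp: transpose_simps psd_sym matrix_vector_simps inner_diff_right power2_norm_eq_inner)

lemma psd_norm_le_trace: "psd X \<Longrightarrow> norm X \<le> trace X"
proof -
  assume X: "psd X"
  have "X \<bullet> X \<le> X \<bullet> (trace X *\<^sub>R mat 1)"
    by (rule psd_inner_mono[OF X psd_le_trace[OF X]])
  also have "\<dots> = trace X * trace X"
    by (simp add: inner_mat_1[symmetric] inner_commute)
  finally have "(norm X)\<^sup>2 \<le> (trace X)\<^sup>2"
    unfolding power2_norm_eq_inner by (simp add: power2_eq_square)
  then show ?thesis
    by (rule power2_le_imp_le) (rule psd_trace_nonneg[OF X])
qed

text \<open>The triangle inequality for X = (Y + X) - Y: the summand \<open>Y + X\<close> has trace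
  at most 2 tr Y, and on the cone the norm is at most the trace.\<close>

lemma psd_norm_sandwich:
  assumes "psd (Y - X)" "psd (Y + X)"
  shows "norm X \<le> 3 * trace Y"
proof -
  have "psd (2 *\<^sub>R Y)" using psd_add[OF assms] by (simp add: scaleR_2)
  then have Y: "psd Y" using psd_scaleR[of "2 *\<^sub>R Y" "1/2"] by simp
  have "trace X \<le> trace Y" by (rule psd_trace_mono[OF assms(1)])
  then have "norm (Y + X) \<le> 2 * trace Y"
    using psd_norm_le_trace[OF assms(2)] linear_add[OF linear_trace, of Y X] by simp
  moreover have "norm X \<le> norm (Y + X) + norm Y"
    by (metis add_diff_cancel_left' norm_triangle_ineq4)
  ultimately show ?thesis using psd_norm_le_trace[OF Y] by simp
qed

lemma trace_le_opnorm:
  "x \<bullet> (X *v x) \<le> opnorm X * (norm x)\<^sup>2" for X :: "real^'n^'n"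
proof -
  have "x \<bullet> (X *v x) \<le> norm x * norm (X *v x)" by (rule norm_cauchy_schwarz)
  also have "\<dots> \<le> norm x * (opnorm X * norm x)"
    by (intro mult_left_mono opnorm_apply) simp
  finally show ?thesis by (simp add: power2_eq_square ac_simps)
qed

lemma psd_le_opnorm: "transpose X = X \<Longrightarrow> psd (opnorm X *\<^sub>R mat 1 - X)"
  using trace_le_opnorm[of _ X]
  by (intro psdI) (auto simp: transpose_simps matrix_vector_simps inner_diff_right
      power2_norm_eq_inner)

lemma psd_inner_le:
  assumes "psd (c *\<^sub>R mat 1 - X)" "psd Y"
  shows "X \<bullet> Y \<le> c * trace Y"
  using psd_inner_mono_left[OF assms(2) assms(1)] by (simp add: inner_mat_1)

lemma psd_inner_ge:
  assumes "psd (X - c *\<^sub>R mat 1)" "psd Y"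
  shows "c * trace Y \<le> X \<bullet> Y"
  using psd_inner_mono_left[OF assms(2) assms(1)] by (simp add: inner_mat_1)

text \<open>The trace equals \<open>(transpose M ** M) \<bullet> X\<close>, and M^T M is at most the
  squared operator norm times the identity.\<close>

lemma trace_congruence_le:
  fixes M :: "real^'n^'m"
  assumes "psd X"
  shows "trace (M ** X ** transpose M) \<le> (opnorm M)\<^sup>2 * trace X"
proof -
  have eq: "trace (M ** X ** transpose M) = (transpose M ** M) \<bullet> X" for X
  proof -
    have "trace (M ** X ** transpose M) = (M ** (X ** transpose M)) \<bullet> mat 1"
      by (simp add: inner_mat_1[symmetric] inner_commute matrix_mul_assoc)
    also have "\<dots> = X \<bullet> (transpose M ** M)"
      unfolding inner_mult_left[of M] inner_mult_right[of X] by simp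
    finally show ?thesis by (simp add: inner_commute)
  qed
  have "psd ((opnorm M)\<^sup>2 *\<^sub>R mat 1 - transpose M ** M)"
  proof (rule psdI)
    fix x
    have "(norm (M *v x))\<^sup>2 \<le> (opnorm M * norm x)\<^sup>2"
      by (intro power_mono opnorm_apply) simp
    then show "0 \<le> x \<bullet> (((opnorm M)\<^sup>2 *\<^sub>R mat 1 - transpose M ** M) *v x)"
      by (simp add: matrix_vector_simps inner_diff_right power_mult_distrib power2_norm_eq_inner
          matrix_vector_mul_assoc[symmetric] inner_matrix_vector')
  qed (simp add: transpose_simps)
  from psd_inner_le[OF this assms] show ?thesis by (simp add: eq)
qed

lemma trace_congruence_le_norm:
  fixes M :: "real^'n^'m"
  assumes "psd X"
  shows "trace (M ** X ** transpose M) \<le> (norm M)\<^sup>2 * trace X"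
  using trace_congruence_le[OF assms, of M] psd_trace_nonneg[OF assms]
    power_mono[OF opnorm_le_norm opnorm_nonneg, of M 2] mult_right_mono by fastforce

section \<open>Symmetric matrices and their forms; the least singular value\<close>

lemma symmetric_form_zero:
  fixes X :: "real^'n^'n"
  assumes "transpose X = X" "\<And>x. x \<bullet> (X *v x) = 0"
  shows "X = 0"
proof -
  have "psd X" using assms by (simp add: pos_semidef_def)
  then have "X *v y = 0" for y using psd_null assms(2) by blast
  then show ?thesis by (metis matrix_eq matrix_vector_mult_0)
qed

lemma symmetric_form_eq:
  fixes X Y :: "real^'n^'n"
  assumes "transpose X = X" "transpose Y = Y" "\<And>x. x \<bullet> (X *v x) = x \<bullet> (Y *v x)"
  shows "X = Y"
proof -
  have "X - Y = 0"
    by (rule symmetric_form_zero)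
      (simp_all add: assms transpose_simps matrix_vector_simps inner_diff_right)
  then show ?thesis by simp
qed

text \<open>\<open>sigma_min\<close> is a \<open>Min\<close>, hence determined only for a finite
  set. Eigenvectors of the symmetric matrix M^T M for different eigenvalues are orthogonal, and s
  \<ge> 0 is recovered from s^2.\<close>

lemma singular_values_finite: "finite (singular_values (M :: real^'n^'n))"
proof -
  define G where "G = transpose M ** M"
  define f where "f s = (SOME v. v \<noteq> 0 \<and> G *v v = s\<^sup>2 *\<^sub>R v)" for s :: real
  have f: "f s \<noteq> 0 \<and> G *v f s = s\<^sup>2 *\<^sub>R f s" if "s \<in> singular_values M" for s
  proof -
    have "\<exists>v. v \<noteq> 0 \<and> G *v v = s\<^sup>2 *\<^sub>R v"
      using that unfolding singular_values_def G_def by auto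
    then show ?thesis unfolding f_def by (rule someI_ex)
  qed
  have orth: "f s \<bullet> f t = 0" if "s \<in> singular_values M" "t \<in> singular_values M" "s \<noteq> t" for s t
  proof -
    have "transpose G = G" by (simp add: G_def transpose_simps)
    then have "f s \<bullet> (G *v f t) = (G *v f s) \<bullet> f t" by (simp add: inner_matrix_vector)
    then have "(t\<^sup>2 - s\<^sup>2) * (f s \<bullet> f t) = 0"
      using f[OF that(1)] f[OF that(2)] by (simp add: algebra_simps)
    moreover have "t\<^sup>2 \<noteq> s\<^sup>2" using that by (auto simp: singular_values_def power2_eq_iff)
    ultimately show ?thesis by simp
  qed
  have "inj_on f (singular_values M)"
    using f orth by (intro inj_onI) (metis inner_eq_zero_iff)
  moreover have "finite (f ` singular_values M)"
    by (rule pairwise_orthogonal_imp_finite)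
      (auto simp: pairwise_def orthogonal_def dest: orth)
  ultimately show ?thesis by (rule finite_imageD[rotated])
qed

lemma pos_def_imp_psd: "pos_def M \<Longrightarrow> psd M"
  unfolding pos_def_def pos_semidef_def
  by (metis inner_zero_left less_eq_real_def)

text \<open>The minimum \<open>l\<close> of the form on the unit sphere is attained at some
  \<open>v\<close>; \<open>M - l *\<^sub>R mat 1\<close> is positive semidefinite with vanishing
  form at \<open>v\<close>, so \<open>v\<close> is an eigenvector. Thus \<open>l\<close> is a
  singular value, and Cauchy-Schwarz shows that it is the least.\<close>

lemma sigma_min_pos_def:
  fixes M :: "real^'n^'n"
  assumes "pos_def M"
  shows "0 < sigma_min M" and "psd (M - sigma_min M *\<^sub>R mat 1)"
proof -
  have psd: "psd M" by (rule pos_def_imp_psd[OF assms])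
  have "axis undefined 1 \<in> sphere (0 :: real^'n) 1" by (simp add: norm_axis_1)
  then have "sphere (0 :: real^'n) 1 \<noteq> {}" by blast
  moreover have "continuous_on (sphere (0 :: real^'n) 1) (\<lambda>x. x \<bullet> (M *v x))"
    by (intro continuous_intros)
  ultimately have "\<exists>x\<in>sphere (0 :: real^'n) 1. \<forall>y\<in>sphere 0 1. x \<bullet> (M *v x) \<le> y \<bullet> (M *v y)"
    by (rule continuous_attains_inf[OF compact_sphere])
  then
  obtain v where v: "norm v = 1" "\<And>y. norm y = 1 \<Longrightarrow> v \<bullet> (M *v v) \<le> y \<bullet> (M *v y)"
    by auto
  define l where "l = v \<bullet> (M *v v)"
  have "v \<noteq> 0" using v by auto
  then have "0 < l" using assms by (simp add: l_def pos_def_def)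
  have psd2: "psd (M - l *\<^sub>R mat 1)"
  proof (rule psdI)
    fix x
    show "0 \<le> x \<bullet> ((M - l *\<^sub>R mat 1) *v x)"
    proof (cases "x = 0")
      case False
      have "l \<le> (x /\<^sub>R norm x) \<bullet> (M *v (x /\<^sub>R norm x))"
        unfolding l_def using False by (intro v) simp
      also have "\<dots> = (x \<bullet> (M *v x)) / (x \<bullet> x)"
        by (simp add: matrix_vector_simps power2_norm_eq_inner[symmetric] power2_eq_square field_simps)
      finally have "l * (x \<bullet> x) \<le> x \<bullet> (M *v x)"
        using False by (simp add: field_simps)
      then show ?thesis by (simp add: matrix_vector_simps inner_diff_right)
    qed simp
  qed (simp add: transpose_simps psd_sym[OF psd])
  have "(M - l *\<^sub>R mat 1) *v v = 0"
    using v by (intro psd_null[OF psd2])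
      (simp add: matrix_vector_simps inner_diff_right l_def power2_norm_eq_inner[symmetric])
  then have "M *v v = l *\<^sub>R v" by (simp add: matrix_vector_simps)
  then have "l \<in> singular_values M"
    using \<open>0 < l\<close> \<open>v \<noteq> 0\<close> psd_sym[OF psd]
    by (auto simp: singular_values_def matrix_vector_mul_assoc[symmetric] matrix_vector_simps
        power2_eq_square intro!: exI[of _ v])
  moreover have "l \<le> s" if "s \<in> singular_values M" for s
  proof -
    have "0 \<le> s" "\<exists>w. w \<noteq> 0 \<and> (M ** M) *v w = s\<^sup>2 *\<^sub>R w"
      using that by (auto simp: singular_values_def psd_sym[OF psd])
    then obtain w where w: "w \<noteq> 0" "M *v (M *v w) = s\<^sup>2 *\<^sub>R w" "0 \<le> s"
      by (metis matrix_vector_mul_assoc)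
    have "(norm (M *v w))\<^sup>2 = w \<bullet> (M *v (M *v w))"
      by (simp add: power2_norm_eq_inner inner_matrix_vector psd_sym[OF psd])
    then have "(norm (M *v w))\<^sup>2 = (s * norm w)\<^sup>2"
      by (simp add: w power_mult_distrib power2_norm_eq_inner)
    then have nw: "norm (M *v w) = s * norm w"
      using w(3) by (metis abs_of_nonneg mult_nonneg_nonneg norm_ge_zero power2_abs power2_eq_imp_eq)
    have "l * (norm w)\<^sup>2 \<le> w \<bullet> (M *v w)"
      using psd_ge0[OF psd2, of w]
      by (simp add: matrix_vector_simps inner_diff_right power2_norm_eq_inner)
    also have "\<dots> \<le> norm w * (s * norm w)"
      using norm_cauchy_schwarz[of w "M *v w"] by (simp add: nw)
    finally show ?thesis using w(1) by (simp add: power2_eq_square)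
  qed
  ultimately have "sigma_min M = l"
    unfolding sigma_min_def by (intro Min_eqI singular_values_finite)
  then show "0 < sigma_min M" and "psd (M - sigma_min M *\<^sub>R mat 1)"
    using \<open>0 < l\<close> psd2 by simp_all
qed

lemma opnorm_ge_sigma:
  fixes X :: "real^'n^'n"
  assumes "psd (X - c *\<^sub>R mat 1)"
  shows "c \<le> opnorm X"
proof -
  define e where "e = (axis undefined 1 :: real^'n)"
  have "norm e = 1" by (simp add: e_def norm_axis_1)
  then have "0 \<le> e \<bullet> (X *v e) - c"
    using psd_ge0[OF assms, of e]
    by (simp add: matrix_vector_simps inner_diff_right power2_norm_eq_inner[symmetric])
  also have "\<dots> \<le> opnorm X - c"
    using trace_le_opnorm[of e X] \<open>norm e = 1\<close> by simp
  finally show ?thesis by simp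
qed

lemma form_mono_psd:
  fixes X Y :: "real^'n^'n"
  assumes "transpose X = X" "transpose Y = Y" "\<And>x. x \<bullet> (X *v x) \<le> x \<bullet> (Y *v x)"
  shows "psd (Y - X)"
  using assms by (intro psdI) (simp_all add: transpose_simps matrix_vector_simps inner_diff_right)

section \<open>Positive linear maps and discrete Lyapunov equations\<close>

definition positive_map :: "(real^'n^'n \<Rightarrow> real^'n^'n) \<Rightarrow> bool" where
  "positive_map F \<longleftrightarrow> linear F \<and> (\<forall>X. psd X \<longrightarrow> psd (F X))"

lemma positive_map_linear: "positive_map F \<Longrightarrow> linear F"
  and positive_map_psd: "positive_map F \<Longrightarrow> psd X \<Longrightarrow> psd (F X)"
  by (simp_all add: positive_map_def)

lemma positive_map_diff: "positive_map F \<Longrightarrow> F (X - Y) = F X - F Y"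
  and positive_map_add: "positive_map F \<Longrightarrow> F (X + Y) = F X + F Y"
  and positive_map_scaleR: "positive_map F \<Longrightarrow> F (c *\<^sub>R X) = c *\<^sub>R F X"
  by (simp_all add: positive_map_def linear_diff linear_add linear_scale)

lemmas positive_map_simps = positive_map_diff positive_map_add positive_map_scaleR

lemma linear_funpow: "linear F \<Longrightarrow> linear (F ^^ t)" for F :: "'a::real_vector \<Rightarrow> 'a"
  by (induction t) (auto simp: id_def linear_iff)

lemma positive_map_funpow: "positive_map F \<Longrightarrow> positive_map (F ^^ t)"
  unfolding positive_map_def
proof (intro conjI; (elim conjE)?)
  show "linear F \<Longrightarrow> linear (F ^^ t)" by (rule linear_funpow)
  assume *: "\<forall>X. psd X \<longrightarrow> psd (F X)"
  show "\<forall>X. psd X \<longrightarrow> psd ((F ^^ t) X)" using * by (induction t) auto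
qed

lemma continuous_on_linear: "linear F \<Longrightarrow> continuous_on S F"
  for F :: "'a::euclidean_space \<Rightarrow> 'b::real_normed_vector"
  by (simp add: linear_continuous_on linear_conv_bounded_linear)

lemma tendsto_linear:
  "linear F \<Longrightarrow> (f \<longlongrightarrow> l) A \<Longrightarrow> ((\<lambda>x. F (f x)) \<longlongrightarrow> F l) A"
  for F :: "'a::euclidean_space \<Rightarrow> 'b::real_normed_vector"
  using bounded_linear.tendsto[of F f l A] by (simp add: linear_conv_bounded_linear)

text \<open>Telescoping: applying \<open>F ^^ t\<close> to the hypothesis and summing over
  \<open>t\<close> leaves the remainder \<open>(F ^^ T) Y\<close>, which is positive semidefinite
  and may be dropped.\<close>

lemma lyapunov_partial_sum:
  assumes F: "positive_map F" and Y: "psd Y" and YW: "psd (Y - F Y - W)"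
  shows "psd (Y - (\<Sum>t<T. (F ^^ t) W))"
proof -
  have "psd (Y - (F ^^ T) Y - (\<Sum>t<T. (F ^^ t) W))"
  proof (induction T)
    case (Suc T)
    have "psd ((F ^^ T) (Y - F Y - W))"
      by (rule positive_map_psd[OF positive_map_funpow[OF F] YW])
    then have "psd ((F ^^ T) Y - (F ^^ Suc T) Y - (F ^^ T) W)"
      by (simp add: positive_map_diff[OF positive_map_funpow[OF F]] funpow_swap1)
    from psd_add[OF Suc this] show ?case by (simp add: algebra_simps)
  qed simp
  from psd_add[OF this positive_map_psd[OF positive_map_funpow[OF F, of T] Y]]
  show ?thesis by simp
qed

text \<open>The Neumann series for (1 - F)^(-1) W. It carries meaning only under convergence, which
  is why later lemmas take a \<open>sums\<close> hypothesis.\<close>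

definition lsum :: "(real^'n^'n \<Rightarrow> real^'n^'n) \<Rightarrow> real^'n^'n \<Rightarrow> real^'n^'n" where
  "lsum F W = (\<Sum>t. (F ^^ t) W)"

text \<open>The traces of the terms are nonnegative with partial sums bounded by
  \<open>trace Y\<close>, and on the cone they dominate the norms.\<close>

lemma lyapunov_summable:
  assumes F: "positive_map F" and Y: "psd Y" and W: "psd W" and YW: "psd (Y - F Y - W)"
  shows "summable (\<lambda>t. norm ((F ^^ t) W))" and "(\<lambda>t. (F ^^ t) W) sums lsum F W"
proof -
  have pos: "psd ((F ^^ t) W)" for t by (rule positive_map_psd[OF positive_map_funpow[OF F] W])
  have "summable (\<lambda>t. trace ((F ^^ t) W))"
  proof (rule summableI_nonneg_bounded)
    show "0 \<le> trace ((F ^^ t) W)" for t by (rule psd_trace_nonneg[OF pos])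
    show "(\<Sum>t<T. trace ((F ^^ t) W)) \<le> trace Y" for T
      using psd_trace_mono[OF lyapunov_partial_sum[OF F Y YW, of T]]
      by (simp add: linear_sum[OF linear_trace])
  qed
  then show *: "summable (\<lambda>t. norm ((F ^^ t) W))"
    by (rule summable_comparison_test'[of _ 0]) (simp add: psd_norm_le_trace[OF pos])
  show "(\<lambda>t. (F ^^ t) W) sums lsum F W"
    unfolding lsum_def by (rule summable_sums[OF summable_norm_cancel[OF *]])
qed

lemma lsum_fixpoint:
  assumes F: "positive_map F" and sums: "(\<lambda>t. (F ^^ t) W) sums lsum F W"
  shows "F (lsum F W) + W = lsum F W"
proof -
  have "(\<lambda>t. F ((F ^^ t) W)) sums F (lsum F W)"
    by (rule bounded_linear.sums[OF _ sums])
      (use positive_map_linear[OF F] in \<open>simp add: linear_conv_bounded_linear\<close>)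
  then have "(\<lambda>t. (F ^^ Suc t) W) sums F (lsum F W)" by simp
  then have "(\<lambda>t. (F ^^ t) W) sums (F (lsum F W) + (F ^^ 0) W)" by (rule sums_Suc)
  then show ?thesis using sums sums_unique2 by fastforce
qed

lemma psd_sums: "f sums S \<Longrightarrow> (\<And>t. psd (f t)) \<Longrightarrow> psd S"
  unfolding sums_def by (rule psd_limit[rotated]) (auto intro: psd_sum)

lemma lsum_psd:
  assumes "positive_map F" "psd W" "(\<lambda>t. (F ^^ t) W) sums lsum F W"
  shows "psd (lsum F W)"
  by (rule psd_sums[OF assms(3)]) (rule positive_map_psd[OF positive_map_funpow[OF assms(1)] assms(2)])

lemma lsum_le:
  assumes F: "positive_map F" and Y: "psd Y" and W: "psd W" and YW: "psd (Y - F Y - W)"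
  shows "psd (Y - lsum F W)"
proof (rule psd_limit)
  show "psd (Y - (\<Sum>t<T. (F ^^ t) W))" for T by (rule lyapunov_partial_sum[OF F Y YW])
  show "(\<lambda>T. Y - (\<Sum>t<T. (F ^^ t) W)) \<longlonglongrightarrow> Y - lsum F W"
    using lyapunov_summable(2)[OF F Y W YW] by (intro tendsto_intros) (simp add: sums_def)
qed

text \<open>In contrast to \<open>lsum_le\<close>, the telescoped remainder
  \<open>(F ^^ T) Y\<close> now has the wrong sign and must tend to 0.\<close>

lemma lsum_ge:
  assumes F: "positive_map F" and Y: "psd Y" and W: "psd W"
    and sums: "(\<lambda>t. (F ^^ t) W) sums lsum F W" and YS: "(\<lambda>t. (F ^^ t) Y) \<longlonglongrightarrow> 0"
    and YW: "psd (F Y + W - Y)"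
  shows "psd (lsum F W - Y)"
proof (rule psd_limit)
  show "psd ((\<Sum>t<T. (F ^^ t) W) + (F ^^ T) Y - Y)" for T
  proof (induction T)
    case (Suc T)
    have "psd ((F ^^ T) (F Y + W - Y))"
      by (rule positive_map_psd[OF positive_map_funpow[OF F] YW])
    then have "psd ((F ^^ Suc T) Y + (F ^^ T) W - (F ^^ T) Y)"
      by (simp add: positive_map_simps[OF positive_map_funpow[OF F]] funpow_swap1)
    from psd_add[OF Suc this] show ?case by (simp add: algebra_simps)
  qed simp
  have "(\<lambda>T. (\<Sum>t<T. (F ^^ t) W) + (F ^^ T) Y - Y) \<longlonglongrightarrow> lsum F W + 0 - Y"
    using sums YS by (intro tendsto_intros) (simp_all add: sums_def)
  then show "(\<lambda>T. (\<Sum>t<T. (F ^^ t) W) + (F ^^ T) Y - Y) \<longlonglongrightarrow> lsum F W - Y" by simp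
qed

definition lyap_stable :: "(real^'n^'n \<Rightarrow> real^'n^'n) \<Rightarrow> bool" where
  "lyap_stable F \<longleftrightarrow> (\<exists>Y e. 0 < e \<and> psd Y \<and> psd (Y - F Y - e *\<^sub>R mat 1))"

text \<open>\<open>W\<close> is at most its trace times the identity, so the certificate scaled by
  \<open>trace W / e\<close> dominates it.\<close>

lemma lyap_stable_dominates:
  assumes F: "positive_map F" and "lyap_stable F" and W: "psd W"
  obtains Y where "psd Y" "psd (Y - F Y - W)"
proof -
  obtain Y e where Y: "0 < e" "psd Y" "psd (Y - F Y - e *\<^sub>R mat 1)"
    using \<open>lyap_stable F\<close> by (auto simp: lyap_stable_def)
  define c where "c = trace W / e"
  have c: "0 \<le> c" "c * e = trace W" using Y psd_trace_nonneg[OF W] by (simp_all add: c_def)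
  have "psd (c *\<^sub>R (Y - F Y - e *\<^sub>R mat 1) + (trace W *\<^sub>R mat 1 - W))"
    by (intro psd_add psd_scaleR Y c psd_le_trace W)
  then have "psd (c *\<^sub>R Y - F (c *\<^sub>R Y) - W)"
    using c(2) by (simp add: positive_map_simps[OF F] algebra_simps)
  then show ?thesis using that[of "c *\<^sub>R Y"] psd_scaleR[OF Y(2) c(1)] by blast
qed

lemma lyap_stable_summable:
  assumes "positive_map F" "lyap_stable F" "psd W"
  shows "summable (\<lambda>t. norm ((F ^^ t) W))" and "(\<lambda>t. (F ^^ t) W) sums lsum F W"
proof -
  obtain Y where Y: "psd Y" "psd (Y - F Y - W)" by (rule lyap_stable_dominates[OF assms])
  show "summable (\<lambda>t. norm ((F ^^ t) W))" and "(\<lambda>t. (F ^^ t) W) sums lsum F W"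
    by (rule lyapunov_summable[OF assms(1) Y(1) assms(3) Y(2)])+
qed

lemma lyap_stable_powers:
  assumes "positive_map F" "lyap_stable F" "psd W"
  shows "(\<lambda>t. (F ^^ t) W) \<longlonglongrightarrow> 0"
  using lyap_stable_summable(2)[OF assms] by (auto intro: summable_LIMSEQ_zero sums_summable)

subsection \<open>Lyapunov stability and the spectral radius\<close>

text \<open>In complex notation this is F^k (X + i Y) = z^k (X + i Y), split into real and imaginary
  parts.\<close>

lemma eigen_funpow:
  fixes F :: "'a::real_vector \<Rightarrow> 'a"
  assumes "linear F"
    and "F X = Re z *\<^sub>R X - Im z *\<^sub>R Y" "F Y = Im z *\<^sub>R X + Re z *\<^sub>R Y"
  shows "(F ^^ k) X = Re (z ^ k) *\<^sub>R X - Im (z ^ k) *\<^sub>R Y \<and>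
    (F ^^ k) Y = Im (z ^ k) *\<^sub>R X + Re (z ^ k) *\<^sub>R Y"
proof (induction k)
  case (Suc k)
  have "(F ^^ Suc k) X = F (Re (z ^ k) *\<^sub>R X - Im (z ^ k) *\<^sub>R Y)"
    "(F ^^ Suc k) Y = F (Im (z ^ k) *\<^sub>R X + Re (z ^ k) *\<^sub>R Y)"
    using Suc.IH by simp_all
  then show ?case
    by (simp add: linear_diff[OF assms(1)] linear_add[OF assms(1)] linear_scale[OF assms(1)]
        assms(2,3) algebra_simps del: funpow.simps)
qed simp

text \<open>Counting in place of Cayley-Hamilton: \<open>A k\<close> lists the values of F^k at all
  matrix units, and \<open>d + 1\<close> such vectors in a space of dimension \<open>d\<close> are
  linearly dependent.\<close>

lemma annihilating_polynomial:
  fixes F :: "real^'n^'n \<Rightarrow> real^'n^'n"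
  assumes "linear F"
  obtains c :: "nat \<Rightarrow> real" and d where "\<exists>i\<le>d. c i \<noteq> 0" "\<forall>X. (\<Sum>k\<le>d. c k *\<^sub>R (F ^^ k) X) = 0"
proof -
  define A :: "nat \<Rightarrow> (real^'n^'n)^('n \<times> 'n)"
    where "A k = (\<chi> p. (F ^^ k) (axis (fst p) (axis (snd p) 1)))" for k
  define d where "d = DIM((real^'n^'n)^('n \<times> 'n))"
  have "\<exists>c. (\<exists>i\<le>d. c i \<noteq> 0) \<and> (\<Sum>k\<le>d. c k *\<^sub>R A k) = 0"
  \<comment> \<open>Dependence of a set counts distinct elements only; if two of the
    \<open>A k\<close> coincide, their difference is the relation.\<close>
  proof (cases "inj_on A {..d}")
    case True
    then have "dependent (A ` {..d})"
      by (intro dependent_biggerset) (auto simp: card_image d_def)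
    then obtain u where u: "\<exists>v\<in>A ` {..d}. u v \<noteq> 0" "(\<Sum>v\<in>A ` {..d}. u v *\<^sub>R v) = 0"
      by (auto simp: dependent_finite)
    then show ?thesis
      using True by (intro exI[of _ "u \<circ> A"]) (auto simp: sum.reindex)
  next
    case False
    then obtain i j where ij: "i \<le> d" "j \<le> d" "i \<noteq> j" "A i = A j" by (auto simp: inj_on_def)
    define c where "c k = (if k = i then 1 else if k = j then -1 else (0::real))" for k
    have "(\<Sum>k\<le>d. c k *\<^sub>R A k) = (\<Sum>k\<in>{i, j}. c k *\<^sub>R A k)"
      using ij by (intro sum.mono_neutral_right) (auto simp: c_def)
    also have "\<dots> = 0" using ij by (simp add: c_def)
    finally show ?thesis using ij by (intro exI[of _ c]) (auto simp: c_def)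
  qed
  then obtain c where c: "\<exists>i\<le>d. c i \<noteq> 0" "(\<Sum>k\<le>d. c k *\<^sub>R A k) = 0" by blast
  have lin: "linear (\<lambda>X. \<Sum>k\<le>d. c k *\<^sub>R (F ^^ k) X)"
    by (intro linear_compose_sum ballI linear_compose_scale_right linear_funpow assms)
  have "(\<Sum>k\<le>d. c k *\<^sub>R (F ^^ k) X) = 0" for X
  proof (rule linear_eq_0_on_span[OF lin, of Basis])
    fix B :: "real^'n^'n" assume "B \<in> Basis"
    then obtain i j where B: "B = axis i (axis j 1)" by (auto simp: Basis_vec_def)
    have "(\<Sum>k\<le>d. c k *\<^sub>R A k) $ (i, j) = 0" using c(2) by simp
    then show "(\<Sum>k\<le>d. c k *\<^sub>R (F ^^ k) B) = 0" by (simp add: A_def B)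
  qed simp
  then show ?thesis using that c(1) by blast
qed

text \<open>Every spectral value is a root of the annihilating polynomial. Finiteness is what gives
  the \<open>Max\<close> in \<open>spectral_radius_on\<close> its meaning.\<close>

lemma finite_spectrum_on:
  fixes F :: "real^'n^'n \<Rightarrow> real^'n^'n"
  assumes "linear F"
  shows "finite (spectrum_on S F)"
proof -
  obtain c d where c: "\<exists>i\<le>d. c i \<noteq> (0::real)"
    and zero: "\<forall>X. (\<Sum>k\<le>d. c k *\<^sub>R (F ^^ k) X) = 0"
    by (rule annihilating_polynomial[OF assms])
  have "spectrum_on S F \<subseteq> {z. (\<Sum>k\<le>d. complex_of_real (c k) * z ^ k) = 0}"
  proof clarify
    fix z assume "z \<in> spectrum_on S F"
    then obtain X Y where XY: "X \<noteq> 0 \<or> Y \<noteq> 0"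
      and eig: "F X = Re z *\<^sub>R X - Im z *\<^sub>R Y" "F Y = Im z *\<^sub>R X + Re z *\<^sub>R Y"
      unfolding spectrum_on_def by blast
    define a b where "a = (\<Sum>k\<le>d. c k * Re (z ^ k))" and "b = (\<Sum>k\<le>d. c k * Im (z ^ k))"
    note pow = eigen_funpow[OF assms eig, THEN conjunct1] eigen_funpow[OF assms eig, THEN conjunct2]
    \<comment> \<open>With p(z) = a + i b, this and \<open>2\<close> say p(z) (X + i Y) = 0;
      multiplying by the conjugate of p(z) isolates \<open>X\<close> and \<open>Y\<close>.\<close>
    have 1: "a *\<^sub>R X - b *\<^sub>R Y = 0"
      using spec[OF zero, of X]
      by (simp add: pow a_def b_def scaleR_sum_left scaleR_diff_right sum_subtractf)
    have 2: "b *\<^sub>R X + a *\<^sub>R Y = 0"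
      using spec[OF zero, of Y]
      by (simp add: pow a_def b_def scaleR_sum_left scaleR_add_right sum.distrib)
    have "(a\<^sup>2 + b\<^sup>2) *\<^sub>R X = a *\<^sub>R (a *\<^sub>R X - b *\<^sub>R Y) + b *\<^sub>R (b *\<^sub>R X + a *\<^sub>R Y)"
      "(a\<^sup>2 + b\<^sup>2) *\<^sub>R Y = a *\<^sub>R (b *\<^sub>R X + a *\<^sub>R Y) - b *\<^sub>R (a *\<^sub>R X - b *\<^sub>R Y)"
      by (simp_all add: power2_eq_square algebra_simps)
    then have "(a\<^sup>2 + b\<^sup>2) *\<^sub>R X = 0" "(a\<^sup>2 + b\<^sup>2) *\<^sub>R Y = 0"
      by (simp_all add: 1 2)
    then have "a\<^sup>2 + b\<^sup>2 = 0" using XY by (metis scaleR_eq_0_iff)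
    then have "a = 0" "b = 0" by (simp_all add: sum_power2_eq_zero_iff)
    then show "(\<Sum>k\<le>d. complex_of_real (c k) * z ^ k) = 0"
      by (intro complex_eqI) (simp_all add: a_def b_def)
  qed
  moreover have "finite {z. (\<Sum>k\<le>d. complex_of_real (c k) * z ^ k) = 0}"
    by (subst polyfun_finite_roots) (use c in auto)
  ultimately show ?thesis by (rule finite_subset)
qed

text \<open>
  Brouwer's theorem on the compact convex set of positive semidefinite matrices of trace 1,
  applied to \<open>X \<mapsto> F X + e I\<close> normalised by its trace.
\<close>

lemma perturbed_eigenvector:
  fixes F :: "real^'n^'n \<Rightarrow> real^'n^'n"
  assumes F: "positive_map F" and "0 < e"
  obtains X where "psd X" "trace X = 1"
    "F X + e *\<^sub>R mat 1 = (trace (F X) + e * real CARD('n)) *\<^sub>R X"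
proof -
  define K where "K = {X :: real^'n^'n. psd X \<and> trace X = 1}"
  define n where "n = real CARD('n)"
  have tr1: "trace (mat 1 :: real^'n^'n) = n" by (simp add: trace_def mat_def n_def)
  have "0 < n" by (simp add: n_def)
  have contF: "continuous_on S F" for S by (rule continuous_on_linear[OF positive_map_linear[OF F]])
  have conttr: "continuous_on S (trace :: real^'n^'n \<Rightarrow> real)" for S
    by (rule continuous_on_linear[OF linear_trace])
  have "closed K" unfolding K_def
    by (intro closed_Collect_conj closed_psd closed_Collect_eq conttr continuous_intros)
  moreover have "bounded K"
    by (rule boundedI[of _ 1]) (use psd_norm_le_trace in \<open>fastforce simp: K_def\<close>)
  ultimately have "compact K" by (simp add: compact_eq_bounded_closed)
  moreover have "convex K"
    unfolding K_def convex_def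
    by (auto intro!: psd_add psd_scaleR simp: linear_add[OF linear_trace] linear_scale[OF linear_trace])
  moreover have "(1 / n) *\<^sub>R mat 1 \<in> K"
    using \<open>0 < n\<close> by (auto simp: K_def linear_scale[OF linear_trace] tr1 intro!: psd_scaleR psd_mat1)
  then have "K \<noteq> {}" by blast
  moreover
  define f where "f X = (1 / (trace (F X) + e * n)) *\<^sub>R (F X + e *\<^sub>R mat 1)" for X
  \<comment> \<open>The perturbation keeps the normalising factor positive even where F X =
    0.\<close>
  have pos: "0 < trace (F X) + e * n" if "X \<in> K" for X
    using that psd_trace_nonneg[OF positive_map_psd[OF F]] \<open>0 < e\<close> \<open>0 < n\<close>
    by (auto simp: K_def intro!: add_nonneg_pos)
  have "continuous_on K f"
    unfolding f_def
    by (intro continuous_intros contF continuous_on_compose2[OF conttr contF]) (use pos in force)+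
  moreover have "f \<in> K \<rightarrow> K"
  proof
    fix X assume X: "X \<in> K"
    have "psd (F X + e *\<^sub>R mat 1)"
      using X \<open>0 < e\<close> by (intro psd_add psd_scaleR psd_mat1 positive_map_psd[OF F]) (auto simp: K_def)
    then show "f X \<in> K"
      using pos[OF X] unfolding K_def f_def
      by (auto intro!: psd_scaleR simp: linear_scale[OF linear_trace] linear_add[OF linear_trace] tr1)
  qed
  ultimately obtain X where X: "X \<in> K" "f X = X" by (rule brouwer)
  have "F X + e *\<^sub>R mat 1 = (trace (F X) + e * n) *\<^sub>R f X"
    using pos[OF X(1)] by (simp add: f_def)
  then show ?thesis using X that[of X] by (auto simp: K_def n_def)
qed

text \<open>As the perturbation tends to 0, a subsequence of the perturbed eigenvectors converges to
  an eigenvector for \<open>l\<close>. If \<open>l < 1\<close>, the certificate is not the limit,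
  which may be singular, but a perturbed vector far along the subsequence, where X - F X = (1 - t) X
  + e I with t < 1.\<close>

lemma positive_eigenvector:
  fixes F :: "real^'n^'n \<Rightarrow> real^'n^'n"
  assumes F: "positive_map F"
  obtains l where "complex_of_real l \<in> spectrum_on sym_matrices F" "l < 1 \<longrightarrow> lyap_stable F"
proof -
  define n where "n = real CARD('n)"
  define e where "e k = inverse (real (Suc k))" for k
  have "0 < e k" for k by (simp add: e_def)
  then have "\<exists>X. psd X \<and> trace X = 1 \<and> F X + e k *\<^sub>R mat 1 = (trace (F X) + e k * n) *\<^sub>R X" for k
    unfolding n_def by (rule perturbed_eigenvector[OF F]) blast+
  then obtain X where X: "\<And>k. psd (X k)" "\<And>k. trace (X k) = 1"
    "\<And>k. F (X k) + e k *\<^sub>R mat 1 = (trace (F (X k)) + e k * n) *\<^sub>R X k" by metis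
  have "bounded (range X)"
    by (rule boundedI[of _ 1]) (use psd_norm_le_trace X in \<open>fastforce\<close>)
  then obtain r Y where r: "strict_mono r" "(X \<circ> r) \<longlonglongrightarrow> Y"
    using bounded_imp_convergent_subsequence by blast
  have Xr: "(\<lambda>k. X (r k)) \<longlonglongrightarrow> Y" using r(2) by (simp add: comp_def)
  have linF: "linear F" by (rule positive_map_linear[OF F])
  have e0: "(\<lambda>k. e (r k)) \<longlonglongrightarrow> 0"
    using LIMSEQ_subseq_LIMSEQ[OF LIMSEQ_inverse_real_of_nat r(1)] by (simp add: comp_def e_def)
  define l where "l = trace (F Y)"
  have lim: "(\<lambda>k. trace (F (X (r k))) + e (r k) * n) \<longlonglongrightarrow> l"
    unfolding l_def
    by (rule tendsto_eq_intros refl tendsto_linear[OF linear_trace] tendsto_linear[OF linF] Xr e0)+ simp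
  have "(\<lambda>k. F (X (r k)) + e (r k) *\<^sub>R mat 1) \<longlonglongrightarrow> F Y + 0 *\<^sub>R mat 1"
    by (intro tendsto_intros tendsto_linear[OF linF] Xr e0)
  moreover have "(\<lambda>k. F (X (r k)) + e (r k) *\<^sub>R mat 1) \<longlonglongrightarrow> l *\<^sub>R Y"
    unfolding X(3) by (intro tendsto_intros lim Xr)
  ultimately have eig: "F Y = l *\<^sub>R Y" using LIMSEQ_unique by fastforce
  have Y: "psd Y" by (rule psd_limit[OF _ Xr]) (rule X)
  have "(\<lambda>k. trace (X (r k))) \<longlonglongrightarrow> trace Y" by (rule tendsto_linear[OF linear_trace Xr])
  then have "trace Y = 1" using X(2) LIMSEQ_unique[OF _ tendsto_const] by simp
  then have "Y \<noteq> 0" by (auto simp: trace_def)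
  then have "complex_of_real l \<in> spectrum_on sym_matrices F"
    unfolding spectrum_on_def sym_matrices_def
    using eig psd_sym[OF Y] linear_0[OF linF] by (auto intro!: bexI[of _ Y] bexI[of _ 0] simp: transpose_zero)
  moreover have "lyap_stable F" if "l < 1"
  proof -
    have "\<forall>\<^sub>F k in sequentially. trace (F (X (r k))) + e (r k) * n < 1"
      by (rule order_tendstoD(2)[OF lim that])
    then obtain k where "trace (F (X (r k))) + e (r k) * n < 1" (is "?t < 1")
      by (auto simp: eventually_sequentially)
    then have "psd ((1 - ?t) *\<^sub>R X (r k))" by (intro psd_scaleR X) simp
    also have "(1 - ?t) *\<^sub>R X (r k) = X (r k) - F (X (r k)) - e (r k) *\<^sub>R mat 1"
      using X(3)[of "r k"] by (simp add: algebra_simps)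
    finally show ?thesis
      unfolding lyap_stable_def using X(1) \<open>0 < e (r k)\<close> by blast
  qed
  ultimately show ?thesis using that by blast
qed

text \<open>A spectral value with |z| \<ge> 1 would keep |F^t X|^2 + |F^t Y|^2 = |z|^(2 t) (|X|^2 +
  |Y|^2) away from 0. Convergence on the cone extends to symmetric matrices by adding a multiple of
  the identity.\<close>

lemma spectral_radius_less_1I:
  fixes F :: "real^'n^'n \<Rightarrow> real^'n^'n"
  assumes F: "positive_map F" and pow: "\<And>W. psd W \<Longrightarrow> (\<lambda>t. (F ^^ t) W) \<longlonglongrightarrow> 0"
  shows "spectral_radius_on sym_matrices F < 1"
proof -
  have sym0: "(\<lambda>t. (F ^^ t) X) \<longlonglongrightarrow> 0" if "transpose X = X" for X
  proof -
    define c where "c = opnorm (- X)"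
    have "psd (c *\<^sub>R mat 1 + X)"
      using psd_le_opnorm[of "- X"] that by (simp add: c_def transpose_simps)
    then have "(\<lambda>t. (F ^^ t) (c *\<^sub>R mat 1 + X) - c *\<^sub>R (F ^^ t) (mat 1)) \<longlonglongrightarrow> 0 - c *\<^sub>R 0"
      by (intro tendsto_intros pow psd_mat1)
    then show ?thesis by (simp add: positive_map_simps[OF positive_map_funpow[OF F]])
  qed
  have "cmod z < 1" if "z \<in> spectrum_on sym_matrices F" for z
  proof (rule ccontr)
    assume "\<not> cmod z < 1"
    then have z: "1 \<le> cmod z" by simp
    from that obtain X Y where XY: "X \<noteq> 0 \<or> Y \<noteq> 0" "transpose X = X" "transpose Y = Y"
      and eig: "F X = Re z *\<^sub>R X - Im z *\<^sub>R Y" "F Y = Im z *\<^sub>R X + Re z *\<^sub>R Y"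
      unfolding spectrum_on_def sym_matrices_def by blast
    note p = eigen_funpow[OF positive_map_linear[OF F] eig]
    define g where "g t = (F ^^ t) X \<bullet> (F ^^ t) X + (F ^^ t) Y \<bullet> (F ^^ t) Y" for t
    have "g \<longlonglongrightarrow> 0 \<bullet> (0 :: real^'n^'n) + 0 \<bullet> (0 :: real^'n^'n)"
      unfolding g_def by (intro tendsto_intros sym0 XY)
    moreover have "X \<bullet> X + Y \<bullet> Y \<le> g t" for t
    proof -
      have "g t = ((Re (z ^ t))\<^sup>2 + (Im (z ^ t))\<^sup>2) * (X \<bullet> X + Y \<bullet> Y)"
        unfolding g_def p[THEN conjunct1] p[THEN conjunct2]
        by (simp add: inner_diff_left inner_diff_right inner_add_left inner_add_right
            inner_commute[of Y X] power2_eq_square algebra_simps)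
      also have "(Re (z ^ t))\<^sup>2 + (Im (z ^ t))\<^sup>2 = (cmod z ^ t)\<^sup>2"
        by (simp add: cmod_power2[symmetric] norm_power)
      finally have g: "g t = (cmod z ^ t)\<^sup>2 * (X \<bullet> X + Y \<bullet> Y)" .
      have "1 \<le> (cmod z ^ t)\<^sup>2" using z by (simp add: one_le_power)
      then have "1 * (X \<bullet> X + Y \<bullet> Y) \<le> (cmod z ^ t)\<^sup>2 * (X \<bullet> X + Y \<bullet> Y)"
        by (intro mult_right_mono) simp_all
      then show ?thesis by (simp add: g)
    qed
    ultimately have "X \<bullet> X + Y \<bullet> Y \<le> 0" by (intro LIMSEQ_le_const[of g 0]) auto
    then show False using XY(1) by (metis add_nonneg_pos add_pos_nonneg inner_ge_zero inner_gt_zero_iff not_le)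
  qed
  \<comment> \<open>\<open>Max\<close> also needs a nonempty set.\<close>
  moreover have "spectrum_on sym_matrices F \<noteq> {}" by (rule positive_eigenvector[OF F]) blast
  ultimately show ?thesis
    unfolding spectral_radius_on_def
    by (subst Max_less_iff) (auto simp: finite_spectrum_on[OF positive_map_linear[OF F]])
qed

lemma spectral_radius_less_1_iff:
  fixes F :: "real^'n^'n \<Rightarrow> real^'n^'n"
  assumes F: "positive_map F"
  shows "spectral_radius_on sym_matrices F < 1 \<longleftrightarrow> lyap_stable F"
proof
  assume rho: "spectral_radius_on sym_matrices F < 1"
  obtain l where l: "complex_of_real l \<in> spectrum_on sym_matrices F" "l < 1 \<longrightarrow> lyap_stable F"
    by (rule positive_eigenvector[OF F])
  have "cmod (complex_of_real l) \<le> spectral_radius_on sym_matrices F"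
    unfolding spectral_radius_on_def
    using l(1) by (intro Max_ge imageI finite_imageI finite_spectrum_on positive_map_linear[OF F])
  then have "l < 1" using rho by simp
  then show "lyap_stable F" using l(2) by simp
next
  assume "lyap_stable F"
  then show "spectral_radius_on sym_matrices F < 1"
    by (intro spectral_radius_less_1I F lyap_stable_powers)
qed

section \<open>Continuous functions of the random parameters\<close>

lemma integral_linear:
  fixes f :: "'a::euclidean_space \<Rightarrow> 'b::euclidean_space"
  assumes "linear f" "integrable M g"
  shows "(LINT x|M. f (g x)) = f (LINT x|M. g x)" and "integrable M (\<lambda>x. f (g x))"
  using assms integral_bounded_linear[of f M g] integrable_bounded_linear[of f M g]
  by (simp_all add: linear_conv_bounded_linear)

lemma linear_form: "linear (\<lambda>X :: real^'n^'m. y \<bullet> (X *v x))"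
  by (simp add: linear_iff matrix_vector_simps inner_add_right)

lemma psd_integral:
  assumes "integrable M g" "AE x in M. psd (g x)"
  shows "psd (LINT x|M. g x)"
proof (rule psdI)
  have "(LINT x|M. transpose (g x)) = (LINT x|M. g x)"
    using assms(2) integral_linear(2)[OF linear_transpose assms(1)] assms(1)
    by (intro integral_cong_AE) (auto simp: psd_sym intro: borel_measurable_integrable)
  then show "transpose (LINT x|M. g x) = (LINT x|M. g x)"
    by (simp add: integral_linear(1)[OF linear_transpose assms(1)])
  show "0 \<le> y \<bullet> ((LINT x|M. g x) *v y)" for y
    unfolding integral_linear(1)[OF linear_form assms(1), symmetric]
    using assms(2) by (intro integral_nonneg_AE) (auto elim!: eventually_mono simp: psd_ge0)
qed

lemma continuous_on_parA [continuous_intros]: "continuous_on S f \<Longrightarrow> continuous_on S (\<lambda>x. parA (f x))"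
  and continuous_on_parB [continuous_intros]: "continuous_on S f \<Longrightarrow> continuous_on S (\<lambda>x. parB (f x))"
  and continuous_on_parQ [continuous_intros]: "continuous_on S f \<Longrightarrow> continuous_on S (\<lambda>x. parQ (f x))"
  and continuous_on_parR [continuous_intros]: "continuous_on S f \<Longrightarrow> continuous_on S (\<lambda>x. parR (f x))"
  unfolding parA_def parB_def parQ_def parR_def by (intro continuous_intros; assumption)+

section \<open>The block matrix of the cost weights\<close>

lemma sum_UNIV_sum:
  "(\<Sum>j\<in>(UNIV :: ('a::finite + 'b::finite) set). g j) = (\<Sum>a\<in>UNIV. g (Inl a)) + (\<Sum>b\<in>UNIV. g (Inr b))"
  by (simp add: UNIV_Plus_UNIV[symmetric] sum.Plus comp_def del: UNIV_Plus_UNIV)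

definition joinv :: "real^'n \<Rightarrow> real^'m \<Rightarrow> real^('n + 'm)" where
  "joinv x y = (\<chi> j. case j of Inl a \<Rightarrow> x $ a | Inr b \<Rightarrow> y $ b)"

lemma Nmat_form:
  "joinv x y \<bullet> (Nmat p *v joinv x y) = x \<bullet> (parQ p *v x) + y \<bullet> (parR p *v y)"
  by (simp add: inner_vec_def matrix_vector_mult_def sum_UNIV_sum joinv_def Nmat_def)

lemma psd_Nmat:
  assumes "psd (Nmat p)"
  shows "psd (parQ p)" "psd (parR p)"
proof -
  have s: "Nmat p $ j $ i = Nmat p $ i $ j" for i j
  proof -
    have "transpose (Nmat p) $ i $ j = Nmat p $ i $ j" by (simp only: psd_sym[OF assms])
    then show ?thesis by (simp add: transpose_def)
  qed
  have "transpose (parQ p) = parQ p"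
    using s[of "Inl _" "Inl _"] by (simp add: Nmat_def transpose_def vec_eq_iff)
  moreover have "transpose (parR p) = parR p"
    using s[of "Inr _" "Inr _"] by (simp add: Nmat_def transpose_def vec_eq_iff)
  moreover have "0 \<le> x \<bullet> (parQ p *v x)" for x
    using psd_ge0[OF assms, of "joinv x 0"] by (simp add: Nmat_form)
  moreover have "0 \<le> x \<bullet> (parR p *v x)" for x
    using psd_ge0[OF assms, of "joinv 0 x"] by (simp add: Nmat_form)
  ultimately show "psd (parQ p)" "psd (parR p)" by (simp_all add: pos_semidef_def)
qed

lemma continuous_on_Nmat: "continuous_on S (Nmat :: ('n::finite, 'm::finite) params \<Rightarrow> _)"
proof -
  have "continuous_on S (\<lambda>p :: ('n, 'm) params. (case (i, j) of
       (Inl a, Inl b) \<Rightarrow> parQ p $ a $ b | (Inr a, Inr b) \<Rightarrow> parR p $ a $ b | _ \<Rightarrow> 0))" for i j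
    by (cases i; cases j) (auto intro!: continuous_intros)
  then show ?thesis unfolding Nmat_def by (intro continuous_on_vec_lambda)
qed

definition Mcl :: "real^'n^'m \<Rightarrow> ('n::finite, 'm::finite) params \<Rightarrow> real^'n^'n" where
  "Mcl L p = parA p - parB p ** L"

lemma continuous_on_Mcl [continuous_intros]:
  "continuous_on S f \<Longrightarrow> continuous_on S g \<Longrightarrow> continuous_on S (\<lambda>x. Mcl (f x) (g x))"
  unfolding Mcl_def by (intro continuous_intros)

section \<open>The standing assumptions and the averaged weights\<close>

locale lq =
  fixes D :: "(real^'n) measure" and P :: "('n::finite, 'm::finite) params measure" and K :: real
  assumes lq: "lq_problem D P" and mom: "moments_stabilizable D P"
    and Sigma0_pos: "pos_def (Sigma0 D)" and K_pos: "0 < K" and bounded: "as_bounded P K"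
begin

sublocale Dp: prob_space D using lq by (simp add: lq_problem_def)
sublocale Pp: prob_space P using lq by (simp add: lq_problem_def)

lemma sets_D: "sets D = sets borel" and sets_P: "sets P = sets borel"
  using lq by (simp_all add: lq_problem_def)

lemma measurable_P: "continuous_on UNIV f \<Longrightarrow> f \<in> borel_measurable P"
  and measurable_D: "continuous_on UNIV g \<Longrightarrow> g \<in> borel_measurable D"
  by (simp_all add: measurable_cong_sets[OF sets_P refl] measurable_cong_sets[OF sets_D refl]
      borel_measurable_continuous_onI)

lemma AE_psd: "AE p in P. psd (parQ p) \<and> psd (parR p)"
  using lq by (auto simp: lq_problem_def elim!: eventually_mono intro: psd_Nmat)

lemma AE_opnorm:
  "AE p in P. opnorm (parA p) \<le> K \<and> opnorm (parB p) \<le> K \<and> opnorm (parQ p) \<le> K \<and> opnorm (parR p) \<le> K"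
  using bounded by (simp add: as_bounded_def)

lemma AE_cball: "\<exists>c. AE p in P. p \<in> cball 0 c"
proof (rule exI)
  define c where "c = K * (2 * sqrt (real CARD('n)) + 2 * sqrt (real CARD('m)))"
  have le: "norm X \<le> sqrt (real CARD('a)) * K" if "opnorm X \<le> K" for X :: "real^'a^'b"
    by (rule order_trans[OF norm_le_opnorm mult_left_mono[OF that]]) simp
  show "AE p in P. p \<in> cball 0 c"
    using AE_opnorm
  proof eventually_elim
    fix p :: "('n, 'm) params"
    assume p: "opnorm (parA p) \<le> K \<and> opnorm (parB p) \<le> K \<and> opnorm (parQ p) \<le> K \<and> opnorm (parR p) \<le> K"
    have eq: "(parA p, parB p, parQ p, parR p) = p" by (simp add: parA_def parB_def parQ_def parR_def)
    have "norm (parA p, parB p, parQ p, parR p)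
      \<le> norm (parA p) + (norm (parB p) + (norm (parQ p) + norm (parR p)))"
      by (intro order_trans[OF norm_Pair_le] add_left_mono order_refl)
    then have "norm p \<le> norm (parA p) + (norm (parB p) + (norm (parQ p) + norm (parR p)))"
      unfolding eq .
    also have "\<dots> \<le> c"
      using p le[of "parA p"] le[of "parB p"] le[of "parQ p"] le[of "parR p"] K_pos
      by (simp add: c_def algebra_simps)
    finally show "p \<in> cball 0 c" by simp
  qed
qed

text \<open>Almost surely the parameters lie in a compact ball, on which a continuous function is
  bounded. Integrability of functions of one parameter quadruple is settled this way
  throughout.\<close>

lemma integrable_P:
  fixes f :: "('n, 'm) params \<Rightarrow> 'b::{banach, second_countable_topology}"
  assumes "continuous_on UNIV f"
  shows "integrable P f"
proof -
  obtain c where c: "AE p in P. p \<in> cball 0 c" using AE_cball by blast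
  have "compact (f ` cball 0 c)"
    by (intro compact_continuous_image continuous_on_subset[OF assms]) auto
  then obtain b where b: "\<And>p. p \<in> cball 0 c \<Longrightarrow> norm (f p) \<le> b"
    by (metis bounded_iff compact_imp_bounded imageI)
  show ?thesis
    using c by (intro Pp.integrable_const_bound[where B = b] measurable_P assms)
      (auto elim!: eventually_mono intro: b)
qed

lemma integral_sandwich_psd:
  fixes f :: "('n, 'm) params \<Rightarrow> real^'a^'a"
  assumes "continuous_on UNIV f" "\<And>p. psd (f p)"
  shows "psd (LINT p|P. f p)"
  by (rule psd_integral[OF integrable_P]) (simp_all add: assms)

abbreviation "\<Sigma>\<^sub>0 \<equiv> Sigma0 D"
abbreviation "\<mu> \<equiv> mu D"
definition "Qm = (LINT p|P. parQ p)"
definition "Rm = (LINT p|P. parR p)"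
definition "q = sigma_min Qm"
definition "\<rho> = sigma_min Rm"
definition "b2 = (LINT p|P. (opnorm (parB p))\<^sup>2)"
definition "R1 = (LINT p|P. opnorm (parR p))"

text \<open>The form of the mean block matrix at \<open>joinv x y\<close> splits into the forms of
  \<open>Qm\<close> and \<open>Rm\<close>; vectors supported in one block test each of them
  separately.\<close>

lemma pos_def_QR: "pos_def Qm" "pos_def Rm"
proof -
  have iN: "integrable P Nmat" by (rule integrable_P[OF continuous_on_Nmat])
  have iQ: "integrable P parQ" and iR: "integrable P parR"
    by (intro integrable_P continuous_intros)+
  have pd: "pos_def (LINT p|P. Nmat p)" using mom by (simp add: moments_stabilizable_def)
  have form: "joinv x y \<bullet> ((LINT p|P. Nmat p) *v joinv x y) = x \<bullet> (Qm *v x) + y \<bullet> (Rm *v y)" for x y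
    unfolding Qm_def Rm_def integral_linear(1)[OF linear_form iN, symmetric]
      integral_linear(1)[OF linear_form iQ, symmetric] integral_linear(1)[OF linear_form iR, symmetric]
      Nmat_form
    by (intro Bochner_Integration.integral_add integral_linear(2)[OF linear_form] iQ iR)
  have join0: "joinv x y \<noteq> 0" if "x \<noteq> 0 \<or> y \<noteq> 0" for x :: "real^'n" and y :: "real^'m"
  proof
    assume "joinv x y = 0"
    then have "joinv x y $ Inl a = 0" "joinv x y $ Inr b = 0" for a b by simp_all
    then show False using that by (auto simp: joinv_def vec_eq_iff)
  qed
  have psd: "psd Qm" "psd Rm"
    unfolding Qm_def Rm_def using AE_psd by (auto intro!: psd_integral iQ iR elim!: eventually_mono)
  show "pos_def Qm"
    unfolding pos_def_def
  proof (intro conjI allI impI)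
    fix x :: "real^'n" assume "x \<noteq> 0"
    then have "0 < joinv x (0::real^'m) \<bullet> ((LINT p|P. Nmat p) *v joinv x 0)"
      using pd join0[of x 0] unfolding pos_def_def by blast
    then show "0 < x \<bullet> (Qm *v x)" by (simp add: form)
  qed (rule psd_sym[OF psd(1)])
  show "pos_def Rm"
    unfolding pos_def_def
  proof (intro conjI allI impI)
    fix y :: "real^'m" assume "y \<noteq> 0"
    then have "0 < joinv (0::real^'n) y \<bullet> ((LINT p|P. Nmat p) *v joinv 0 y)"
      using pd join0[of 0 y] unfolding pos_def_def by blast
    then show "0 < y \<bullet> (Rm *v y)" by (simp add: form)
  qed (rule psd_sym[OF psd(2)])
qed

lemma q_pos: "0 < q" and Qm_ge: "psd (Qm - q *\<^sub>R mat 1)" and Qm_psd: "psd Qm"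
  and \<rho>_pos: "0 < \<rho>" and Rm_ge: "psd (Rm - \<rho> *\<^sub>R mat 1)" and Rm_psd: "psd Rm"
  and \<mu>_pos: "0 < \<mu>" and Sigma0_ge: "psd (\<Sigma>\<^sub>0 - \<mu> *\<^sub>R mat 1)" and Sigma0_psd: "psd \<Sigma>\<^sub>0"
  unfolding q_def \<rho>_def mu_def
  using pos_def_QR Sigma0_pos by (simp_all add: sigma_min_pos_def pos_def_imp_psd)

lemma b2_nonneg: "0 \<le> b2" and R1_nonneg: "0 \<le> R1"
  by (simp_all add: b2_def R1_def opnorm_nonneg)

lemma Rm_le: "psd (R1 *\<^sub>R mat 1 - Rm)"
proof -
  have int: "integrable P (\<lambda>p. opnorm (parR p) *\<^sub>R mat 1 - parR p)"
    by (intro integrable_P continuous_intros)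
  have "psd (LINT p|P. opnorm (parR p) *\<^sub>R mat 1 - parR p)"
  proof (rule psd_integral[OF int])
    show "AE p in P. psd (opnorm (parR p) *\<^sub>R mat 1 - parR p)"
      using AE_psd by eventually_elim (intro psd_le_opnorm psd_sym, simp)
  qed
  also have "(LINT p|P. opnorm (parR p) *\<^sub>R mat 1 - parR p) = R1 *\<^sub>R mat 1 - Rm"
  proof -
    have "integrable P (\<lambda>p. opnorm (parR p))" "integrable P parR"
      by (intro integrable_P continuous_intros)+
    then show ?thesis by (simp add: R1_def Rm_def)
  qed
  finally show ?thesis .
qed

section \<open>The closed-loop covariance map and its adjoint\<close>

abbreviation "F \<equiv> cl_map P"

lemma cl_map_eq: "F L X = (LINT p|P. Mcl L p ** X ** transpose (Mcl L p))"
  by (simp add: cl_map_def Mcl_def)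

text \<open>The adjoint of \<open>F L\<close> for the Frobenius inner product: \<open>F L\<close>
  moves covariances forward in time, \<open>Fa L\<close> moves quadratic value functions
  backward.\<close>

definition Fa :: "real^'n^'m \<Rightarrow> real^'n^'n \<Rightarrow> real^'n^'n" where
  "Fa L W = (LINT p|P. transpose (Mcl L p) ** W ** Mcl L p)"

lemma integrable_F: "integrable P (\<lambda>p. Mcl L p ** X ** transpose (Mcl L p))"
  and integrable_Fa: "integrable P (\<lambda>p. transpose (Mcl L p) ** X ** Mcl L p)"
  by (intro integrable_P continuous_intros)+

lemma positive_map_F: "positive_map (F L)"
  unfolding positive_map_def
proof (intro conjI allI impI)
  show "linear (F L)"
    unfolding linear_iff cl_map_eq
    by (simp add: matrix_mult_simps integrable_F flip: Bochner_Integration.integral_add)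
  show "psd X \<Longrightarrow> psd (F L X)" for X
    unfolding cl_map_eq by (intro psd_integral integrable_F AE_I2 psd_congruence)
qed

lemma positive_map_Fa: "positive_map (Fa L)"
  unfolding positive_map_def
proof (intro conjI allI impI)
  show "linear (Fa L)"
    unfolding linear_iff Fa_def
    by (simp add: matrix_mult_simps integrable_Fa flip: Bochner_Integration.integral_add)
  show "psd X \<Longrightarrow> psd (Fa L X)" for X
    unfolding Fa_def by (intro psd_integral integrable_Fa AE_I2 psd_congruence')
qed

lemma Fa_adjoint: "Fa L W \<bullet> X = W \<bullet> F L X"
proof -
  have "W \<bullet> (M ** X ** transpose M) = (transpose M ** W ** M) \<bullet> X" for M
  proof -
    have "(M ** X ** transpose M) \<bullet> W = X \<bullet> (transpose M ** (W ** M))"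
      by (simp add: inner_mult_right[of "M ** X"] inner_mult_left[of M])
    then show ?thesis by (simp add: inner_commute matrix_mul_assoc)
  qed
  then show ?thesis
    unfolding cl_map_eq Fa_def
      integral_linear(1)[OF linear_inner_right integrable_F, symmetric]
      integral_linear(1)[OF linear_inner_left integrable_Fa, symmetric] by simp
qed

lemma Fa_adjoint_funpow: "(Fa L ^^ t) W \<bullet> X = W \<bullet> (F L ^^ t) X"
proof (induction t arbitrary: X)
  case (Suc t)
  have "(Fa L ^^ Suc t) W \<bullet> X = W \<bullet> (F L ^^ t) (F L X)" by (simp add: Fa_adjoint Suc.IH)
  then show ?case by (simp add: funpow_swap1)
qed simp

lemma U_ad_iff: "L \<in> U_ad P \<longleftrightarrow> lyap_stable (F L)"
  by (simp add: U_ad_def spectral_radius_less_1_iff[OF positive_map_F])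

section \<open>Covariance, value matrix and cost of an admissible feedback matrix\<close>

definition QL :: "real^'n^'m \<Rightarrow> real^'n^'n" where
  "QL L = Qm + transpose L ** Rm ** L"

lemma QL_psd: "psd (QL L)"
  unfolding QL_def by (intro psd_add Qm_psd psd_congruence' Rm_psd)

text \<open>Counterparts, given by series, of expectations along trajectories: the summed
  covariance, the value matrix and the cost. For admissible \<open>L\<close> they are identified
  with \<open>state_cov\<close> and \<open>cost\<close> only in \<open>state_cov_eq\<close> and
  \<open>cost_eq\<close>; the analysis before that is free of trajectories.\<close>

definition Sg :: "real^'n^'m \<Rightarrow> real^'n^'n" where "Sg L = lsum (F L) \<Sigma>\<^sub>0"
definition PL :: "real^'n^'m \<Rightarrow> real^'n^'n" where "PL L = lsum (Fa L) (QL L)"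
definition Ct :: "real^'n^'m \<Rightarrow> real" where "Ct L = QL L \<bullet> Sg L"

context
  fixes L assumes L: "L \<in> U_ad P"
begin

lemma stable: "lyap_stable (F L)" using L by (simp add: U_ad_iff)

lemma Sg_sums: "(\<lambda>t. (F L ^^ t) \<Sigma>\<^sub>0) sums Sg L"
  unfolding Sg_def by (rule lyap_stable_summable(2)[OF positive_map_F stable Sigma0_psd])

lemma Sg_fix: "F L (Sg L) + \<Sigma>\<^sub>0 = Sg L"
  unfolding Sg_def by (rule lsum_fixpoint[OF positive_map_F Sg_sums[unfolded Sg_def]])

lemma Sg_psd: "psd (Sg L)"
  unfolding Sg_def by (rule lsum_psd[OF positive_map_F Sigma0_psd Sg_sums[unfolded Sg_def]])

lemma Sg_ge_Sigma0: "psd (Sg L - \<Sigma>\<^sub>0)"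
  using positive_map_psd[OF positive_map_F Sg_psd, of L] Sg_fix
  by (metis add_diff_cancel_right')

lemma Sg_ge: "psd (Sg L - \<mu> *\<^sub>R mat 1)"
  by (rule psd_diff_trans[OF Sg_ge_Sigma0 Sigma0_ge])

text \<open>The Lyapunov certificate belongs to \<open>F L\<close>, not to its adjoint. Duality
  transfers summability: tr(Fa^t W) = W \<bullet> F^t I.\<close>

lemma Fa_summable:
  assumes W: "psd W"
  shows "(\<lambda>t. (Fa L ^^ t) W) sums lsum (Fa L) W"
proof -
  have psd: "psd ((Fa L ^^ t) W)" for t
    by (rule positive_map_psd[OF positive_map_funpow[OF positive_map_Fa] W])
  have "summable (\<lambda>t. W \<bullet> (F L ^^ t) (mat 1))"
    using lyap_stable_summable(2)[OF positive_map_F stable psd_mat1]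
    by (intro bounded_linear.summable[OF bounded_linear_inner_right]) (simp add: sums_summable)
  then have "summable (\<lambda>t. trace ((Fa L ^^ t) W))"
    by (simp add: Fa_adjoint_funpow[symmetric] inner_mat_1 inner_commute[of _ "mat 1"])
  then have "summable (\<lambda>t. norm ((Fa L ^^ t) W))"
    by (rule summable_comparison_test'[of _ 0]) (simp add: psd_norm_le_trace[OF psd])
  then show ?thesis
    unfolding lsum_def by (rule summable_sums[OF summable_norm_cancel])
qed

lemma PL_sums: "(\<lambda>t. (Fa L ^^ t) (QL L)) sums PL L"
  unfolding PL_def by (rule Fa_summable[OF QL_psd])

lemma PL_fix: "Fa L (PL L) + QL L = PL L"
  unfolding PL_def by (rule lsum_fixpoint[OF positive_map_Fa PL_sums[unfolded PL_def]])

lemma PL_psd: "psd (PL L)"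
  unfolding PL_def by (rule lsum_psd[OF positive_map_Fa QL_psd PL_sums[unfolded PL_def]])

lemma Ct_sums: "(\<lambda>t. QL L \<bullet> (F L ^^ t) \<Sigma>\<^sub>0) sums Ct L"
  unfolding Ct_def by (rule bounded_linear.sums[OF bounded_linear_inner_right Sg_sums])

lemma Ct_eq_PL: "Ct L = PL L \<bullet> \<Sigma>\<^sub>0"
proof -
  have "(\<lambda>t. (Fa L ^^ t) (QL L) \<bullet> \<Sigma>\<^sub>0) sums (PL L \<bullet> \<Sigma>\<^sub>0)"
    by (rule bounded_linear.sums[OF bounded_linear_inner_left PL_sums])
  then show ?thesis using Ct_sums by (simp add: Fa_adjoint_funpow sums_unique2)
qed

text \<open>With \<open>Ct_ge_PL\<close> and \<open>Ct_ge_norm\<close>, the coercivity of the cost: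
  the mean weights and the initial covariance dominate multiples of the identity, so a cost bound
  controls \<open>Sg\<close>, \<open>PL\<close> and \<open>L\<close>.\<close>

lemma Ct_ge_Sg: "q * trace (Sg L) \<le> Ct L"
proof -
  have "psd (QL L - q *\<^sub>R mat 1)"
    using psd_add[OF Qm_ge psd_congruence'[OF Rm_psd, of L]] by (simp add: QL_def algebra_simps)
  then show ?thesis unfolding Ct_def by (rule psd_inner_ge[OF _ Sg_psd])
qed

lemma Ct_ge_PL: "\<mu> * trace (PL L) \<le> Ct L"
  unfolding Ct_eq_PL by (subst inner_commute) (rule psd_inner_ge[OF Sigma0_ge PL_psd])

lemma Ct_ge_norm: "\<rho> * \<mu> * (norm L)\<^sup>2 \<le> Ct L"
proof -
  have LL: "psd (L ** transpose L)"
    using psd_congruence[OF psd_mat1, of L] by simp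
  have "trace (L ** transpose L) = (norm L)\<^sup>2"
    by (simp add: inner_mat_1[symmetric] inner_commute[of "mat 1"] inner_mult_right power2_norm_eq_inner)
  then have "\<rho> * (norm L)\<^sup>2 \<le> Rm \<bullet> (L ** transpose L)"
    using psd_inner_ge[OF Rm_ge LL] by simp
  also have "\<dots> = trace (transpose L ** Rm ** L)"
  proof -
    have "trace (transpose L ** Rm ** L) = (transpose L ** (Rm ** L)) \<bullet> mat 1"
      by (simp add: inner_mat_1[symmetric] inner_commute matrix_mul_assoc)
    also have "\<dots> = Rm \<bullet> (L ** transpose L)"
      unfolding inner_mult_left[of "transpose L"] inner_mult_right[of Rm] by simp
    finally show ?thesis by simp
  qed
  finally have "\<mu> * (\<rho> * (norm L)\<^sup>2) \<le> \<mu> * trace (transpose L ** Rm ** L)"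
    using \<mu>_pos by simp
  also have "\<dots> \<le> Sg L \<bullet> (transpose L ** Rm ** L)"
    by (rule psd_inner_ge[OF Sg_ge psd_congruence'[OF Rm_psd]])
  also have "\<dots> \<le> Ct L"
    unfolding Ct_def QL_def
    using psd_inner_nonneg[OF Qm_psd Sg_psd] by (simp add: inner_add_left inner_commute[of "Sg L"])
  finally show ?thesis by (simp add: ac_simps)
qed

lemma trace_Sg_ge: "\<mu> \<le> trace (Sg L)"
proof -
  have "trace (\<mu> *\<^sub>R mat 1 :: real^'n^'n) \<le> trace (Sg L)" by (rule psd_trace_mono[OF Sg_ge])
  moreover have "trace (\<mu> *\<^sub>R mat 1 :: real^'n^'n) = \<mu> * real CARD('n)"
    by (simp add: linear_scale[OF linear_trace]) (simp add: trace_def mat_def)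
  moreover have "\<mu> * 1 \<le> \<mu> * real CARD('n)" using \<mu>_pos by (intro mult_left_mono) auto
  ultimately show ?thesis by simp
qed

lemma Ct_pos: "0 < Ct L"
  using Ct_ge_Sg trace_Sg_ge q_pos \<mu>_pos by (meson less_le_trans mult_pos_pos)

end

section \<open>Perturbation of the feedback\<close>

text \<open>A substitute for the square root of \<open>b2\<close>: it is positive, its square is at
  least \<open>b2\<close>, and it stays polynomial in the parameters.\<close>

definition "\<beta> = 1 + b2"

text \<open>\<open>Sg L\<close> is at most \<open>\<tau> L\<close> times
  \<open>\<Sigma>\<^sub>0\<close>, since it is at most its trace times the identity, while
  \<open>\<Sigma>\<^sub>0\<close> is at least \<open>\<mu>\<close> times the identity.\<close>

definition \<tau> :: "real^'n^'m \<Rightarrow> real" where "\<tau> L = trace (Sg L) / \<mu>"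

text \<open>
  The mixed terms of \<open>(M - B Z) S (M - B Z)\<^sup>T\<close> are absorbed by \<open>s M S M\<^sup>T\<close> and \<open>s\<^sup>-\<^sup>1 B Z S (B Z)\<^sup>T\<close>,
  which needs no bound on \<open>M\<close> since \<open>F S \<le> S\<close>.
\<close>

lemma perturbation:
  fixes Z :: "real^'n^'m"
  assumes L: "L \<in> U_ad P" and small: "3 * (\<beta> * norm Z) * \<tau> L \<le> 1 / 4"
  defines "\<theta> \<equiv> 3 * (\<beta> * norm Z) * \<tau> L"
  shows "psd (Sg L - F (L + Z) (Sg L) - (1 - \<theta>) *\<^sub>R \<Sigma>\<^sub>0)"
    and "psd (F (L + Z) (Sg L) + (1 + \<theta>) *\<^sub>R \<Sigma>\<^sub>0 - Sg L)"
proof -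
  define S where "S = Sg L"
  define s where "s = \<beta> * norm Z"
  have S: "psd S" using Sg_psd[OF L] by (simp add: S_def)
  have symS: "transpose S = S" by (rule psd_sym[OF S])
  have tS: "\<mu> \<le> trace S" using trace_Sg_ge[OF L] by (simp add: S_def)
  have \<theta>: "\<theta> = 3 * s * (trace S / \<mu>)" by (simp add: \<theta>_def s_def \<tau>_def S_def)
  have "psd (Sg L - F (L + Z) (Sg L) - (1 - \<theta>) *\<^sub>R \<Sigma>\<^sub>0) \<and>
    psd (F (L + Z) (Sg L) + (1 + \<theta>) *\<^sub>R \<Sigma>\<^sub>0 - Sg L)"
  \<comment> \<open>The mixed-term bounds are divided by \<open>s\<close>, which vanishes with
    \<open>Z\<close>.\<close>
  proof (cases "Z = 0")
    case True
    then have "\<theta> = 0" by (simp add: \<theta> s_def)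
    then show ?thesis using Sg_fix[OF L] True by (simp add: algebra_simps)
  next
    case False
    then have "0 < s" using b2_nonneg by (simp add: s_def \<beta>_def add_pos_nonneg)
    define M N where "M = Mcl L" and "N p = parB p ** Z" for p :: "('n, 'm) params"
    define X1 X2 X3 where "X1 = (LINT p|P. M p ** S ** transpose (M p))"
      and "X2 = (LINT p|P. M p ** S ** transpose (N p) + N p ** S ** transpose (M p))"
      and "X3 = (LINT p|P. N p ** S ** transpose (N p))"
    have int: "integrable P (\<lambda>p. M p ** S ** transpose (M p))"
      "integrable P (\<lambda>p. M p ** S ** transpose (N p) + N p ** S ** transpose (M p))"
      "integrable P (\<lambda>p. N p ** S ** transpose (N p))"
      unfolding M_def N_def by (intro integrable_P continuous_intros)+
    have X1: "X1 = F L S" by (simp add: X1_def cl_map_eq M_def)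
    have FX: "F (L + Z) S = X1 - X2 + X3"
    proof -
      have "Mcl (L + Z) p ** S ** transpose (Mcl (L + Z) p)
        = M p ** S ** transpose (M p) - (M p ** S ** transpose (N p) + N p ** S ** transpose (M p))
          + N p ** S ** transpose (N p)" for p
      proof -
        have "Mcl (L + Z) p = M p - N p" by (simp add: Mcl_def M_def N_def matrix_mult_simps)
        then show ?thesis
          by (simp only: matrix_mult_simps transpose_simps) (simp add: algebra_simps)
      qed
      then show ?thesis unfolding cl_map_eq X1_def X2_def X3_def using int by simp
    qed
    \<comment> \<open>Expand the positive semidefinite expectation of (s M + e N) S (s M + e N)^T;
      the two signs of \<open>e\<close> bound \<open>X2\<close> from both sides.\<close>
    have mixed: "psd (s\<^sup>2 *\<^sub>R X1 + (e * s) *\<^sub>R X2 + X3)" if "e = 1 \<or> e = -1" for e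
    proof -
      have "psd (LINT p|P. (s *\<^sub>R M p + e *\<^sub>R N p) ** S ** transpose (s *\<^sub>R M p + e *\<^sub>R N p))"
        unfolding M_def N_def
        by (intro integral_sandwich_psd continuous_intros psd_congruence S)
      also have "(\<lambda>p. (s *\<^sub>R M p + e *\<^sub>R N p) ** S ** transpose (s *\<^sub>R M p + e *\<^sub>R N p))
        = (\<lambda>p. s\<^sup>2 *\<^sub>R (M p ** S ** transpose (M p))
          + (e * s) *\<^sub>R (M p ** S ** transpose (N p) + N p ** S ** transpose (M p))
          + N p ** S ** transpose (N p))"
        using that by (auto simp: fun_eq_iff matrix_mult_simps transpose_simps power2_eq_square algebra_simps)
      finally show ?thesis unfolding X1_def X2_def X3_def using int by simp
    qed
    have X3: "psd X3"
      unfolding X3_def by (intro psd_integral int AE_I2 psd_congruence S)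
    have "trace X3 = (LINT p|P. trace (N p ** S ** transpose (N p)))"
      unfolding X3_def by (rule integral_linear(1)[OF linear_trace int(3), symmetric])
    also have "\<dots> \<le> (LINT p|P. (opnorm (parB p))\<^sup>2 * ((norm Z)\<^sup>2 * trace S))"
    proof (rule integral_mono)
      show "integrable P (\<lambda>p. trace (N p ** S ** transpose (N p)))"
        by (rule integral_linear(2)[OF linear_trace int(3)])
      show "integrable P (\<lambda>p. (opnorm (parB p))\<^sup>2 * ((norm Z)\<^sup>2 * trace S))"
        by (intro integrable_P continuous_intros)
      fix p
      have "trace (N p ** S ** transpose (N p)) = trace (parB p ** (Z ** S ** transpose Z) ** transpose (parB p))"
        by (simp add: N_def transpose_simps matrix_mul_assoc)
      also have "\<dots> \<le> (opnorm (parB p))\<^sup>2 * trace (Z ** S ** transpose Z)"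
        by (rule trace_congruence_le[OF psd_congruence[OF S]])
      also have "\<dots> \<le> (opnorm (parB p))\<^sup>2 * ((norm Z)\<^sup>2 * trace S)"
        by (intro mult_left_mono trace_congruence_le_norm S) simp
      finally show "trace (N p ** S ** transpose (N p)) \<le> (opnorm (parB p))\<^sup>2 * ((norm Z)\<^sup>2 * trace S)" .
    qed
    also have "\<dots> = (b2 * (norm Z)\<^sup>2) * trace S"
      by (simp add: b2_def ac_simps)
    also have "\<dots> \<le> s\<^sup>2 * trace S"
    proof (intro mult_right_mono psd_trace_nonneg S)
      have "b2 * (norm Z)\<^sup>2 \<le> \<beta>\<^sup>2 * (norm Z)\<^sup>2"
        using b2_nonneg by (intro mult_right_mono) (simp_all add: \<beta>_def power2_eq_square algebra_simps)
      then show "b2 * (norm Z)\<^sup>2 \<le> s\<^sup>2" by (simp add: s_def power_mult_distrib)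
    qed
    finally have trX3: "trace X3 \<le> s\<^sup>2 * trace S" .
    have s1: "s \<le> 1"
    proof -
      have "s * 1 \<le> s * (trace S / \<mu>)" using tS \<mu>_pos \<open>0 < s\<close> by (intro mult_left_mono) auto
      then show ?thesis using small by (simp add: \<tau>_def s_def S_def)
    qed
    have X1S: "X1 = S - \<Sigma>\<^sub>0" using Sg_fix[OF L] by (simp add: X1 S_def algebra_simps)
    have symF: "transpose (F (L + Z) S) = F (L + Z) S"
      by (rule psd_sym[OF positive_map_psd[OF positive_map_F S]])
    have sym0: "transpose \<Sigma>\<^sub>0 = \<Sigma>\<^sub>0" by (rule psd_sym[OF Sigma0_psd])
    have key: "- \<theta> * (x \<bullet> (\<Sigma>\<^sub>0 *v x)) \<le> x \<bullet> (F (L + Z) S *v x) - x \<bullet> (X1 *v x)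
       \<and> x \<bullet> (F (L + Z) S *v x) - x \<bullet> (X1 *v x) \<le> \<theta> * (x \<bullet> (\<Sigma>\<^sub>0 *v x))" for x
    proof -
      define f where "f X = x \<bullet> (X *v x)" for X :: "real^'n^'n"
      have fadd: "f (X + Y) = f X + f Y" "f (X - Y) = f X - f Y" "f (c *\<^sub>R X) = c * f X" for X Y c
        by (simp_all add: f_def matrix_vector_simps inner_add_right inner_diff_right)
      define nx where "nx = trace S * (norm x)\<^sup>2"
      have "0 \<le> nx" using psd_trace_nonneg[OF S] by (simp add: nx_def)
      have m1: "0 \<le> s\<^sup>2 * f X1 + s * f X2 + f X3" and m2: "0 \<le> s\<^sup>2 * f X1 - s * f X2 + f X3"
        using psd_ge0[OF mixed[of 1], of x] psd_ge0[OF mixed[of "-1"], of x]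
        by (simp_all add: f_def[symmetric] fadd)
      have fS: "f S \<le> nx" unfolding f_def nx_def by (rule psd_form_le_trace[OF S])
      have f1: "f X1 \<le> nx" "0 \<le> f X1"
        using fS psd_ge0[OF Sigma0_psd, of x] psd_ge0[OF positive_map_psd[OF positive_map_F S], of x L]
        by (simp_all add: X1S fadd f_def[symmetric]) (simp add: X1[symmetric] X1S fadd)
      have "f X3 \<le> trace X3 * (norm x)\<^sup>2" unfolding f_def by (rule psd_form_le_trace[OF X3])
      also have "\<dots> \<le> s\<^sup>2 * nx" using mult_right_mono[OF trX3, of "(norm x)\<^sup>2"] by (simp add: nx_def ac_simps)
      finally have f3: "f X3 \<le> s\<^sup>2 * nx" "0 \<le> f X3" using psd_ge0[OF X3] by (simp_all add: f_def)
      have sf1: "s\<^sup>2 * f X1 \<le> s\<^sup>2 * nx" using f1 by (intro mult_left_mono) simp_all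
      have "s * f X2 \<le> s * (2 * s * nx)" "s * (- (2 * s * nx)) \<le> s * f X2"
        using m1 m2 sf1 f3 by (simp_all add: power2_eq_square algebra_simps)
      then have f2: "f X2 \<le> 2 * s * nx" "- (2 * s * nx) \<le> f X2"
        using \<open>0 < s\<close> by (simp_all only: mult_le_cancel_left_pos)
      have "s\<^sup>2 * nx \<le> s * nx" using s1 \<open>0 < s\<close> \<open>0 \<le> nx\<close> by (intro mult_right_mono) (simp_all add: power2_eq_square)
      \<comment> \<open>\<open>X2\<close> contributes 2 s and \<open>X3\<close> contributes s^2
        \<le> s, whence the 3 in \<open>\<theta>\<close>.\<close>
      then have "\<bar>f (F (L + Z) S) - f X1\<bar> \<le> 3 * s * nx"
        using f2 f3 \<open>0 \<le> nx\<close> \<open>0 < s\<close> mult_nonneg_nonneg[of s nx] by (simp add: FX fadd abs_le_iff)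
      also have "\<dots> \<le> \<theta> * f \<Sigma>\<^sub>0"
      proof -
        have "\<mu> * (norm x)\<^sup>2 \<le> f \<Sigma>\<^sub>0"
          using psd_ge0[OF Sigma0_ge, of x]
          by (simp add: f_def matrix_vector_simps inner_diff_right power2_norm_eq_inner)
        then have "(3 * s * (trace S / \<mu>)) * (\<mu> * (norm x)\<^sup>2) \<le> (3 * s * (trace S / \<mu>)) * f \<Sigma>\<^sub>0"
          using \<open>0 < s\<close> \<mu>_pos psd_trace_nonneg[OF S] by (intro mult_left_mono) simp_all
        then show ?thesis using \<mu>_pos by (simp add: \<theta> nx_def field_simps)
      qed
      finally show ?thesis unfolding f_def by linarith
    qed
    show ?thesis
    proof
      have "psd ((S - F (L + Z) S) - (1 - \<theta>) *\<^sub>R \<Sigma>\<^sub>0)"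
      proof (rule form_mono_psd)
        fix x
        show "x \<bullet> ((1 - \<theta>) *\<^sub>R \<Sigma>\<^sub>0 *v x) \<le> x \<bullet> ((S - F (L + Z) S) *v x)"
          using key[of x] by (simp add: X1S matrix_vector_simps inner_diff_right algebra_simps)
      qed (simp_all add: transpose_simps symS symF sym0)
      then show "psd (Sg L - F (L + Z) (Sg L) - (1 - \<theta>) *\<^sub>R \<Sigma>\<^sub>0)" by (simp add: S_def)
      have "psd (F (L + Z) S + (1 + \<theta>) *\<^sub>R \<Sigma>\<^sub>0 - S)"
      proof (rule form_mono_psd)
        fix x
        show "x \<bullet> (S *v x) \<le> x \<bullet> ((F (L + Z) S + (1 + \<theta>) *\<^sub>R \<Sigma>\<^sub>0) *v x)"
          using key[of x] by (simp add: X1S matrix_vector_simps inner_diff_right inner_add_right algebra_simps)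
      qed (simp_all add: transpose_simps symS symF sym0)
      then show "psd (F (L + Z) (Sg L) + (1 + \<theta>) *\<^sub>R \<Sigma>\<^sub>0 - Sg L)" by (simp add: S_def)
    qed
  qed
  then show "psd (Sg L - F (L + Z) (Sg L) - (1 - \<theta>) *\<^sub>R \<Sigma>\<^sub>0)"
    "psd (F (L + Z) (Sg L) + (1 + \<theta>) *\<^sub>R \<Sigma>\<^sub>0 - Sg L)" by blast+
qed

text \<open>By \<open>perturbation\<close>, \<open>Sg L\<close> divided by
  \<open>1 - \<theta>\<close> is a supersolution and divided by \<open>1 + \<theta>\<close> a
  subsolution of the Lyapunov equation of \<open>L + Z\<close>; comparison encloses
  \<open>Sg (L + Z)\<close>. For \<theta> \<le> 1/4 these reciprocals are at most 1 + 2 \<theta> and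
  at least 1 - \<theta>.\<close>

lemma perturbation_stable:
  fixes Z :: "real^'n^'m"
  assumes L: "L \<in> U_ad P" and small: "3 * (\<beta> * norm Z) * \<tau> L \<le> 1 / 4"
  defines "\<theta> \<equiv> 3 * (\<beta> * norm Z) * \<tau> L"
  shows "L + Z \<in> U_ad P"
    and "psd ((1 + 2 * \<theta>) *\<^sub>R Sg L - Sg (L + Z))" and "psd (Sg (L + Z) - (1 - \<theta>) *\<^sub>R Sg L)"
proof -
  note p = perturbation[OF L small, folded \<theta>_def]
  have "0 \<le> \<theta>"
    unfolding \<theta>_def \<tau>_def \<beta>_def
    using b2_nonneg trace_Sg_ge[OF L] \<mu>_pos by (intro mult_nonneg_nonneg divide_nonneg_pos) auto
  have \<theta>1: "\<theta> \<le> 1 / 4" using small by (simp add: \<theta>_def)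
  have S: "psd (Sg L)" by (rule Sg_psd[OF L])
  have "psd ((Sg L - F (L + Z) (Sg L) - (1 - \<theta>) *\<^sub>R \<Sigma>\<^sub>0) + (1 - \<theta>) *\<^sub>R (\<Sigma>\<^sub>0 - \<mu> *\<^sub>R mat 1))"
    using \<theta>1 by (intro psd_add psd_scaleR p Sigma0_ge) simp
  then have "psd (Sg L - F (L + Z) (Sg L) - ((1 - \<theta>) * \<mu>) *\<^sub>R mat 1)"
    by (simp add: algebra_simps)
  then have st: "lyap_stable (F (L + Z))"
    unfolding lyap_stable_def using S \<theta>1 \<mu>_pos by (intro exI[of _ "Sg L"] exI[of _ "(1 - \<theta>) * \<mu>"]) simp
  then show L': "L + Z \<in> U_ad P" by (simp add: U_ad_iff)
  have S': "psd (Sg (L + Z))" by (rule Sg_psd[OF L'])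
  define c where "c = 1 / (1 - \<theta>)"
  have c: "0 \<le> c" "c * (1 - \<theta>) = 1" "c \<le> 1 + 2 * \<theta>"
    using \<theta>1 \<open>0 \<le> \<theta>\<close> mult_right_mono[OF \<theta>1 \<open>0 \<le> \<theta>\<close>] by (auto simp: c_def field_simps)
  have "psd (c *\<^sub>R (Sg L - F (L + Z) (Sg L) - (1 - \<theta>) *\<^sub>R \<Sigma>\<^sub>0))" by (intro psd_scaleR p c)
  also have "c *\<^sub>R (Sg L - F (L + Z) (Sg L) - (1 - \<theta>) *\<^sub>R \<Sigma>\<^sub>0)
    = c *\<^sub>R Sg L - F (L + Z) (c *\<^sub>R Sg L) - \<Sigma>\<^sub>0"
    by (simp only: scaleR_diff_right scaleR_scaleR c(2) positive_map_scaleR[OF positive_map_F] scaleR_one)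
  finally have "psd (c *\<^sub>R Sg L - F (L + Z) (c *\<^sub>R Sg L) - \<Sigma>\<^sub>0)" .
  then have "psd (c *\<^sub>R Sg L - Sg (L + Z))"
    unfolding Sg_def[of "L + Z"] by (intro lsum_le positive_map_F Sigma0_psd psd_scaleR c S)
  moreover have "psd ((1 + 2 * \<theta> - c) *\<^sub>R Sg L)" using c by (intro psd_scaleR S) simp
  ultimately have "psd ((c *\<^sub>R Sg L - Sg (L + Z)) + (1 + 2 * \<theta> - c) *\<^sub>R Sg L)" by (rule psd_add)
  then show "psd ((1 + 2 * \<theta>) *\<^sub>R Sg L - Sg (L + Z))" by (simp add: algebra_simps)
  define d where "d = 1 / (1 + \<theta>)"
  have d: "0 \<le> d" "d * (1 + \<theta>) = 1" "1 - \<theta> \<le> d"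
    using \<open>0 \<le> \<theta>\<close> by (auto simp: d_def field_simps)
  have "psd (d *\<^sub>R (F (L + Z) (Sg L) + (1 + \<theta>) *\<^sub>R \<Sigma>\<^sub>0 - Sg L))" by (intro psd_scaleR p d)
  also have "d *\<^sub>R (F (L + Z) (Sg L) + (1 + \<theta>) *\<^sub>R \<Sigma>\<^sub>0 - Sg L)
    = F (L + Z) (d *\<^sub>R Sg L) + \<Sigma>\<^sub>0 - d *\<^sub>R Sg L"
    by (simp only: scaleR_diff_right scaleR_right_distrib scaleR_scaleR d(2)
        positive_map_scaleR[OF positive_map_F] scaleR_one)
  finally have "psd (F (L + Z) (d *\<^sub>R Sg L) + \<Sigma>\<^sub>0 - d *\<^sub>R Sg L)" .
  then have "psd (Sg (L + Z) - d *\<^sub>R Sg L)"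
    unfolding Sg_def[of "L + Z"]
    using Sg_sums[OF L', unfolded Sg_def]
    by (intro lsum_ge positive_map_F Sigma0_psd psd_scaleR d S lyap_stable_powers st)
  moreover have "psd ((d - (1 - \<theta>)) *\<^sub>R Sg L)" using d by (intro psd_scaleR S) simp
  ultimately have "psd ((Sg (L + Z) - d *\<^sub>R Sg L) + (d - (1 - \<theta>)) *\<^sub>R Sg L)" by (rule psd_add)
  then show "psd (Sg (L + Z) - (1 - \<theta>) *\<^sub>R Sg L)" by (simp add: algebra_simps)
qed

end
section \<open>Cost differences, gradient domination and existence of a minimiser\<close>

context lq
begin

text \<open>Equals \<open>HL L ** L\<close> minus E[B^T P A], where P is
  \<open>PL L\<close>.\<close>

definition EL :: "real^'n^'m \<Rightarrow> real^'n^'m" where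
  "EL L = Rm ** L - (LINT p|P. transpose (parB p) ** PL L ** Mcl L p)"

definition HL :: "real^'n^'m \<Rightarrow> real^'m^'m" where
  "HL L = Rm + (LINT p|P. transpose (parB p) ** PL L ** parB p)"

text \<open>The gradient of the cost. It is not obtained by differentiation; the expansion in
  \<open>smoothness\<close> justifies it.\<close>

definition GL :: "real^'n^'m \<Rightarrow> real^'n^'m" where
  "GL L = 2 *\<^sub>R (EL L ** Sg L)"

definition hL :: "real^'n^'m \<Rightarrow> real" where
  "hL L = R1 + b2 * trace (PL L)"

text \<open>What the Bellman right-hand side gains when the feedback changes to \<open>L + Z\<close>
  while the value matrix \<open>PL L\<close> is kept (\<open>bellman_defect_eq\<close>); it is
  exactly quadratic in \<open>Z\<close>.\<close>

definition bellman_defect :: "real^'n^'m \<Rightarrow> real^'n^'m \<Rightarrow> real^'n^'n" where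
  "bellman_defect L Z = transpose Z ** EL L + transpose (EL L) ** Z + transpose Z ** HL L ** Z"

lemma linear_mult: "linear (\<lambda>Y :: real^'b^'a. X ** Y)" "linear (\<lambda>Y :: real^'a^'b. Y ** X')"
  by (simp_all add: linear_iff matrix_mult_simps)

lemma bellman_defect_eq:
  assumes L: "L \<in> U_ad P"
  shows "QL (L + Z) + Fa (L + Z) (PL L) = PL L + bellman_defect L Z"
proof -
  define W where "W = PL L"
  have W: "transpose W = W" using psd_sym[OF PL_psd[OF L]] by (simp add: W_def)
  define I1 where "I1 = (LINT p|P. transpose (parB p) ** W ** Mcl L p)"
  define I2 where "I2 = (LINT p|P. transpose (parB p) ** W ** parB p)"
  have i0: "integrable P (\<lambda>p. transpose (Mcl L p) ** W ** Mcl L p)"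
    and i1: "integrable P (\<lambda>p. transpose (parB p) ** W ** Mcl L p)"
    and i2: "integrable P (\<lambda>p. transpose (parB p) ** W ** parB p)"
    by (intro integrable_P continuous_intros)+
  have ZI1: "(LINT p|P. transpose Z ** (transpose (parB p) ** W ** Mcl L p)) = transpose Z ** I1"
    "integrable P (\<lambda>p. transpose Z ** (transpose (parB p) ** W ** Mcl L p))"
    unfolding I1_def by (rule integral_linear[OF linear_mult(1) i1])+
  have I1Z: "(LINT p|P. transpose (transpose Z ** (transpose (parB p) ** W ** Mcl L p)))
      = transpose (transpose Z ** I1)"
    "integrable P (\<lambda>p. transpose (transpose Z ** (transpose (parB p) ** W ** Mcl L p)))"
    unfolding ZI1(1)[symmetric] by (rule integral_linear[OF linear_transpose ZI1(2)])+
  have ZI2: "(LINT p|P. transpose Z ** (transpose (parB p) ** W ** parB p)) = transpose Z ** I2"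
    "integrable P (\<lambda>p. transpose Z ** (transpose (parB p) ** W ** parB p))"
    unfolding I2_def by (rule integral_linear[OF linear_mult(1) i2])+
  have ZI2Z: "(LINT p|P. transpose Z ** (transpose (parB p) ** W ** parB p) ** Z) = transpose Z ** I2 ** Z"
    "integrable P (\<lambda>p. transpose Z ** (transpose (parB p) ** W ** parB p) ** Z)"
    unfolding ZI2(1)[symmetric] by (rule integral_linear[OF linear_mult(2) ZI2(2)])+
  have "transpose (Mcl (L + Z) p) ** W ** Mcl (L + Z) p
      = transpose (Mcl L p) ** W ** Mcl L p - transpose Z ** (transpose (parB p) ** W ** Mcl L p)
        - transpose (transpose Z ** (transpose (parB p) ** W ** Mcl L p))
        + transpose Z ** (transpose (parB p) ** W ** parB p) ** Z" for p
  proof -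
    have "Mcl (L + Z) p = Mcl L p - parB p ** Z" by (simp add: Mcl_def matrix_mult_simps)
    then show ?thesis
      by (simp add: matrix_mult_simps transpose_simps W matrix_mul_assoc)
  qed
  then have f1: "Fa (L + Z) W = Fa L W - transpose Z ** I1 - transpose (transpose Z ** I1)
      + transpose Z ** I2 ** Z"
    unfolding Fa_def using i0 ZI1 I1Z ZI2Z by simp
  have f2: "QL (L + Z) = QL L + transpose Z ** (Rm ** L) + transpose (transpose Z ** (Rm ** L))
      + transpose Z ** Rm ** Z"
    by (simp add: QL_def matrix_mult_simps transpose_simps psd_sym[OF Rm_psd] matrix_mul_assoc)
  have f3: "Fa L W = W - QL L" using PL_fix[OF L] by (simp add: W_def algebra_simps)
  have f4: "bellman_defect L Z = transpose Z ** (Rm ** L) - transpose Z ** I1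
      + transpose (transpose Z ** (Rm ** L)) - transpose (transpose Z ** I1)
      + transpose Z ** Rm ** Z + transpose Z ** I2 ** Z"
    unfolding bellman_defect_def EL_def HL_def W_def[symmetric] I1_def[symmetric] I2_def[symmetric]
    by (simp add: matrix_mult_simps transpose_simps)
  show ?thesis unfolding W_def[symmetric] f1 f2 f3 f4 by simp
qed

text \<open>Write the initial covariance through the Lyapunov equation of \<open>L + Z\<close>, move
  the closed-loop map onto \<open>PL L\<close> by adjointness, and the Bellman defect remains. There
  is no remainder term, and the covariance is that of the new feedback matrix.\<close>

lemma Ct_diff:
  assumes L: "L \<in> U_ad P" and L': "L + Z \<in> U_ad P"
  shows "Ct (L + Z) - Ct L = bellman_defect L Z \<bullet> Sg (L + Z)"
proof -
  have "\<Sigma>\<^sub>0 = Sg (L + Z) - F (L + Z) (Sg (L + Z))" using Sg_fix[OF L'] by (simp add: algebra_simps)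
  then have "Ct L = PL L \<bullet> (Sg (L + Z) - F (L + Z) (Sg (L + Z)))"
    by (metis Ct_eq_PL[OF L])
  also have "\<dots> = (PL L - Fa (L + Z) (PL L)) \<bullet> Sg (L + Z)"
    by (simp add: inner_diff_left inner_diff_right Fa_adjoint)
  also have "PL L - Fa (L + Z) (PL L) = QL (L + Z) - bellman_defect L Z"
    using bellman_defect_eq[OF L, of Z] by (simp add: algebra_simps)
  finally show ?thesis by (simp add: Ct_def inner_diff_left)
qed

context
  fixes L :: "real^'n^'m" assumes L: "L \<in> U_ad P"
begin

lemma HL_psd_ge: "psd (HL L - \<rho> *\<^sub>R mat 1)"
proof -
  have "psd (LINT p|P. transpose (parB p) ** PL L ** parB p)"
    by (intro integral_sandwich_psd continuous_intros psd_congruence' PL_psd L)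
  from psd_add[OF Rm_ge this] show ?thesis by (simp add: HL_def algebra_simps)
qed

lemma HL_psd: "psd (HL L)"
  using psd_add[OF HL_psd_ge psd_scaleR[OF psd_mat1, of \<rho>]] \<rho>_pos by simp

lemma HL_le: "psd (hL L *\<^sub>R mat 1 - HL L)"
proof -
  define W where "W = PL L"
  have W: "psd W" using PL_psd[OF L] by (simp add: W_def)
  have i2: "integrable P (\<lambda>p. transpose (parB p) ** W ** parB p)"
    by (intro integrable_P continuous_intros)
  have ib: "integrable P (\<lambda>p. (opnorm (parB p))\<^sup>2)" by (intro integrable_P continuous_intros)
  have psd1: "psd ((trace W * (opnorm B)\<^sup>2) *\<^sub>R mat 1 - transpose B ** W ** B)" for B :: "real^'m^'n"
  proof (rule form_mono_psd)
    show "transpose (transpose B ** W ** B) = transpose B ** W ** B"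
      by (rule psd_sym[OF psd_congruence'[OF W]])
    fix x
    have "x \<bullet> ((transpose B ** W ** B) *v x) = (B *v x) \<bullet> (W *v (B *v x))"
      by (simp only: matrix_vector_mul_assoc[symmetric] inner_matrix_vector[of x "transpose B"]
          transpose_transpose)
    also have "\<dots> \<le> trace W * (norm (B *v x))\<^sup>2" by (rule psd_form_le_trace[OF W])
    also have "\<dots> \<le> trace W * (opnorm B * norm x)\<^sup>2"
      by (intro mult_left_mono power_mono opnorm_apply psd_trace_nonneg W) simp
    finally show "x \<bullet> ((transpose B ** W ** B) *v x) \<le> x \<bullet> ((trace W * (opnorm B)\<^sup>2) *\<^sub>R mat 1 *v x)"
      by (simp add: matrix_vector_simps power2_norm_eq_inner power_mult_distrib)
  qed (simp add: transpose_simps)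
  have "psd (LINT p|P. (trace W * (opnorm (parB p))\<^sup>2) *\<^sub>R mat 1 - transpose (parB p) ** W ** parB p)"
    by (intro integral_sandwich_psd continuous_intros psd1)
  also have "(LINT p|P. (trace W * (opnorm (parB p))\<^sup>2) *\<^sub>R mat 1 - transpose (parB p) ** W ** parB p)
    = (trace W * b2) *\<^sub>R mat 1 - (LINT p|P. transpose (parB p) ** W ** parB p)"
    using i2 ib by (simp add: b2_def)
  finally have "psd ((trace W * b2) *\<^sub>R mat 1 - (LINT p|P. transpose (parB p) ** W ** parB p))" .
  from psd_add[OF Rm_le this] show ?thesis
    by (simp add: HL_def hL_def W_def algebra_simps)
qed

lemma hL_pos: "0 < hL L"
proof -
  have "psd ((hL L - \<rho>) *\<^sub>R mat 1 :: real^'m^'m)"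
    using psd_add[OF HL_le HL_psd_ge] by (simp add: algebra_simps)
  from psd_ge0[OF this, of "axis undefined 1"] show ?thesis
    using \<rho>_pos by (simp add: matrix_vector_simps inner_axis_axis)
qed

lemma inner_defect:
  assumes "transpose X = X"
  shows "bellman_defect L Z \<bullet> X = 2 * (EL L \<bullet> (Z ** X)) + HL L \<bullet> (Z ** X ** transpose Z)"
proof -
  have 1: "(transpose Z ** EL L) \<bullet> X = EL L \<bullet> (Z ** X)" by (simp add: inner_mult_left)
  have "(transpose (EL L) ** Z) \<bullet> X = transpose (transpose Z ** EL L) \<bullet> X"
    by (simp add: transpose_simps)
  also have "\<dots> = EL L \<bullet> (Z ** X)" by (simp add: inner_transpose_left assms 1)
  finally have 2: "(transpose (EL L) ** Z) \<bullet> X = EL L \<bullet> (Z ** X)" .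
  have "(transpose Z ** HL L ** Z) \<bullet> X = (transpose Z ** (HL L ** Z)) \<bullet> X"
    by (simp add: matrix_mul_assoc)
  also have "\<dots> = HL L \<bullet> (Z ** X ** transpose Z)"
    unfolding inner_mult_left[of "transpose Z"] inner_mult_right[of "HL L"] by simp
  finally show ?thesis by (simp add: bellman_defect_def inner_add_left 1 2)
qed

lemma inner_GL: "GL L \<bullet> Z = 2 * (EL L \<bullet> (Z ** Sg L))"
  by (simp add: GL_def inner_mult_right psd_sym[OF Sg_psd[OF L]])

lemma HL_inner_le:
  assumes "psd X"
  shows "0 \<le> HL L \<bullet> (Z ** X ** transpose Z)"
    and "HL L \<bullet> (Z ** X ** transpose Z) \<le> hL L * (norm Z)\<^sup>2 * trace X"
proof -
  have ZX: "psd (Z ** X ** transpose Z)" by (rule psd_congruence[OF assms])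
  show "0 \<le> HL L \<bullet> (Z ** X ** transpose Z)" by (rule psd_inner_nonneg[OF HL_psd ZX])
  have "HL L \<bullet> (Z ** X ** transpose Z) \<le> hL L * trace (Z ** X ** transpose Z)"
    by (rule psd_inner_le[OF HL_le ZX])
  also have "\<dots> \<le> hL L * ((norm Z)\<^sup>2 * trace X)"
    using hL_pos by (intro mult_left_mono trace_congruence_le_norm assms) simp
  finally show "HL L \<bullet> (Z ** X ** transpose Z) \<le> hL L * (norm Z)\<^sup>2 * trace X" by (simp add: ac_simps)
qed

text \<open>
  The right-hand side of the Bellman equation is positive semidefinite for every feedback matrix,
  stabilising or not; the bound is its trace at \<open>Z = - E / h\<close>.
\<close>

lemma EL_bound: "(norm (EL L))\<^sup>2 \<le> hL L * trace (PL L)"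
proof -
  define Z where "Z = - (1 / hL L) *\<^sub>R EL L"
  have "psd (PL L + bellman_defect L Z)"
    unfolding bellman_defect_eq[OF L, symmetric]
    by (intro psd_add QL_psd positive_map_psd[OF positive_map_Fa] PL_psd L)
  then have "0 \<le> (PL L + bellman_defect L Z) \<bullet> mat 1"
    by (rule psd_inner_nonneg[OF _ psd_mat1])
  also have "\<dots> = trace (PL L) + 2 * (EL L \<bullet> Z) + HL L \<bullet> (Z ** mat 1 ** transpose Z)"
    unfolding inner_add_left inner_defect[OF transpose_mat] inner_commute[of "PL L"] inner_mat_1
    by simp
  also have "HL L \<bullet> (Z ** mat 1 ** transpose Z) \<le> hL L * (norm Z)\<^sup>2"
  proof -
    have ZZ: "psd (Z ** mat 1 ** transpose Z)" by (rule psd_congruence[OF psd_mat1])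
    have "trace (Z ** mat 1 ** transpose Z) = (norm Z)\<^sup>2"
      by (simp add: inner_mat_1[symmetric] inner_commute[of "mat 1"] inner_mult_right power2_norm_eq_inner)
    then show ?thesis using psd_inner_le[OF HL_le ZZ] by simp
  qed
  also have "hL L * (norm Z)\<^sup>2 = (norm (EL L))\<^sup>2 / hL L"
    using hL_pos by (simp add: Z_def power_mult_distrib power2_eq_square field_simps)
  also have "EL L \<bullet> Z = - (norm (EL L))\<^sup>2 / hL L"
    by (simp add: Z_def power2_norm_eq_inner)
  finally have "(norm (EL L))\<^sup>2 / hL L \<le> trace (PL L)" by simp
  then show ?thesis using hL_pos by (simp add: field_simps)
qed

text \<open>Completing the square in \<open>Z\<close>: since \<open>HL L\<close> is at least
  \<open>\<rho>\<close> times the identity, the defect is at least -(1/\<rho>) E^T E whatever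
  \<open>Z\<close> is, so the distance from \<open>L\<close> to \<open>L'\<close> does not
  enter.\<close>

lemma gradient_domination:
  assumes L': "L' \<in> U_ad P"
  shows "Ct L - Ct L' \<le> opnorm (Sg L') / (4 * \<mu>\<^sup>2 * \<rho>) * (norm (GL L))\<^sup>2"
proof -
  define Z where "Z = L' - L"
  define S where "S = Sg L'"
  have S: "psd S" using Sg_psd[OF L'] by (simp add: S_def)
  have "Ct L' - Ct L = bellman_defect L Z \<bullet> S"
    using Ct_diff[OF L, of Z] L' by (simp add: Z_def S_def)
  moreover have "- ((1 / \<rho>) * (norm (EL L))\<^sup>2 * opnorm S) \<le> bellman_defect L Z \<bullet> S"
  proof -
    have "psd (bellman_defect L Z + (1 / \<rho>) *\<^sub>R (transpose (EL L) ** EL L))"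
    proof (rule psdI)
      show "transpose (bellman_defect L Z + (1 / \<rho>) *\<^sub>R (transpose (EL L) ** EL L))
        = bellman_defect L Z + (1 / \<rho>) *\<^sub>R (transpose (EL L) ** EL L)"
        by (simp add: bellman_defect_def transpose_simps psd_sym[OF HL_psd] matrix_mul_assoc)
      fix x
      define u v where "u = Z *v x" and "v = EL L *v x"
      have "x \<bullet> ((bellman_defect L Z + (1 / \<rho>) *\<^sub>R (transpose (EL L) ** EL L)) *v x)
        = 2 * (u \<bullet> v) + u \<bullet> (HL L *v u) + (1 / \<rho>) * (v \<bullet> v)"
      proof -
        have t: "x \<bullet> ((transpose X ** Y) *v x) = (X *v x) \<bullet> (Y *v x)" for X Y :: "real^'n^'m"
          by (simp only: matrix_vector_mul_assoc[symmetric] inner_matrix_vector[of x "transpose X"]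
              transpose_transpose)
        have "x \<bullet> ((transpose Z ** HL L ** Z) *v x) = u \<bullet> (HL L *v u)"
          using t[of Z "HL L ** Z"] by (simp add: matrix_mul_assoc matrix_vector_mul_assoc u_def)
        then show ?thesis
          by (simp add: bellman_defect_def matrix_vector_simps inner_add_right t u_def v_def inner_commute)
      qed
      also have "\<dots> \<ge> 2 * (u \<bullet> v) + \<rho> * (u \<bullet> u) + (1 / \<rho>) * (v \<bullet> v)"
        using psd_ge0[OF HL_psd_ge, of u] by (simp add: matrix_vector_simps inner_diff_right)
      also have "2 * (u \<bullet> v) + \<rho> * (u \<bullet> u) + (1 / \<rho>) * (v \<bullet> v)
          = (1 / \<rho>) * ((\<rho> *\<^sub>R u + v) \<bullet> (\<rho> *\<^sub>R u + v))"
        using \<rho>_pos by (simp add: inner_add_left inner_add_right inner_commute[of v u] field_simps)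
      finally show "0 \<le> x \<bullet> ((bellman_defect L Z + (1 / \<rho>) *\<^sub>R (transpose (EL L) ** EL L)) *v x)"
        using \<rho>_pos by (smt (verit) divide_nonneg_pos inner_ge_zero mult_nonneg_nonneg)
    qed
    from psd_inner_nonneg[OF this S]
    have "0 \<le> bellman_defect L Z \<bullet> S + (1 / \<rho>) * ((transpose (EL L) ** EL L) \<bullet> S)"
      by (simp add: inner_add_left)
    moreover have "(transpose (EL L) ** EL L) \<bullet> S \<le> opnorm S * trace (transpose (EL L) ** EL L)"
      using psd_inner_le[OF psd_le_opnorm[OF psd_sym[OF S]] psd_congruence'[OF psd_mat1, of "EL L"]]
      by (simp add: inner_commute)
    moreover have "trace (transpose (EL L) ** EL L) = (norm (EL L))\<^sup>2"
      by (simp add: inner_mat_1[symmetric] inner_commute[of "mat 1"] inner_mult_left power2_norm_eq_inner)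
    ultimately show ?thesis
      using \<rho>_pos by (simp add: field_simps)
  qed
  \<comment> \<open>\<open>Sg L\<close> is at least \<open>\<mu>\<close> times the identity, so
    multiplying by it stretches every row of \<open>EL L\<close> by at least \<open>\<mu>\<close>;
    the 4 is the square of the 2 in \<open>GL\<close>.\<close>
  moreover have "4 * \<mu>\<^sup>2 * (norm (EL L))\<^sup>2 \<le> (norm (GL L))\<^sup>2"
  proof -
    have "\<mu> * norm y \<le> norm (Sg L *v y)" for y
    proof (cases "y = 0")
      case False
      have "\<mu> * (norm y)\<^sup>2 \<le> y \<bullet> (Sg L *v y)"
        using psd_ge0[OF Sg_ge[OF L], of y]
        by (simp add: matrix_vector_simps inner_diff_right power2_norm_eq_inner)
      also have "\<dots> \<le> norm y * norm (Sg L *v y)" by (rule norm_cauchy_schwarz)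
      finally have "norm y * (\<mu> * norm y) \<le> norm y * norm (Sg L *v y)"
        by (simp add: power2_eq_square ac_simps)
      then show ?thesis using False by simp
    qed simp
    then have sq: "\<mu>\<^sup>2 * (y \<bullet> y) \<le> (Sg L *v y) \<bullet> (Sg L *v y)" for y
      using power_mono[of "\<mu> * norm y" "norm (Sg L *v y)" 2] \<mu>_pos
      by (simp add: power_mult_distrib power2_norm_eq_inner)
    have row: "(EL L ** Sg L) $ i = Sg L *v (EL L $ i)" for i
    proof -
      have "Sg L $ k $ j = Sg L $ j $ k" for j k
        using psd_sym[OF Sg_psd[OF L]] by (metis (no_types) transpose_def vec_lambda_beta)
      then show ?thesis
        by (simp add: vec_eq_iff matrix_matrix_mult_def matrix_vector_mult_def ac_simps)
    qed
    have "\<mu>\<^sup>2 * (norm (EL L))\<^sup>2 = (\<Sum>i\<in>UNIV. \<mu>\<^sup>2 * (EL L $ i \<bullet> EL L $ i))"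
      unfolding power2_norm_eq_inner inner_vec_def[of "EL L"] by (simp add: sum_distrib_left)
    also have "\<dots> \<le> (\<Sum>i\<in>UNIV. (EL L ** Sg L) $ i \<bullet> (EL L ** Sg L) $ i)"
      unfolding row by (intro sum_mono sq)
    also have "\<dots> = (norm (EL L ** Sg L))\<^sup>2"
      unfolding power2_norm_eq_inner inner_vec_def[of "EL L ** Sg L"] ..
    finally show ?thesis by (simp add: GL_def power_mult_distrib)
  qed
  then have "(1 / \<rho>) * (norm (EL L))\<^sup>2 * opnorm S \<le> opnorm S / (4 * \<mu>\<^sup>2 * \<rho>) * (norm (GL L))\<^sup>2"
  proof -
    assume *: "4 * \<mu>\<^sup>2 * (norm (EL L))\<^sup>2 \<le> (norm (GL L))\<^sup>2"
    have "(1 / \<rho>) * (norm (EL L))\<^sup>2 * opnorm S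
      = opnorm S / (4 * \<mu>\<^sup>2 * \<rho>) * (4 * \<mu>\<^sup>2 * (norm (EL L))\<^sup>2)"
      using \<rho>_pos \<mu>_pos by (simp add: field_simps)
    also have "\<dots> \<le> opnorm S / (4 * \<mu>\<^sup>2 * \<rho>) * (norm (GL L))\<^sup>2"
      using * \<rho>_pos \<mu>_pos by (intro mult_left_mono divide_nonneg_pos opnorm_nonneg) simp_all
    finally show ?thesis .
  qed
  ultimately show ?thesis unfolding S_def by linarith
qed

end

text \<open>One number for all bounds. It uses only parameters in \<open>system_params\<close>, as
  the constant of the step size has to; being at least 1, its powers may be raised freely.\<close>

definition w :: real where "w = 1 + b2 + R1 + 1 / \<mu> + 1 / q + 1 / \<rho>"

lemma w_ge: "1 \<le> w" "b2 \<le> w" "R1 \<le> w" "1 / \<mu> \<le> w" "1 / q \<le> w" "1 / \<rho> \<le> w" "\<beta> \<le> w"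
proof -
  have "0 \<le> 1 / \<mu>" "0 \<le> 1 / q" "0 \<le> 1 / \<rho>" using \<mu>_pos q_pos \<rho>_pos by simp_all
  then show "1 \<le> w" "b2 \<le> w" "R1 \<le> w" "1 / \<mu> \<le> w" "1 / q \<le> w" "1 / \<rho> \<le> w" "\<beta> \<le> w"
    using b2_nonneg R1_nonneg unfolding w_def \<beta>_def by linarith+
qed

section \<open>Estimates in terms of a bound on the cost; smoothness\<close>

context
  fixes L :: "real^'n^'m" and c :: real
  assumes L: "L \<in> U_ad P" and c: "Ct L \<le> c" "1 \<le> c"
begin

lemma trace_Sg_le: "trace (Sg L) \<le> w * c"
proof -
  have "trace (Sg L) \<le> (1 / q) * Ct L" using Ct_ge_Sg[OF L] q_pos by (simp add: field_simps)
  also have "\<dots> \<le> w * c"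
    using w_ge c Ct_pos[OF L] by (intro mult_mono) auto
  finally show ?thesis .
qed

lemma trace_PL_le: "trace (PL L) \<le> w * c"
proof -
  have "trace (PL L) \<le> (1 / \<mu>) * Ct L" using Ct_ge_PL[OF L] \<mu>_pos by (simp add: field_simps)
  also have "\<dots> \<le> w * c"
    using w_ge c Ct_pos[OF L] by (intro mult_mono) auto
  finally show ?thesis .
qed

lemma tau_le: "\<tau> L \<le> w ^ 2 * c" and tau_nonneg: "0 \<le> \<tau> L"
proof -
  have "\<tau> L = (1 / \<mu>) * trace (Sg L)" by (simp add: \<tau>_def)
  also have "\<dots> \<le> w * (w * c)"
    using w_ge trace_Sg_le trace_Sg_ge[OF L] \<mu>_pos by (intro mult_mono) auto
  finally show "\<tau> L \<le> w ^ 2 * c" by (simp add: power2_eq_square)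
  show "0 \<le> \<tau> L" using trace_Sg_ge[OF L] \<mu>_pos by (simp add: \<tau>_def)
qed

lemma hL_le: "hL L \<le> 2 * w ^ 2 * c"
proof -
  have "b2 * trace (PL L) \<le> w * (w * c)"
    using w_ge b2_nonneg trace_PL_le psd_trace_nonneg[OF PL_psd[OF L]] by (intro mult_mono) auto
  moreover have "R1 \<le> w * (w * c)"
    using w_ge c mult_mono[of R1 w 1 "w * c"] mult_mono[of 1 w 1 c] by simp
  ultimately show ?thesis by (simp add: hL_def power2_eq_square)
qed

lemma norm_EL_le: "norm (EL L) \<le> 2 * w ^ 2 * c"
proof -
  have "(norm (EL L))\<^sup>2 \<le> hL L * trace (PL L)" by (rule EL_bound[OF L])
  also have "\<dots> \<le> (2 * w ^ 2 * c) * (w * c)"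
    using hL_le trace_PL_le psd_trace_nonneg[OF PL_psd[OF L]] w_ge c
    by (intro mult_mono) auto
  also have "\<dots> \<le> (2 * w ^ 2 * c) * (2 * w ^ 2 * c)"
    using w_ge c by (intro mult_left_mono) (auto simp: power2_eq_square)
  finally have "(norm (EL L))\<^sup>2 \<le> (2 * w ^ 2 * c)\<^sup>2"
    by (simp only: power2_eq_square[of "2 * w ^ 2 * c"])
  then show ?thesis
    by (rule power2_le_imp_le) (use w_ge c in auto)
qed

lemma norm_GL_le: "norm (GL L) \<le> 4 * w ^ 3 * c ^ 2"
proof -
  have "norm (GL L) \<le> 2 * (norm (EL L) * norm (Sg L))"
    using norm_matrix_mult_le[of "EL L" "Sg L"] by (simp add: GL_def)
  also have "\<dots> \<le> 2 * ((2 * w ^ 2 * c) * (w * c))"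
    using norm_EL_le psd_norm_le_trace[OF Sg_psd[OF L]] trace_Sg_le w_ge c
    by (intro mult_left_mono mult_mono) auto
  finally show ?thesis by (simp add: power2_eq_square power3_eq_cube ac_simps)
qed

lemma norm_L_le: "(norm L)\<^sup>2 \<le> w ^ 2 * c"
proof -
  have "(norm L)\<^sup>2 \<le> (1 / \<rho>) * ((1 / \<mu>) * Ct L)"
    using Ct_ge_norm[OF L] \<mu>_pos \<rho>_pos by (simp add: field_simps)
  also have "\<dots> \<le> w * (w * c)"
    using w_ge c Ct_pos[OF L] \<mu>_pos \<rho>_pos by (intro mult_mono) auto
  finally show ?thesis by (simp add: power2_eq_square)
qed

text \<open>In the exact cost difference, replacing the new covariance by the old one turns the
  linear term into \<open>GL L \<bullet> Z\<close>; the error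
  \<open>EL L \<bullet> (Z ** (S' - S))\<close> is of second order because S' - S is of order |Z|.
  The hypothesis on \<open>Z\<close> yields \<open>\<theta> \<le> 1 / 4\<close> as needed for
  \<open>perturbation_stable\<close>, and 76 = 2 * 36 + 4 collects the covariance error and the
  quadratic term.\<close>

lemma smoothness:
  fixes Z :: "real^'n^'m"
  assumes Z: "12 * w ^ 3 * c * norm Z \<le> 1"
  shows "L + Z \<in> U_ad P"
    and "\<bar>Ct (L + Z) - Ct L - GL L \<bullet> Z\<bar> \<le> 76 * w ^ 6 * c ^ 3 * (norm Z)\<^sup>2"
    and "\<tau> (L + Z) \<le> 2 * w ^ 2 * c"
proof -
  define \<theta> where "\<theta> = 3 * (\<beta> * norm Z) * \<tau> L"
  have bt: "\<beta> * \<tau> L \<le> w ^ 3 * c"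
  proof -
    have "\<beta> * \<tau> L \<le> w * (w ^ 2 * c)"
      using w_ge tau_le tau_nonneg by (intro mult_mono) auto
    then show ?thesis by (simp add: power2_eq_square power3_eq_cube ac_simps)
  qed
  have \<theta>_le: "\<theta> \<le> 3 * (w ^ 3 * c) * norm Z"
    using mult_right_mono[OF bt norm_ge_zero[of Z]] by (simp add: \<theta>_def ac_simps)
  then have small: "\<theta> \<le> 1 / 4" using Z by simp
  have "0 \<le> \<theta>"
    using tau_nonneg b2_nonneg by (simp add: \<theta>_def \<beta>_def)
  note p = perturbation_stable[OF L small[unfolded \<theta>_def], folded \<theta>_def]
  show L': "L + Z \<in> U_ad P" by (rule p(1))
  define S S' where "S = Sg L" and "S' = Sg (L + Z)"
  have S: "psd S" and S': "psd S'" using Sg_psd L L' by (simp_all add: S_def S'_def)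
  have tS: "0 \<le> trace S" "trace S \<le> w * c"
    using psd_trace_nonneg[OF S] trace_Sg_le by (simp_all add: S_def)
  have trS': "trace S' \<le> 2 * trace S"
  proof -
    have "trace S' \<le> trace ((1 + 2 * \<theta>) *\<^sub>R S)"
      using psd_trace_mono[OF p(2)] by (simp add: S_def S'_def)
    also have "\<dots> = (1 + 2 * \<theta>) * trace S" by (simp add: linear_scale[OF linear_trace])
    also have "\<dots> \<le> 2 * trace S" using small tS by (intro mult_right_mono) auto
    finally show ?thesis .
  qed
  show "\<tau> (L + Z) \<le> 2 * w ^ 2 * c"
  proof -
    have "\<tau> (L + Z) \<le> 2 * \<tau> L"
      using trS' \<mu>_pos by (simp add: \<tau>_def S_def S'_def field_simps)
    then show ?thesis using tau_le by simp
  qed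
  have diff: "norm (S' - S) \<le> 6 * \<theta> * trace S"
  proof -
    have "psd ((2 * \<theta>) *\<^sub>R S - (S' - S))" using p(2) by (simp add: S_def S'_def algebra_simps)
    moreover have "psd ((2 * \<theta>) *\<^sub>R S + (S' - S))"
    proof -
      have e: "(2 * \<theta>) *\<^sub>R S = \<theta> *\<^sub>R S + \<theta> *\<^sub>R S"
        by (simp flip: scaleR_add_left)
      have "(2 * \<theta>) *\<^sub>R S + (S' - S) = (S' - (1 - \<theta>) *\<^sub>R S) + \<theta> *\<^sub>R S"
        unfolding e by (simp add: scaleR_left_diff_distrib)
      also have "psd \<dots>"
        by (rule psd_add[OF p(3)[folded S_def S'_def] psd_scaleR[OF S \<open>0 \<le> \<theta>\<close>]])
      finally show ?thesis .
    qed
    ultimately have "norm (S' - S) \<le> 3 * trace ((2 * \<theta>) *\<^sub>R S)" by (rule psd_norm_sandwich)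
    then show ?thesis by (simp add: linear_scale[OF linear_trace])
  qed
  have "Ct (L + Z) - Ct L - GL L \<bullet> Z
      = 2 * (EL L \<bullet> (Z ** (S' - S))) + HL L \<bullet> (Z ** S' ** transpose Z)"
    unfolding Ct_diff[OF L L'] inner_GL[OF L] S'_def[symmetric] S_def[symmetric]
      inner_defect[OF L psd_sym[OF S']]
    by (simp add: matrix_mult_simps inner_diff_right algebra_simps)
  moreover have "\<bar>EL L \<bullet> (Z ** (S' - S))\<bar> \<le> 36 * w ^ 6 * c ^ 3 * (norm Z)\<^sup>2"
  proof -
    have "\<bar>EL L \<bullet> (Z ** (S' - S))\<bar> \<le> norm (EL L) * norm (Z ** (S' - S))"
      by (rule Cauchy_Schwarz_ineq2)
    also have "\<dots> \<le> norm (EL L) * (norm Z * (6 * \<theta> * trace S))"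
      by (intro mult_left_mono order_trans[OF norm_matrix_mult_le] diff) simp_all
    also have "\<dots> \<le> (2 * w ^ 2 * c) * (norm Z * (6 * (3 * (w ^ 3 * c) * norm Z) * (w * c)))"
      using norm_EL_le \<theta>_le tS \<open>0 \<le> \<theta>\<close> w_ge c
      by (intro mult_mono) auto
    also have "\<dots> = 36 * w ^ 6 * c ^ 3 * (norm Z)\<^sup>2" by algebra
    finally show ?thesis .
  qed
  moreover have "0 \<le> HL L \<bullet> (Z ** S' ** transpose Z)" by (rule HL_inner_le(1)[OF L S'])
  moreover have "HL L \<bullet> (Z ** S' ** transpose Z) \<le> 4 * w ^ 6 * c ^ 3 * (norm Z)\<^sup>2"
  proof -
    have "HL L \<bullet> (Z ** S' ** transpose Z) \<le> hL L * (norm Z)\<^sup>2 * trace S'"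
      by (rule HL_inner_le(2)[OF L S'])
    also have "\<dots> \<le> (2 * w ^ 2 * c) * (norm Z)\<^sup>2 * (2 * (w * c))"
      using hL_le hL_pos[OF L] trS' tS psd_trace_nonneg[OF S'] w_ge c
      by (intro mult_mono) auto
    also have "\<dots> = 4 * (w ^ 3 * c ^ 2) * (norm Z)\<^sup>2" by algebra
    also have "\<dots> \<le> 4 * (w ^ 6 * c ^ 3) * (norm Z)\<^sup>2"
      using w_ge c by (intro mult_right_mono mult_left_mono mult_mono power_increasing) auto
    finally show ?thesis by (simp add: ac_simps)
  qed
  ultimately show "\<bar>Ct (L + Z) - Ct L - GL L \<bullet> Z\<bar> \<le> 76 * w ^ 6 * c ^ 3 * (norm Z)\<^sup>2"
    by (simp add: abs_le_iff)
qed

end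

section \<open>Sublevel sets and the minimiser\<close>

definition sublevel :: "real \<Rightarrow> (real^'n^'m) set" where
  "sublevel c = {L \<in> U_ad P. Ct L \<le> c}"

lemma continuous_Ct:
  assumes L: "L \<in> U_ad P" and "f \<longlonglongrightarrow> L"
  shows "(\<lambda>j. Ct (f j)) \<longlonglongrightarrow> Ct L"
proof -
  define c where "c = max 1 (Ct L)"
  have c: "Ct L \<le> c" "1 \<le> c" by (simp_all add: c_def)
  define Z where "Z = (\<lambda>j. f j - L)"
  have Z: "Z \<longlonglongrightarrow> 0" unfolding Z_def by (rule LIM_zero) fact
  have "(\<lambda>j. 12 * w ^ 3 * c * norm (Z j)) \<longlonglongrightarrow> 12 * w ^ 3 * c * norm (0 :: real^'n^'m)"
    by (intro tendsto_intros Z)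
  then have "\<forall>\<^sub>F j in sequentially. 12 * w ^ 3 * c * norm (Z j) < 1"
    by (rule order_tendstoD) simp
  then have "\<forall>\<^sub>F j in sequentially. \<bar>Ct (f j) - Ct L - GL L \<bullet> Z j\<bar> \<le> 76 * w ^ 6 * c ^ 3 * (norm (Z j))\<^sup>2"
  proof eventually_elim
    case (elim j)
    then show ?case using smoothness(2)[OF L c, of "Z j"] by (simp add: Z_def)
  qed
  moreover have "(\<lambda>j. 76 * w ^ 6 * c ^ 3 * (norm (Z j))\<^sup>2) \<longlonglongrightarrow> 76 * w ^ 6 * c ^ 3 * (norm (0 :: real^'n^'m))\<^sup>2"
    by (intro tendsto_intros Z)
  ultimately have "(\<lambda>j. Ct (f j) - Ct L - GL L \<bullet> Z j) \<longlonglongrightarrow> 0"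
    using Lim_null_comparison[of "\<lambda>j. Ct (f j) - Ct L - GL L \<bullet> Z j"
        "\<lambda>j. 76 * w ^ 6 * c ^ 3 * (norm (Z j))\<^sup>2" sequentially] by simp
  then have "(\<lambda>j. (Ct (f j) - Ct L - GL L \<bullet> Z j) + Ct L + GL L \<bullet> Z j) \<longlonglongrightarrow> 0 + Ct L + GL L \<bullet> 0"
    by (intro tendsto_intros Z)
  then show ?thesis by simp
qed

text \<open>The point is that a limit is admissible at all. The radius within which
  \<open>smoothness\<close> preserves admissibility depends on the cost bound only, so one late term
  of the sequence carries it over to the limit.\<close>

lemma closed_sublevel: "closed (sublevel c)"
  unfolding closed_sequential_limits
proof (intro allI impI, elim conjE)
  fix f L assume f: "\<forall>j. f j \<in> sublevel c" and lim: "f \<longlonglongrightarrow> L"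
  define c' where "c' = max 1 c"
  have w0: "0 < 12 * w ^ 3 * c'" using w_ge(1) by (simp add: c'_def)
  have "\<forall>\<^sub>F j in sequentially. dist (f j) L < 1 / (12 * w ^ 3 * c')"
    using lim w0 by (intro tendstoD) simp_all
  then obtain j where j: "norm (L - f j) < 1 / (12 * w ^ 3 * c')"
    by (auto simp: eventually_sequentially dist_norm norm_minus_commute)
  have "f j + (L - f j) \<in> U_ad P"
    using f w0 j by (intro smoothness(1)[of _ c']) (auto simp: sublevel_def c'_def field_simps le_max_iff_disj)
  then have L: "L \<in> U_ad P" by simp
  have "Ct L \<le> c"
    using f by (intro LIMSEQ_le_const2[OF continuous_Ct[OF L lim]]) (auto simp: sublevel_def)
  with L show "L \<in> sublevel c" by (simp add: sublevel_def)
qed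

lemma compact_sublevel: "compact (sublevel c)"
proof -
  have "bounded (sublevel c)"
  proof (rule boundedI)
    fix L assume "L \<in> sublevel c"
    then have "(norm L)\<^sup>2 \<le> w ^ 2 * max 1 c"
      by (intro norm_L_le) (auto simp: sublevel_def)
    then show "norm L \<le> sqrt (w ^ 2 * max 1 c)" by (rule real_le_rsqrt)
  qed
  then show ?thesis using closed_sublevel by (simp add: compact_eq_bounded_closed)
qed

text \<open>\<open>L_opt\<close> is an \<open>arg_min_on\<close>, so nothing can be said about it
  before a minimiser is known to exist.\<close>

lemma Ct_minimiser_exists:
  assumes "L\<^sub>0 \<in> U_ad P"
  obtains L where "L \<in> U_ad P" "\<forall>L'\<in>U_ad P. Ct L \<le> Ct L'"
proof -
  have "continuous_on (sublevel (Ct L\<^sub>0)) Ct"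
    unfolding continuous_on_sequentially
    by (auto simp: comp_def sublevel_def intro!: continuous_Ct)
  moreover have "sublevel (Ct L\<^sub>0) \<noteq> {}" using assms by (auto simp: sublevel_def)
  ultimately obtain L where L: "L \<in> sublevel (Ct L\<^sub>0)" "\<forall>L'\<in>sublevel (Ct L\<^sub>0). Ct L \<le> Ct L'"
    using continuous_attains_inf[OF compact_sublevel] by blast
  have "Ct L \<le> Ct L'" if "L' \<in> U_ad P" for L'
    using L that by (cases "Ct L' \<le> Ct L\<^sub>0") (auto simp: sublevel_def)
  then show ?thesis using that[of L] L(1) by (auto simp: sublevel_def)
qed

end

section \<open>Expectations along trajectories\<close>

lemma borel_measurable_matrix_vector [measurable (raw)]:
  "f \<in> borel_measurable M \<Longrightarrow> g \<in> borel_measurable M \<Longrightarrow>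
    (\<lambda>x. (f x :: real^'n^'m) *v (g x :: real^'n)) \<in> borel_measurable M"
  by (rule borel_measurable_continuous_Pair[where H = "(*v)"]) (auto intro!: continuous_intros)

lemma borel_measurable_outer [measurable (raw)]:
  "f \<in> borel_measurable M \<Longrightarrow> g \<in> borel_measurable M \<Longrightarrow>
    (\<lambda>x. outer (f x :: real^'n) (g x)) \<in> borel_measurable M"
  by (rule borel_measurable_continuous_Pair[where H = outer]) (auto intro!: continuous_intros)

lemma borel_measurable_par [measurable (raw)]:
  fixes f :: "'a \<Rightarrow> ('n::finite, 'm::finite) params"
  assumes "f \<in> borel_measurable M"
  shows "(\<lambda>x. parA (f x)) \<in> borel_measurable M" "(\<lambda>x. parB (f x)) \<in> borel_measurable M"
    "(\<lambda>x. parQ (f x)) \<in> borel_measurable M" "(\<lambda>x. parR (f x)) \<in> borel_measurable M"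
    "g \<in> borel_measurable M \<Longrightarrow> (\<lambda>x. Mcl (g x) (f x)) \<in> borel_measurable M"
proof -
  show "(\<lambda>x. parA (f x)) \<in> borel_measurable M" "(\<lambda>x. parB (f x)) \<in> borel_measurable M"
    "(\<lambda>x. parQ (f x)) \<in> borel_measurable M" "(\<lambda>x. parR (f x)) \<in> borel_measurable M"
    by (rule borel_measurable_continuous_on[OF _ assms], intro continuous_intros)+
  show "(\<lambda>x. Mcl (g x) (f x)) \<in> borel_measurable M" if "g \<in> borel_measurable M"
    by (rule borel_measurable_continuous_Pair[where H = Mcl, OF that assms])
      (intro continuous_intros)
qed

lemma borel_measurable_state [measurable (raw)]:
  fixes \<xi> :: "'a \<Rightarrow> nat \<Rightarrow> ('n::finite, 'm::finite) params"
  assumes [measurable]: "L \<in> borel_measurable M" "x \<in> borel_measurable M" "\<And>t. (\<lambda>\<omega>. \<xi> \<omega> t) \<in> borel_measurable M"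
  shows "(\<lambda>\<omega>. state (L \<omega>) (x \<omega>, \<xi> \<omega>) t) \<in> borel_measurable M"
proof (induction t)
  case (Suc t)
  note [measurable] = Suc
  show ?case by simp measurable
qed simp

lemma stage_cost_eq:
  "stage_cost L w t = state L w t \<bullet> (parQ (snd w t) *v state L w t)
    + (L *v state L w t) \<bullet> (parR (snd w t) *v (L *v state L w t))"
  by (simp add: stage_cost_def Let_def matrix_vector_simps)

lemma stage_cost_eq':
  "stage_cost L w t = state L w t \<bullet>
    ((parQ (snd w t) + transpose L ** parR (snd w t) ** L) *v state L w t)"
  unfolding stage_cost_eq
  by (simp add: matrix_vector_simps inner_add_right matrix_vector_mul_assoc[symmetric]
      inner_matrix_vector[of _ "transpose L"])

lemma borel_measurable_stage_cost [measurable (raw)]: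
  fixes \<xi> :: "'a \<Rightarrow> nat \<Rightarrow> ('n::finite, 'm::finite) params"
  assumes [measurable]: "L \<in> borel_measurable M" "x \<in> borel_measurable M" "\<And>t. (\<lambda>\<omega>. \<xi> \<omega> t) \<in> borel_measurable M"
  shows "(\<lambda>\<omega>. stage_cost (L \<omega>) (x \<omega>, \<xi> \<omega>) t) \<in> borel_measurable M"
  unfolding stage_cost_eq by simp

lemma state_Suc_Mcl: "state L w (Suc t) = Mcl L (snd w t) *v state L w t"
  by (simp add: Mcl_def matrix_vector_simps matrix_vector_mul_assoc)

text \<open>First-step decomposition: \<open>case_nat p \<xi>\<close> puts \<open>p\<close> in front
  of the sequence, so after one step the trajectory restarts from \<open>Mcl L p *v x\<close> with
  the sequence \<open>\<xi>\<close>.\<close>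

lemma state_shift: "state L (x, case_nat p \<xi>) (Suc t) = state L (Mcl L p *v x, \<xi>) t"
proof (induction t)
  case 0
  show ?case by (simp add: Mcl_def matrix_vector_simps matrix_vector_mul_assoc)
next
  case (Suc t)
  have "state L (x, case_nat p \<xi>) (Suc (Suc t)) = Mcl L (\<xi> t) *v state L (x, case_nat p \<xi>) (Suc t)"
    by (subst state_Suc_Mcl) (simp del: state.simps)
  also have "\<dots> = state L (Mcl L p *v x, \<xi>) (Suc t)"
    by (simp add: Suc.IH state_Suc_Mcl[of L "(Mcl L p *v x, \<xi>)" t] del: state.simps)
  finally show ?case .
qed

lemma stage_cost_shift:
  "stage_cost L (x, case_nat p \<xi>) (Suc t) = stage_cost L (Mcl L p *v x, \<xi>) t"
  unfolding stage_cost_eq state_shift by simp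

text \<open>One computation with nonnegative integrals yields integrability, the value and, by
  monotone convergence, almost sure summability.\<close>

lemma nn_integral_integral:
  assumes "\<And>t. f t \<in> borel_measurable M" "AE x in M. \<forall>t. 0 \<le> f t x"
    and "\<And>t. (\<integral>\<^sup>+x. ennreal (f t x) \<partial>M) = ennreal (a t)" "\<And>t. 0 \<le> a t"
  shows "integrable M (f t)" "(LINT x|M. f t x) = a t"
    and "summable a \<Longrightarrow> AE x in M. summable (\<lambda>t. f t x)"
proof -
  have nn: "AE x in M. 0 \<le> f t x" for t using assms(2) by eventually_elim simp
  show int: "integrable M (f t)" for t
    by (rule integrableI_nonneg) (simp_all add: assms nn)
  show "(LINT x|M. f t x) = a t"
    by (subst integral_eq_nn_integral[OF assms(1) nn]) (simp add: assms(3,4))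
  assume "summable a"
  have "(\<integral>\<^sup>+x. (\<Sum>t. ennreal (f t x)) \<partial>M) = (\<Sum>t. ennreal (a t))"
    using assms by (subst nn_integral_suminf) auto
  also have "\<dots> = ennreal (suminf a)"
    using \<open>summable a\<close> assms(4) by (intro suminf_ennreal2) auto
  finally have "(\<integral>\<^sup>+x. (\<Sum>t. ennreal (f t x)) \<partial>M) \<noteq> \<infinity>" by simp
  then have "AE x in M. (\<Sum>t. ennreal (f t x)) \<noteq> \<infinity>"
    using assms(1) by (intro nn_integral_PInf_AE) auto
  then show "AE x in M. summable (\<lambda>t. f t x)"
    using assms(2) by eventually_elim (auto intro: summable_suminf_not_top)
qed

section \<open>Integration over trajectories\<close>

context lq
begin

abbreviation "PS \<equiv> \<Pi>\<^sub>M t\<in>(UNIV :: nat set). P"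
abbreviation "TS \<equiv> traj_space D P"

sublocale PI: sequence_space P ..

lemma prob_space_PS: "prob_space PS"
  by (rule prob_space_PiM) (rule Pp.prob_space_axioms)

lemmas sigma_finite_PS = prob_space_imp_sigma_finite[OF prob_space_PS]
lemmas emeasure_PS = prob_space.emeasure_space_1[OF prob_space_PS]

sublocale DPI: pair_prob_space D PS ..

sublocale PPI: pair_prob_space P PS ..

lemma prob_space_TS: "prob_space TS"
  unfolding traj_space_def by (rule DPI.P.prob_space_axioms)

lemma measurable_component_P: "(\<lambda>\<xi>. \<xi> t) \<in> borel_measurable PS"
  using measurable_component_singleton[of t UNIV "\<lambda>_. P"]
  by (simp add: measurable_cong_sets[OF refl sets_P])

lemma measurable_TS [measurable]:
  "fst \<in> borel_measurable TS" "(\<lambda>w. snd w t) \<in> borel_measurable TS"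
proof -
  show "fst \<in> borel_measurable TS"
    unfolding traj_space_def using measurable_fst[of D PS]
    by (simp add: measurable_cong_sets[OF refl sets_D])
  show "(\<lambda>w. snd w t) \<in> borel_measurable TS"
    unfolding traj_space_def by (rule measurable_compose[OF measurable_snd measurable_component_P])
qed

lemma measurable_state_TS [measurable]: "(\<lambda>w. state L w t) \<in> borel_measurable TS"
  and measurable_stage_TS [measurable]: "(\<lambda>w. stage_cost L w t) \<in> borel_measurable TS"
  using borel_measurable_state[of "\<lambda>_. L" TS fst snd t]
    borel_measurable_stage_cost[of "\<lambda>_. L" TS fst snd t] by simp_all

lemma measurable_state_S [measurable]: "(\<lambda>\<xi>. state L (x, \<xi>) t) \<in> borel_measurable PS"
  and measurable_stage_S [measurable]: "(\<lambda>\<xi>. stage_cost L (x, \<xi>) t) \<in> borel_measurable PS"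
  using borel_measurable_state[of "\<lambda>_. L" PS "\<lambda>_. x" "\<lambda>\<xi>. \<xi>" t]
    borel_measurable_stage_cost[of "\<lambda>_. L" PS "\<lambda>_. x" "\<lambda>\<xi>. \<xi>" t] measurable_component_P by simp_all

text \<open>Prepending an independent draw preserves the product measure; this is conditioning on
  the first parameter.\<close>

lemma nn_integral_shift:
  assumes f: "f \<in> borel_measurable PS"
  shows "(\<integral>\<^sup>+\<xi>. f \<xi> \<partial>PS) = (\<integral>\<^sup>+p. (\<integral>\<^sup>+\<xi>. f (case_nat p \<xi>) \<partial>PS) \<partial>P)"
proof -
  have m: "(\<lambda>(s, \<omega>). case_nat s \<omega>) \<in> measurable (P \<Otimes>\<^sub>M PS) PS"
    by measurable
  have "(\<integral>\<^sup>+\<xi>. f \<xi> \<partial>PS) = (\<integral>\<^sup>+\<xi>. f \<xi> \<partial>distr (P \<Otimes>\<^sub>M PS) PS (\<lambda>(s, \<omega>). case_nat s \<omega>))"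
    by (subst PI.PiM_iter) simp
  also have "\<dots> = (\<integral>\<^sup>+x. f (case x of (s, \<omega>) \<Rightarrow> case_nat s \<omega>) \<partial>(P \<Otimes>\<^sub>M PS))"
    by (rule nn_integral_distr[OF m]) (simp add: f)
  also have "\<dots> = (\<integral>\<^sup>+p. (\<integral>\<^sup>+\<xi>. f (case (p, \<xi>) of (s, \<omega>) \<Rightarrow> case_nat s \<omega>) \<partial>PS) \<partial>P)"
    by (rule sigma_finite_measure.nn_integral_fst[OF sigma_finite_PS, symmetric]) (rule measurable_compose[OF m f])
  finally show ?thesis by simp
qed

lemma nn_integral_Fa:
  assumes W: "psd W"
  shows "(\<integral>\<^sup>+p. ennreal ((Mcl L p *v x) \<bullet> (W *v (Mcl L p *v x))) \<partial>P) = ennreal (x \<bullet> (Fa L W *v x))"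
proof -
  have eq: "(Mcl L p *v x) \<bullet> (W *v (Mcl L p *v x)) = x \<bullet> ((transpose (Mcl L p) ** W ** Mcl L p) *v x)" for p
    by (simp only: matrix_vector_mul_assoc[symmetric] inner_matrix_vector[of x "transpose (Mcl L p)"]
        transpose_transpose)
  have "(\<integral>\<^sup>+p. ennreal ((Mcl L p *v x) \<bullet> (W *v (Mcl L p *v x))) \<partial>P)
      = ennreal (LINT p|P. (Mcl L p *v x) \<bullet> (W *v (Mcl L p *v x)))"
    by (intro nn_integral_eq_integral integrable_P continuous_intros AE_I2 psd_ge0[OF W])
  then show ?thesis
    unfolding eq Fa_def by (simp add: integral_linear(1)[OF linear_form integrable_Fa])
qed

lemma Fa_funpow_psd: "psd W \<Longrightarrow> psd ((Fa L ^^ t) W)" and F_funpow_psd: "psd W \<Longrightarrow> psd ((F L ^^ t) W)"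
  by (rule positive_map_psd[OF positive_map_funpow]; simp add: positive_map_Fa positive_map_F)+

text \<open>The induction conditions on the first step. It therefore needs an arbitrary start
  \<open>x\<close> and produces the adjoint map: the outermost \<open>Fa L\<close> averages over the
  first parameter.\<close>

lemma nn_integral_state_form:
  assumes W: "psd W"
  shows "(\<integral>\<^sup>+\<xi>. ennreal (state L (x, \<xi>) t \<bullet> (W *v state L (x, \<xi>) t)) \<partial>PS)
    = ennreal (x \<bullet> ((Fa L ^^ t) W *v x))"
proof (induction t arbitrary: x)
  case 0
  show ?case by (simp add: emeasure_PS)
next
  case (Suc t)
  show ?case
    by (subst nn_integral_shift)
      (simp_all add: state_shift Suc.IH nn_integral_Fa[OF Fa_funpow_psd[OF W]] del: state.simps)
qed

lemma nn_integral_stage_cost: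
  "(\<integral>\<^sup>+\<xi>. ennreal (stage_cost L (x, \<xi>) t) \<partial>PS) = ennreal (x \<bullet> ((Fa L ^^ t) (QL L) *v x))"
proof (induction t arbitrary: x)
  case 0
  have "integrable P (\<lambda>p. parQ p + transpose L ** parR p ** L)"
    by (intro integrable_P continuous_intros)
  note lin = integral_linear[OF linear_form this]
  have "(\<integral>\<^sup>+\<xi>. ennreal (stage_cost L (x, \<xi>) 0) \<partial>PS)
      = (\<integral>\<^sup>+p. ennreal (x \<bullet> ((parQ p + transpose L ** parR p ** L) *v x)) \<partial>P)"
  proof -
    have m: "(\<lambda>\<xi>. ennreal (stage_cost L (x, \<xi>) 0)) \<in> borel_measurable PS" by measurable
    show ?thesis unfolding nn_integral_shift[OF m] by (simp add: stage_cost_eq' emeasure_PS)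
  qed
  also have "\<dots> = ennreal (x \<bullet> ((LINT p|P. parQ p + transpose L ** parR p ** L) *v x))"
    unfolding lin(1)[symmetric]
  proof (rule nn_integral_eq_integral[OF lin(2)])
    show "AE p in P. 0 \<le> x \<bullet> ((parQ p + transpose L ** parR p ** L) *v x)"
      using AE_psd by eventually_elim (auto intro!: psd_ge0 psd_add psd_congruence')
  qed
  also have "(LINT p|P. parQ p + transpose L ** parR p ** L) = QL L"
  proof -
    have iR: "integrable P parR" and iQ: "integrable P parQ" by (intro integrable_P continuous_intros)+
    have "linear (\<lambda>R :: real^'m^'m. transpose L ** R ** L)"
      by (simp add: linear_iff matrix_mult_simps)
    from integral_linear[OF this iR] iQ show ?thesis by (simp add: QL_def Qm_def Rm_def)
  qed
  finally show ?case by simp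
next
  case (Suc t)
  show ?case
    by (subst nn_integral_shift)
      (simp_all add: stage_cost_shift Suc.IH nn_integral_Fa[OF Fa_funpow_psd[OF QL_psd]])
qed

lemma integrable_norm2_D: "integrable D (\<lambda>x. (norm x)\<^sup>2)"
  using mom by (simp add: moments_stabilizable_def)

lemma integrable_outer_D: "integrable D (\<lambda>x. outer x x)"
proof (rule Bochner_Integration.integrable_bound[OF integrable_norm2_D])
  show "(\<lambda>x. outer x x) \<in> borel_measurable D" by (intro measurable_D continuous_intros)
  have "norm (outer x x) \<le> norm ((norm x)\<^sup>2)" for x :: "real^'n"
    using psd_norm_le_trace[OF psd_outer, of x] by (simp add: trace_outer power2_norm_eq_inner)
  then show "AE x in D. norm (outer x x) \<le> norm ((norm x)\<^sup>2)" by simp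
qed

lemma nn_integral_D_form:
  assumes W: "psd W"
  shows "(\<integral>\<^sup>+x. ennreal (x \<bullet> (W *v x)) \<partial>D) = ennreal (W \<bullet> \<Sigma>\<^sub>0)"
proof -
  have "(LINT x|D. W \<bullet> outer x x) = W \<bullet> \<Sigma>\<^sub>0" "integrable D (\<lambda>x. W \<bullet> outer x x)"
    unfolding Sigma0_def by (rule integral_linear[OF linear_inner_right integrable_outer_D])+
  moreover have "W \<bullet> outer x x = x \<bullet> (W *v x)" for x by (rule inner_outer)
  ultimately show ?thesis
    using nn_integral_eq_integral[of D "\<lambda>x. x \<bullet> (W *v x)"] psd_ge0[OF W] by simp
qed

lemma nn_integral_TS:
  assumes f: "f \<in> borel_measurable TS"
  shows "(\<integral>\<^sup>+w. f w \<partial>TS) = (\<integral>\<^sup>+x. (\<integral>\<^sup>+\<xi>. f (x, \<xi>) \<partial>PS) \<partial>D)"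
  using f unfolding traj_space_def by (rule sigma_finite_measure.nn_integral_fst[OF sigma_finite_PS, symmetric])

lemma nn_integral_TS_state_form:
  assumes W: "psd W"
  shows "(\<integral>\<^sup>+w. ennreal (state L w t \<bullet> (W *v state L w t)) \<partial>TS) = ennreal (W \<bullet> (F L ^^ t) \<Sigma>\<^sub>0)"
  by (subst nn_integral_TS)
    (simp_all add: nn_integral_state_form[OF W] nn_integral_D_form[OF Fa_funpow_psd[OF W]] Fa_adjoint_funpow)

lemma nn_integral_TS_stage_cost:
  "(\<integral>\<^sup>+w. ennreal (stage_cost L w t) \<partial>TS) = ennreal (QL L \<bullet> (F L ^^ t) \<Sigma>\<^sub>0)"
  by (subst nn_integral_TS)
    (simp_all add: nn_integral_stage_cost nn_integral_D_form[OF Fa_funpow_psd[OF QL_psd]] Fa_adjoint_funpow)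

lemma AE_TS_component:
  assumes "AE p in P. Q p"
  shows "AE w in TS. \<forall>t. Q (snd w t)"
proof -
  have "AE \<xi> in PS. Q (\<xi> t)" for t
    using assms by (intro AE_PiM_component Pp.prob_space_axioms) auto
  then have "AE \<xi> in PS. \<forall>t. Q (\<xi> t)" by (simp add: AE_all_countable)
  then have "AE w in D \<Otimes>\<^sub>M PS. \<forall>t. Q (snd w t)"
  proof (rule AE_E3)
    fix N assume N: "\<And>\<xi>. \<xi> \<in> space PS - N \<Longrightarrow> \<forall>t. Q (\<xi> t)" "N \<in> null_sets PS"
    have "space D \<times> N \<in> null_sets (D \<Otimes>\<^sub>M PS)"
      using N(2) by (intro sigma_finite_measure.times_in_null_sets2[OF sigma_finite_PS]) auto
    then show ?thesis
      using N(1) by (intro AE_I'[of "space D \<times> N"]) (auto simp: space_pair_measure, metis)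
  qed
  then show ?thesis unfolding traj_space_def .
qed

lemma AE_stage_cost_nonneg: "AE w in TS. \<forall>t L. 0 \<le> stage_cost L w t"
  using AE_TS_component[OF AE_psd]
  by eventually_elim (auto simp: stage_cost_eq intro!: add_nonneg_nonneg psd_ge0)

lemma QL_F_nonneg: "0 \<le> QL L \<bullet> (F L ^^ t) \<Sigma>\<^sub>0"
  by (intro psd_inner_nonneg QL_psd F_funpow_psd Sigma0_psd)

lemma integrable_stage_cost: "integrable TS (\<lambda>w. stage_cost L w t)"
  and integral_stage_cost: "(LINT w|TS. stage_cost L w t) = QL L \<bullet> (F L ^^ t) \<Sigma>\<^sub>0"
  and AE_summable_stage_cost:
    "summable (\<lambda>t. QL L \<bullet> (F L ^^ t) \<Sigma>\<^sub>0) \<Longrightarrow> AE w in TS. summable (\<lambda>t. stage_cost L w t)"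
proof -
  have "AE w in TS. \<forall>t. 0 \<le> stage_cost L w t" using AE_stage_cost_nonneg by eventually_elim simp
  note * = nn_integral_integral[OF measurable_stage_TS this nn_integral_TS_stage_cost QL_F_nonneg]
  show "integrable TS (\<lambda>w. stage_cost L w t)" "(LINT w|TS. stage_cost L w t) = QL L \<bullet> (F L ^^ t) \<Sigma>\<^sub>0"
    by (rule *)+
  show "AE w in TS. summable (\<lambda>t. stage_cost L w t)" if "summable (\<lambda>t. QL L \<bullet> (F L ^^ t) \<Sigma>\<^sub>0)"
    by (rule *(3)[OF that])
qed

lemma cost_eq:
  assumes L: "L \<in> U_ad P"
  shows "cost D P L = Ct L"
proof -
  have sm: "summable (\<lambda>t. QL L \<bullet> (F L ^^ t) \<Sigma>\<^sub>0)" using Ct_sums[OF L] by (rule sums_summable)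
  have nn: "AE w in TS. \<forall>t. 0 \<le> stage_cost L w t" using AE_stage_cost_nonneg by eventually_elim simp
  have n_eq: "(LINT w|TS. norm (stage_cost L w t)) = QL L \<bullet> (F L ^^ t) \<Sigma>\<^sub>0" for t
    unfolding integral_stage_cost[symmetric] using nn
    by (intro integral_cong_AE) (auto elim!: eventually_mono)
  have "cost D P L = (LINT w|TS. (\<Sum>t. stage_cost L w t))"
    unfolding cost_def stage_cost_eq' ..
  also have "\<dots> = (\<Sum>t. LINT w|TS. stage_cost L w t)"
  proof (rule integral_suminf)
    show "AE w in TS. summable (\<lambda>t. norm (stage_cost L w t))"
      using nn AE_summable_stage_cost[OF sm] by eventually_elim simp
    show "summable (\<lambda>t. LINT w|TS. norm (stage_cost L w t))" unfolding n_eq by (rule sm)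
  qed (rule integrable_stage_cost)
  also have "\<dots> = Ct L" unfolding integral_stage_cost using Ct_sums[OF L] by (simp add: sums_iff)
  finally show ?thesis .
qed

lemma integrable_state_form:
  assumes W: "psd W"
  shows "integrable TS (\<lambda>w. state L w t \<bullet> (W *v state L w t))"
    and "(LINT w|TS. state L w t \<bullet> (W *v state L w t)) = W \<bullet> (F L ^^ t) \<Sigma>\<^sub>0"
    and "summable (\<lambda>t. W \<bullet> (F L ^^ t) \<Sigma>\<^sub>0) \<Longrightarrow> AE w in TS. summable (\<lambda>t. state L w t \<bullet> (W *v state L w t))"
proof -
  have m: "(\<lambda>w. state L w t \<bullet> (W *v state L w t)) \<in> borel_measurable TS" for t by measurable
  have "AE w in TS. \<forall>t. 0 \<le> state L w t \<bullet> (W *v state L w t)" using psd_ge0[OF W] by simp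
  moreover have "0 \<le> W \<bullet> (F L ^^ t) \<Sigma>\<^sub>0" for t by (intro psd_inner_nonneg W F_funpow_psd Sigma0_psd)
  ultimately show "integrable TS (\<lambda>w. state L w t \<bullet> (W *v state L w t))"
    "(LINT w|TS. state L w t \<bullet> (W *v state L w t)) = W \<bullet> (F L ^^ t) \<Sigma>\<^sub>0"
    "summable (\<lambda>t. W \<bullet> (F L ^^ t) \<Sigma>\<^sub>0) \<Longrightarrow> AE w in TS. summable (\<lambda>t. state L w t \<bullet> (W *v state L w t))"
    using nn_integral_integral[where f = "\<lambda>t w. state L w t \<bullet> (W *v state L w t)", OF m _ nn_integral_TS_state_form[OF W]]
    by (simp_all only:)
qed

text \<open>Mean-square stability only speaks of the orbit of \<open>\<Sigma>\<^sub>0\<close>. As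
  \<open>\<Sigma>\<^sub>0\<close> is positive definite, a multiple of it dominates any positive
  semidefinite \<open>W\<close>, so all orbits tend to 0.\<close>

lemma U_ad_nonempty: "U_ad P \<noteq> {}"
proof -
  obtain L where "ms_stabilizing D P L" using mom by (auto simp: moments_stabilizable_def)
  then have lim: "(\<lambda>t. trace ((F L ^^ t) \<Sigma>\<^sub>0)) \<longlonglongrightarrow> 0"
    using integrable_state_form(2)[OF psd_mat1, of L] by (simp add: ms_stabilizing_def inner_mat_1)
  have "(\<lambda>t. (F L ^^ t) W) \<longlonglongrightarrow> 0" if W: "psd W" for W
  proof (rule Lim_null_comparison)
    define c where "c = trace W / \<mu>"
    have c: "0 \<le> c" "c * \<mu> = trace W" using psd_trace_nonneg[OF W] \<mu>_pos by (simp_all add: c_def)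
    have "psd (c *\<^sub>R (\<Sigma>\<^sub>0 - \<mu> *\<^sub>R mat 1) + (trace W *\<^sub>R mat 1 - W))"
      by (intro psd_add psd_scaleR Sigma0_ge c psd_le_trace W)
    then have "psd (c *\<^sub>R \<Sigma>\<^sub>0 - W)" using c(2) by (simp add: algebra_simps)
    then have "psd (c *\<^sub>R (F L ^^ t) \<Sigma>\<^sub>0 - (F L ^^ t) W)" for t
      using F_funpow_psd[of "c *\<^sub>R \<Sigma>\<^sub>0 - W" t L]
      by (simp add: positive_map_simps[OF positive_map_funpow[OF positive_map_F]])
    then have "trace ((F L ^^ t) W) \<le> c * trace ((F L ^^ t) \<Sigma>\<^sub>0)" for t
      using psd_trace_mono by (metis linear_scale[OF linear_trace] real_scaleR_def)
    then show "\<forall>\<^sub>F t in sequentially. norm ((F L ^^ t) W) \<le> c * trace ((F L ^^ t) \<Sigma>\<^sub>0)"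
      by (intro always_eventually allI order_trans[OF psd_norm_le_trace[OF F_funpow_psd[OF W]]])
    show "(\<lambda>t. c * trace ((F L ^^ t) \<Sigma>\<^sub>0)) \<longlonglongrightarrow> 0"
      using tendsto_mult_left[OF lim, of c] by simp
  qed
  then have "spectral_radius_on sym_matrices (F L) < 1"
    by (rule spectral_radius_less_1I[OF positive_map_F])
  then show ?thesis by (auto simp: U_ad_def)
qed

text \<open>The matrix expectations are identified through their quadratic forms: the form of
  \<open>f t w\<close> at \<open>x\<close> is the form of \<open>outer x x\<close> at the state,
  whose expectation is known.\<close>

lemma state_cov_eq:
  assumes L: "L \<in> U_ad P"
  shows "state_cov D P L = Sg L"
proof -
  define f where "f t w = outer (state L w t) (state L w t)" for t w
  have fm: "f t \<in> borel_measurable TS" for t unfolding f_def by measurable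
  have tr: "(LINT w|TS. (norm (state L w t))\<^sup>2) = trace ((F L ^^ t) \<Sigma>\<^sub>0)"
    and int_n: "integrable TS (\<lambda>w. (norm (state L w t))\<^sup>2)" for t
    using integrable_state_form(1,2)[OF psd_mat1, of L t] by (simp_all add: inner_mat_1 power2_norm_eq_inner)
  have sm: "summable (\<lambda>t. trace ((F L ^^ t) \<Sigma>\<^sub>0))"
    using bounded_linear.sums[OF bounded_linear_inner_right[of "mat 1"] Sg_sums[OF L]]
    by (simp add: inner_mat_1 sums_summable)
  have ae: "AE w in TS. summable (\<lambda>t. (norm (state L w t))\<^sup>2)"
    using integrable_state_form(3)[OF psd_mat1, of L] sm by (simp add: inner_mat_1 power2_norm_eq_inner)
  have nf: "norm (f t w) \<le> (norm (state L w t))\<^sup>2" for t w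
    using psd_norm_le_trace[OF psd_outer] by (simp add: f_def trace_outer power2_norm_eq_inner)
  have int_f: "integrable TS (f t)" for t
    by (rule Bochner_Integration.integrable_bound[OF int_n[of t] fm]) (simp add: nf)
  have Ef: "(LINT w|TS. f t w) = (F L ^^ t) \<Sigma>\<^sub>0" for t
  proof (rule symmetric_form_eq)
    show "transpose (LINT w|TS. f t w) = (LINT w|TS. f t w)"
      by (rule psd_sym[OF psd_integral[OF int_f]]) (simp add: f_def psd_outer)
    show "transpose ((F L ^^ t) \<Sigma>\<^sub>0) = (F L ^^ t) \<Sigma>\<^sub>0" by (rule psd_sym[OF F_funpow_psd[OF Sigma0_psd]])
    fix x
    have "x \<bullet> (f t w *v x) = state L w t \<bullet> (outer x x *v state L w t)" for w
      by (simp add: f_def outer_apply inner_commute)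
    then have "x \<bullet> ((LINT w|TS. f t w) *v x) = (LINT w|TS. state L w t \<bullet> (outer x x *v state L w t))"
      by (simp add: integral_linear(1)[OF linear_form int_f, symmetric])
    also have "\<dots> = x \<bullet> ((F L ^^ t) \<Sigma>\<^sub>0 *v x)"
      by (simp add: integrable_state_form(2)[OF psd_outer] inner_outer inner_commute[of "outer x x"])
    finally show "x \<bullet> ((LINT w|TS. f t w) *v x) = x \<bullet> ((F L ^^ t) \<Sigma>\<^sub>0 *v x)" .
  qed
  have "state_cov D P L = (LINT w|TS. (\<Sum>t. f t w))" by (simp add: state_cov_def f_def)
  also have "\<dots> = (\<Sum>t. LINT w|TS. f t w)"
  proof (rule integral_suminf[OF int_f])
    show "AE w in TS. summable (\<lambda>t. norm (f t w))"
      using ae by eventually_elim (rule summable_comparison_test'[of _ 0], auto simp: nf)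
    show "summable (\<lambda>t. LINT w|TS. norm (f t w))"
    proof (rule summable_comparison_test'[OF sm, of 0])
      fix t
      have "(LINT w|TS. norm (f t w)) \<le> trace ((F L ^^ t) \<Sigma>\<^sub>0)"
        unfolding tr[symmetric] by (intro integral_mono integrable_norm int_f int_n nf)
      then show "norm (LINT w|TS. norm (f t w)) \<le> trace ((F L ^^ t) \<Sigma>\<^sub>0)" by simp
    qed
  qed
  also have "\<dots> = Sg L" unfolding Ef using Sg_sums[OF L] by (simp add: sums_iff)
  finally show ?thesis .
qed

lemma L_opt:
  shows "L_opt D P \<in> U_ad P" and "L \<in> U_ad P \<Longrightarrow> Ct (L_opt D P) \<le> Ct L"
proof -
  obtain L\<^sub>0 where "L\<^sub>0 \<in> U_ad P" using U_ad_nonempty by blast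
  then obtain L\<^sub>1 where L1: "L\<^sub>1 \<in> U_ad P" "\<forall>L'\<in>U_ad P. Ct L\<^sub>1 \<le> Ct L'"
    by (rule Ct_minimiser_exists)
  then have "is_arg_min (cost D P) (\<lambda>L. L \<in> U_ad P) L\<^sub>1"
    by (auto simp: is_arg_min_linorder cost_eq)
  then have "is_arg_min (cost D P) (\<lambda>L. L \<in> U_ad P) (L_opt D P)"
    unfolding L_opt_def arg_min_on_def arg_min_def by (rule someI)
  then show *: "L_opt D P \<in> U_ad P" "L \<in> U_ad P \<Longrightarrow> Ct (L_opt D P) \<le> Ct L"
    by (auto simp: is_arg_min_linorder cost_eq)
qed

end

section \<open>Second moments of the uniform law on a sphere\<close>

text \<open>For an involution the preimage of a box is the box with permuted corners, of the same
  volume.\<close>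

lemma lborel_distr_permute_coords:
  fixes \<pi> :: "'a::euclidean_space \<Rightarrow> 'a"
  assumes \<pi>: "\<And>j. j \<in> Basis \<Longrightarrow> \<pi> j \<in> Basis" "\<And>j. \<pi> (\<pi> j) = j"
  defines "T \<equiv> \<lambda>x :: 'a. \<Sum>j\<in>Basis. (x \<bullet> \<pi> j) *\<^sub>R j"
  shows "distr lborel borel T = lborel"
proof (rule lborel_eqI[symmetric])
  have Tm: "T \<in> borel_measurable borel" unfolding T_def by measurable
  have T: "T x \<bullet> j = x \<bullet> \<pi> j" if "j \<in> Basis" for x j
    using that by (simp add: T_def inner_sum_left inner_Basis if_distrib sum.delta' cong: if_cong)
  fix l u :: 'a assume lu: "\<And>b. b \<in> Basis \<Longrightarrow> l \<bullet> b \<le> u \<bullet> b"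
  have bij: "bij_betw \<pi> Basis Basis"
    by (rule bij_betw_byWitness[where f' = \<pi>]) (use \<pi> in auto)
  have "T -` box l u = box (T l) (T u)"
    using \<pi> T by (auto simp: mem_box) metis+
  then have "emeasure (distr lborel borel T) (box l u) = emeasure lborel (box (T l) (T u))"
    using Tm by (simp add: emeasure_distr)
  also have "\<dots> = ennreal (\<Prod>b\<in>Basis. (T u - T l) \<bullet> b)"
    using lu \<pi> by (intro emeasure_lborel_box) (simp add: T)
  also have "(\<Prod>b\<in>Basis. (T u - T l) \<bullet> b) = (\<Prod>b\<in>Basis. (u - l) \<bullet> \<pi> b)"
    by (intro prod.cong refl) (simp add: inner_diff_left T)
  also have "\<dots> = (\<Prod>b\<in>Basis. (u - l) \<bullet> b)"
    using prod.reindex_bij_betw[OF bij, of "\<lambda>b. (u - l) \<bullet> b"] by simp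
  finally show "emeasure (distr lborel borel T) (box l u) = ennreal (\<Prod>b\<in>Basis. (u - l) \<bullet> b)" .
qed simp

lemma lborel_distr_flip_coords:
  fixes c :: "'a::euclidean_space \<Rightarrow> real"
  assumes "\<And>j. \<bar>c j\<bar> = 1"
  shows "distr lborel borel (\<lambda>x :: 'a. \<Sum>j\<in>Basis. (c j * (x \<bullet> j)) *\<^sub>R j) = lborel"
proof -
  have "c j \<noteq> 0" for j using assms[of j] by auto
  then show ?thesis
    using lborel_affine_euclidean[of c "0 :: 'a"] by (simp add: assms density_1)
qed

lemma prob_space_uniform_ball:
  "prob_space (uniform_measure lborel (ball (0 :: 'a::euclidean_space) 1))"
proof (rule prob_space_uniform_measure)
  show "emeasure lborel (ball (0 :: 'a) 1) \<noteq> 0"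
    using content_ball_pos[of 1 "0 :: 'a"] by (auto simp: measure_def)
  show "emeasure lborel (ball (0 :: 'a) 1) \<noteq> \<infinity>"
    using emeasure_bounded_finite[of "ball (0 :: 'a) 1"] by simp
qed

lemma sets_uniform_sphere [simp, measurable_cong]: "sets (uniform_sphere r) = sets borel"
  and space_uniform_sphere [simp]: "space (uniform_sphere r) = UNIV"
  by (simp_all add: uniform_sphere_def)

lemma measurable_radial: "(\<lambda>z :: 'a::euclidean_space. r *\<^sub>R sgn z) \<in> borel_measurable (uniform_measure lborel A)"
  by (simp add: sgn_div_norm)

lemma prob_space_uniform_sphere: "prob_space (uniform_sphere r)"
  unfolding uniform_sphere_def
  by (intro prob_space.prob_space_distr prob_space_uniform_ball measurable_radial)

lemma AE_uniform_sphere: "0 \<le> r \<Longrightarrow> AE U in uniform_sphere r. norm (U :: 'a::euclidean_space) = r"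
proof -
  assume "0 \<le> r"
  have "AE z in lborel. z \<noteq> (0 :: 'a)" by (rule AE_lborel_singleton)
  then have "AE z in uniform_measure lborel (ball (0 :: 'a) 1). z \<noteq> 0"
    by (intro AE_uniform_measureI) (auto elim: eventually_mono)
  then have "AE z in uniform_measure lborel (ball (0 :: 'a) 1). norm (r *\<^sub>R sgn z) = r"
    using \<open>0 \<le> r\<close> by (auto elim!: eventually_mono simp: norm_sgn)
  then show ?thesis
    unfolding uniform_sphere_def
    by (subst AE_distr_iff[OF measurable_radial]) auto
qed

text \<open>A norm-preserving linear map commutes with the radial projection and preserves the ball,
  so invariance of Lebesgue measure passes to the sphere.\<close>

lemma uniform_sphere_invariant:
  fixes T :: "'a::euclidean_space \<Rightarrow> 'a"
  assumes T: "linear T" "\<And>x. norm (T x) = norm x" and inv: "distr lborel borel T = lborel"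
  shows "distr (uniform_sphere r) borel T = uniform_sphere r"
proof -
  let ?B = "ball (0 :: 'a) 1"
  have Tm [measurable]: "T \<in> borel_measurable borel"
    by (intro borel_measurable_continuous_onI continuous_on_linear T)
  have Tm': "T \<in> borel_measurable (uniform_measure lborel ?B)" by simp
  have eq: "distr (uniform_measure lborel ?B) borel T = uniform_measure lborel ?B"
  proof (rule measure_eqI)
    fix X assume "X \<in> sets (distr (uniform_measure lborel ?B) borel T)"
    then have X [measurable]: "X \<in> sets borel" by simp
    have "T -` X \<in> sets borel" using measurable_sets[OF Tm X] by simp
    then have "emeasure (distr (uniform_measure lborel ?B) borel T) X
      = emeasure lborel (?B \<inter> T -` X) / emeasure lborel ?B"
      using X by (simp add: emeasure_distr[OF Tm'])
    also have "?B \<inter> T -` X = T -` (?B \<inter> X)" using T(2) by auto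
    also have "emeasure lborel (T -` (?B \<inter> X)) = emeasure (distr lborel borel T) (?B \<inter> X)"
      by (simp add: emeasure_distr)
    also have "\<dots> = emeasure lborel (?B \<inter> X)" by (simp only: inv)
    finally show "emeasure (distr (uniform_measure lborel ?B) borel T) X = emeasure (uniform_measure lborel ?B) X"
      using X by simp
  qed simp
  have sgnT: "T (r *\<^sub>R sgn z) = r *\<^sub>R sgn (T z)" for z
    by (simp add: sgn_div_norm linear_scale[OF T(1)] T(2))
  have "distr (uniform_sphere r) borel T
    = distr (uniform_measure lborel ?B) borel (\<lambda>z. r *\<^sub>R sgn (T z))"
    unfolding uniform_sphere_def
    by (subst distr_distr[OF Tm measurable_radial]) (simp add: comp_def sgnT)
  also have "\<dots> = distr (distr (uniform_measure lborel ?B) borel T) borel (\<lambda>z. r *\<^sub>R sgn z)"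
    by (subst distr_distr) (simp_all add: comp_def sgn_div_norm)
  also have "\<dots> = uniform_sphere r" by (simp only: eq uniform_sphere_def)
  finally show ?thesis .
qed

lemma integrable_uniform_sphere:
  fixes f :: "'a::euclidean_space \<Rightarrow> 'b::{banach, second_countable_topology}"
  assumes "0 \<le> r" "f \<in> borel_measurable borel" "\<And>U. norm U = r \<Longrightarrow> norm (f U) \<le> B"
  shows "integrable (uniform_sphere r) f"
proof -
  interpret prob_space "uniform_sphere r :: 'a measure" by (rule prob_space_uniform_sphere)
  have "f \<in> borel_measurable (uniform_sphere r)"
    using assms(2) by (simp add: measurable_cong_sets[OF sets_uniform_sphere refl])
  then show ?thesis
    using AE_uniform_sphere[OF assms(1)]
    by (intro integrable_const_bound[where B = B]) (auto elim!: eventually_mono intro: assms)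
qed

text \<open>Two symmetries suffice: flipping the sign of one coordinate kills the mean and the mixed
  moments, and exchanging two coordinates makes all second moments equal, with sum
  \<open>r\<^sup>2\<close>.\<close>

lemma uniform_sphere_moments:
  fixes b b' :: "'a::euclidean_space"
  assumes r: "0 \<le> r" and b: "b \<in> Basis" "b' \<in> Basis"
  shows "(LINT U|uniform_sphere r. U \<bullet> b) = 0"
    and "(LINT U|uniform_sphere r. (U \<bullet> b) * (U \<bullet> b')) = (if b = b' then r\<^sup>2 / DIM('a) else 0)"
proof -
  interpret prob_space "uniform_sphere r :: 'a measure" by (rule prob_space_uniform_sphere)
  have inv: "(LINT U|uniform_sphere r. f (T U)) = (LINT U|uniform_sphere r. f U)"
    if "linear T" "\<And>x. norm (T x) = norm x" "distr lborel borel T = lborel" "f \<in> borel_measurable borel"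
    for T :: "'a \<Rightarrow> 'a" and f :: "'a \<Rightarrow> real"
  proof -
    have "T \<in> borel_measurable borel"
      by (intro borel_measurable_continuous_onI continuous_on_linear that)
    then have "(LINT U|uniform_sphere r. f (T U)) = (LINT U|distr (uniform_sphere r) borel T. f U)"
      using that(4) by (subst integral_distr) simp_all
    then show ?thesis by (simp only: uniform_sphere_invariant[OF that(1-3)])
  qed
  define T where "T x = (\<Sum>j\<in>Basis. ((if j = b then -1 else 1) * (x \<bullet> j)) *\<^sub>R j)" for x :: 'a
  have Tj: "T x \<bullet> j = (if j = b then -1 else 1) * (x \<bullet> j)" if "j \<in> Basis" for x j
    using that by (simp add: T_def inner_sum_left inner_Basis if_distrib sum.delta' cong: if_cong)
  have linT: "linear T"
    by (rule linearI; rule euclidean_eqI) (simp_all add: Tj inner_add_left algebra_simps)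
  have normT: "norm (T x) = norm x" for x
    unfolding norm_eq_sqrt_inner
    by (subst (1 2) euclidean_inner) (auto simp: Tj intro!: arg_cong[of _ _ sqrt] sum.cong)
  have invT: "distr lborel borel T = lborel"
    unfolding T_def by (rule lborel_distr_flip_coords) simp
  have "(LINT U|uniform_sphere r. U \<bullet> b) = (LINT U|uniform_sphere r. T U \<bullet> b)"
    by (rule inv[OF linT normT invT, symmetric]) simp
  then show "(LINT U|uniform_sphere r. U \<bullet> b) = 0" using b by (simp add: Tj)
  have int: "integrable (uniform_sphere r) (\<lambda>U. (U \<bullet> j) * (U \<bullet> j'))" if "j \<in> Basis" "j' \<in> Basis" for j j' :: 'a
  proof (rule integrable_uniform_sphere[OF r])
    fix U :: 'a assume "norm U = r"
    then show "norm ((U \<bullet> j) * (U \<bullet> j')) \<le> r * r"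
      using Basis_le_norm[OF that(1), of U] Basis_le_norm[OF that(2), of U] r
      by (auto simp: abs_mult intro!: mult_mono)
  qed simp
  show "(LINT U|uniform_sphere r. (U \<bullet> b) * (U \<bullet> b')) = (if b = b' then r\<^sup>2 / DIM('a) else 0)"
  proof (cases "b = b'")
    case False
    have "(LINT U|uniform_sphere r. (U \<bullet> b) * (U \<bullet> b')) = (LINT U|uniform_sphere r. (T U \<bullet> b) * (T U \<bullet> b'))"
      by (rule inv[OF linT normT invT, symmetric]) simp
    then show ?thesis using b False by (simp add: Tj)
  next
    case True
    have same: "(LINT U|uniform_sphere r. (U \<bullet> j) * (U \<bullet> j)) = (LINT U|uniform_sphere r. (U \<bullet> b) * (U \<bullet> b))"
      if j: "j \<in> Basis" for j :: 'a
    proof -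
      define \<pi> where "\<pi> i = (if i = j then b else if i = b then j else i)" for i
      have \<pi>: "\<pi> i \<in> Basis" if "i \<in> Basis" for i using that b j by (auto simp: \<pi>_def)
      have \<pi>2: "\<pi> (\<pi> i) = i" for i by (auto simp: \<pi>_def)
      define S where "S x = (\<Sum>i\<in>Basis. (x \<bullet> \<pi> i) *\<^sub>R i)" for x :: 'a
      have Si: "S x \<bullet> i = x \<bullet> \<pi> i" if "i \<in> Basis" for x i
        using that by (simp add: S_def inner_sum_left inner_Basis if_distrib sum.delta' cong: if_cong)
      have linS: "linear S"
        by (rule linearI; rule euclidean_eqI) (simp_all add: Si inner_add_left \<pi>)
      have bij: "bij_betw \<pi> Basis Basis"
        by (rule bij_betw_byWitness[where f' = \<pi>]) (use \<pi> \<pi>2 in auto)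
      have normS: "norm (S x) = norm x" for x
      proof -
        have "S x \<bullet> S x = (\<Sum>i\<in>Basis. (x \<bullet> \<pi> i) * (x \<bullet> \<pi> i))"
          by (subst euclidean_inner) (simp add: Si)
        also have "\<dots> = (\<Sum>i\<in>Basis. (x \<bullet> i) * (x \<bullet> i))"
          using sum.reindex_bij_betw[OF bij, of "\<lambda>i. (x \<bullet> i) * (x \<bullet> i)"] by simp
        also have "\<dots> = x \<bullet> x" by (rule euclidean_inner[symmetric])
        finally show ?thesis by (simp add: norm_eq_sqrt_inner)
      qed
      have invS: "distr lborel borel S = lborel"
        unfolding S_def by (rule lborel_distr_permute_coords) (simp_all add: \<pi> \<pi>2)
      have "(LINT U|uniform_sphere r. (U \<bullet> b) * (U \<bullet> b)) = (LINT U|uniform_sphere r. (S U \<bullet> b) * (S U \<bullet> b))"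
        by (rule inv[OF linS normS invS, symmetric]) simp
      then show ?thesis using b by (auto simp: Si \<pi>_def split: if_splits)
    qed
    have "r\<^sup>2 = (LINT U|uniform_sphere r. (norm (U :: 'a))\<^sup>2)"
    proof -
      have "(LINT U|uniform_sphere r. (norm (U :: 'a))\<^sup>2) = (LINT U|(uniform_sphere r :: 'a measure). r\<^sup>2)"
      proof (rule integral_cong_AE)
        show "AE U in uniform_sphere r. (norm (U :: 'a))\<^sup>2 = r\<^sup>2"
          using AE_uniform_sphere[OF r, where 'a = 'a] by eventually_elim simp
      qed measurable
      moreover have "measure (uniform_sphere r :: 'a measure) UNIV = 1" using prob_space by simp
      ultimately show ?thesis by simp
    qed
    also have "\<dots> = (LINT U|uniform_sphere r. (\<Sum>j\<in>Basis. ((U :: 'a) \<bullet> j) * (U \<bullet> j)))"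
      unfolding power2_norm_eq_inner by (subst euclidean_inner) (rule refl)
    also have "\<dots> = (\<Sum>j\<in>(Basis :: 'a set). LINT U|uniform_sphere r. (U \<bullet> j) * (U \<bullet> j))"
      by (rule Bochner_Integration.integral_sum) (rule int)
    also have "\<dots> = (\<Sum>j\<in>(Basis :: 'a set). LINT U|uniform_sphere r. (U \<bullet> b) * (U \<bullet> b))"
      by (intro sum.cong refl same)
    finally show ?thesis using True by (simp add: field_simps)
  qed
qed

lemma uniform_sphere_mean:
  assumes r: "0 \<le> r"
  shows "(LINT U|uniform_sphere r. (U :: 'a::euclidean_space)) = 0"
    and "(LINT U|uniform_sphere r. (g \<bullet> U) *\<^sub>R (U :: 'a)) = (r\<^sup>2 / DIM('a)) *\<^sub>R g"
proof -
  have i1: "integrable (uniform_sphere r) (\<lambda>U :: 'a. U)"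
    by (rule integrable_uniform_sphere[OF r, of _ r]) simp_all
  show "(LINT U|uniform_sphere r. (U :: 'a)) = 0"
    by (rule euclidean_eqI) (simp add: uniform_sphere_moments(1)[OF r] flip: integral_inner_left[OF i1])
  have i2: "integrable (uniform_sphere r) (\<lambda>U :: 'a. (g \<bullet> U) *\<^sub>R U)"
  proof (rule integrable_uniform_sphere[OF r])
    fix U :: 'a assume "norm U = r"
    then show "norm ((g \<bullet> U) *\<^sub>R U) \<le> (norm g * r) * r"
      using Cauchy_Schwarz_ineq2[of g U] r by (auto intro!: mult_right_mono)
  qed simp
  have int: "integrable (uniform_sphere r) (\<lambda>U. (g \<bullet> j) * ((U \<bullet> j) * (U \<bullet> b)))"
    if "j \<in> Basis" "b \<in> Basis" for j b :: 'a
  proof (rule integrable_mult_right, rule integrable_uniform_sphere[OF r])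
    fix U :: 'a assume "norm U = r"
    then show "norm ((U \<bullet> j) * (U \<bullet> b)) \<le> r * r"
      using Basis_le_norm[OF that(1), of U] Basis_le_norm[OF that(2), of U] r
      by (auto simp: abs_mult intro!: mult_mono)
  qed simp
  show "(LINT U|uniform_sphere r. (g \<bullet> U) *\<^sub>R (U :: 'a)) = (r\<^sup>2 / DIM('a)) *\<^sub>R g"
  proof (rule euclidean_eqI)
    fix b :: 'a assume b: "b \<in> Basis"
    have "(LINT U|uniform_sphere r. (g \<bullet> U) *\<^sub>R (U :: 'a)) \<bullet> b
      = (LINT U|uniform_sphere r. (g \<bullet> U) * (U \<bullet> b))"
      by (simp flip: integral_inner_left[OF i2])
    also have "\<dots> = (LINT U|uniform_sphere r. (\<Sum>j\<in>Basis. (g \<bullet> j) * ((U \<bullet> j) * (U \<bullet> b))))"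
    proof -
      have "(g \<bullet> U) * (U \<bullet> b) = (\<Sum>j\<in>Basis. (g \<bullet> j) * ((U \<bullet> j) * (U \<bullet> b)))" for U :: 'a
        by (subst euclidean_inner[of g U]) (simp add: sum_distrib_right mult.assoc)
      then show ?thesis by (simp only:)
    qed
    also have "\<dots> = (\<Sum>j\<in>Basis. (g \<bullet> j) * (LINT U|uniform_sphere r. (U \<bullet> j) * (U \<bullet> b)))"
      by (subst Bochner_Integration.integral_sum[OF int[OF _ b]]) simp_all
    also have "\<dots> = (\<Sum>j\<in>Basis. if j = b then (g \<bullet> b) * (r\<^sup>2 / DIM('a)) else 0)"
      by (intro sum.cong refl) (simp add: uniform_sphere_moments(2)[OF r _ b])
    also have "\<dots> = ((r\<^sup>2 / DIM('a)) *\<^sub>R g) \<bullet> b" using b by simp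
    finally show "(LINT U|uniform_sphere r. (g \<bullet> U) *\<^sub>R (U :: 'a)) \<bullet> b = ((r\<^sup>2 / DIM('a)) *\<^sub>R g) \<bullet> b" .
  qed
qed

section \<open>Bias of the gradient estimate\<close>

context lq
begin

abbreviation "SL \<equiv> sample_law D P"

definition dm :: real where "dm = real CARD('m) * real CARD('n)"

lemma dm_pos: "1 \<le> dm"
proof -
  have "1 * 1 \<le> real CARD('m) * real CARD('n)" by (intro mult_mono) auto
  then show ?thesis by (simp add: dm_def)
qed

lemma prob_space_SL: "prob_space (SL r)"
proof -
  interpret US: prob_space "uniform_sphere r :: (real^'n^'m) measure" by (rule prob_space_uniform_sphere)
  interpret TSp: prob_space TS by (rule prob_space_TS)
  interpret pair_prob_space "uniform_sphere r :: (real^'n^'m) measure" TS ..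
  show ?thesis unfolding sample_law_def by (rule P.prob_space_axioms)
qed

lemma measurable_SL [measurable]:
  "fst \<in> borel_measurable (SL r)" "(\<lambda>s. fst (snd s)) \<in> borel_measurable (SL r)"
  "(\<lambda>s. snd (snd s) t) \<in> borel_measurable (SL r)"
proof -
  have "fst \<in> measurable (SL r) (uniform_sphere r)" unfolding sample_law_def by (rule measurable_fst)
  then show "fst \<in> borel_measurable (SL r)" by (simp add: measurable_cong_sets[OF refl sets_uniform_sphere])
  have s: "snd \<in> measurable (SL r) TS" unfolding sample_law_def by (rule measurable_snd)
  show "(\<lambda>s. fst (snd s)) \<in> borel_measurable (SL r)" "(\<lambda>s. snd (snd s) t) \<in> borel_measurable (SL r)"
    by (rule measurable_compose[OF s]; rule measurable_TS)+
qed

text \<open>Jointly in the feedback matrix and the sample, because the method evaluates rollouts at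
  random iterates.\<close>

lemma borel_measurable_rollout_cost:
  assumes L: "L \<in> borel_measurable M" and s: "s \<in> measurable M (SL r)"
  shows "(\<lambda>\<omega>. rollout_cost (L \<omega>) l (s \<omega>)) \<in> borel_measurable M"
proof -
  have [measurable]: "(\<lambda>\<omega>. fst (s \<omega>)) \<in> borel_measurable M"
    "(\<lambda>\<omega>. fst (snd (s \<omega>))) \<in> borel_measurable M" "(\<lambda>\<omega>. snd (snd (s \<omega>)) t) \<in> borel_measurable M" for t
    by (rule measurable_compose[OF s]; rule measurable_SL)+
  note [measurable] = L
  have "(\<lambda>\<omega>. stage_cost (L \<omega> + fst (s \<omega>)) (fst (snd (s \<omega>)), snd (snd (s \<omega>))) t) \<in> borel_measurable M" for t
    by measurable
  then show ?thesis unfolding rollout_cost_def by simp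
qed

text \<open>The mean of a rollout, by \<open>rollout_TS\<close>; as a finite sum it makes sense for
  every \<open>L\<close>.\<close>

definition Cl :: "nat \<Rightarrow> real^'n^'m \<Rightarrow> real" where
  "Cl l L = (\<Sum>t<l. QL L \<bullet> (F L ^^ t) \<Sigma>\<^sub>0)"

lemma rollout_TS:
  "integrable TS (\<lambda>w. rollout_cost L l (U, w))"
  "(LINT w|TS. rollout_cost L l (U, w)) = Cl l (L + U)"
  unfolding rollout_cost_def Cl_def fst_conv snd_conv
  by (simp_all add: integrable_stage_cost integral_stage_cost)

lemma AE_rollout_nonneg: "AE w in TS. 0 \<le> rollout_cost L l (U, w)"
  using AE_stage_cost_nonneg by eventually_elim (auto simp: rollout_cost_def intro: sum_nonneg)

lemma Cl_nonneg: "0 \<le> Cl l L"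
  unfolding Cl_def by (intro sum_nonneg QL_F_nonneg)

lemma Cl_le:
  assumes L: "L \<in> U_ad P"
  shows "Cl l L \<le> Ct L"
proof -
  have "Ct L = (\<Sum>t. QL L \<bullet> (F L ^^ t) \<Sigma>\<^sub>0)" "summable (\<lambda>t. QL L \<bullet> (F L ^^ t) \<Sigma>\<^sub>0)"
    using Ct_sums[OF L] by (simp_all add: sums_iff)
  then show ?thesis unfolding Cl_def by (simp add: sum_le_suminf QL_F_nonneg)
qed

text \<open>
  The tail \<open>b\<^sub>l = Q\<^sub>L \<bullet> F\<^sup>l S\<close> of the cost is decreasing in \<open>l\<close> and at most \<open>\<tau>\<close> times the \<open>l\<close>-th stage
  cost, so \<open>l b\<^sub>l\<close> is at most \<open>\<tau>\<close> times the sum of the first \<open>l\<close> stage costs.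
\<close>

lemma Ct_Cl_diff:
  assumes L: "L \<in> U_ad P" and l: "0 < l"
  shows "Ct L - Cl l L \<le> \<tau> L * Ct L / l"
proof -
  define a where "a t = QL L \<bullet> (F L ^^ t) \<Sigma>\<^sub>0" for t
  define b where "b t = QL L \<bullet> (F L ^^ t) (Sg L)" for t
  note pf = positive_map_funpow[OF positive_map_F, of _ L]
  have step: "b t = a t + b (Suc t)" for t
  proof -
    have "(F L ^^ t) (Sg L) = (F L ^^ t) (F L (Sg L)) + (F L ^^ t) \<Sigma>\<^sub>0"
      by (subst Sg_fix[OF L, symmetric]) (rule positive_map_add[OF pf])
    moreover have "(F L ^^ Suc t) (Sg L) = (F L ^^ t) (F L (Sg L))" by (simp add: funpow_swap1)
    ultimately show ?thesis unfolding a_def b_def by (metis add.commute inner_add_right)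
  qed
  have a0: "0 \<le> a t" for t unfolding a_def by (rule QL_F_nonneg)
  have Cl: "Ct L - Cl j L = b j" for j
  proof (induction j)
    case 0
    then show ?case by (simp add: Cl_def b_def Ct_def)
  next
    case (Suc j)
    then show ?case using step[of j] by (simp add: Cl_def a_def)
  qed
  have dec: "b l \<le> b j" if "j \<le> l" for j
    using that by (induction rule: inc_induct) (use step a0 in \<open>smt (verit)\<close>)+
  have ba: "b t \<le> \<tau> L * a t" for t
  proof -
    have \<tau>0: "0 \<le> \<tau> L" using trace_Sg_ge[OF L] \<mu>_pos by (simp add: \<tau>_def)
    have "\<tau> L * \<mu> = trace (Sg L)" using \<mu>_pos by (simp add: \<tau>_def)
    moreover have "psd (\<tau> L *\<^sub>R (\<Sigma>\<^sub>0 - \<mu> *\<^sub>R mat 1) + (trace (Sg L) *\<^sub>R mat 1 - Sg L))"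
      by (intro psd_add psd_scaleR Sigma0_ge \<tau>0 psd_le_trace Sg_psd L)
    ultimately have "psd (\<tau> L *\<^sub>R \<Sigma>\<^sub>0 - Sg L)" by (simp add: algebra_simps)
    from positive_map_psd[OF pf this] have "psd (\<tau> L *\<^sub>R (F L ^^ t) \<Sigma>\<^sub>0 - (F L ^^ t) (Sg L))"
      by (simp add: positive_map_simps[OF pf])
    from psd_inner_mono[OF QL_psd this] show ?thesis by (simp add: a_def b_def)
  qed
  have "real l * b l = (\<Sum>j<l. b l)" by simp
  also have "\<dots> \<le> (\<Sum>j<l. \<tau> L * a j)"
    by (intro sum_mono) (meson ba dec lessThan_iff less_imp_le order_trans)
  also have "\<dots> = \<tau> L * Cl l L" by (simp add: Cl_def a_def sum_distrib_left)
  also have "\<dots> \<le> \<tau> L * Ct L"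
    using trace_Sg_ge[OF L] \<mu>_pos Cl_le[OF L] by (intro mult_left_mono) (simp_all add: \<tau>_def)
  finally show ?thesis using l unfolding Cl by (simp add: field_simps)
qed

definition mean_est :: "nat \<Rightarrow> real \<Rightarrow> real^'n^'m \<Rightarrow> real^'n^'m" where
  "mean_est l r L = (LINT s|SL r. (dm / r\<^sup>2 * rollout_cost L l s) *\<^sub>R fst s)"

text \<open>
  No smoothed cost and no divergence theorem: the estimate of the smoothness lemma is inserted into
  the expectation, and \<open>C(L)\<close> times the mean of \<open>U\<close> vanishes.
\<close>

lemma bias_bound:
  assumes L: "L \<in> U_ad P" and c: "Ct L \<le> c" "1 \<le> c" and r: "0 < r" "12 * w ^ 3 * c * r \<le> 1" and l: "0 < l"
  shows "integrable (SL r) (\<lambda>s. (dm / r\<^sup>2 * rollout_cost L l s) *\<^sub>R fst s)"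
    and "norm (mean_est l r L - GL L) \<le> dm * (76 * w ^ 6 * c ^ 3 * r + 4 * w ^ 2 * c ^ 2 / (r * l))"
proof -
  let ?US = "uniform_sphere r :: (real^'n^'m) measure"
  interpret US: prob_space ?US by (rule prob_space_uniform_sphere)
  interpret TSp: prob_space TS by (rule prob_space_TS)
  interpret PP: pair_prob_space ?US TS ..
  have SL: "SL r = ?US \<Otimes>\<^sub>M TS" by (simp add: sample_law_def)
  have w3: "0 < w ^ 3" using w_ge(1) by simp
  have "12 * (r * (w ^ 3 * c)) = 12 * w ^ 3 * c * r" by simp
  then have rc: "r * (w ^ 3 * c) \<le> 1 / 12" using r(2) by linarith
  \<comment> \<open>The whole sphere of radius \<open>r\<close> around \<open>L\<close> is
    admissible, with cost at most 2 c: the linear term of the expansion adds at most c/3, the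
    quadratic one at most 2 c/3.\<close>
  have near: "L + U \<in> U_ad P" "\<bar>Ct (L + U) - Ct L - GL L \<bullet> U\<bar> \<le> 76 * w ^ 6 * c ^ 3 * r\<^sup>2"
    "\<tau> (L + U) \<le> 2 * w ^ 2 * c" "Ct (L + U) \<le> 2 * c" if "norm U = r" for U
  proof -
    have U: "12 * w ^ 3 * c * norm U \<le> 1" using r(2) that by simp
    note sm = smoothness[OF L c U]
    show "L + U \<in> U_ad P" "\<bar>Ct (L + U) - Ct L - GL L \<bullet> U\<bar> \<le> 76 * w ^ 6 * c ^ 3 * r\<^sup>2"
      "\<tau> (L + U) \<le> 2 * w ^ 2 * c"
      using sm that by simp_all
    have "GL L \<bullet> U \<le> norm (GL L) * r" using norm_cauchy_schwarz[of "GL L" U] that by simp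
    also have "\<dots> \<le> (4 * w ^ 3 * c ^ 2) * r" using norm_GL_le[OF L c] r by (intro mult_right_mono) auto
    also have "\<dots> = 4 * c * (r * (w ^ 3 * c))" by algebra
    also have "\<dots> \<le> 4 * c * (1 / 12)" using rc c by (intro mult_left_mono) auto
    finally have 1: "GL L \<bullet> U \<le> c / 3" by simp
    have "76 * w ^ 6 * c ^ 3 * r\<^sup>2 = 76 * c * (r * (w ^ 3 * c))\<^sup>2" by algebra
    also have "\<dots> \<le> 76 * c * (1 / 12)\<^sup>2"
      using rc r c w3 by (intro mult_left_mono power_mono) auto
    also have "\<dots> \<le> 2 * c / 3" using c by (simp add: power2_eq_square)
    finally show "Ct (L + U) \<le> 2 * c" using sm(2)[unfolded that] 1 c by linarith
  qed
  have Cl_bound: "\<bar>Cl l (L + U)\<bar> \<le> 2 * c" if "norm U = r" for U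
    using Cl_le[OF near(1)[OF that], of l] Cl_nonneg[of l "L + U"] near(4)[OF that] by simp
  define f where "f s = (dm / r\<^sup>2 * rollout_cost L l s) *\<^sub>R fst s" for s :: "(real^'n^'m) \<times> ('n, 'm) outcome"
  have roll_m [measurable]: "rollout_cost L l \<in> borel_measurable (SL r)"
    using borel_measurable_rollout_cost[of "\<lambda>_. L" "SL r" "\<lambda>s. s" r l] by simp
  have fm: "f \<in> borel_measurable (?US \<Otimes>\<^sub>M TS)" unfolding f_def SL[symmetric] by measurable
  \<comment> \<open>Measurability in \<open>U\<close> is obtained by integrating out the trajectory,
    not from continuity.\<close>
  have Clm: "(\<lambda>U. Cl l (L + U)) \<in> borel_measurable ?US"
  proof -
    have "(\<lambda>(U, w). rollout_cost L l (U, w)) \<in> borel_measurable (?US \<Otimes>\<^sub>M TS)"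
      using roll_m by (simp add: SL)
    from TSp.borel_measurable_lebesgue_integral[OF this] show ?thesis by (simp add: rollout_TS)
  qed
  have fU: "integrable TS (\<lambda>w. f (U, w))" "(LINT w|TS. f (U, w)) = (dm / r\<^sup>2 * Cl l (L + U)) *\<^sub>R U"
    "(LINT w|TS. norm (f (U, w))) = dm / r\<^sup>2 * Cl l (L + U) * norm U" for U
  proof -
    have i: "integrable TS (\<lambda>w. dm / r\<^sup>2 * rollout_cost L l (U, w))" using rollout_TS(1) by simp
    show "integrable TS (\<lambda>w. f (U, w))"
      unfolding f_def fst_conv by (rule integrable_scaleR_left) (rule i)
    have "(LINT w|TS. f (U, w)) = (LINT w|TS. dm / r\<^sup>2 * rollout_cost L l (U, w)) *\<^sub>R U"
      unfolding f_def fst_conv by (rule integral_scaleR_left) (rule i)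
    then show "(LINT w|TS. f (U, w)) = (dm / r\<^sup>2 * Cl l (L + U)) *\<^sub>R U" by (simp add: rollout_TS)
    have "(LINT w|TS. norm (f (U, w))) = (LINT w|TS. (dm / r\<^sup>2 * rollout_cost L l (U, w)) * norm U)"
    proof (rule integral_cong_AE)
      show "(\<lambda>w. norm (f (U, w))) \<in> borel_measurable TS"
        by (rule borel_measurable_integrable[OF integrable_norm]) fact
      show "(\<lambda>w. (dm / r\<^sup>2 * rollout_cost L l (U, w)) * norm U) \<in> borel_measurable TS"
        by (rule borel_measurable_integrable[OF integrable_mult_left]) (rule i)
      show "AE w in TS. norm (f (U, w)) = (dm / r\<^sup>2 * rollout_cost L l (U, w)) * norm U"
        using AE_rollout_nonneg[of L l U]
        by eventually_elim (use dm_pos in \<open>simp add: f_def abs_mult\<close>)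
    qed
    then show "(LINT w|TS. norm (f (U, w))) = dm / r\<^sup>2 * Cl l (L + U) * norm U"
      by (simp add: rollout_TS)
  qed
  have int_f: "integrable (?US \<Otimes>\<^sub>M TS) f"
  proof (rule PP.Fubini_integrable[OF fm])
    show "integrable ?US (\<lambda>U. LINT w|TS. norm (f (U, w)))"
      unfolding fU(3)
    proof (rule integrable_uniform_sphere)
      show "(\<lambda>U. dm / r\<^sup>2 * Cl l (L + U) * norm U) \<in> borel_measurable borel"
        using Clm by (simp add: measurable_cong_sets[OF sets_uniform_sphere refl])
      show "norm (dm / r\<^sup>2 * Cl l (L + U) * norm U) \<le> dm / r\<^sup>2 * (2 * c) * r" if "norm U = r" for U :: "real^'n^'m"
        using Cl_bound[OF that] dm_pos r that by (auto simp: abs_mult intro!: mult_mono divide_right_mono)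
    qed (use r in simp)
  qed (simp add: fU)
  then show "integrable (SL r) (\<lambda>s. (dm / r\<^sup>2 * rollout_cost L l s) *\<^sub>R fst s)"
    by (simp add: SL f_def[abs_def])
  have mean: "mean_est l r L = (LINT U|?US. (dm / r\<^sup>2 * Cl l (L + U)) *\<^sub>R U)"
    unfolding mean_est_def f_def[symmetric] SL using PP.integral_fst'[OF int_f] by (simp add: fU)
  \<comment> \<open>Value and linear part at \<open>L\<close> are subtracted. The factor
    \<open>dm / r\<^sup>2\<close> is the reciprocal of the second moment of a coordinate, so the
    linear part integrates to exactly \<open>GL L\<close>.\<close>
  define g where "g U = (dm / r\<^sup>2) *\<^sub>R ((Cl l (L + U) - Ct L - GL L \<bullet> U) *\<^sub>R U)" for U
  have i1: "integrable ?US (\<lambda>U. (dm / r\<^sup>2 * Cl l (L + U)) *\<^sub>R U)"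
  proof (rule integrable_uniform_sphere)
    show "(\<lambda>U. (dm / r\<^sup>2 * Cl l (L + U)) *\<^sub>R U) \<in> borel_measurable borel"
      using Clm by (simp add: measurable_cong_sets[OF sets_uniform_sphere refl])
    show "norm ((dm / r\<^sup>2 * Cl l (L + U)) *\<^sub>R U) \<le> dm / r\<^sup>2 * (2 * c) * r" if "norm U = r" for U :: "real^'n^'m"
      using Cl_bound[OF that] dm_pos r that by (auto simp: abs_mult intro!: mult_mono divide_right_mono)
  qed (use r in simp)
  have i2: "integrable ?US (\<lambda>U. U)"
    by (rule integrable_uniform_sphere[of _ _ r]) (use r in simp_all)
  have i3: "integrable ?US (\<lambda>U. (GL L \<bullet> U) *\<^sub>R U)"
  proof (rule integrable_uniform_sphere)
    show "norm ((GL L \<bullet> U) *\<^sub>R U) \<le> (norm (GL L) * r) * r" if "norm U = r" for U :: "real^'n^'m"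
      using Cauchy_Schwarz_ineq2[of "GL L" U] r that by (auto intro!: mult_right_mono)
  qed (use r in simp_all)
  have dim: "real DIM(real^'n^'m) = dm" by (simp add: dm_def)
  have geq: "g = (\<lambda>U. (dm / r\<^sup>2 * Cl l (L + U)) *\<^sub>R U - (dm / r\<^sup>2 * Ct L) *\<^sub>R U
      - (dm / r\<^sup>2) *\<^sub>R ((GL L \<bullet> U) *\<^sub>R U))"
    by (simp add: g_def fun_eq_iff scaleR_diff_left scaleR_diff_right)
  have d1: "integrable ?US (\<lambda>U. (dm / r\<^sup>2 * Ct L) *\<^sub>R U)"
    by (rule integrable_scaleR_right) (rule i2)
  have d2: "integrable ?US (\<lambda>U. (dm / r\<^sup>2) *\<^sub>R ((GL L \<bullet> U) *\<^sub>R U))"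
    by (rule integrable_scaleR_right) (rule i3)
  note d = Bochner_Integration.integrable_diff[OF i1 d1]
  have ig: "integrable ?US g" unfolding geq by (rule Bochner_Integration.integrable_diff[OF d d2])
  have "(LINT U|?US. g U) = mean_est l r L - (dm / r\<^sup>2 * Ct L) *\<^sub>R (LINT U|?US. U)
      - (dm / r\<^sup>2) *\<^sub>R (LINT U|?US. (GL L \<bullet> U) *\<^sub>R U)"
    unfolding geq Bochner_Integration.integral_diff[OF d d2] Bochner_Integration.integral_diff[OF i1 d1]
      integral_scaleR_right mean ..
  also have "\<dots> = mean_est l r L - GL L"
    using r dm_pos dim unfolding uniform_sphere_mean[OF less_imp_le[OF r(1)]] by simp
  finally have "norm (mean_est l r L - GL L) = norm (LINT U|?US. g U)" by simp
  also have "\<dots> \<le> (LINT U|?US. norm (g U))" by (rule integral_norm_bound)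
  also have "\<dots> \<le> (LINT U|?US. dm / r\<^sup>2 * ((76 * w ^ 6 * c ^ 3 * r\<^sup>2 + 4 * w ^ 2 * c ^ 2 / l) * r))"
  proof (rule integral_mono_AE)
    show "integrable ?US (\<lambda>U. norm (g U))" by (rule integrable_norm[OF ig])
    show "AE U in ?US. norm (g U) \<le> dm / r\<^sup>2 * ((76 * w ^ 6 * c ^ 3 * r\<^sup>2 + 4 * w ^ 2 * c ^ 2 / l) * r)"
      using AE_uniform_sphere[OF less_imp_le[OF r(1)]]
    proof eventually_elim
      case (elim U)
      have "Ct (L + U) - Cl l (L + U) \<le> \<tau> (L + U) * Ct (L + U) / l"
        by (rule Ct_Cl_diff[OF near(1)[OF elim] l])
      also have "\<dots> \<le> (2 * w ^ 2 * c) * (2 * c) / l"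
        using near(3,4)[OF elim] Ct_pos[OF near(1)[OF elim]] w_ge(1) c
        by (intro divide_right_mono mult_mono) auto
      also have "\<dots> = 4 * w ^ 2 * c ^ 2 / l" by (simp add: power2_eq_square)
      finally have t: "\<bar>Ct (L + U) - Cl l (L + U)\<bar> \<le> 4 * w ^ 2 * c ^ 2 / l"
        using Cl_le[OF near(1)[OF elim], of l] by simp
      have "\<bar>Cl l (L + U) - Ct L - GL L \<bullet> U\<bar> \<le> 76 * w ^ 6 * c ^ 3 * r\<^sup>2 + 4 * w ^ 2 * c ^ 2 / l"
        using t near(2)[OF elim] by linarith
      then have "\<bar>Cl l (L + U) - Ct L - GL L \<bullet> U\<bar> * r \<le> (76 * w ^ 6 * c ^ 3 * r\<^sup>2 + 4 * w ^ 2 * c ^ 2 / l) * r"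
        using r by (intro mult_right_mono) auto
      then have "dm / r\<^sup>2 * (\<bar>Cl l (L + U) - Ct L - GL L \<bullet> U\<bar> * r)
        \<le> dm / r\<^sup>2 * ((76 * w ^ 6 * c ^ 3 * r\<^sup>2 + 4 * w ^ 2 * c ^ 2 / l) * r)"
        using dm_pos by (intro mult_left_mono) auto
      moreover have "norm (g U) = dm / r\<^sup>2 * (\<bar>Cl l (L + U) - Ct L - GL L \<bullet> U\<bar> * r)"
      proof -
        have "\<bar>dm / r\<^sup>2\<bar> = dm / r\<^sup>2" using dm_pos by simp
        then show ?thesis unfolding g_def norm_scaleR elim by simp
      qed
      ultimately show ?case by simp
    qed
  qed simp
  also have "\<dots> = dm / r\<^sup>2 * ((76 * w ^ 6 * c ^ 3 * r\<^sup>2 + 4 * w ^ 2 * c ^ 2 / l) * r)"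
    using US.prob_space by simp
  also have "\<dots> = dm * (76 * w ^ 6 * c ^ 3 * r + 4 * w ^ 2 * c ^ 2 / (r * l))"
    using r l by (simp add: field_simps power2_eq_square)
  finally show "norm (mean_est l r L - GL L) \<le> dm * (76 * w ^ 6 * c ^ 3 * r + 4 * w ^ 2 * c ^ 2 / (r * l))" .
qed

end

section \<open>Sub-Gaussian vectors\<close>

text \<open>Used at \<open>j = k\<close>, where the power (2 k)^k cancels the one produced by the
  choice of s in \<open>exp_square_integral_le\<close>.\<close>

lemma fact_add_le: "fact (k + j) \<le> fact k * real (k + j) ^ j"
proof (induction j)
  case (Suc j)
  have "fact (k + Suc j) = real (k + Suc j) * fact (k + j)" by simp
  also have "\<dots> \<le> real (k + Suc j) * (fact k * real (k + j) ^ j)"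
    by (intro mult_left_mono Suc.IH) simp
  also have "\<dots> \<le> real (k + Suc j) * (fact k * real (k + Suc j) ^ j)"
    by (intro mult_left_mono power_mono) simp_all
  finally show ?case by (simp add: ac_simps)
qed simp

text \<open>A single term of the even power series, all of whose terms are nonnegative.\<close>

lemma power_le_cosh: "x ^ (2 * k) \<le> fact (2 * k) * cosh (x :: real)"
proof -
  let ?f = "\<lambda>n. if even n then x ^ n /\<^sub>R fact n else 0"
  have s: "?f sums cosh x" by (rule cosh_converges)
  have "sum ?f {2 * k} \<le> suminf ?f"
    using s by (intro sum_le_suminf) (auto simp: sums_iff zero_le_even_power)
  also have "suminf ?f = cosh x" using s by (simp add: sums_iff)
  finally show ?thesis by (simp add: field_simps)
qed

text \<open>
  The \<open>k\<close>-th term of the exponential series of \<open>y\<^sup>2 / (6 v)\<close> is at most \<open>6\<^sup>-\<^sup>k cosh (s y)\<close> with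
  \<open>s\<^sup>2 = 2 k / v\<close>, whose expectation is at most \<open>(e / 6)\<^sup>k\<close>.
\<close>

lemma exp_square_integral_le:
  assumes y: "y \<in> borel_measurable M" and v: "0 < v"
    and mgf: "\<And>s. (\<integral>\<^sup>+x. ennreal (exp (s * y x)) \<partial>M) \<le> ennreal (exp (v * s\<^sup>2 / 2))"
  shows "(\<integral>\<^sup>+x. ennreal (exp ((y x)\<^sup>2 / (6 * v))) \<partial>M) \<le> 2"
proof -
  note [measurable] = y
  define s where "s k = sqrt (2 * real k / v)" for k :: nat
  have s2: "(s k)\<^sup>2 = 2 * real k / v" for k using v by (simp add: s_def)
  have term_le: "((z\<^sup>2 / (6 * v)) ^ k) / fact k \<le> (1 / 6) ^ k * cosh (s k * z)" for z k
  proof -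
    have "(s k * z) ^ (2 * k) = (2 * real k) ^ k * (z\<^sup>2 / v) ^ k"
      by (simp add: power_mult power_mult_distrib s2 power_divide)
    then have "(2 * real k) ^ k * (z\<^sup>2 / v) ^ k \<le> fact (2 * k) * cosh (s k * z)"
      using power_le_cosh[of "s k * z" k] by simp
    also have "\<dots> \<le> (fact k * (2 * real k) ^ k) * cosh (s k * z)"
    proof (rule mult_right_mono)
      have "fact (k + k) \<le> fact k * (real k + real k) ^ k" using fact_add_le[of k k] by (simp only: of_nat_add)
      then show "fact (2 * k) \<le> fact k * (2 * real k) ^ k" by (simp only: mult_2)
    qed (rule cosh_real_nonneg)
    finally have "(2 * real k) ^ k * (z\<^sup>2 / v) ^ k \<le> (2 * real k) ^ k * (fact k * cosh (s k * z))"
      by (simp add: ac_simps)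
    then have "(z\<^sup>2 / v) ^ k \<le> fact k * cosh (s k * z)"
      by (cases "k = 0") (simp_all add: mult_le_cancel_left_pos)
    then have "(z\<^sup>2 / v) ^ k / fact k \<le> cosh (s k * z)"
      by (simp only: pos_divide_le_eq[OF fact_gt_zero] mult.commute)
    then have "(1 / 6) ^ k * ((z\<^sup>2 / v) ^ k / fact k) \<le> (1 / 6) ^ k * cosh (s k * z)"
      by (rule mult_left_mono) simp
    then show ?thesis by (simp add: power_divide power_mult_distrib)
  qed
  have term_int: "(\<integral>\<^sup>+x. ennreal (((y x)\<^sup>2 / (6 * v)) ^ k / fact k) \<partial>M) \<le> ennreal ((1 / 2) ^ k)" for k
  proof -
    have e: "exp (v * (s k)\<^sup>2 / 2) = exp 1 ^ k"
      using v by (simp add: s2 exp_of_nat_mult[symmetric])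
    have "(\<integral>\<^sup>+x. ennreal (((y x)\<^sup>2 / (6 * v)) ^ k / fact k) \<partial>M)
      \<le> (\<integral>\<^sup>+x. ennreal ((1 / 6) ^ k / 2) * (ennreal (exp (s k * y x)) + ennreal (exp (- s k * y x))) \<partial>M)"
    proof (rule nn_integral_mono)
      fix x
      have "((y x)\<^sup>2 / (6 * v)) ^ k / fact k \<le> ((1 / 6) ^ k / 2) * (exp (s k * y x) + exp (- s k * y x))"
        using term_le[of "y x" k] by (simp add: cosh_def field_simps)
      then show "ennreal (((y x)\<^sup>2 / (6 * v)) ^ k / fact k)
        \<le> ennreal ((1 / 6) ^ k / 2) * (ennreal (exp (s k * y x)) + ennreal (exp (- s k * y x)))"
        by (simp flip: ennreal_plus ennreal_mult)
    qed
    also have "\<dots> = ennreal ((1 / 6) ^ k / 2)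
        * ((\<integral>\<^sup>+x. ennreal (exp (s k * y x)) \<partial>M) + (\<integral>\<^sup>+x. ennreal (exp (- s k * y x)) \<partial>M))"
      by (simp add: nn_integral_cmult nn_integral_add)
    also have "\<dots> \<le> ennreal ((1 / 6) ^ k / 2) * (ennreal (exp 1 ^ k) + ennreal (exp 1 ^ k))"
      using mgf[of "s k"] mgf[of "- s k"] by (intro mult_left_mono add_mono) (simp_all add: e)
    also have "\<dots> = ennreal ((exp 1 / 6) ^ k)"
      by (simp flip: ennreal_plus ennreal_mult add: power_divide)
    \<comment> \<open>e \<le> 3 makes the ratio at most 1/2, and the geometric series sums to the 2
      of the claim.\<close>
    also have "\<dots> \<le> ennreal ((1 / 2) ^ k)"
      using exp_le by (intro ennreal_leI power_mono) simp_all
    finally show ?thesis .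
  qed
  have "(\<integral>\<^sup>+x. ennreal (exp ((y x)\<^sup>2 / (6 * v))) \<partial>M)
    = (\<integral>\<^sup>+x. (\<Sum>k. ennreal (((y x)\<^sup>2 / (6 * v)) ^ k / fact k)) \<partial>M)"
  proof (rule nn_integral_cong)
    fix x
    have "(\<lambda>k. ((y x)\<^sup>2 / (6 * v)) ^ k / fact k) sums exp ((y x)\<^sup>2 / (6 * v))"
      using exp_converges[of "(y x)\<^sup>2 / (6 * v)"] by (simp add: field_simps)
    then show "ennreal (exp ((y x)\<^sup>2 / (6 * v))) = (\<Sum>k. ennreal (((y x)\<^sup>2 / (6 * v)) ^ k / fact k))"
      using v by (subst suminf_ennreal2) (auto simp: sums_iff)
  qed
  also have "\<dots> = (\<Sum>k. \<integral>\<^sup>+x. ennreal (((y x)\<^sup>2 / (6 * v)) ^ k / fact k) \<partial>M)"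
    by (rule nn_integral_suminf) measurable
  also have "\<dots> \<le> (\<Sum>k. ennreal ((1 / 2) ^ k))"
    by (intro suminf_le term_int) auto
  also have "\<dots> = 2"
    by (subst suminf_ennreal2) (simp_all add: suminf_geometric)
  finally show ?thesis .
qed

text \<open>A largest coordinate will do. The coordinates of a sub-Gaussian vector may be dependent,
  so the exponential of the squared norm is bounded through one coordinate at a time instead of
  being factorised.\<close>

lemma norm_square_le_coordinate:
  fixes z :: "real^'n"
  obtains i where "(norm z)\<^sup>2 \<le> real CARD('n) * (z $ i)\<^sup>2"
proof (rule ccontr)
  assume neg: "\<not> thesis"
  then have "(z $ i)\<^sup>2 < (norm z)\<^sup>2 / real CARD('n)" for i
    using that[of i] by (simp add: field_simps not_le) (metis mult.commute not_le)
  then have "(\<Sum>i\<in>UNIV. (z $ i)\<^sup>2) < of_nat (card (UNIV :: 'n set)) * ((norm z)\<^sup>2 / real CARD('n))"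
    by (intro sum_bounded_above_strict) simp_all
  moreover have "(norm z)\<^sup>2 = (\<Sum>i\<in>UNIV. (z $ i)\<^sup>2)"
    unfolding power2_norm_eq_inner inner_vec_def by (simp add: power2_eq_square)
  ultimately show False by simp
qed

text \<open>Origin of \<open>a\<close>: by |x|^2 \<le> 2 |x - m|^2 + 2 |m|^2 the factor 12 n is 2
  from centring, n from the largest coordinate and 6 from \<open>exp_square_integral_le\<close>;
  \<open>1 + m2\<close> makes the mean contribute at most 1/2 to the exponent, and
  \<open>1 + \<sigma>\<close> avoids division by 0. In the bound, 4 n is a 2 for exp(1/2) and a 2
  for each of the n coordinates.\<close>

lemma sub_gaussian_exp_norm_square:
  fixes D :: "(real^'n) measure"
  assumes "prob_space D" and sets: "sets D = sets borel" and int2: "integrable D (\<lambda>x. (norm x)\<^sup>2)"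
    and sg: "sub_gaussian D \<sigma>" "0 \<le> \<sigma>"
  defines "m2 \<equiv> (LINT x|D. (norm x)\<^sup>2)"
  defines "a \<equiv> 1 / (12 * real CARD('n) * (1 + \<sigma>)\<^sup>2 * (1 + m2))"
  shows "integrable D (\<lambda>x. exp (a * (norm x)\<^sup>2))" and "(LINT x|D. exp (a * (norm x)\<^sup>2)) \<le> 4 * real CARD('n)"
proof -
  interpret prob_space D by fact
  have meas: "f \<in> borel_measurable D" if "continuous_on UNIV f" for f :: "real^'n \<Rightarrow> real"
    using that by (simp add: measurable_cong_sets[OF sets refl] borel_measurable_continuous_onI)
  define n where "n = real CARD('n)"
  have n: "1 \<le> n" by (simp add: n_def Suc_leI)
  define v where "v = (1 + \<sigma>)\<^sup>2"
  have v: "0 < v" using sg(2) by (simp add: v_def)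
  have m2: "0 \<le> m2" by (simp add: m2_def)
  define m where "m = (LINT y|D. y)"
  have int1: "integrable D (\<lambda>x. x)"
  proof (rule Bochner_Integration.integrable_bound)
    show "integrable D (\<lambda>x. 1 + (norm x)\<^sup>2)" using int2 by simp
    show "(\<lambda>x. x) \<in> borel_measurable D" by (simp add: measurable_cong_sets[OF sets refl])
    have "norm x \<le> 1 + (norm x)\<^sup>2" for x :: "real^'n"
      using sum_squares_bound[of "norm x" 1, simplified] norm_ge_zero[of x] by linarith
    then have "norm x \<le> norm (1 + (norm x)\<^sup>2)" for x :: "real^'n" by simp
    then show "AE x in D. norm x \<le> norm (1 + (norm x)\<^sup>2)" by simp
  qed
  have m_le: "(norm m)\<^sup>2 \<le> m2"
  proof -
    have "0 \<le> (LINT x|D. (norm (x - m))\<^sup>2)" by simp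
    also have "(\<lambda>x. (norm (x - m))\<^sup>2) = (\<lambda>x. (norm x)\<^sup>2 - 2 * (m \<bullet> x) + (norm m)\<^sup>2)"
      by (simp add: fun_eq_iff power2_norm_eq_inner inner_diff_left inner_diff_right inner_commute)
    also have "(LINT x|D. (norm x)\<^sup>2 - 2 * (m \<bullet> x) + (norm m)\<^sup>2) = m2 - 2 * (m \<bullet> m) + (norm m)\<^sup>2"
      using int1 int2 by (simp add: m2_def m_def prob_space)
    finally show ?thesis by (simp add: power2_norm_eq_inner)
  qed
  have a: "0 < a" using n v m2 by (simp add: a_def n_def[symmetric] v_def[symmetric])
  have an: "2 * a * n \<le> 1 / (6 * v)"
  proof -
    have "2 * a * n = 1 / (6 * v * (1 + m2))" using n by (simp add: a_def n_def[symmetric] v_def[symmetric])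
    also have "\<dots> \<le> 1 / (6 * v)"
    proof (rule divide_left_mono)
      show "6 * v \<le> 6 * v * (1 + m2)" using v m2 mult_nonneg_nonneg[of v m2] by (simp add: algebra_simps)
      show "0 < 6 * v * (1 + m2) * (6 * v)" using v m2 by (intro mult_pos_pos add_pos_nonneg) simp_all
    qed simp
    finally show ?thesis .
  qed
  have am: "2 * a * m2 \<le> 1 / 2"
  proof -
    have "1 * 1 \<le> n * v" using n sg(2) by (intro mult_mono) (simp_all add: v_def power2_eq_square algebra_simps)
    moreover define X where "X = n * v * (1 + m2)"
    ultimately have "1 * (1 + m2) \<le> X" unfolding X_def using m2 by (intro mult_right_mono) auto
    then have X: "4 * m2 \<le> 12 * X" and "0 < X" using m2 by simp_all
    have "2 * a * m2 = 2 * m2 / (12 * X)"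
      by (simp add: a_def n_def[symmetric] v_def[symmetric] X_def)
    also have "\<dots> \<le> 1 / 2" using X \<open>0 < X\<close> by (simp add: pos_divide_le_eq)
    finally show ?thesis .
  qed
  have mgf: "(\<integral>\<^sup>+x. ennreal (exp (s * ((x - m) $ i))) \<partial>D) \<le> ennreal (exp (v * s\<^sup>2 / 2))" for s i
  proof -
    have "(\<integral>\<^sup>+x. ennreal (exp (s * ((x - m) $ i))) \<partial>D) \<le> ennreal (exp (\<sigma>\<^sup>2 * s\<^sup>2 / 2))"
      using sg(1) norm_axis_1[of i] unfolding sub_gaussian_def m_def
      by (metis (no_types, lifting) cart_eq_inner_axis inner_commute nn_integral_cong)
    also have "\<dots> \<le> ennreal (exp (v * s\<^sup>2 / 2))"
      using sg(2) by (intro ennreal_leI) (simp add: v_def mult_right_mono power_mono)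
    finally show ?thesis .
  qed
  have coord: "(\<integral>\<^sup>+x. ennreal (exp (((x - m) $ i)\<^sup>2 / (6 * v))) \<partial>D) \<le> 2" for i
    by (rule exp_square_integral_le[OF _ v mgf]) (intro meas continuous_intros)
  have "(\<integral>\<^sup>+x. ennreal (exp (a * (norm x)\<^sup>2)) \<partial>D)
    \<le> (\<integral>\<^sup>+x. 2 * (\<Sum>i\<in>UNIV. ennreal (exp (((x - m) $ i)\<^sup>2 / (6 * v)))) \<partial>D)"
  proof (rule nn_integral_mono)
    fix x
    define z where "z = x - m"
    obtain i where i: "(norm z)\<^sup>2 \<le> n * (z $ i)\<^sup>2" unfolding n_def by (rule norm_square_le_coordinate)
    have "norm x \<le> norm z + norm m" unfolding z_def by (metis diff_add_cancel norm_triangle_ineq)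
    then have "(norm x)\<^sup>2 \<le> (norm z + norm m)\<^sup>2" by (intro power_mono) simp_all
    also have "\<dots> \<le> 2 * (norm z)\<^sup>2 + 2 * (norm m)\<^sup>2"
      using sum_squares_bound[of "norm z" "norm m"] by (simp add: power2_eq_square algebra_simps)
    also have "\<dots> \<le> 2 * (n * (z $ i)\<^sup>2) + 2 * m2" using i m_le by simp
    finally have "a * (norm x)\<^sup>2 \<le> a * (2 * (n * (z $ i)\<^sup>2) + 2 * m2)" using a by simp
    also have "\<dots> = (2 * a * n) * (z $ i)\<^sup>2 + 2 * a * m2" by (simp add: algebra_simps)
    also have "\<dots> \<le> (1 / (6 * v)) * (z $ i)\<^sup>2 + 1 / 2"
      by (intro add_mono mult_right_mono an am) simp
    finally have "exp (a * (norm x)\<^sup>2) \<le> exp ((z $ i)\<^sup>2 / (6 * v)) * exp (1 / 2)"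
      by (simp flip: exp_add)
    also have "\<dots> \<le> exp ((z $ i)\<^sup>2 / (6 * v)) * 2"
      by (intro mult_left_mono exp_half_le2) simp
    finally have "ennreal (exp (a * (norm x)\<^sup>2)) \<le> ennreal (2 * exp ((z $ i)\<^sup>2 / (6 * v)))"
      by (intro ennreal_leI) (simp add: ac_simps)
    also have "\<dots> = 2 * ennreal (exp ((z $ i)\<^sup>2 / (6 * v)))" by (simp add: ennreal_mult)
    also have "\<dots> \<le> 2 * (\<Sum>i\<in>UNIV. ennreal (exp ((z $ i)\<^sup>2 / (6 * v))))"
      by (intro mult_left_mono member_le_sum) simp_all
    finally show "ennreal (exp (a * (norm x)\<^sup>2)) \<le> 2 * (\<Sum>i\<in>UNIV. ennreal (exp (((x - m) $ i)\<^sup>2 / (6 * v))))"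
      by (simp add: z_def)
  qed
  also have "\<dots> = 2 * (\<Sum>i\<in>UNIV. \<integral>\<^sup>+x. ennreal (exp (((x - m) $ i)\<^sup>2 / (6 * v))) \<partial>D)"
  proof -
    have m: "(\<lambda>x. ennreal (exp (((x - m) $ i)\<^sup>2 / (6 * v)))) \<in> borel_measurable D" for i
      by (intro measurable_compose[OF _ measurable_ennreal] meas continuous_intros) (use v in simp)
    show ?thesis
      by (subst nn_integral_cmult, rule borel_measurable_sum, rule m)
        (subst nn_integral_sum, rule m, rule refl)
  qed
  also have "\<dots> \<le> 2 * (\<Sum>i\<in>(UNIV :: 'n set). 2)"
    by (intro mult_left_mono sum_mono coord) simp
  also have "\<dots> = ennreal (4 * n)"
  proof -
    have "(\<Sum>i\<in>(UNIV :: 'n set). 2) = ennreal (2 * n)"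
      by (simp add: n_def ennreal_mult ennreal_of_nat_eq_real_of_nat mult.commute)
    then show ?thesis using n by (simp add: ennreal_mult flip: mult.assoc)
  qed
  finally have le: "(\<integral>\<^sup>+x. ennreal (exp (a * (norm x)\<^sup>2)) \<partial>D) \<le> ennreal (4 * n)" .
  show int: "integrable D (\<lambda>x. exp (a * (norm x)\<^sup>2))"
  proof (rule integrableI_nonneg)
    show "(\<lambda>x. exp (a * (norm x)\<^sup>2)) \<in> borel_measurable D" by (intro meas continuous_intros)
    show "(\<integral>\<^sup>+x. ennreal (exp (a * (norm x)\<^sup>2)) \<partial>D) < \<infinity>"
      using le by (rule le_less_trans) simp
  qed simp
  have "ennreal (LINT x|D. exp (a * (norm x)\<^sup>2)) \<le> ennreal (4 * n)"
    using le nn_integral_eq_integral[OF int] by simp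
  then show "(LINT x|D. exp (a * (norm x)\<^sup>2)) \<le> 4 * real CARD('n)"
    using n by (simp add: n_def[symmetric])
qed

section \<open>Concentration of sample means\<close>

text \<open>Compare the exponential series from the quadratic term on: |t| \<le> 1 gives |t|^j \<le>
  t^2 for j \<ge> 2.\<close>

lemma exp_le_quadratic:
  fixes t g :: real
  assumes "\<bar>t\<bar> \<le> 1"
  shows "exp (t * g) \<le> 1 + t * g + t\<^sup>2 * exp \<bar>g\<bar>"
proof -
  have two: "(\<lambda>n. inverse (fact (n + 2)) *\<^sub>R (x ^ (n + 2))) sums (exp x - 1 - x)" for x :: real
  proof -
    have "summable (\<lambda>n. inverse (fact (n + 2)) *\<^sub>R (x ^ (n + 2)))"
      using summable_exp_generic[of x] by (intro summable_ignore_initial_segment) (simp add: summable_exp_generic)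
    then show ?thesis using exp_first_two_terms[of x] by (simp add: sums_iff)
  qed
  have "exp (t * g) - 1 - t * g \<le> t\<^sup>2 * (exp \<bar>g\<bar> - 1 - \<bar>g\<bar>)"
  proof (rule sums_le[OF _ two sums_mult[OF two]])
    fix n
    have "(t * g) ^ (n + 2) \<le> \<bar>t * g\<bar> ^ (n + 2)" by (metis abs_ge_self power_abs)
    also have "\<dots> = \<bar>t\<bar> ^ (n + 2) * \<bar>g\<bar> ^ (n + 2)" by (simp only: abs_mult power_mult_distrib)
    also have "\<dots> \<le> t\<^sup>2 * \<bar>g\<bar> ^ (n + 2)"
    proof (rule mult_right_mono)
      have "\<bar>t\<bar> ^ (n + 2) \<le> \<bar>t\<bar> ^ 2" using assms by (intro power_decreasing) auto
      then show "\<bar>t\<bar> ^ (n + 2) \<le> t\<^sup>2" by simp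
    qed simp
    finally have "inverse (fact (n + 2)) * (t * g) ^ (n + 2) \<le> inverse (fact (n + 2)) * (t\<^sup>2 * \<bar>g\<bar> ^ (n + 2))"
      by (rule mult_left_mono) simp
    then show "inverse (fact (n + 2)) *\<^sub>R (t * g) ^ (n + 2) \<le> t\<^sup>2 * (inverse (fact (n + 2)) *\<^sub>R \<bar>g\<bar> ^ (n + 2))"
      by (simp only: real_scaleR_def ac_simps)
  qed
  moreover have "t\<^sup>2 * (exp \<bar>g\<bar> - 1 - \<bar>g\<bar>) \<le> t\<^sup>2 * exp \<bar>g\<bar>" by (intro mult_left_mono) auto
  ultimately show ?thesis by linarith
qed

text \<open>\<open>B\<close> is squared because centring adds E z to the envelope: |f - E f| \<le> z
  + E z, and each summand contributes a factor at most \<open>B\<close>.\<close>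

lemma mgf_bound:
  fixes f z :: "'a \<Rightarrow> real"
  assumes "prob_space M" and f: "f \<in> borel_measurable M" and z: "z \<in> borel_measurable M"
    and fz: "AE s in M. \<bar>f s\<bar> \<le> z s"
    and int: "integrable M (\<lambda>s. exp (z s))" and B: "(LINT s|M. exp (z s)) \<le> B" and t: "\<bar>t\<bar> \<le> 1"
  shows "integrable M f" and "(\<integral>\<^sup>+s. ennreal (exp (t * (f s - (LINT s|M. f s)))) \<partial>M) \<le> ennreal (exp (t\<^sup>2 * B\<^sup>2))"
proof -
  interpret prob_space M by fact
  note [measurable] = f z
  have ez: "x \<le> exp x" for x :: real using exp_ge_add_one_self[of x] by linarith
  have iz: "integrable M z"
  proof (rule Bochner_Integration.integrable_bound[OF int])
    show "AE s in M. norm (z s) \<le> norm (exp (z s))"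
      using fz by eventually_elim (use ez in \<open>auto simp: abs_le_iff intro: order_trans\<close>)
  qed simp
  show if': "integrable M f"
    by (rule Bochner_Integration.integrable_bound[OF iz]) (use fz in \<open>auto elim!: eventually_mono\<close>)
  define Ez Ef where "Ez = (LINT s|M. z s)" and "Ef = (LINT s|M. f s)"
  \<comment> \<open>Jensen's inequality, from 1 + x \<le> exp x at x = z - E z.\<close>
  have expE: "exp Ez \<le> B"
  proof -
    have ie: "integrable M (\<lambda>s. exp (z s - Ez))" using int by (simp add: exp_diff)
    have "1 = (LINT s|M. 1 + (z s - Ez))" using iz by (simp add: Ez_def prob_space)
    also have "\<dots> \<le> (LINT s|M. exp (z s - Ez))"
      using iz by (intro integral_mono ie) (auto intro: exp_ge_add_one_self)
    also have "\<dots> = (LINT s|M. exp (z s)) / exp Ez" by (simp add: exp_diff)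
    finally show ?thesis using B by (simp add: field_simps)
  qed
  have "\<bar>Ef\<bar> \<le> (LINT s|M. \<bar>f s\<bar>)" unfolding Ef_def by (rule integral_abs_bound)
  also have "\<dots> \<le> Ez" unfolding Ez_def
    using fz if' iz by (intro integral_mono_AE) auto
  finally have Ef: "\<bar>Ef\<bar> \<le> Ez" .
  define g where "g s = f s - Ef" for s
  have gm [measurable]: "g \<in> borel_measurable M" unfolding g_def by simp
  have ge: "AE s in M. exp \<bar>g s\<bar> \<le> exp (z s) * exp Ez"
    using fz by eventually_elim (use Ef in \<open>auto simp: g_def exp_add[symmetric]\<close>)
  have ieg: "integrable M (\<lambda>s. exp \<bar>g s\<bar>)"
    by (rule Bochner_Integration.integrable_bound[of _ "\<lambda>s. exp (z s) * exp Ez"])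
      (use ge int in \<open>auto elim!: eventually_mono\<close>)
  have "0 \<le> exp Ez" by simp
  then have "0 \<le> B" using expE by linarith
  have Eeg: "(LINT s|M. exp \<bar>g s\<bar>) \<le> B\<^sup>2"
  proof -
    have "(LINT s|M. exp \<bar>g s\<bar>) \<le> (LINT s|M. exp (z s) * exp Ez)"
      using ge int by (intro integral_mono_AE ieg) auto
    also have "\<dots> = (LINT s|M. exp (z s)) * exp Ez" by simp
    also have "\<dots> \<le> B * B" using B expE \<open>0 \<le> B\<close> by (intro mult_mono) auto
    finally show ?thesis by (simp add: power2_eq_square)
  qed
  have ig: "integrable M g" unfolding g_def using if' by simp
  have g0: "(LINT s|M. g s) = 0" unfolding g_def using if' by (simp add: Ef_def prob_space)
  have ir: "integrable M (\<lambda>s. 1 + t * g s + t\<^sup>2 * exp \<bar>g s\<bar>)" using ig ieg by simp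
  have ie: "integrable M (\<lambda>s. exp (t * g s))"
  proof (rule Bochner_Integration.integrable_bound[OF ieg])
    have "t * g s \<le> \<bar>g s\<bar>" for s
      using mult_mono[OF t order_refl, of "\<bar>g s\<bar>"] by (simp add: abs_mult[symmetric])
    then show "AE s in M. norm (exp (t * g s)) \<le> norm (exp \<bar>g s\<bar>)" by simp
  qed simp
  have "(LINT s|M. exp (t * g s)) \<le> (LINT s|M. 1 + t * g s + t\<^sup>2 * exp \<bar>g s\<bar>)"
    by (intro integral_mono ie ir exp_le_quadratic t)
  also have "\<dots> = 1 + t\<^sup>2 * (LINT s|M. exp \<bar>g s\<bar>)" using ig ieg by (simp add: g0 prob_space)
  also have "\<dots> \<le> 1 + t\<^sup>2 * B\<^sup>2" using Eeg by (intro add_left_mono mult_left_mono) auto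
  also have "\<dots> \<le> exp (t\<^sup>2 * B\<^sup>2)" by (rule exp_ge_add_one_self)
  finally show "(\<integral>\<^sup>+s. ennreal (exp (t * (f s - (LINT s|M. f s)))) \<partial>M) \<le> ennreal (exp (t\<^sup>2 * B\<^sup>2))"
    using nn_integral_eq_integral[OF ie] by (simp add: g_def Ef_def)
qed

lemma indep_vars_PiM_coordinates:
  fixes M :: "'a measure"
  assumes "prob_space M"
  shows "prob_space.indep_vars (\<Pi>\<^sub>M j\<in>(UNIV :: 'i set). M) (\<lambda>_. M) (\<lambda>j \<omega>. \<omega> j) UNIV"
proof -
  interpret PM: prob_space "\<Pi>\<^sub>M j\<in>(UNIV :: 'i set). M" by (intro prob_space_PiM assms)
  have "distr (\<Pi>\<^sub>M j\<in>(UNIV :: 'i set). M) (\<Pi>\<^sub>M j\<in>UNIV. M) (\<lambda>x. \<lambda>i\<in>UNIV. x i) = (\<Pi>\<^sub>M j\<in>UNIV. M)"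
    by (simp add: restrict_UNIV distr_id2)
  moreover have "distr (\<Pi>\<^sub>M j\<in>(UNIV :: 'i set). M) M (\<lambda>x. x i) = M" for i
    using distr_PiM_component[of UNIV "\<lambda>_. M" i] assms by simp
  ultimately show ?thesis
    by (subst PM.indep_vars_iff_distr_eq_PiM') (simp_all add: measurable_component_singleton)
qed

text \<open>Markov's inequality for the exponential of t times the sum;
  \<open>t = e / (2 * B\<^sup>2)\<close> minimises t^2 B^2 - t e, and
  \<open>e \<le> 2 * B\<^sup>2\<close> keeps t \<le> 1 as \<open>mgf_bound\<close> requires. The
  samples are the coordinates in \<open>J\<close> of a larger product, so that the bound applies to
  one iteration inside the whole run.\<close>

lemma chernoff_mean:
  fixes f z :: "'a \<Rightarrow> real" and J :: "'i set"
  assumes M: "prob_space M" and f: "f \<in> borel_measurable M" and z: "z \<in> borel_measurable M"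
    and fz: "AE s in M. \<bar>f s\<bar> \<le> z s"
    and int: "integrable M (\<lambda>s. exp (z s))" and B: "(LINT s|M. exp (z s)) \<le> B" "1 \<le> B"
    and J: "finite J" and e: "0 \<le> e" "e \<le> 2 * B\<^sup>2"
  shows "emeasure (\<Pi>\<^sub>M j\<in>(UNIV :: 'i set). M)
      {\<omega> \<in> space (\<Pi>\<^sub>M j\<in>UNIV. M). real (card J) * e \<le> (\<Sum>j\<in>J. f (\<omega> j) - (LINT s|M. f s))}
    \<le> ennreal (exp (- (real (card J) * e\<^sup>2 / (4 * B\<^sup>2))))"
proof -
  interpret prob_space M by fact
  let ?P = "\<Pi>\<^sub>M j\<in>(UNIV :: 'i set). M"
  interpret PM: prob_space ?P by (intro prob_space_PiM M)
  note [measurable] = f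
  define N where "N = real (card J)"
  define t where "t = e / (2 * B\<^sup>2)"
  have t: "0 \<le> t" "\<bar>t\<bar> \<le> 1" using e B(2) by (simp_all add: t_def)
  define g where "g s = f s - (LINT s|M. f s)" for s
  have gm [measurable]: "g \<in> borel_measurable M" unfolding g_def by simp
  have mgf: "(\<integral>\<^sup>+s. ennreal (exp (t * g s)) \<partial>M) \<le> ennreal (exp (t\<^sup>2 * B\<^sup>2))"
    unfolding g_def by (rule mgf_bound(2)[OF M f z fz int B(1) t(2)])
  have comp: "(\<lambda>\<omega>. \<omega> j) \<in> measurable ?P M" for j by (rule measurable_component_singleton) simp
  have "PM.indep_vars (\<lambda>_. borel) (\<lambda>j \<omega>. ennreal (exp (t * g (\<omega> j)))) UNIV"
    by (rule PM.indep_vars_compose2[OF indep_vars_PiM_coordinates[OF M]]) measurable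
  then have ind: "PM.indep_vars (\<lambda>_. borel) (\<lambda>j \<omega>. ennreal (exp (t * g (\<omega> j)))) J"
    by (rule PM.indep_vars_subset) simp
  have gj [measurable]: "(\<lambda>\<omega>. g (\<omega> j)) \<in> borel_measurable ?P" for j
    by (rule measurable_compose[OF comp gm])
  let ?A = "{\<omega> \<in> space ?P. N * e \<le> (\<Sum>j\<in>J. g (\<omega> j))}"
  have A: "?A \<in> sets ?P" by measurable
  have "emeasure ?P ?A = (\<integral>\<^sup>+\<omega>. indicator ?A \<omega> \<partial>?P)" using A by simp
  also have "\<dots> \<le> (\<integral>\<^sup>+\<omega>. ennreal (exp (- (t * (N * e)))) * (\<Prod>j\<in>J. ennreal (exp (t * g (\<omega> j)))) \<partial>?P)"
  proof (rule nn_integral_mono)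
    fix \<omega>
    show "indicator ?A \<omega> \<le> ennreal (exp (- (t * (N * e)))) * (\<Prod>j\<in>J. ennreal (exp (t * g (\<omega> j))))"
    proof (cases "\<omega> \<in> ?A")
      case True
      then have "t * (N * e) \<le> t * (\<Sum>j\<in>J. g (\<omega> j))" using t(1) by (intro mult_left_mono) auto
      then have "1 \<le> exp (- (t * (N * e))) * exp (\<Sum>j\<in>J. t * g (\<omega> j))"
        by (simp add: sum_distrib_left flip: exp_add)
      also have "exp (\<Sum>j\<in>J. t * g (\<omega> j)) = (\<Prod>j\<in>J. exp (t * g (\<omega> j)))"
        using J by (rule exp_sum)
      finally have "ennreal 1 \<le> ennreal (exp (- (t * (N * e))) * (\<Prod>j\<in>J. exp (t * g (\<omega> j))))"
        by (rule ennreal_leI)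
      then show ?thesis using True by (simp add: ennreal_mult prod_nonneg prod_ennreal)
    qed simp
  qed
  also have "\<dots> = ennreal (exp (- (t * (N * e)))) * (\<Prod>j\<in>J. \<integral>\<^sup>+\<omega>. ennreal (exp (t * g (\<omega> j))) \<partial>?P)"
    by (subst nn_integral_cmult) (simp_all add: PM.indep_vars_nn_integral[OF J ind])
  also have "(\<Prod>j\<in>J. \<integral>\<^sup>+\<omega>. ennreal (exp (t * g (\<omega> j))) \<partial>?P) = (\<Prod>j\<in>J. \<integral>\<^sup>+s. ennreal (exp (t * g s)) \<partial>M)"
  proof (rule prod.cong[OF refl])
    fix j
    have "(\<integral>\<^sup>+s. ennreal (exp (t * g s)) \<partial>M) = (\<integral>\<^sup>+s. ennreal (exp (t * g s)) \<partial>distr ?P M (\<lambda>\<omega>. \<omega> j))"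
      using distr_PiM_component[of UNIV "\<lambda>_. M" j] M by simp
    also have "\<dots> = (\<integral>\<^sup>+\<omega>. ennreal (exp (t * g (\<omega> j))) \<partial>?P)"
      by (rule nn_integral_distr[OF comp]) simp
    finally show "(\<integral>\<^sup>+\<omega>. ennreal (exp (t * g (\<omega> j))) \<partial>?P) = (\<integral>\<^sup>+s. ennreal (exp (t * g s)) \<partial>M)" by simp
  qed
  also have "ennreal (exp (- (t * (N * e)))) * \<dots> \<le> ennreal (exp (- (t * (N * e)))) * (\<Prod>j\<in>J. ennreal (exp (t\<^sup>2 * B\<^sup>2)))"
    by (intro mult_left_mono prod_mono_ennreal mgf) simp
  also have "\<dots> = ennreal (exp (- (t * (N * e))) * exp (N * (t\<^sup>2 * B\<^sup>2)))"
    by (simp add: N_def exp_of_nat_mult ennreal_power flip: ennreal_mult)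
  also have "exp (- (t * (N * e))) * exp (N * (t\<^sup>2 * B\<^sup>2)) = exp (- (N * e\<^sup>2 / (4 * B\<^sup>2)))"
  proof -
    have "- (t * (N * e)) + N * (t\<^sup>2 * B\<^sup>2) = - (N * e\<^sup>2 / (4 * B\<^sup>2))"
      using B(2) by (simp add: t_def field_simps power2_eq_square)
    then show ?thesis by (simp flip: exp_add)
  qed
  finally show ?thesis by (simp add: N_def g_def)
qed

text \<open>A deviation larger than \<open>e\<close> forces some coordinate to deviate by at least
  \<open>e\<close> divided by the dimension; a union bound over the signed coordinates follows.
  Scaling by \<open>\<beta>\<close> brings the envelope to where its exponential moment is
  known.\<close>

lemma vector_mean_concentration:
  fixes Y :: "'a \<Rightarrow> 'b::euclidean_space" and J :: "'i set"
  assumes M: "prob_space M" and Y: "Y \<in> borel_measurable M" and z: "z \<in> borel_measurable M"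
    and Yz: "AE s in M. norm (Y s) \<le> z s"
    and int: "integrable M (\<lambda>s. exp (\<beta> * z s))" and B: "(LINT s|M. exp (\<beta> * z s)) \<le> B" "1 \<le> B" and \<beta>: "0 < \<beta>"
    and J: "finite J" "J \<noteq> {}" and e: "0 < e" "\<beta> * e \<le> 2 * B\<^sup>2"
  shows "emeasure (\<Pi>\<^sub>M j\<in>(UNIV :: 'i set). M)
      {\<omega> \<in> space (\<Pi>\<^sub>M j\<in>UNIV. M). e < norm ((1 / real (card J)) *\<^sub>R (\<Sum>j\<in>J. Y (\<omega> j)) - (LINT s|M. Y s))}
    \<le> ennreal (2 * DIM('b) * exp (- (real (card J) * (\<beta> * e / DIM('b))\<^sup>2 / (4 * B\<^sup>2))))"
proof -
  interpret prob_space M by fact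
  let ?P = "\<Pi>\<^sub>M j\<in>(UNIV :: 'i set). M"
  interpret PM: prob_space ?P by (intro prob_space_PiM M)
  note [measurable] = Y z
  define N where "N = real (card J)"
  have N: "0 < N" using J by (simp add: N_def card_gt_0_iff)
  define d where "d = real DIM('b)"
  have d: "1 \<le> d" using DIM_positive[where 'a = 'b] by (simp add: d_def Suc_leI)
  define e' where "e' = \<beta> * e / d"
  have e': "0 \<le> e'" "e' \<le> 2 * B\<^sup>2"
  proof -
    show "0 \<le> e'" using \<beta> e d by (simp add: e'_def)
    have "\<beta> * e / d \<le> \<beta> * e / 1" using \<beta> e d by (intro divide_left_mono) auto
    then show "e' \<le> 2 * B\<^sup>2" using e by (simp add: e'_def)
  qed
  have comp: "(\<lambda>\<omega>. \<omega> j) \<in> measurable ?P M" for j by (rule measurable_component_singleton) simp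
  have Yj [measurable]: "(\<lambda>\<omega>. Y (\<omega> j)) \<in> borel_measurable ?P" for j
    by (rule measurable_compose[OF comp Y])
  have ez: "x \<le> exp x" for x :: real using exp_ge_add_one_self[of x] by linarith
  have iY: "integrable M Y"
  proof (rule Bochner_Integration.integrable_bound[of _ "\<lambda>s. (1 / \<beta>) * exp (\<beta> * z s)"])
    show "integrable M (\<lambda>s. (1 / \<beta>) * exp (\<beta> * z s))" using int by simp
    show "AE s in M. norm (Y s) \<le> norm ((1 / \<beta>) * exp (\<beta> * z s))"
      using Yz
    proof eventually_elim
      case (elim s)
      have "\<beta> * norm (Y s) \<le> exp (\<beta> * z s)"
        using elim \<beta> ez[of "\<beta> * z s"] mult_left_mono[OF elim, of \<beta>] by linarith
      then show ?case using \<beta> by (simp add: field_simps)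
    qed
  qed simp
  define m where "m = (LINT s|M. Y s)"
  define A where "A c = {\<omega> \<in> space ?P. N * e' \<le> (\<Sum>j\<in>J. \<beta> * (Y (\<omega> j) \<bullet> c) - \<beta> * (m \<bullet> c))}" for c
  have A_le: "emeasure ?P (A c) \<le> ennreal (exp (- (N * e'\<^sup>2 / (4 * B\<^sup>2))))" if c: "norm c = 1" for c
  proof -
    have "AE s in M. \<bar>\<beta> * (Y s \<bullet> c)\<bar> \<le> \<beta> * z s"
      using Yz
    proof eventually_elim
      case (elim s)
      have "\<bar>Y s \<bullet> c\<bar> \<le> norm (Y s)" using Cauchy_Schwarz_ineq2[of "Y s" c] c by simp
      then show ?case using elim \<beta> by (simp add: abs_mult)
    qed
    moreover have "(LINT s|M. \<beta> * (Y s \<bullet> c)) = \<beta> * (m \<bullet> c)"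
      using integral_inner_left[of c M Y] iY by (simp add: m_def)
    moreover have "(\<lambda>s. \<beta> * (Y s \<bullet> c)) \<in> borel_measurable M" "(\<lambda>s. \<beta> * z s) \<in> borel_measurable M"
      by measurable
    ultimately show ?thesis
      using chernoff_mean[OF M _ _ _ int B J(1) e', of "\<lambda>s. \<beta> * (Y s \<bullet> c)"]
      by (simp only: A_def N_def)
  qed
  have A_sets: "A c \<in> sets ?P" for c unfolding A_def by measurable
  let ?E = "{\<omega> \<in> space ?P. e < norm ((1 / N) *\<^sub>R (\<Sum>j\<in>J. Y (\<omega> j)) - m)}"
  have "?E \<subseteq> (\<Union>b\<in>Basis. A b \<union> A (- b))"
  proof
    fix \<omega> assume \<omega>: "\<omega> \<in> ?E"
    define v where "v = (1 / N) *\<^sub>R (\<Sum>j\<in>J. Y (\<omega> j)) - m"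
    have "\<exists>b\<in>Basis. e / d \<le> \<bar>v \<bullet> b\<bar>"
    proof (rule ccontr)
      assume "\<not> ?thesis"
      then have "\<bar>v \<bullet> b\<bar> \<le> e / d" if "b \<in> Basis" for b using that by (metis less_eq_real_def linorder_not_le)
      then have "(\<Sum>b\<in>Basis. \<bar>v \<bullet> b\<bar>) \<le> (\<Sum>b\<in>(Basis :: 'b set). e / d)" by (rule sum_mono)
      then have "norm v \<le> e" using norm_le_l1[of v] d by (simp add: d_def)
      then show False using \<omega> by (simp add: v_def)
    qed
    then obtain b where b: "b \<in> Basis" "e / d \<le> \<bar>v \<bullet> b\<bar>" by blast
    have in_A: "\<omega> \<in> A c" if "e / d \<le> v \<bullet> c" for c
    proof -
      have "N * e' = N * \<beta> * (e / d)" by (simp add: e'_def)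
      also have "\<dots> \<le> N * \<beta> * (v \<bullet> c)" using that N \<beta> by (intro mult_left_mono) auto
      also have "\<dots> = (\<Sum>j\<in>J. \<beta> * (Y (\<omega> j) \<bullet> c) - \<beta> * (m \<bullet> c))"
        using N by (simp add: v_def inner_diff_left inner_sum_left sum_subtractf sum_distrib_left[symmetric]
            N_def[symmetric] field_simps)
      finally show ?thesis using \<omega> by (simp add: A_def)
    qed
    show "\<omega> \<in> (\<Union>b\<in>Basis. A b \<union> A (- b))"
    proof (cases "0 \<le> v \<bullet> b")
      case True
      then have "\<omega> \<in> A b" using b by (intro in_A) simp
      then show ?thesis using b by blast
    next
      case False
      then have "\<omega> \<in> A (- b)" using b by (intro in_A) simp
      then show ?thesis using b by blast
    qed
  qed
  then have "emeasure ?P ?E \<le> emeasure ?P (\<Union>b\<in>Basis. A b \<union> A (- b))"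
    using A_sets by (intro emeasure_mono) auto
  also have "\<dots> \<le> (\<Sum>b\<in>Basis. emeasure ?P (A b \<union> A (- b)))"
    using A_sets by (intro emeasure_subadditive_finite) auto
  also have "\<dots> \<le> (\<Sum>b\<in>Basis. emeasure ?P (A b) + emeasure ?P (A (- b)))"
    using A_sets by (intro sum_mono emeasure_subadditive) auto
  also have "\<dots> \<le> (\<Sum>b\<in>(Basis :: 'b set). ennreal (exp (- (N * e'\<^sup>2 / (4 * B\<^sup>2)))) + ennreal (exp (- (N * e'\<^sup>2 / (4 * B\<^sup>2)))))"
    by (intro sum_mono add_mono A_le) simp_all
  also have "\<dots> = ennreal (2 * d * exp (- (N * e'\<^sup>2 / (4 * B\<^sup>2))))"
    by (simp add: d_def ennreal_of_nat_eq_real_of_nat flip: ennreal_plus ennreal_mult)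
  finally show ?thesis by (simp add: N_def m_def e'_def d_def)
qed

section \<open>Concentration of the gradient estimate\<close>

lemma AE_pair_fst:
  assumes "prob_space A" "prob_space B" "AE x in A. Q x"
  shows "AE s in A \<Otimes>\<^sub>M B. Q (fst s)"
proof -
  interpret B: prob_space B by fact
  from assms(3) show ?thesis
  proof (rule AE_E3)
    fix N assume N: "\<And>x. x \<in> space A - N \<Longrightarrow> Q x" "N \<in> null_sets A"
    have "N \<times> space B \<in> null_sets (A \<Otimes>\<^sub>M B)"
      using N(2) by (intro B.times_in_null_sets1) auto
    then show ?thesis
      using N(1) by (intro AE_I'[of "N \<times> space B"]) (auto simp: space_pair_measure, metis)
  qed
qed

lemma AE_pair_snd:
  assumes "prob_space A" "prob_space B" "AE x in B. Q x"
  shows "AE s in A \<Otimes>\<^sub>M B. Q (snd s)"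
proof -
  interpret B: prob_space B by fact
  from assms(3) show ?thesis
  proof (rule AE_E3)
    fix N assume N: "\<And>x. x \<in> space B - N \<Longrightarrow> Q x" "N \<in> null_sets B"
    have "space A \<times> N \<in> null_sets (A \<Otimes>\<^sub>M B)"
      using N(2) by (intro B.times_in_null_sets2) auto
    then show ?thesis
      using N(1) by (intro AE_I'[of "space A \<times> N"]) (auto simp: space_pair_measure, metis)
  qed
qed

text \<open>Mean-square stability gives no bound on individual trajectories, so the almost sure
  parameter bound is used and the growth is exponential in \<open>t\<close>.\<close>

lemma state_norm_le:
  fixes L :: "real^'n^'m"
  assumes K: "0 < K" and op: "\<And>t. opnorm (parA (\<xi> t)) \<le> K \<and> opnorm (parB (\<xi> t)) \<le> K"
    and k: "(1 + K) * (1 + norm L) \<le> k"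
  shows "norm (state L (x, \<xi>) t) \<le> k ^ t * norm x"
proof (induction t)
  case (Suc t)
  let ?x = "state L (x, \<xi>) t"
  have "norm (state L (x, \<xi>) (Suc t)) \<le> norm (parA (\<xi> t) *v ?x) + norm (parB (\<xi> t) *v (L *v ?x))"
    using norm_triangle_ineq4[of "parA (\<xi> t) *v ?x" "parB (\<xi> t) *v (L *v ?x)"]
    by (simp add: matrix_vector_simps)
  also have "norm (parA (\<xi> t) *v ?x) \<le> K * norm ?x"
    using op[of t] by (intro order_trans[OF opnorm_apply] mult_right_mono) auto
  also have "norm (parB (\<xi> t) *v (L *v ?x)) \<le> K * (norm L * norm ?x)"
  proof -
    have "norm (parB (\<xi> t) *v (L *v ?x)) \<le> opnorm (parB (\<xi> t)) * norm (L *v ?x)" by (rule opnorm_apply)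
    also have "\<dots> \<le> K * (norm L * norm ?x)"
      using op[of t] K by (intro mult_mono norm_matrix_vector_le) auto
    finally show ?thesis .
  qed
  also have "K * norm ?x + K * (norm L * norm ?x) = (K * (1 + norm L)) * norm ?x"
    by (simp add: algebra_simps)
  also have "\<dots> \<le> ((1 + K) * (1 + norm L)) * norm ?x" by (intro mult_right_mono) auto
  also have "\<dots> \<le> k * norm ?x" by (intro mult_right_mono k) simp
  also have "\<dots> \<le> k * (k ^ t * norm x)"
  proof (rule mult_left_mono[OF Suc.IH])
    have "0 \<le> (1 + K) * (1 + norm L)" using K by simp
    then show "0 \<le> k" using k by linarith
  qed
  finally show ?case by (simp add: ac_simps)
qed simp

text \<open>\<open>k\<^sup>2\<close> also absorbs the weight K (1 + |L'|^2) of a stage cost, so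
  stage \<open>t\<close> costs at most k^(2 (t + 1)) |x|^2, and t + 1 \<le> l.\<close>

lemma rollout_cost_le:
  fixes L U :: "real^'n^'m"
  assumes K: "0 < K"
    and op: "\<And>t. opnorm (parA (\<xi> t)) \<le> K \<and> opnorm (parB (\<xi> t)) \<le> K \<and> opnorm (parQ (\<xi> t)) \<le> K \<and> opnorm (parR (\<xi> t)) \<le> K"
    and k: "(1 + K) * (1 + norm (L + U)) \<le> k"
  shows "rollout_cost L l (U, x, \<xi>) \<le> real l * k ^ (2 * l) * (norm x)\<^sup>2"
proof -
  define L' where "L' = L + U"
  have k0: "0 \<le> (1 + K) * (1 + norm L')" "1 \<le> (1 + K) * (1 + norm L')"
    using K by (simp_all add: algebra_simps)
  then have k1: "1 \<le> k" using k by (simp add: L'_def)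
  have "stage_cost L' (x, \<xi>) t \<le> k ^ (2 * l) * (norm x)\<^sup>2" if "t < l" for t
  proof -
    let ?y = "state L' (x, \<xi>) t"
    have "stage_cost L' (x, \<xi>) t = ?y \<bullet> (parQ (\<xi> t) *v ?y) + (L' *v ?y) \<bullet> (parR (\<xi> t) *v (L' *v ?y))"
      by (simp add: stage_cost_eq)
    also have "\<dots> \<le> K * (norm ?y)\<^sup>2 + K * (norm (L' *v ?y))\<^sup>2"
      using op[of t] by (intro add_mono order_trans[OF trace_le_opnorm] mult_right_mono) auto
    also have "\<dots> \<le> K * (norm ?y)\<^sup>2 + K * (norm L' * norm ?y)\<^sup>2"
      using K by (intro add_left_mono mult_left_mono power_mono norm_matrix_vector_le) auto
    also have "\<dots> = (K * (1 + (norm L')\<^sup>2)) * (norm ?y)\<^sup>2"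
      by (simp add: power_mult_distrib algebra_simps)
    also have "\<dots> \<le> ((1 + K) * (1 + norm L'))\<^sup>2 * (norm ?y)\<^sup>2"
    proof (rule mult_right_mono)
      have "1 + (norm L')\<^sup>2 \<le> (1 + norm L')\<^sup>2" by (simp add: power2_sum)
      moreover have "K \<le> (1 + K)\<^sup>2" using K by (simp add: power2_eq_square algebra_simps)
      ultimately have "K * (1 + (norm L')\<^sup>2) \<le> (1 + K)\<^sup>2 * (1 + norm L')\<^sup>2"
        using K by (intro mult_mono) auto
      then show "K * (1 + (norm L')\<^sup>2) \<le> ((1 + K) * (1 + norm L'))\<^sup>2" by (simp add: power_mult_distrib)
    qed simp
    also have "\<dots> \<le> k\<^sup>2 * (k ^ t * norm x)\<^sup>2"
      using k0(1) k K op by (intro mult_mono power_mono state_norm_le) (auto simp: L'_def)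
    also have "\<dots> = k ^ (2 * Suc t) * (norm x)\<^sup>2"
      by (simp add: power_mult_distrib power_mult[symmetric] power_add[symmetric] ac_simps)
    also have "\<dots> \<le> k ^ (2 * l) * (norm x)\<^sup>2"
      using that k1 by (intro mult_right_mono power_increasing) auto
    finally show ?thesis .
  qed
  then have "(\<Sum>t<l. stage_cost L' (x, \<xi>) t) \<le> (\<Sum>t<l. k ^ (2 * l) * (norm x)\<^sup>2)"
    by (intro sum_mono) simp
  then show ?thesis by (simp add: rollout_cost_def L'_def ac_simps)
qed

locale lq_sub_gaussian = lq D P K
  for D :: "(real^'n) measure" and P :: "('n::finite, 'm::finite) params measure" and K :: real +
  fixes \<sigma> :: real
  assumes sub_gaussian: "sub_gaussian D \<sigma>" and \<sigma>_nonneg: "0 \<le> \<sigma>"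
begin

definition m2 :: real where "m2 = (LINT x|D. (norm x)\<^sup>2)"

lemma m2_nonneg: "0 \<le> m2" by (simp add: m2_def)

definition n\<^sub>r :: real where "n\<^sub>r = real CARD('n)"

lemma n\<^sub>r_ge: "1 \<le> n\<^sub>r" by (simp add: n\<^sub>r_def Suc_leI)

definition a\<^sub>g :: real where "a\<^sub>g = 1 / (12 * n\<^sub>r * (1 + \<sigma>)\<^sup>2 * (1 + m2))"

lemma a\<^sub>g_pos: "0 < a\<^sub>g" and a\<^sub>g_le: "a\<^sub>g \<le> 1"
proof -
  define X where "X = 12 * n\<^sub>r * (1 + \<sigma>)\<^sup>2 * (1 + m2)"
  have "1 * 1 * 1 * 1 \<le> X"
    unfolding X_def using n\<^sub>r_ge \<sigma>_nonneg m2_nonneg by (intro mult_mono) (auto simp: one_le_power)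
  then show "0 < a\<^sub>g" "a\<^sub>g \<le> 1" unfolding a\<^sub>g_def X_def[symmetric] by simp_all
qed

lemma exp_moment_SL:
  "integrable (SL r) (\<lambda>s. exp (a\<^sub>g * (norm (fst (snd s)))\<^sup>2))"
  "(LINT s|SL r. exp (a\<^sub>g * (norm (fst (snd s)))\<^sup>2)) \<le> 4 * n\<^sub>r"
proof -
  let ?US = "uniform_sphere r :: (real^'n^'m) measure"
  let ?f = "\<lambda>x :: real^'n. exp (a\<^sub>g * (norm x)\<^sup>2)"
  interpret US: prob_space ?US by (rule prob_space_uniform_sphere)
  interpret TSp: prob_space TS by (rule prob_space_TS)
  have D: "integrable D ?f" "(LINT x|D. ?f x) \<le> 4 * n\<^sub>r"
    using sub_gaussian_exp_norm_square[OF Dp.prob_space_axioms sets_D integrable_norm2_D sub_gaussian \<sigma>_nonneg]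
    by (simp_all add: a\<^sub>g_def n\<^sub>r_def m2_def)
  have m1: "(\<lambda>s. ?f (fst (snd s))) \<in> borel_measurable (SL r)" by measurable
  have m2: "(\<lambda>w. ?f (fst w)) \<in> borel_measurable TS" by measurable
  have "(\<integral>\<^sup>+s. ennreal (?f (fst (snd s))) \<partial>SL r) = (\<integral>\<^sup>+U. (\<integral>\<^sup>+w. ennreal (?f (fst (snd (U, w)))) \<partial>TS) \<partial>?US)"
    using m1 unfolding sample_law_def by (intro TSp.nn_integral_fst[symmetric]) simp
  also have "\<dots> = (\<integral>\<^sup>+w. ennreal (?f (fst w)) \<partial>TS)"
    using US.emeasure_space_1 by simp
  also have "\<dots> = (\<integral>\<^sup>+x. ennreal (?f x) \<partial>D)"
    using m2 by (subst nn_integral_TS) (simp_all add: emeasure_PS)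
  also have "\<dots> = ennreal (LINT x|D. ?f x)" by (rule nn_integral_eq_integral[OF D(1)]) simp
  finally have nn: "(\<integral>\<^sup>+s. ennreal (?f (fst (snd s))) \<partial>SL r) = ennreal (LINT x|D. ?f x)" .
  show "integrable (SL r) (\<lambda>s. exp (a\<^sub>g * (norm (fst (snd s)))\<^sup>2))"
    by (rule integrableI_nonneg[OF m1]) (simp_all add: nn)
  have "(LINT s|SL r. ?f (fst (snd s))) = (LINT x|D. ?f x)"
    by (subst integral_eq_nn_integral[OF m1]) (simp_all add: nn)
  then show "(LINT s|SL r. exp (a\<^sub>g * (norm (fst (snd s)))\<^sup>2)) \<le> 4 * n\<^sub>r" using D(2) by simp
qed

abbreviation Yest :: "nat \<Rightarrow> real \<Rightarrow> real^'n^'m \<Rightarrow> ('n, 'm) sample \<Rightarrow> real^'n^'m" where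
  "Yest l r L s \<equiv> (dm / r\<^sup>2 * rollout_cost L l s) *\<^sub>R fst s"

lemma AE_Yest_le:
  assumes r: "0 < r" and k: "(1 + K) * (1 + norm L + r) \<le> k"
  shows "AE s in SL r. norm (Yest l r L s) \<le> dm / r * real l * k ^ (2 * l) * (norm (fst (snd s)))\<^sup>2"
proof -
  have "AE s in SL r. norm (fst s) = r"
    unfolding sample_law_def
    by (intro AE_pair_fst prob_space_uniform_sphere prob_space_TS AE_uniform_sphere) (use r in simp)
  moreover have "AE s in SL r. (\<forall>t. opnorm (parA (snd (snd s) t)) \<le> K \<and> opnorm (parB (snd (snd s) t)) \<le> K
      \<and> opnorm (parQ (snd (snd s) t)) \<le> K \<and> opnorm (parR (snd (snd s) t)) \<le> K)"
    unfolding sample_law_def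
    by (rule AE_pair_snd[OF prob_space_uniform_sphere prob_space_TS AE_TS_component[OF AE_opnorm]])
  moreover have "AE s in SL r. (\<forall>t L. 0 \<le> stage_cost L (snd s) t)"
    unfolding sample_law_def
    by (rule AE_pair_snd[OF prob_space_uniform_sphere prob_space_TS AE_stage_cost_nonneg])
  ultimately show ?thesis
  proof eventually_elim
    case (elim s)
    obtain U x \<xi> where s: "s = (U, x, \<xi>)" by (metis prod.exhaust)
    have "norm (L + U) \<le> norm L + r" using elim(1) norm_triangle_ineq[of L U] by (simp add: s)
    then have "(1 + K) * (1 + norm (L + U)) \<le> (1 + K) * (1 + norm L + r)"
      using K_pos by (intro mult_left_mono) auto
    then have "rollout_cost L l (U, x, \<xi>) \<le> real l * k ^ (2 * l) * (norm x)\<^sup>2"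
      using elim(2) k by (intro rollout_cost_le[OF K_pos]) (auto simp: s)
    moreover have "0 \<le> rollout_cost L l (U, x, \<xi>)"
      using elim(3) by (auto simp: rollout_cost_def s intro: sum_nonneg)
    ultimately have "\<bar>dm / r\<^sup>2 * rollout_cost L l s\<bar> \<le> dm / r\<^sup>2 * (real l * k ^ (2 * l) * (norm x)\<^sup>2)"
      using dm_pos by (simp add: s abs_mult mult_left_mono divide_right_mono)
    then have "\<bar>dm / r\<^sup>2 * rollout_cost L l s\<bar> * r \<le> dm / r\<^sup>2 * (real l * k ^ (2 * l) * (norm x)\<^sup>2) * r"
      using r by (intro mult_right_mono) auto
    then have "norm (Yest l r L s) \<le> dm / r\<^sup>2 * (real l * k ^ (2 * l) * (norm x)\<^sup>2) * r"
      unfolding norm_scaleR elim(1) .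
    also have "\<dots> = dm / r * real l * k ^ (2 * l) * (norm (fst (snd s)))\<^sup>2"
      using r by (simp add: s power2_eq_square)
    finally show ?case .
  qed
qed

abbreviation "RS r \<equiv> run_space D P r"

lemma RS_eq: "RS r = (\<Pi>\<^sub>M j\<in>(UNIV :: (nat \<times> nat) set). SL r)"
  by (simp add: run_space_def)

lemma prob_space_RS: "prob_space (RS r)"
  unfolding RS_eq by (intro prob_space_PiM prob_space_SL)

lemma grad_est_eq:
  assumes "N > 0"
  shows "grad_est N l r L (\<lambda>i. \<omega> (k, i)) =
    (1 / real (card ({k} \<times> {..<N}))) *\<^sub>R (\<Sum>j\<in>{k} \<times> {..<N}. Yest l r L (\<omega> j))"
proof -
  have "(\<Sum>j\<in>{k} \<times> {..<N}. Yest l r L (\<omega> j)) = (\<Sum>i<N. Yest l r L (\<omega> (k, i)))"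
  proof -
    have "{k} \<times> {..<N} = Pair k ` {..<N}" by auto
    moreover have "inj_on (Pair k) {..<N}" by (simp add: inj_on_def)
    ultimately show ?thesis by (simp only: sum.reindex comp_def)
  qed
  then show ?thesis by (simp add: grad_est_def dm_def card_cartesian_product)
qed

lemma borel_measurable_Yest:
  assumes L: "L \<in> borel_measurable M" and s: "s \<in> measurable M (SL r)"
  shows "(\<lambda>\<omega>. Yest l r (L \<omega>) (s \<omega>)) \<in> borel_measurable M"
proof -
  have [measurable]: "(\<lambda>\<omega>. fst (s \<omega>)) \<in> borel_measurable M"
    by (rule measurable_compose[OF s measurable_SL(1)])
  have [measurable]: "(\<lambda>\<omega>. rollout_cost (L \<omega>) l (s \<omega>)) \<in> borel_measurable M"
    by (rule borel_measurable_rollout_cost[OF L s])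
  show ?thesis by measurable
qed

lemma borel_measurable_grad_est:
  assumes L: "L \<in> borel_measurable M" and s: "\<And>i. s i \<in> measurable M (SL r)"
  shows "(\<lambda>\<omega>. grad_est N l r (L \<omega>) (\<lambda>i. s i \<omega>)) \<in> borel_measurable M"
  unfolding grad_est_def dm_def[symmetric]
  by (intro borel_measurable_scaleR borel_measurable_const borel_measurable_sum borel_measurable_Yest L s)

lemma borel_measurable_mean_est: "mean_est l r \<in> borel_measurable borel"
proof -
  interpret SLp: prob_space "SL r" by (rule prob_space_SL)
  have "(\<lambda>(L, s). Yest l r L s) \<in> borel_measurable (borel \<Otimes>\<^sub>M SL r)"
    using borel_measurable_Yest[of fst "borel \<Otimes>\<^sub>M SL r" snd r l] by (simp add: case_prod_beta)
  from SLp.borel_measurable_lebesgue_integral[OF this] show ?thesis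
    by (simp add: mean_est_def[abs_def])
qed

text \<open>The bound of \<open>vector_mean_concentration\<close> in dimension \<open>dm\<close>
  with \<open>B = 4 * n\<^sub>r\<close> and rate \<open>a\<^sub>g\<close> divided by the envelope
  factor of \<open>AE_Yest_le\<close>; squaring that factor produces k^(4 l).\<close>

definition fail_prob :: "nat \<Rightarrow> nat \<Rightarrow> real \<Rightarrow> real \<Rightarrow> real \<Rightarrow> real" where
  "fail_prob N l r k e =
    2 * dm * exp (- (real N * (a\<^sub>g / (dm / r * real l * k ^ (2 * l)) * e / dm)\<^sup>2 / (4 * (4 * n\<^sub>r)\<^sup>2)))"

lemma grad_est_concentration:
  fixes L :: "real^'n^'m"
  assumes r: "0 < r" "r \<le> 1" and k: "(1 + K) * (1 + norm L + r) \<le> k" and l: "0 < l" and N: "0 < N"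
    and e: "0 < e" "e \<le> 1"
  shows "emeasure (RS r) {\<omega> \<in> space (RS r). e < norm (grad_est N l r L (\<lambda>i. \<omega> (j, i)) - mean_est l r L)}
    \<le> ennreal (fail_prob N l r k e)"
proof -
  define z0 where "z0 = dm / r * real l * k ^ (2 * l)"
  have k1: "1 \<le> k"
  proof -
    have "1 * 1 \<le> (1 + K) * (1 + norm L + r)" using K_pos r by (intro mult_mono) auto
    then show ?thesis using k by simp
  qed
  have z0: "1 \<le> z0"
  proof -
    have "1 \<le> dm / r" using dm_pos r by (simp add: pos_le_divide_eq)
    moreover have "0 \<le> dm / r * real l"
    proof (rule mult_nonneg_nonneg)
      show "0 \<le> dm / r" using \<open>1 \<le> dm / r\<close> by linarith
    qed simp
    ultimately have "1 * 1 * 1 \<le> dm / r * real l * k ^ (2 * l)"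
      using l k1 by (intro mult_mono) (auto simp: one_le_power)
    then show ?thesis by (simp add: z0_def)
  qed
  define J where "J = {j} \<times> {..<N}"
  have cJ: "card J = N" by (simp add: J_def card_cartesian_product)
  have small: "a\<^sub>g / z0 * e \<le> 2 * (4 * n\<^sub>r)\<^sup>2"
  proof -
    have "a\<^sub>g / z0 \<le> 1" using a\<^sub>g_le a\<^sub>g_pos z0 by (simp add: pos_divide_le_eq)
    then have "a\<^sub>g / z0 * e \<le> 1 * 1" using e a\<^sub>g_pos z0 by (intro mult_mono) auto
    also have "\<dots> \<le> 2 * (4 * n\<^sub>r)\<^sup>2" using one_le_power[OF n\<^sub>r_ge, of 2] by (simp add: power_mult_distrib)
    finally show ?thesis .
  qed
  have bz: "a\<^sub>g / z0 * (z0 * x) = a\<^sub>g * x" for x using z0 by simp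
  have Ym: "(\<lambda>s. Yest l r L s) \<in> borel_measurable (SL r)"
    using borel_measurable_Yest[of "\<lambda>_. L" "SL r" "\<lambda>s. s" r l] by simp
  have zm: "(\<lambda>s. z0 * (norm (fst (snd s)))\<^sup>2) \<in> borel_measurable (SL r)" by measurable
  have "emeasure (RS r) {\<omega> \<in> space (RS r). e < norm ((1 / real (card J)) *\<^sub>R (\<Sum>j\<in>J. Yest l r L (\<omega> j)) - mean_est l r L)}
    \<le> ennreal (2 * DIM(real^'n^'m) * exp (- (real (card J) * (a\<^sub>g / z0 * e / DIM(real^'n^'m))\<^sup>2 / (4 * (4 * n\<^sub>r)\<^sup>2))))"
    unfolding RS_eq mean_est_def
  proof (rule vector_mean_concentration[OF prob_space_SL Ym zm])
    show "AE s in SL r. norm (Yest l r L s) \<le> z0 * (norm (fst (snd s)))\<^sup>2"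
      unfolding z0_def by (rule AE_Yest_le[OF r(1) k])
    show "integrable (SL r) (\<lambda>s. exp (a\<^sub>g / z0 * (z0 * (norm (fst (snd s)))\<^sup>2)))"
      "(LINT s|SL r. exp (a\<^sub>g / z0 * (z0 * (norm (fst (snd s)))\<^sup>2))) \<le> 4 * n\<^sub>r"
      unfolding bz by (rule exp_moment_SL)+
    show "1 \<le> 4 * n\<^sub>r" using n\<^sub>r_ge by simp
    show "0 < a\<^sub>g / z0" using a\<^sub>g_pos z0 by simp
    show "finite J" "J \<noteq> {}" using N by (auto simp: J_def)
  qed (use e small in simp_all)
  moreover have "real DIM(real^'n^'m) = dm" "real (2 * DIM(real^'n^'m)) = 2 * dm" by (simp_all add: dm_def)
  ultimately show ?thesis
    unfolding grad_est_eq[OF N] J_def[symmetric] fail_prob_def z0_def[symmetric] by (simp only: cJ)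
qed

lemma component_SL: "j \<in> I \<Longrightarrow> (\<lambda>\<omega>. \<omega> j) \<in> measurable (\<Pi>\<^sub>M j\<in>I. SL r) (SL r)"
  by (rule measurable_component_singleton)

text \<open>The index set is left open: it is everything when the final event is measured, and the
  past \<open>{..<k} \<times> UNIV\<close> in \<open>fresh_sample_bound\<close>.\<close>

lemma borel_measurable_iterate:
  assumes "{..<k} \<times> UNIV \<subseteq> I"
  shows "(\<lambda>\<omega>. iterate N l r \<eta> L0 \<omega> k) \<in> borel_measurable (\<Pi>\<^sub>M j\<in>I. SL r)"
  using assms
proof (induction k)
  case (Suc k)
  have IH: "(\<lambda>\<omega>. iterate N l r \<eta> L0 \<omega> k) \<in> borel_measurable (\<Pi>\<^sub>M j\<in>I. SL r)"
    using Suc.prems by (intro Suc.IH) auto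
  have "(\<lambda>\<omega>. grad_est N l r (iterate N l r \<eta> L0 \<omega> k) (\<lambda>i. \<omega> (k, i))) \<in> borel_measurable (\<Pi>\<^sub>M j\<in>I. SL r)"
    using Suc.prems by (intro borel_measurable_grad_est IH component_SL) auto
  then show ?case using IH by simp
qed simp

lemma iterate_cong:
  assumes "\<And>j i. j < k \<Longrightarrow> \<omega> (j, i) = \<omega>' (j, i)"
  shows "iterate N l r \<eta> L0 \<omega> k = iterate N l r \<eta> L0 \<omega>' k"
  using assms
proof (induction k)
  case (Suc k)
  have "(\<lambda>i. \<omega> (k, i)) = (\<lambda>i. \<omega>' (k, i))" using Suc.prems by simp
  moreover have "iterate N l r \<eta> L0 \<omega> k = iterate N l r \<eta> L0 \<omega>' k" using Suc by simp
  ultimately show ?case by simp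
qed simp

text \<open>
  The \<open>k\<close>-th iterate depends on the samples of the iterations before \<open>k\<close> only, so the bound for a
  fixed feedback matrix carries over to it by Fubini.
\<close>

lemma fresh_sample_bound:
  fixes S :: "(real^'n^'m) set" and \<eta> :: real and L0 :: "real^'n^'m"
  assumes S: "S \<in> sets borel"
    and p: "\<And>L. L \<in> S \<Longrightarrow>
      emeasure (RS r) {\<omega> \<in> space (RS r). e < norm (grad_est N l r L (\<lambda>i. \<omega> (k, i)) - mean_est l r L)} \<le> p"
  defines "E \<equiv> {\<omega> \<in> space (RS r). iterate N l r \<eta> L0 \<omega> k \<in> S \<and>
      e < norm (grad_est N l r (iterate N l r \<eta> L0 \<omega> k) (\<lambda>i. \<omega> (k, i)) - mean_est l r (iterate N l r \<eta> L0 \<omega> k))}"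
  shows "E \<in> sets (RS r)" and "emeasure (RS r) E \<le> p"
proof -
  interpret R: prob_space "RS r" by (rule prob_space_RS)
  \<comment> \<open>\<open>A\<close> indexes the past, \<open>B\<close> the samples of iteration
    \<open>k\<close>; restrictions to disjoint index sets are independent, so the joint law of
    \<open>X\<close> and \<open>Y\<close> is a product.\<close>
  define A B :: "(nat \<times> nat) set" where "A = {..<k} \<times> UNIV" and "B = {k} \<times> UNIV"
  define PA PB where "PA = (\<Pi>\<^sub>M j\<in>A. SL r)" and "PB = (\<Pi>\<^sub>M j\<in>B. SL r)"
  define X Y where "X \<omega> = restrict \<omega> A" and "Y \<omega> = restrict \<omega> B" for \<omega> :: "nat \<times> nat \<Rightarrow> ('n, 'm) sample"
  have ind: "R.indep_vars (\<lambda>_. SL r) (\<lambda>j \<omega>. \<omega> j) UNIV"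
    unfolding RS_eq by (rule indep_vars_PiM_coordinates[OF prob_space_SL])
  have AB: "A \<inter> B = {}" by (auto simp: A_def B_def)
  have "R.indep_var PA X PB Y"
    using R.indep_var_restrict[OF ind AB]
    by (simp add: PA_def PB_def X_def[abs_def] Y_def[abs_def])
  then have Xm: "X \<in> measurable (RS r) PA" and Ym: "Y \<in> measurable (RS r) PB"
    and dist: "distr (RS r) PA X \<Otimes>\<^sub>M distr (RS r) PB Y = distr (RS r) (PA \<Otimes>\<^sub>M PB) (\<lambda>\<omega>. (X \<omega>, Y \<omega>))"
    unfolding R.indep_var_distribution_eq by blast+
  have XYm: "(\<lambda>\<omega>. (X \<omega>, Y \<omega>)) \<in> measurable (RS r) (PA \<Otimes>\<^sub>M PB)" using Xm Ym by measurable
  define it where "it \<omega> = iterate N l r \<eta> L0 \<omega> k" for \<omega>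
  have itm: "it \<in> borel_measurable PA"
    unfolding it_def PA_def by (intro borel_measurable_iterate) (simp add: A_def)
  define h where "h L b = norm (grad_est N l r L (\<lambda>i. b (k, i)) - mean_est l r L)" for L b
  have hm: "(\<lambda>ab. h (it (fst ab)) (snd ab)) \<in> borel_measurable (PA \<Otimes>\<^sub>M PB)"
  proof -
    have it': "(\<lambda>ab. it (fst ab)) \<in> borel_measurable (PA \<Otimes>\<^sub>M PB)"
      by (rule measurable_compose[OF measurable_fst itm])
    have "(\<lambda>ab. grad_est N l r (it (fst ab)) (\<lambda>i. snd ab (k, i))) \<in> borel_measurable (PA \<Otimes>\<^sub>M PB)"
    proof (rule borel_measurable_grad_est[OF it'])
      show "(\<lambda>ab. snd ab (k, i)) \<in> measurable (PA \<Otimes>\<^sub>M PB) (SL r)" for i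
        by (rule measurable_compose[OF measurable_snd]) (auto simp: PB_def B_def intro!: component_SL)
    qed
    moreover have "(\<lambda>ab. mean_est l r (it (fst ab))) \<in> borel_measurable (PA \<Otimes>\<^sub>M PB)"
      by (rule measurable_compose[OF it' borel_measurable_mean_est])
    ultimately show ?thesis
      unfolding h_def by measurable
  qed
  define G where "G = {ab \<in> space (PA \<Otimes>\<^sub>M PB). it (fst ab) \<in> S \<and> e < h (it (fst ab)) (snd ab)}"
  have Gs: "G \<in> sets (PA \<Otimes>\<^sub>M PB)"
  proof -
    have "(\<lambda>ab. it (fst ab)) \<in> borel_measurable (PA \<Otimes>\<^sub>M PB)"
      by (rule measurable_compose[OF measurable_fst itm])
    from measurable_sets[OF this S] have "{ab \<in> space (PA \<Otimes>\<^sub>M PB). it (fst ab) \<in> S} \<in> sets (PA \<Otimes>\<^sub>M PB)"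
      by (simp add: vimage_def Int_def conj_commute)
    moreover have "{ab \<in> space (PA \<Otimes>\<^sub>M PB). e < h (it (fst ab)) (snd ab)} \<in> sets (PA \<Otimes>\<^sub>M PB)"
      using hm by measurable
    ultimately have "{ab \<in> space (PA \<Otimes>\<^sub>M PB). it (fst ab) \<in> S} \<inter> {ab \<in> space (PA \<Otimes>\<^sub>M PB). e < h (it (fst ab)) (snd ab)}
      \<in> sets (PA \<Otimes>\<^sub>M PB)" by (rule sets.Int)
    also have "{ab \<in> space (PA \<Otimes>\<^sub>M PB). it (fst ab) \<in> S} \<inter> {ab \<in> space (PA \<Otimes>\<^sub>M PB). e < h (it (fst ab)) (snd ab)} = G"
      by (auto simp: G_def)
    finally show ?thesis .
  qed
  have itX: "it (X \<omega>) = iterate N l r \<eta> L0 \<omega> k" for \<omega>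
    unfolding it_def by (rule iterate_cong) (simp add: X_def A_def)
  have hY: "h L (Y \<omega>) = norm (grad_est N l r L (\<lambda>i. \<omega> (k, i)) - mean_est l r L)" for L \<omega>
    by (simp add: h_def Y_def B_def)
  have E: "E = (\<lambda>\<omega>. (X \<omega>, Y \<omega>)) -` G \<inter> space (RS r)"
    using measurable_space[OF XYm] by (auto simp: E_def G_def itX hY)
  show "E \<in> sets (RS r)" unfolding E by (rule measurable_sets[OF XYm Gs])
  interpret DX: prob_space "distr (RS r) PA X" by (rule R.prob_space_distr[OF Xm])
  interpret DY: prob_space "distr (RS r) PB Y" by (rule R.prob_space_distr[OF Ym])
  have "emeasure (RS r) E = emeasure (distr (RS r) (PA \<Otimes>\<^sub>M PB) (\<lambda>\<omega>. (X \<omega>, Y \<omega>))) G"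
    unfolding E by (rule emeasure_distr[OF XYm Gs, symmetric])
  also have "\<dots> = emeasure (distr (RS r) PA X \<Otimes>\<^sub>M distr (RS r) PB Y) G" by (simp only: dist)
  also have "\<dots> = (\<integral>\<^sup>+a. emeasure (distr (RS r) PB Y) (Pair a -` G) \<partial>distr (RS r) PA X)"
    by (rule DY.emeasure_pair_measure_alt) (simp add: Gs)
  also have "\<dots> \<le> (\<integral>\<^sup>+a. p \<partial>distr (RS r) PA X)"
  proof (rule nn_integral_mono)
    \<comment> \<open>For a fixed past \<open>a\<close> the iterate is a constant, and the
      hypothesis on \<open>S\<close> applies to it whenever it lies in \<open>S\<close>.\<close>
    fix a assume "a \<in> space (distr (RS r) PA X)"
    have sec: "Pair a -` G \<in> sets PB" by (rule sets_Pair1[OF Gs])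
    have "emeasure (distr (RS r) PB Y) (Pair a -` G) = emeasure (RS r) (Y -` (Pair a -` G) \<inter> space (RS r))"
      by (rule emeasure_distr[OF Ym sec])
    also have "\<dots> \<le> p"
    proof (cases "it a \<in> S")
      case True
      have "emeasure (RS r) (Y -` (Pair a -` G) \<inter> space (RS r))
        \<le> emeasure (RS r) {\<omega> \<in> space (RS r). e < norm (grad_est N l r (it a) (\<lambda>i. \<omega> (k, i)) - mean_est l r (it a))}"
      proof (rule emeasure_mono)
        have "(\<lambda>\<omega>. grad_est N l r (it a) (\<lambda>i. \<omega> (k, i))) \<in> borel_measurable (RS r)"
          unfolding RS_eq by (intro borel_measurable_grad_est component_SL) simp_all
        then show "{\<omega> \<in> space (RS r). e < norm (grad_est N l r (it a) (\<lambda>i. \<omega> (k, i)) - mean_est l r (it a))} \<in> sets (RS r)"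
          by measurable
      qed (auto simp: G_def hY)
      also have "\<dots> \<le> p" by (rule p[OF True])
      finally show ?thesis .
    next
      case False
      then have "Y -` (Pair a -` G) \<inter> space (RS r) = {}" by (auto simp: G_def)
      then show ?thesis by simp
    qed
    finally show "emeasure (distr (RS r) PB Y) (Pair a -` G) \<le> p" .
  qed
  also have "\<dots> = p" using DX.emeasure_space_1 by simp
  finally show "emeasure (RS r) E \<le> p" .
qed

end

section \<open>Convergence of the policy gradient iteration\<close>

context lq
begin

text \<open>608 = 8 * 76 turns the quadratic error of \<open>smoothness\<close> into
  \<open>\<eta> / 8 * (norm g)\<^sup>2\<close>; together with |g| \<le> 5 w^3 c^2 it also keeps the
  step within the radius of \<open>smoothness\<close>.\<close>

lemma gradient_step:
  fixes g :: "real^'n^'m"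
  assumes L: "L \<in> U_ad P" and c: "Ct L \<le> c" "1 \<le> c" and \<eta>: "0 < \<eta>" "608 * w ^ 6 * c ^ 3 * \<eta> \<le> 1"
    and g: "norm (g - GL L) \<le> e0" "e0 \<le> 1"
  shows "L - \<eta> *\<^sub>R g \<in> U_ad P"
    and "Ct (L - \<eta> *\<^sub>R g) \<le> Ct L - \<eta> / 2 * (norm (GL L))\<^sup>2 + 3 * \<eta> * e0\<^sup>2"
proof -
  define v where "v = g - GL L"
  define Z where "Z = - \<eta> *\<^sub>R g"
  have w3: "1 \<le> w ^ 3" "1 \<le> c ^ 2" using w_ge(1) c by (simp_all add: one_le_power)
  have "norm g \<le> norm (GL L) + norm v" using norm_triangle_ineq[of "GL L" v] by (simp add: v_def)
  also have "\<dots> \<le> 4 * w ^ 3 * c ^ 2 + 1" using norm_GL_le[OF L c] g by (simp add: v_def)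
  also have "\<dots> \<le> 5 * (w ^ 3 * c ^ 2)"
  proof -
    have "1 * 1 \<le> w ^ 3 * c ^ 2" using w3 w_ge(1) by (intro mult_mono) auto
    then show ?thesis by linarith
  qed
  finally have ng: "norm g \<le> 5 * (w ^ 3 * c ^ 2)" .
  have "12 * w ^ 3 * c * norm Z = 12 * w ^ 3 * c * \<eta> * norm g" using \<eta> by (simp add: Z_def)
  also have "\<dots> \<le> 12 * w ^ 3 * c * \<eta> * (5 * (w ^ 3 * c ^ 2))"
    using w_ge(1) c \<eta> by (intro mult_left_mono ng) auto
  also have "\<dots> = (60 / 608) * (608 * w ^ 6 * c ^ 3 * \<eta>)" by algebra
  also have "\<dots> \<le> (60 / 608) * 1" by (intro mult_left_mono \<eta>) simp
  finally have Z: "12 * w ^ 3 * c * norm Z \<le> 1" by linarith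
  note sm = smoothness[OF L c Z]
  have LZ: "L + Z = L - \<eta> *\<^sub>R g" by (simp add: Z_def)
  show "L - \<eta> *\<^sub>R g \<in> U_ad P" using sm(1) by (simp add: LZ)
  have "76 * w ^ 6 * c ^ 3 * (norm Z)\<^sup>2 = (608 * w ^ 6 * c ^ 3 * \<eta>) * (\<eta> / 8 * (norm g)\<^sup>2)"
    by (simp add: Z_def power_mult_distrib power2_eq_square)
  also have "\<dots> \<le> 1 * (\<eta> / 8 * (norm g)\<^sup>2)" using \<eta> by (intro mult_right_mono) auto
  finally have quad: "76 * w ^ 6 * c ^ 3 * (norm Z)\<^sup>2 \<le> \<eta> / 8 * (norm g)\<^sup>2" by simp
  have nv: "(norm v)\<^sup>2 \<le> e0\<^sup>2" using g by (intro power_mono) (simp_all add: v_def)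
  \<comment> \<open>Write g = G + v with |v| \<le> e0 and use -G \<bullet> v \<le> (|G|^2 + |v|^2) /
    2.\<close>
  have key: "- (GL L \<bullet> g) + (norm g)\<^sup>2 / 8 \<le> - (norm (GL L))\<^sup>2 / 2 + 3 * e0\<^sup>2"
  proof -
    have gv: "g = GL L + v" by (simp add: v_def)
    have "- (GL L \<bullet> v) \<le> norm (GL L) * norm v" using Cauchy_Schwarz_ineq2[of "GL L" v] by simp
    also have "\<dots> \<le> ((norm (GL L))\<^sup>2 + (norm v)\<^sup>2) / 2"
      using sum_squares_bound[of "norm (GL L)" "norm v"] by simp
    finally have "- (GL L \<bullet> v) \<le> ((norm (GL L))\<^sup>2 + (norm v)\<^sup>2) / 2" .
    moreover have "(norm g)\<^sup>2 = (norm (GL L))\<^sup>2 + 2 * (GL L \<bullet> v) + (norm v)\<^sup>2"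
      by (simp add: gv power2_norm_eq_inner inner_add_left inner_add_right inner_commute)
    moreover have "GL L \<bullet> g = (norm (GL L))\<^sup>2 + GL L \<bullet> v"
      by (simp add: gv power2_norm_eq_inner inner_add_right)
    moreover have "- Y + X / 8 \<le> - A / 2 + 3 * E'"
      if "- B \<le> (A + C) / 2" "X = A + 2 * B + C" "Y = A + B" "C \<le> E'" "0 \<le> C" for A B C X Y E' :: real
      using that by (simp add: field_simps)
    ultimately show ?thesis using nv zero_le_power2[of "norm v"] by blast
  qed
  have "Ct (L + Z) \<le> Ct L + GL L \<bullet> Z + \<eta> / 8 * (norm g)\<^sup>2"
    using sm(2) quad by linarith
  also have "\<dots> = Ct L + \<eta> * (- (GL L \<bullet> g) + (norm g)\<^sup>2 / 8)" by (simp add: Z_def algebra_simps)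
  also have "\<dots> \<le> Ct L + \<eta> * (- (norm (GL L))\<^sup>2 / 2 + 3 * e0\<^sup>2)"
    using \<eta>(1) key by (intro add_left_mono mult_left_mono) auto
  finally show "Ct (L - \<eta> *\<^sub>R g) \<le> Ct L - \<eta> / 2 * (norm (GL L))\<^sup>2 + 3 * \<eta> * e0\<^sup>2"
    by (simp add: LZ algebra_simps)
qed

abbreviation "Lopt \<equiv> L_opt D P"

definition opS :: real where "opS = opnorm (Sg Lopt)"

text \<open>The reciprocal of the factor in \<open>num_steps\<close>. The contraction in
  \<open>gradient_step_rate\<close> is 1 - 2 rate; one half of it is kept for the decrease, the
  other half absorbs the noise.\<close>

definition rate :: "real \<Rightarrow> real" where "rate \<eta> = \<eta> * \<mu>\<^sup>2 * \<rho> / opS"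

lemma opS_ge: "\<mu> \<le> opS" and opS_pos: "0 < opS"
proof -
  show "\<mu> \<le> opS" unfolding opS_def by (rule opnorm_ge_sigma[OF Sg_ge[OF L_opt(1)]])
  then show "0 < opS" using \<mu>_pos by linarith
qed

lemma rate_pos: "0 < \<eta> \<Longrightarrow> 0 < rate \<eta>"
  using \<mu>_pos \<rho>_pos opS_pos by (simp add: rate_def)

lemma gradient_step_rate:
  fixes g :: "real^'n^'m"
  assumes L: "L \<in> U_ad P" and c: "Ct L \<le> c" "1 \<le> c" and \<eta>: "0 < \<eta>" "608 * w ^ 6 * c ^ 3 * \<eta> \<le> 1"
    and g: "norm (g - GL L) \<le> e0" "e0 \<le> 1"
  shows "Ct (L - \<eta> *\<^sub>R g) - Ct Lopt \<le> (1 - 2 * rate \<eta>) * (Ct L - Ct Lopt) + 3 * \<eta> * e0\<^sup>2"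
proof -
  have "Ct L - Ct Lopt \<le> opS / (4 * \<mu>\<^sup>2 * \<rho>) * (norm (GL L))\<^sup>2"
    unfolding opS_def by (rule gradient_domination[OF L L_opt(1)])
  then have "2 * rate \<eta> * (Ct L - Ct Lopt) \<le> 2 * rate \<eta> * (opS / (4 * \<mu>\<^sup>2 * \<rho>) * (norm (GL L))\<^sup>2)"
    using rate_pos[OF \<eta>(1)] by (intro mult_left_mono) auto
  also have "\<dots> = \<eta> / 2 * (norm (GL L))\<^sup>2"
    using \<mu>_pos \<rho>_pos opS_pos by (simp add: rate_def field_simps)
  finally show ?thesis using gradient_step(2)[OF assms] by (simp add: algebra_simps)
qed

lemma \<rho>_le: "\<rho> \<le> w"
proof -
  have "psd ((R1 - \<rho>) *\<^sub>R mat 1 :: real^'m^'m)"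
    using psd_add[OF Rm_le Rm_ge] by (simp add: algebra_simps)
  from psd_ge0[OF this, of "axis undefined 1"] have "\<rho> \<le> R1"
    by (simp add: matrix_vector_simps inner_axis_axis)
  then show ?thesis using w_ge(3) by simp
qed

context
  fixes L :: "real^'n^'m" and c :: real
  assumes L: "L \<in> U_ad P" and c: "Ct L \<le> c" "1 \<le> c"
begin

lemma \<mu>_le: "\<mu> \<le> w * c"
  using trace_Sg_ge[OF L] trace_Sg_le[OF L c] by simp

lemma opS_le: "opS \<le> w * c"
proof -
  have "Ct Lopt \<le> c" using L_opt(2)[OF L] c by simp
  from trace_Sg_le[OF L_opt(1) this c(2)] show ?thesis
    unfolding opS_def
    using opnorm_le_norm[of "Sg Lopt"] psd_norm_le_trace[OF Sg_psd[OF L_opt(1)]] by linarith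
qed

text \<open>Makes \<open>1 - 2 * rate \<eta>\<close> nonnegative, so that the recursion is monotone
  in the current gap.\<close>

lemma rate_le:
  assumes \<eta>: "0 < \<eta>" "608 * w ^ 6 * c ^ 3 * \<eta> \<le> 1"
  shows "rate \<eta> \<le> 1 / 2"
proof -
  have "rate \<eta> \<le> \<eta> * \<mu>\<^sup>2 * \<rho> / \<mu>"
    unfolding rate_def using opS_ge \<mu>_pos \<rho>_pos \<eta> by (intro divide_left_mono) auto
  also have "\<dots> = \<eta> * (\<mu> * \<rho>)" using \<mu>_pos by (simp add: power2_eq_square)
  also have "\<dots> \<le> \<eta> * ((w * c) * w)"
    using \<mu>_le \<rho>_le \<mu>_pos \<rho>_pos \<eta> w_ge(1) c by (intro mult_left_mono mult_mono) auto
  also have "\<dots> = \<eta> * (w ^ 2 * c ^ 1)" by (simp add: power2_eq_square)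
  also have "\<dots> \<le> \<eta> * (w ^ 6 * c ^ 3)"
    using \<eta> w_ge(1) c by (intro mult_left_mono mult_mono power_increasing) auto
  also have "\<dots> \<le> 1 / 2"
  proof -
    have "608 * (\<eta> * (w ^ 6 * c ^ 3)) \<le> 1" using \<eta>(2) by (simp add: ac_simps)
    then show ?thesis by linarith
  qed
  finally show ?thesis .
qed

lemma rate_inverse_le:
  assumes \<eta>: "0 < \<eta>"
  shows "1 / rate \<eta> \<le> w ^ 4 * c / \<eta>"
proof -
  have "1 / rate \<eta> = (1 / \<eta>) * ((1 / \<mu>) * (1 / \<mu>) * (1 / \<rho>) * opS)"
    using \<eta> \<mu>_pos \<rho>_pos opS_pos by (simp add: rate_def power2_eq_square)
  also have "\<dots> \<le> (1 / \<eta>) * (w * w * w * (w * c))"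
    using \<eta> \<mu>_pos \<rho>_pos opS_pos w_ge opS_le by (intro mult_left_mono mult_mono) auto
  also have "\<dots> = w ^ 4 * c / \<eta>" by (simp add: power4_eq_xxxx)
  finally show ?thesis .
qed

end

lemma sublevel_borel: "sublevel x \<in> sets borel"
  by (intro borel_closed closed_sublevel)

text \<open>A countable union of closed sublevel sets; the success event is the preimage of such a
  set.\<close>

lemma strict_sublevel_borel: "{L \<in> U_ad P. Ct L < x} \<in> sets borel"
proof -
  have "{L \<in> U_ad P. Ct L < x} = (\<Union>i. sublevel (x - inverse (real (Suc i))))"
  proof (intro set_eqI iffI)
    fix L assume "L \<in> {L \<in> U_ad P. Ct L < x}"
    then have L: "L \<in> U_ad P" "0 < x - Ct L" by auto
    obtain i where "inverse (real (Suc i)) < x - Ct L" using reals_Archimedean[OF L(2)] by blast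
    then show "L \<in> (\<Union>i. sublevel (x - inverse (real (Suc i))))" using L by (auto simp: sublevel_def intro!: exI[of _ i])
  next
    fix L assume "L \<in> (\<Union>i. sublevel (x - inverse (real (Suc i))))"
    then obtain i where "L \<in> U_ad P" "Ct L \<le> x - inverse (real (Suc i))" by (auto simp: sublevel_def)
    moreover have "0 < inverse (real (Suc i))" by simp
    ultimately have "Ct L < x" by linarith
    then show "L \<in> {L \<in> U_ad P. Ct L < x}" using \<open>L \<in> U_ad P\<close> by simp
  qed
  then show ?thesis using sublevel_borel by simp
qed

end

section \<open>The union bound over the iterations\<close>

context lq_sub_gaussian
begin

text \<open>From 1 + |L| + r \<le> 3 w c on the initial sublevel set.\<close>

definition kp :: "real \<Rightarrow> real" where "kp c = 3 * (1 + K) * w * c"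

text \<open>2304 = 36 * 64: the square of the 6 in the precision \<open>e\<close> of
  \<open>good_probability\<close>, and the 4 * 4^2 in the exponent of \<open>fail_prob\<close>. Two
  of the four powers of \<open>dm\<close> come from the envelope, two from the splitting into
  coordinates. The last factor is the multiple of \<open>T\<close> that the union bound asks
  for.\<close>

definition sample_const :: "real \<Rightarrow> real" where
  "sample_const c = 2304 * n\<^sub>r\<^sup>2 * dm ^ 4 * w ^ 4 * c\<^sup>2 * (1 / a\<^sub>g)\<^sup>2 * (9 * dm * w ^ 4 * c\<^sup>2)"

lemma good_probability:
  fixes L0 :: "real^'n^'m" and \<epsilon> \<delta> \<eta> r :: real and l N Kst :: nat
  defines "c \<equiv> 1 + Ct L0" and "\<Delta>0 \<equiv> Ct L0 - Ct Lopt"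
  defines "T \<equiv> ln (max 1 (ln (1 / \<epsilon>))) + ln (1 / \<delta>) + ln (1 / \<eta>) + ln (real l)"
  assumes L0: "L0 \<in> U_ad P" and \<epsilon>: "0 < \<epsilon>" "\<epsilon> \<le> \<Delta>0" and \<delta>: "0 < \<delta>" "\<delta> \<le> 1"
    and \<eta>: "0 < \<eta>" "608 * w ^ 6 * c ^ 3 * \<eta> \<le> 1"
    and r: "0 < r" "912 * dm * w ^ 8 * c ^ 4 * r \<le> \<epsilon>"
    and l: "0 < l" "48 * dm * w ^ 4 * c ^ 3 \<le> \<epsilon> * r * real l"
    and N: "sample_const c * kp c ^ (4 * l) * ((real l)\<^sup>2 / (\<epsilon>\<^sup>2 * r\<^sup>2)) * T \<le> real N"
    and Kst: "real Kst \<le> (1 / rate \<eta>) * ln (\<Delta>0 / \<epsilon>) + 2" "(1 / rate \<eta>) * ln (\<Delta>0 / \<epsilon>) + 1 \<le> real Kst"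
  defines "good \<equiv> (\<lambda>\<omega> j. iterate N l r \<eta> L0 \<omega> j \<in> U_ad P \<and> Ct (iterate N l r \<eta> L0 \<omega> j) - Ct Lopt < \<epsilon>)"
  shows "1 - \<delta> \<le> measure (RS r) {\<omega> \<in> space (RS r). good \<omega> Kst}"
proof -
  interpret R: prob_space "RS r" by (rule prob_space_RS)
  define S where "S = sublevel (Ct L0)"
  have Sb: "S \<in> sets borel" unfolding S_def by (rule sublevel_borel)
  have c: "1 \<le> c" "Ct L0 \<le> c" using Ct_pos[OF L0] by (simp_all add: c_def)
  have Sc: "L \<in> U_ad P" "Ct L \<le> c" if "L \<in> S" for L
    using that c by (auto simp: S_def sublevel_def)
  have Cs: "0 < Ct Lopt" by (rule Ct_pos[OF L_opt(1)])
  have \<epsilon>c: "\<epsilon> \<le> c" using \<epsilon>(2) Cs by (simp add: \<Delta>0_def c_def)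
  have w1: "1 \<le> w" by (rule w_ge(1))
  have cpos: "0 < c" using c by linarith
  have wpos: "0 < w" using w1 by linarith
  have dpos: "0 < dm" using dm_pos by linarith
  have pw: "1 \<le> w ^ i" "1 \<le> c ^ i" for i using w1 c by (simp_all add: one_le_power)
  have r12: "12 * w ^ 3 * c * r \<le> 1" and r1: "r \<le> 1"
  proof -
    have "912 * dm * w ^ 8 * c ^ 4 * r = c * (912 * dm * w ^ 8 * c ^ 3 * r)" by algebra
    then have "c * (912 * dm * w ^ 8 * c ^ 3 * r) \<le> c * 1" using r(2) \<epsilon>c by linarith
    then have *: "912 * dm * w ^ 8 * c ^ 3 * r \<le> 1" using cpos by (simp only: mult_le_cancel_left_pos)
    have "12 * w ^ 3 * c * r = 12 * 1 * w ^ 3 * c ^ 1 * r" by simp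
    also have "\<dots> \<le> 912 * dm * w ^ 8 * c ^ 3 * r"
      using dm_pos w1 c r by (intro mult_mono power_increasing) auto
    finally show "12 * w ^ 3 * c * r \<le> 1" using * by linarith
    have "1 * 1 * 1 * 1 * r \<le> 912 * dm * w ^ 8 * c ^ 3 * r"
      using dm_pos pw[of 8] pw[of 3] r dpos wpos cpos by (intro mult_mono) auto
    then show "r \<le> 1" using * by linarith
  qed
  \<comment> \<open>The precision for bias and statistical error separately. With
    \<open>e0 = 2 * e\<close> the noise \<open>3 * \<eta> * e0\<^sup>2\<close> is at most
    \<open>a * \<epsilon> / 3\<close>, because \<eta> / (w^4 c) \<le> a and \<epsilon> \<le>
    c.\<close>
  define e where "e = \<epsilon> / (6 * (w ^ 2 * c))"
  have e: "0 < e" "e \<le> 1"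
  proof -
    show "0 < e" using \<epsilon>(1) wpos cpos by (simp add: e_def)
    have "1 * c \<le> w ^ 2 * c" using pw[of 2] cpos by (intro mult_right_mono) auto
    then have "\<epsilon> \<le> 6 * (w ^ 2 * c)" using \<epsilon>c cpos by linarith
    then show "e \<le> 1" using wpos cpos by (simp add: e_def)
  qed
  have bias: "norm (mean_est l r L - GL L) \<le> e" if "L \<in> S" for L
  proof -
    have "norm (mean_est l r L - GL L) \<le> dm * (76 * w ^ 6 * c ^ 3 * r + 4 * w ^ 2 * c ^ 2 / (r * l))"
      by (rule bias_bound(2)[OF Sc[OF that] c(1) r(1) r12 l(1)])
    also have "\<dots> = dm * 76 * w ^ 6 * c ^ 3 * r + dm * 4 * w ^ 2 * c ^ 2 / (r * l)"
      by (simp add: algebra_simps)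
    \<comment> \<open>912 = 12 * 76 and 48 = 12 * 4 in the hypotheses allot half of \<open>e\<close>
      to each of the two bias terms.\<close>
    also have "dm * 76 * w ^ 6 * c ^ 3 * r \<le> e / 2"
    proof -
      have "(12 * (w ^ 2 * c)) * (dm * 76 * w ^ 6 * c ^ 3 * r) = 912 * dm * w ^ 8 * c ^ 4 * r" by algebra
      also have "\<dots> \<le> \<epsilon>" by (rule r)
      finally show ?thesis using wpos cpos by (simp add: e_def field_simps)
    qed
    also have "dm * 4 * w ^ 2 * c ^ 2 / (r * l) \<le> e / 2"
    proof -
      have "(12 * (w ^ 2 * c)) * (dm * 4 * w ^ 2 * c ^ 2) = 48 * dm * w ^ 4 * c ^ 3" by algebra
      also have "\<dots> \<le> \<epsilon> * (r * l)" using l(2) by (simp add: ac_simps)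
      finally have "dm * 4 * w ^ 2 * c ^ 2 \<le> \<epsilon> * (r * l) / (12 * (w ^ 2 * c))"
        using wpos cpos by (simp add: pos_le_divide_eq mult.commute)
      also have "\<dots> = e / 2 * (r * l)" by (simp add: e_def)
      finally show ?thesis using r(1) l(1) by (simp add: pos_divide_le_eq)
    qed
    finally show ?thesis by simp
  qed
  define a where "a = rate \<eta>"
  have a: "0 < a" "a \<le> 1 / 2" unfolding a_def using rate_pos[OF \<eta>(1)] rate_le[OF L0 c(2,1) \<eta>] by simp_all
  define e0 where "e0 = 2 * e"
  have e0: "e0 \<le> 1"
  proof -
    have "1 * c \<le> w ^ 2 * c" using pw[of 2] cpos by (intro mult_right_mono) auto
    then have "\<epsilon> \<le> 3 * (w ^ 2 * c)" using \<epsilon>c cpos by linarith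
    then show ?thesis using wpos cpos by (simp add: e0_def e_def ac_simps)
  qed
  have noise: "3 * \<eta> * e0\<^sup>2 \<le> a * \<epsilon> / 2"
  proof -
    have "1 / a \<le> w ^ 4 * c / \<eta>" unfolding a_def by (rule rate_inverse_le[OF L0 c(2,1) \<eta>(1)])
    then have "\<eta> \<le> a * (w ^ 4 * c)" using a \<eta>(1) by (simp add: field_simps)
    then have "\<eta> / (w ^ 4 * c) \<le> a" using wpos cpos by (simp add: pos_divide_le_eq)
    have "3 * \<eta> * e0\<^sup>2 = (\<eta> / (w ^ 4 * c)) * (\<epsilon> / 3) * (\<epsilon> / c)"
      using wpos cpos by (simp add: e0_def e_def power2_eq_square power4_eq_xxxx field_simps)
    also have "\<dots> \<le> a * (\<epsilon> / 3) * 1"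
      using \<open>\<eta> / (w ^ 4 * c) \<le> a\<close> \<epsilon>(1) \<epsilon>c cpos a \<eta>(1) wpos by (intro mult_mono) auto
    also have "\<dots> \<le> a * \<epsilon> / 2" using a \<epsilon>(1) by simp
    finally show ?thesis .
  qed
  define it where "it \<omega> j = iterate N l r \<eta> L0 \<omega> j" for \<omega> j
  define ge where "ge \<omega> j = grad_est N l r (it \<omega> j) (\<lambda>i. \<omega> (j, i))" for \<omega> j
  define E where "E j = {\<omega> \<in> space (RS r). it \<omega> j \<in> S \<and> e < norm (ge \<omega> j - mean_est l r (it \<omega> j))}" for j
  \<comment> \<open>Membership in the initial sublevel set is carried along so that the same
    \<open>c\<close>, \<open>e\<close> and \<open>\<eta>\<close> serve every step; a gap that has
    fallen below \<open>\<epsilon>\<close> stays there.\<close>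
  have progress: "it \<omega> j \<in> S \<and> (Ct (it \<omega> j) - Ct Lopt < \<epsilon> \<or> Ct (it \<omega> j) - Ct Lopt \<le> (1 - a) ^ j * \<Delta>0)"
    if \<omega>: "\<omega> \<in> space (RS r)" "\<And>j. j < Kst \<Longrightarrow> \<omega> \<notin> E j" and "j \<le> Kst" for \<omega> j
    using \<open>j \<le> Kst\<close>
  proof (induction j)
    case 0
    then show ?case using L0 by (simp add: it_def S_def sublevel_def \<Delta>0_def)
  next
    case (Suc j)
    then have IH: "it \<omega> j \<in> S" "Ct (it \<omega> j) - Ct Lopt < \<epsilon> \<or> Ct (it \<omega> j) - Ct Lopt \<le> (1 - a) ^ j * \<Delta>0"
      by auto
    have "norm (ge \<omega> j - mean_est l r (it \<omega> j)) \<le> e"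
      using \<omega>(2)[of j] Suc.prems IH(1) \<omega>(1) by (auto simp: E_def)
    then have "norm (ge \<omega> j - GL (it \<omega> j)) \<le> e0"
      using bias[OF IH(1)] norm_triangle_ineq[of "ge \<omega> j - mean_est l r (it \<omega> j)" "mean_est l r (it \<omega> j) - GL (it \<omega> j)"]
      by (simp add: e0_def)
    note step = gradient_step(1)[OF Sc[OF IH(1)] c(1) \<eta> this e0]
      gradient_step_rate[OF Sc[OF IH(1)] c(1) \<eta> this e0]
    have itS: "it \<omega> (Suc j) = it \<omega> j - \<eta> *\<^sub>R ge \<omega> j" by (simp add: it_def ge_def)
    define d d' where "d = Ct (it \<omega> j) - Ct Lopt" and "d' = Ct (it \<omega> (Suc j)) - Ct Lopt"
    have d0: "0 \<le> d" using L_opt(2)[OF Sc(1)[OF IH(1)]] by (simp add: d_def)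
    have d1: "d \<le> \<Delta>0" using IH(1) by (simp add: d_def \<Delta>0_def S_def sublevel_def)
    have rec: "d' \<le> (1 - 2 * a) * d + a * \<epsilon> / 2"
      using step(2) noise by (simp add: d_def d'_def itS a_def)
    have "d' \<le> \<Delta>0"
    proof -
      have "(1 - 2 * a) * d \<le> (1 - 2 * a) * \<Delta>0" using a d1 by (intro mult_left_mono) auto
      moreover have "a * \<epsilon> \<le> a * \<Delta>0" "0 \<le> a * \<Delta>0" using a \<epsilon> by simp_all
      ultimately show ?thesis using rec by (simp add: algebra_simps)
    qed
    then have inS: "it \<omega> (Suc j) \<in> S"
      using step(1) by (simp add: S_def sublevel_def itS d'_def \<Delta>0_def)
    have "d' < \<epsilon> \<or> d' \<le> (1 - a) ^ Suc j * \<Delta>0"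
    proof (cases "d < \<epsilon>")
      case True
      have "(1 - 2 * a) * d \<le> (1 - 2 * a) * \<epsilon>" using a True by (intro mult_left_mono) auto
      moreover have "0 < a * \<epsilon>" using a \<epsilon> by simp
      ultimately show ?thesis using rec by (simp add: algebra_simps)
    next
      case False
      then have "d \<le> (1 - a) ^ j * \<Delta>0" using IH(2) by (simp add: d_def)
      have "a * \<epsilon> \<le> a * d" "0 \<le> a * d" using a False d0 by simp_all
      then have "d' \<le> (1 - a) * d" using rec by (simp add: algebra_simps)
      also have "\<dots> \<le> (1 - a) * ((1 - a) ^ j * \<Delta>0)" using a \<open>d \<le> (1 - a) ^ j * \<Delta>0\<close> by (intro mult_left_mono) simp_all
      finally show ?thesis by simp
    qed
    then show ?case using inS by (simp add: d'_def)
  qed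
  have final: "good \<omega> Kst" if \<omega>: "\<omega> \<in> space (RS r)" "\<And>j. j < Kst \<Longrightarrow> \<omega> \<notin> E j" for \<omega>
  proof -
    have p: "it \<omega> Kst \<in> S" "Ct (it \<omega> Kst) - Ct Lopt < \<epsilon> \<or> Ct (it \<omega> Kst) - Ct Lopt \<le> (1 - a) ^ Kst * \<Delta>0"
      using progress[OF \<omega> order_refl] by auto
    have "(1 - a) ^ Kst * \<Delta>0 < \<epsilon>"
    proof -
      have "(1 - a) ^ Kst \<le> exp (- a) ^ Kst"
        using a exp_ge_add_one_self[of "- a"] by (intro power_mono) auto
      also have "\<dots> = exp (- (a * real Kst))" by (simp add: exp_of_nat_mult[symmetric] mult.commute)
      also have "\<dots> < exp (- ln (\<Delta>0 / \<epsilon>))"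
      proof -
        \<comment> \<open>The one extra step contributes a > 0 and makes the inequality
          strict.\<close>
        have "a * ((1 / a) * ln (\<Delta>0 / \<epsilon>) + 1) \<le> a * real Kst"
          using Kst(2) a by (intro mult_left_mono) (auto simp: a_def)
        then have "ln (\<Delta>0 / \<epsilon>) + a \<le> a * real Kst" using a by (simp add: algebra_simps)
        then show ?thesis using a by simp
      qed
      also have "\<dots> = \<epsilon> / \<Delta>0" using \<epsilon> by (simp add: exp_minus)
      finally show ?thesis using \<epsilon> by (simp add: field_simps)
    qed
    then show ?thesis using p Sc(1) by (auto simp: good_def it_def)
  qed
  have kpk: "(1 + K) * (1 + norm L + r) \<le> kp c" if "L \<in> S" for L
  proof -
    have "(norm L)\<^sup>2 \<le> w ^ 2 * c" by (rule norm_L_le[OF Sc[OF that] c(1)])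
    also have "\<dots> \<le> w ^ 2 * (c * c)" using c wpos by (intro mult_left_mono) auto
    finally have "(norm L)\<^sup>2 \<le> (w * c)\<^sup>2" by (simp add: power2_eq_square ac_simps)
    then have "norm L \<le> w * c" by (rule power2_le_imp_le) (use wpos cpos in simp)
    moreover have "1 \<le> w * c" using mult_mono[OF w1 c(1)] wpos by simp
    ultimately have "1 + norm L + r \<le> 3 * (w * c)" using r1 by simp
    then have "(1 + K) * (1 + norm L + r) \<le> (1 + K) * (3 * (w * c))"
      using K_pos by (intro mult_left_mono) auto
    then show ?thesis by (simp add: kp_def algebra_simps)
  qed
  have kp1: "1 \<le> kp c"
  proof -
    have "1 * 1 * 1 * 1 \<le> 3 * (1 + K) * w * c" using K_pos w1 c by (intro mult_mono) auto
    then show ?thesis by (simp add: kp_def)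
  qed
  define M where "M = max 1 (ln (1 / \<epsilon>))"
  have M1: "1 \<le> M" "ln (1 / \<epsilon>) \<le> M" by (simp_all add: M_def)
  have \<eta>1: "608 * \<eta> \<le> 1"
  proof -
    have "608 * 1 * 1 * \<eta> \<le> 608 * w ^ 6 * c ^ 3 * \<eta>"
      using pw[of 6] pw[of 3] \<eta>(1) wpos cpos by (intro mult_mono) auto
    then show ?thesis using \<eta>(2) by linarith
  qed
  \<comment> \<open>This makes \<open>T\<close> at least 1, so that constants can be absorbed into
    multiples of \<open>T\<close>.\<close>
  have ln\<eta>: "1 \<le> ln (1 / \<eta>)"
  proof -
    have "exp 1 \<le> (3 :: real)" by (rule exp_le)
    also have "3 \<le> 1 / \<eta>" using \<eta>1 \<eta>(1) by (simp add: field_simps)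
    finally show ?thesis using \<eta>(1) by (subst ln_ge_iff) simp_all
  qed
  have T0: "0 \<le> ln M" "0 \<le> ln (1 / \<delta>)" "0 \<le> ln (real l)"
    using M1 \<delta> l(1) by (simp_all add: ln_div)
  have Teq: "T = ln M + ln (1 / \<delta>) + ln (1 / \<eta>) + ln (real l)" by (simp add: T_def M_def)
  have T1: "1 \<le> T" using T0 ln\<eta> by (simp add: Teq)
  \<comment> \<open>The logarithm of this bound accounts for the double logarithm
    \<open>ln M\<close> and for \<open>ln (1 / \<eta>)\<close> in \<open>T\<close>.\<close>
  have Kst_le: "real Kst \<le> 4 * (w ^ 4 * c ^ 2) * M / \<eta>"
  proof -
    have "ln (\<Delta>0 / \<epsilon>) = ln \<Delta>0 + ln (1 / \<epsilon>)" using \<epsilon> by (simp add: ln_div)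
    also have "ln \<Delta>0 \<le> \<Delta>0 - 1" using \<epsilon> by (intro ln_le_minus_one) linarith
    also have "\<Delta>0 - 1 \<le> c" using Cs by (simp add: \<Delta>0_def c_def)
    finally have "ln (\<Delta>0 / \<epsilon>) \<le> c + M" using M1 by simp
    also have "\<dots> \<le> c * M + c * M"
    proof (rule add_mono)
      show "c \<le> c * M" using mult_left_mono[OF M1(1), of c] cpos by simp
      show "M \<le> c * M" using mult_right_mono[OF c(1), of M] M1 by simp
    qed
    finally have lnb: "ln (\<Delta>0 / \<epsilon>) \<le> 2 * c * M" by linarith
    have ln0: "0 \<le> ln (\<Delta>0 / \<epsilon>)" using \<epsilon> by simp
    have "(1 / rate \<eta>) * ln (\<Delta>0 / \<epsilon>) \<le> (w ^ 4 * c / \<eta>) * (2 * c * M)"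
      using rate_inverse_le[OF L0 c(2,1) \<eta>(1)] lnb ln0 wpos cpos \<eta>(1) by (intro mult_mono) auto
    also have "\<dots> = 2 * (w ^ 4 * c ^ 2) * M / \<eta>" by (simp add: power2_eq_square)
    finally have 1: "(1 / rate \<eta>) * ln (\<Delta>0 / \<epsilon>) \<le> 2 * (w ^ 4 * c ^ 2) * M / \<eta>" .
    have "2 * (1 * 1) * 1 / 1 \<le> 2 * (w ^ 4 * c ^ 2) * M / \<eta>"
      using pw[of 4] pw[of 2] M1 \<eta>1 \<eta>(1) by (intro frac_le mult_mono) auto
    then show ?thesis using 1 Kst(1) by linarith
  qed
  have "0 < N"
  proof (rule ccontr)
    assume "\<not> 0 < N"
    moreover have "0 < sample_const c * kp c ^ (4 * l) * ((real l)\<^sup>2 / (\<epsilon>\<^sup>2 * r\<^sup>2)) * T"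
      using n\<^sub>r_ge dpos wpos cpos a\<^sub>g_pos kp1 l(1) \<epsilon>(1) r(1) T1 by (simp add: sample_const_def)
    ultimately show False using N by simp
  qed
  define p where "p = fail_prob N l r (kp c) e"
  have p0: "0 \<le> p" using dpos by (simp add: p_def fail_prob_def)
  have E: "E j \<in> sets (RS r)" "emeasure (RS r) (E j) \<le> ennreal p" for j
  proof -
    have pj: "emeasure (RS r) {\<omega> \<in> space (RS r). e < norm (grad_est N l r L (\<lambda>i. \<omega> (j, i)) - mean_est l r L)} \<le> ennreal p"
      if "L \<in> S" for L
      unfolding p_def by (rule grad_est_concentration[OF r(1) r1 kpk[OF that] l(1) \<open>0 < N\<close> e])
    show "E j \<in> sets (RS r)" "emeasure (RS r) (E j) \<le> ennreal p"
      unfolding E_def ge_def it_def by (rule fresh_sample_bound[OF Sb pj]; assumption)+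
  qed
  \<comment> \<open>A step fails with probability at most 2 dm exp(-x), so x must reach ln(8 dm w^4
    c^2 M / (\<eta> \<delta>)), where 8 is this 2 times the 4 of \<open>Kst_le\<close>;
    \<open>X * T\<close> does.\<close>
  have Kp: "real Kst * p \<le> \<delta>"
  proof -
    define x where "x = real N * (a\<^sub>g / (dm / r * real l * kp c ^ (2 * l)) * e / dm)\<^sup>2 / (4 * (4 * n\<^sub>r)\<^sup>2)"
    define X where "X = 9 * dm * w ^ 4 * c\<^sup>2"
    have xT: "X * T \<le> x"
    proof -
      define Q where "Q = 2304 * n\<^sub>r\<^sup>2 * dm ^ 4 * w ^ 4 * c\<^sup>2 * (1 / a\<^sub>g)\<^sup>2 * kp c ^ (4 * l) * ((real l)\<^sup>2 / (\<epsilon>\<^sup>2 * r\<^sup>2))"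
      have Q: "0 < Q" using n\<^sub>r_ge dpos wpos cpos a\<^sub>g_pos kp1 l(1) \<epsilon>(1) r(1) by (simp add: Q_def)
      have "Q * (X * T) = sample_const c * kp c ^ (4 * l) * ((real l)\<^sup>2 / (\<epsilon>\<^sup>2 * r\<^sup>2)) * T"
        by (simp add: Q_def X_def sample_const_def)
      also have "\<dots> \<le> real N" by (rule N)
      also have "real N = Q * x"
      proof -
        have "l * 4 = l * 2 + l * 2" by simp
        then have k4: "kp c ^ (l * 4) = kp c ^ (l * 2) * kp c ^ (l * 2)" by (simp only: power_add)
        show ?thesis
          using n\<^sub>r_ge dpos wpos cpos a\<^sub>g_pos kp1 l(1) \<epsilon>(1) r(1)
          by (simp add: Q_def x_def e_def k4 power2_eq_square power4_eq_xxxx field_simps)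
      qed
      finally show ?thesis using Q by (simp only: mult_le_cancel_left_pos)
    qed
    have X1: "1 \<le> X"
    proof -
      have "1 * 1 * 1 * 1 \<le> 9 * dm * w ^ 4 * c\<^sup>2" using dm_pos pw[of 4] pw[of 2] by (intro mult_mono) auto
      then show ?thesis by (simp add: X_def)
    qed
    have lnX: "ln (8 * dm * w ^ 4 * c\<^sup>2) + 1 \<le> X"
    proof -
      have "ln (8 * dm * w ^ 4 * c\<^sup>2) \<le> 8 * dm * w ^ 4 * c\<^sup>2 - 1"
        using dpos wpos cpos by (intro ln_le_minus_one) simp
      moreover have "0 < dm * w ^ 4 * c\<^sup>2" using dpos wpos cpos by simp
      ultimately show ?thesis by (simp add: X_def)
    qed
    have ln8: "0 \<le> ln (8 * dm * w ^ 4 * c\<^sup>2)"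
    proof (rule ln_ge_zero)
      have "1 * 1 * 1 * 1 \<le> 8 * dm * w ^ 4 * c\<^sup>2" using dm_pos pw[of 4] pw[of 2] by (intro mult_mono) auto
      then show "1 \<le> 8 * dm * w ^ 4 * c\<^sup>2" by simp
    qed
    have "ln (8 * dm * w ^ 4 * c\<^sup>2 * M / \<eta> / \<delta>) = ln (8 * dm * w ^ 4 * c\<^sup>2) + ln M + ln (1 / \<eta>) + ln (1 / \<delta>)"
      using dpos wpos cpos M1 \<eta>(1) \<delta>(1) by (simp add: ln_mult ln_div)
    also have "\<dots> \<le> ln (8 * dm * w ^ 4 * c\<^sup>2) * T + T"
      using mult_left_mono[OF T1 ln8] T0 by (simp add: Teq)
    also have "\<dots> = (ln (8 * dm * w ^ 4 * c\<^sup>2) + 1) * T" by (simp add: algebra_simps)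
    also have "\<dots> \<le> X * T" using lnX T1 by (intro mult_right_mono) auto
    also have "\<dots> \<le> x" by (rule xT)
    finally have "exp (ln (8 * dm * w ^ 4 * c\<^sup>2 * M / \<eta> / \<delta>)) \<le> exp x" by simp
    moreover have "0 < 8 * dm * w ^ 4 * c\<^sup>2 * M / \<eta> / \<delta>"
      using dpos wpos cpos M1 \<eta>(1) \<delta>(1) by simp
    ultimately have "8 * dm * w ^ 4 * c\<^sup>2 * M / \<eta> / \<delta> \<le> exp x" by (simp only: exp_ln)
    then have "8 * dm * w ^ 4 * c\<^sup>2 * M / \<eta> \<le> exp x * \<delta>"
      using \<delta>(1) by (simp only: pos_divide_le_eq)
    from mult_right_mono[OF this, of "exp (- x)"]
    have "8 * dm * w ^ 4 * c\<^sup>2 * M / \<eta> * exp (- x) \<le> exp x * \<delta> * exp (- x)" by simp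
    also have "exp x * \<delta> * exp (- x) = \<delta>" by (simp add: exp_minus)
    finally have "8 * dm * w ^ 4 * c\<^sup>2 * M / \<eta> * exp (- x) \<le> \<delta>" .
    have "real Kst * p \<le> (4 * (w ^ 4 * c ^ 2) * M / \<eta>) * p" using p0 by (intro mult_right_mono Kst_le)
    also have "\<dots> = 8 * dm * w ^ 4 * c\<^sup>2 * M / \<eta> * exp (- x)"
      by (simp add: p_def fail_prob_def x_def)
    also have "\<dots> \<le> \<delta>" by fact
    finally show ?thesis .
  qed
  have goodm: "{\<omega> \<in> space (RS r). good \<omega> Kst} \<in> sets (RS r)"
  proof -
    have "(\<lambda>\<omega>. it \<omega> Kst) \<in> borel_measurable (RS r)"
      unfolding it_def RS_eq by (rule borel_measurable_iterate) simp
    from measurable_sets[OF this strict_sublevel_borel[of "Ct Lopt + \<epsilon>"]]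
    have "{\<omega> \<in> space (RS r). it \<omega> Kst \<in> U_ad P \<and> Ct (it \<omega> Kst) < Ct Lopt + \<epsilon>} \<in> sets (RS r)"
      by (simp add: vimage_def Int_def conj_commute conj_left_commute)
    also have "{\<omega> \<in> space (RS r). it \<omega> Kst \<in> U_ad P \<and> Ct (it \<omega> Kst) < Ct Lopt + \<epsilon>} = {\<omega> \<in> space (RS r). good \<omega> Kst}"
      by (auto simp: good_def it_def)
    finally show ?thesis .
  qed
  have "measure (RS r) (\<Union>j<Kst. E j) \<le> (\<Sum>j<Kst. measure (RS r) (E j))"
    using E(1) by (intro R.finite_measure_subadditive_finite) auto
  also have "\<dots> \<le> (\<Sum>j<Kst. p)"
  proof (rule sum_mono)
    fix j
    have "ennreal (measure (RS r) (E j)) \<le> ennreal p" using E(2)[of j] by (simp add: R.emeasure_eq_measure)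
    then show "measure (RS r) (E j) \<le> p" using p0 by simp
  qed
  also have "\<dots> \<le> \<delta>" using Kp by simp
  finally have bad: "measure (RS r) (\<Union>j<Kst. E j) \<le> \<delta>" .
  have "1 - \<delta> \<le> 1 - measure (RS r) (\<Union>j<Kst. E j)" using bad by simp
  also have "\<dots> = measure (RS r) (space (RS r) - (\<Union>j<Kst. E j))"
    using E(1) by (subst R.prob_compl) auto
  also have "\<dots> \<le> measure (RS r) {\<omega> \<in> space (RS r). good \<omega> Kst}"
    using goodm final by (intro R.finite_measure_mono) auto
  finally show ?thesis .
qed

end

section \<open>The thresholds as polynomials in the model parameters\<close>

abbreviation (input) "th i x \<equiv> fst x $ i"
abbreviation (input) "inv_th i x \<equiv> fst (snd x) $ i"
abbreviation (input) "inv_1_th i x \<equiv> fst (snd (snd x)) $ i"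
abbreviation (input) "zz x \<equiv> snd (snd (snd x))"

definition w_poly :: poly_fun where
  "w_poly x = 1 + th Mean_B2 x + th Mean_R x + inv_th Mu x + inv_th Sig_Q x + inv_th Sig_R x"

text \<open>
  Since \<open>1 / w\<close> is not a polynomial in the parameters, it is replaced by the lower bound that comes from
  \<open>1 + x\<^sub>1 + \<dots> + x\<^sub>5 \<le> (1 + x\<^sub>1) \<cdots> (1 + x\<^sub>5)\<close>; for the reciprocals \<open>x\<^sub>i = 1 / y\<close> the
  factor is \<open>1 / (1 + x\<^sub>i) = y / (1 + y)\<close>.
\<close>

definition inv_w_poly :: poly_fun where
  "inv_w_poly x = inv_1_th Mean_B2 x * inv_1_th Mean_R x * (th Mu x * inv_1_th Mu x)
     * (th Sig_Q x * inv_1_th Sig_Q x) * (th Sig_R x * inv_1_th Sig_R x)"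

text \<open>Here \<open>zz\<close> stands for 1 / (1 + C(L0)) and \<open>inv_w_poly\<close> for a
  lower bound of 1/w; the 912 is that of \<open>good_probability\<close>.\<close>

definition radius_poly :: poly_fun where
  "radius_poly x = 1 / 912 * (inv_th Dim_m x * inv_th Dim_n x) * inv_w_poly x ^ 8 * zz x ^ 4"

definition length_poly :: poly_fun where
  "length_poly x = 48 * (th Dim_m x * th Dim_n x) * w_poly x ^ 4 * zz x ^ 3"

text \<open>\<open>sample_const\<close> times \<open>kp\<close>. The threshold raises the whole
  polynomial to the power 4 l, so the prefactor is put inside the power; being at least 1
  (\<open>sample_const_ge_1\<close>), it can only grow there.\<close>

definition sample_poly :: poly_fun where
  "sample_poly x =
     (2304 * th Dim_n x ^ 2 * (th Dim_m x * th Dim_n x) ^ 4 * w_poly x ^ 4 * zz x ^ 2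
       * (12 * th Dim_n x * (1 + th Sub_gauss x) ^ 2 * (1 + th Mean_x2 x)) ^ 2
       * (9 * (th Dim_m x * th Dim_n x) * w_poly x ^ 4 * zz x ^ 2))
     * (3 * (1 + th Bound_K x) * w_poly x * zz x)"

definition step_const :: "real^model_param \<Rightarrow> real" where
  "step_const \<theta> = 1 / (608 * (1 + \<theta> $ Mean_B2 + \<theta> $ Mean_R + 1 / \<theta> $ Mu + 1 / \<theta> $ Sig_Q + 1 / \<theta> $ Sig_R) ^ 6)"

lemma real_polynomial_function_components:
  "real_polynomial_function (\<lambda>x :: (real^model_param) \<times> (real^model_param) \<times> (real^model_param) \<times> real. th i x)"
  "real_polynomial_function (\<lambda>x :: (real^model_param) \<times> (real^model_param) \<times> (real^model_param) \<times> real. inv_th i x)"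
  "real_polynomial_function (\<lambda>x :: (real^model_param) \<times> (real^model_param) \<times> (real^model_param) \<times> real. inv_1_th i x)"
  "real_polynomial_function (\<lambda>x :: (real^model_param) \<times> (real^model_param) \<times> (real^model_param) \<times> real. zz x)"
  by (intro real_polynomial_function.intros(1) bounded_linear_compose[OF bounded_linear_vec_nth]
      bounded_linear_compose[OF bounded_linear_fst] bounded_linear_compose[OF bounded_linear_snd]
      bounded_linear_fst bounded_linear_snd)+

lemma real_polynomial_function_thresholds:
  "real_polynomial_function radius_poly" "real_polynomial_function length_poly"
  "real_polynomial_function sample_poly"
  unfolding radius_poly_def[abs_def] length_poly_def[abs_def] sample_poly_def[abs_def]
    w_poly_def inv_w_poly_def
  by (intro real_polynomial_function.intros(2-) real_polynomial_function_power
      real_polynomial_function_components)+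

context lq_sub_gaussian
begin

abbreviation "pv S \<equiv> param_vec D P \<sigma> K S"

lemma param_values:
  "param_value D P \<sigma> K Mean_B2 = b2" "param_value D P \<sigma> K Mean_R = R1" "param_value D P \<sigma> K Mu = \<mu>"
  "param_value D P \<sigma> K Sig_Q = q" "param_value D P \<sigma> K Sig_R = \<rho>" "param_value D P \<sigma> K Mean_x2 = m2"
  by (simp_all add: b2_def R1_def q_def Qm_def \<rho>_def Rm_def sigma_R_def m2_def)

lemma step_const_eq: "step_const (pv system_params) = 1 / (608 * w ^ 6)"
  by (simp add: step_const_def param_vec_def system_params_def param_values w_def del: param_value.simps)

lemma w_poly_eq:
  assumes "{Mean_B2, Mean_R, Mu, Sig_Q, Sig_R} \<subseteq> S"
  shows "w_poly (pv S, (\<chi> i. 1 / pv S $ i), (\<chi> i. 1 / (1 + pv S $ i)), z) = w"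
  using assms by (simp add: w_poly_def param_vec_def param_values w_def del: param_value.simps)

lemma inv_w_poly_bounds:
  fixes z :: real
  assumes "{Mean_B2, Mean_R, Mu, Sig_Q, Sig_R} \<subseteq> S"
  defines "v \<equiv> inv_w_poly (pv S, (\<chi> i. 1 / pv S $ i), (\<chi> i. 1 / (1 + pv S $ i)), z)"
  shows "0 < v" "v * w \<le> 1"
proof -
  have v: "v = 1 / (1 + b2) * (1 / (1 + R1)) * (\<mu> * (1 / (1 + \<mu>))) * (q * (1 / (1 + q))) * (\<rho> * (1 / (1 + \<rho>)))"
    using assms by (simp add: inv_w_poly_def param_vec_def param_values del: param_value.simps)
  note pos = b2_nonneg R1_nonneg \<mu>_pos q_pos \<rho>_pos
  show "0 < v" unfolding v using pos by (intro mult_pos_pos divide_pos_pos) linarith+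
  define A B E G H where "A = b2" and "B = R1" and "E = 1 / \<mu>" and "G = 1 / q" and "H = 1 / \<rho>"
  have nn: "0 \<le> A" "0 \<le> B" "0 \<le> E" "0 \<le> G" "0 \<le> H"
    using pos by (simp_all add: A_def B_def E_def G_def H_def)
  have two: "1 + x + y \<le> (1 + x) * (1 + y)" if "0 \<le> x" "0 \<le> y" for x y :: real
    using that mult_nonneg_nonneg[OF that] by (simp add: algebra_simps)
  have "w = 1 + A + B + E + G + H" by (simp add: w_def A_def B_def E_def G_def H_def)
  also have "\<dots> \<le> (1 + A) * (1 + B) * (1 + E) * (1 + G) * (1 + H)"
  proof -
    define p1 where "p1 = (1 + A) * (1 + B)"
    define p2 where "p2 = p1 * (1 + E)"
    define p3 where "p3 = p2 * (1 + G)"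
    have 1: "1 + A + B \<le> p1" using two[OF nn(1,2)] by (simp add: p1_def)
    have 2: "p1 + E \<le> p2" using two[of "p1 - 1" E] 1 nn by (simp add: p2_def)
    have 3: "p2 + G \<le> p3" using two[of "p2 - 1" G] 1 2 nn by (simp add: p3_def)
    have 4: "p3 + H \<le> p3 * (1 + H)" using two[of "p3 - 1" H] 1 2 3 nn by simp
    show ?thesis using 1 2 3 4 by (simp add: p1_def p2_def p3_def)
  qed
  finally have w: "w \<le> (1 + A) * (1 + B) * (1 + E) * (1 + G) * (1 + H)" .
  have "v * w \<le> v * ((1 + A) * (1 + B) * (1 + E) * (1 + G) * (1 + H))"
    using w \<open>0 < v\<close> by (intro mult_left_mono) auto
  also have "\<dots> = (1 / (1 + A) * (1 + A)) * (1 / (1 + B) * (1 + B)) * (\<mu> * (1 / (1 + \<mu>)) * (1 + E))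
      * (q * (1 / (1 + q)) * (1 + G)) * (\<rho> * (1 / (1 + \<rho>)) * (1 + H))"
    by (simp only: v A_def[symmetric] B_def[symmetric] ac_simps)
  also have "\<dots> = 1"
  proof -
    have inv: "x * (1 / (1 + x)) * (1 + 1 / x) = 1" if "0 < x" for x :: real
    proof -
      have "1 + 1 / x = (1 + x) / x" using that by (simp add: add_divide_distrib)
      then show ?thesis using that by simp
    qed
    have "1 / (1 + A) * (1 + A) = 1" "1 / (1 + B) * (1 + B) = 1" using nn by simp_all
    then show ?thesis
      by (simp only: E_def G_def H_def inv[OF \<mu>_pos] inv[OF q_pos] inv[OF \<rho>_pos] mult_1)
  qed
  finally show "v * w \<le> 1" .
qed

lemma radius_poly_bounds:
  fixes z :: real
  assumes "0 < z"
  defines "pr \<equiv> poly_at radius_poly (pv intrinsic_params) (1 / z)"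
  shows "0 < pr" "912 * dm * w ^ 8 * z ^ 4 * pr \<le> 1"
proof -
  define v where "v = inv_w_poly (pv intrinsic_params, (\<chi> i. 1 / pv intrinsic_params $ i),
    (\<chi> i. 1 / (1 + pv intrinsic_params $ i)), 1 / z)"
  have v: "0 < v" "v * w \<le> 1"
    unfolding v_def by (rule inv_w_poly_bounds, simp add: intrinsic_params_def)+
  have pr: "pr = 1 / 912 * (1 / real CARD('m) * (1 / real CARD('n))) * v ^ 8 * (1 / z) ^ 4"
    by (simp add: pr_def poly_at_def radius_poly_def v_def param_vec_def intrinsic_params_def)
  show "0 < pr" unfolding pr using v assms(1) by simp
  have "912 * dm * w ^ 8 * z ^ 4 * pr = (v * w) ^ 8"
    using assms(1) by (simp add: pr dm_def power_mult_distrib power_divide)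
  also have "\<dots> \<le> 1" using v w_ge(1) by (intro power_le_one) auto
  finally show "912 * dm * w ^ 8 * z ^ 4 * pr \<le> 1" .
qed

lemma length_poly_eq: "poly_at length_poly (pv intrinsic_params) z = 48 * dm * w ^ 4 * z ^ 3"
proof -
  have "{Mean_B2, Mean_R, Mu, Sig_Q, Sig_R} \<subseteq> intrinsic_params" by (simp add: intrinsic_params_def)
  note w = w_poly_eq[OF this, of z]
  show ?thesis
    unfolding poly_at_def length_poly_def w
    by (simp add: param_vec_def intrinsic_params_def dm_def)
qed

lemma sample_poly_eq: "poly_at sample_poly (pv UNIV) z = sample_const z * kp z"
proof -
  note w = w_poly_eq[OF subset_UNIV, of z]
  have a: "1 / a\<^sub>g = 12 * n\<^sub>r * (1 + \<sigma>)\<^sup>2 * (1 + m2)" by (simp add: a\<^sub>g_def)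
  show ?thesis
    unfolding poly_at_def sample_poly_def w sample_const_def kp_def a
    by (simp add: param_vec_def dm_def n\<^sub>r_def m2_def)
qed

lemma sample_const_ge_1: "1 \<le> z \<Longrightarrow> 1 \<le> sample_const z"
proof -
  assume z: "1 \<le> z"
  have "1 \<le> 1 / a\<^sub>g" using a\<^sub>g_pos a\<^sub>g_le by (simp add: field_simps)
  moreover have "1 \<le> 9 * dm * w ^ 4 * z\<^sup>2"
  proof -
    have "1 * 1 * 1 * 1 \<le> 9 * dm * w ^ 4 * z\<^sup>2"
      using dm_pos w_ge(1) z by (intro mult_mono one_le_power) auto
    then show ?thesis by simp
  qed
  ultimately have "1 * 1 * 1 * 1 * 1 * 1 * 1 \<le> 2304 * n\<^sub>r\<^sup>2 * dm ^ 4 * w ^ 4 * z\<^sup>2 * (1 / a\<^sub>g)\<^sup>2 * (9 * dm * w ^ 4 * z\<^sup>2)"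
    using n\<^sub>r_ge dm_pos w_ge(1) z by (intro mult_mono one_le_power) auto
  then show ?thesis by (simp add: sample_const_def)
qed

lemma thresholds_pos:
  assumes L0: "L0 \<in> U_ad P"
  defines "z \<equiv> 1 + cost D P L0"
  shows "0 < poly_at radius_poly (pv intrinsic_params) (1 / z)"
    and "0 < poly_at length_poly (pv intrinsic_params) z" and "0 < poly_at sample_poly (pv UNIV) z"
proof -
  have z: "1 \<le> z" using Ct_pos[OF L0] by (simp add: z_def cost_eq[OF L0])
  then have zpos: "0 < z" by linarith
  show "0 < poly_at radius_poly (pv intrinsic_params) (1 / z)" by (rule radius_poly_bounds(1)[OF zpos])
  show "0 < poly_at length_poly (pv intrinsic_params) z"
    unfolding length_poly_eq using zpos dm_pos w_ge(1) by simp
  show "0 < poly_at sample_poly (pv UNIV) z"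
    unfolding sample_poly_eq kp_def using zpos w_ge(1) K_pos sample_const_ge_1[OF z] by simp
qed

lemma policy_gradient_guarantee:
  fixes L0 :: "real^'n^'m" and \<epsilon> \<delta> \<eta> r :: real and l N :: nat
  assumes L0: "L0 \<in> U_ad P"
  defines "z \<equiv> 1 + cost D P L0"
  defines "pr \<equiv> poly_at radius_poly (pv intrinsic_params) (1 / z)"
    and "pl \<equiv> poly_at length_poly (pv intrinsic_params) z"
    and "ps \<equiv> poly_at sample_poly (pv UNIV) z"
  assumes \<epsilon>: "0 < \<epsilon>" and \<delta>: "0 < \<delta>"
    and \<eta>: "0 < \<eta>" "\<eta> < step_const (pv system_params) * (1 / z ^ 5)"
    and r: "0 < r" "r \<le> pr * \<epsilon>" and l: "pl * (1 / (\<epsilon> * r)) \<le> real l"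
    and N: "h_s_of ps \<epsilon> \<delta> \<eta> r l \<le> real N"
  defines "k \<equiv> num_steps D P L0 \<eta> \<epsilon>"
    and "good \<equiv> (\<lambda>\<omega> j. iterate N l r \<eta> L0 \<omega> j \<in> U_ad P \<and>
      cost D P (iterate N l r \<eta> L0 \<omega> j) - cost D P Lopt < \<epsilon>)"
  shows "1 - \<delta> \<le> measure (run_space D P r)
      {\<omega> \<in> space (run_space D P r). (\<exists>j \<le> nat (k + 1). good \<omega> j) \<and>
        (\<epsilon> \<le> cost D P L0 - cost D P Lopt \<longrightarrow> good \<omega> (nat (k + 1)))}"
proof -
  have C0: "cost D P L0 = Ct L0" and Copt: "cost D P Lopt = Ct Lopt"
    by (rule cost_eq[OF L0], rule cost_eq[OF L_opt(1)])
  have z: "z = 1 + Ct L0" "1 \<le> z" using Ct_pos[OF L0] by (simp_all add: z_def C0)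
  then have zpos: "0 < z" by linarith
  have wpos: "0 < w" using w_ge(1) by linarith
  have dpos: "0 < dm" using dm_pos by linarith
  have pl: "0 < pl" unfolding pl_def z_def by (rule thresholds_pos(2)[OF L0])
  have pl_eq: "pl = 48 * dm * w ^ 4 * z ^ 3" unfolding pl_def by (rule length_poly_eq)
  have ps_eq: "ps = sample_const z * kp z" unfolding ps_def by (rule sample_poly_eq)
  have sc: "1 \<le> sample_const z" by (rule sample_const_ge_1[OF z(2)])
  have kp: "0 < kp z" using K_pos wpos zpos by (simp add: kp_def)
  define \<Delta>0 where "\<Delta>0 = Ct L0 - Ct Lopt"
  have good: "good \<omega> j \<longleftrightarrow> iterate N l r \<eta> L0 \<omega> j \<in> U_ad P \<and> Ct (iterate N l r \<eta> L0 \<omega> j) - Ct Lopt < \<epsilon>" for \<omega> j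
    by (auto simp: good_def cost_eq Copt)
  interpret R: prob_space "RS r" by (rule prob_space_RS)
  let ?G = "{\<omega> \<in> space (run_space D P r). (\<exists>j \<le> nat (k + 1). good \<omega> j) \<and>
        (\<epsilon> \<le> cost D P L0 - cost D P Lopt \<longrightarrow> good \<omega> (nat (k + 1)))}"
  \<comment> \<open>In the first case the initial matrix is already good, while
    \<open>num_steps\<close> takes the logarithm of a number below 1, possibly 0. In the second the
    bound is trivial. In the third \<delta> \<le> 1 makes \<open>ln (1 / \<delta>)\<close>
    nonnegative.\<close>
  consider "\<Delta>0 < \<epsilon>" | "1 < \<delta>" | "\<epsilon> \<le> \<Delta>0" "\<delta> \<le> 1" by linarith
  then show "1 - \<delta> \<le> measure (run_space D P r) ?G"
  proof cases
    case 1
    then have "good \<omega> 0" for \<omega> using L0 by (simp add: good \<Delta>0_def)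
    then have "?G = space (RS r)" using 1 by (auto simp: C0 Copt \<Delta>0_def intro!: exI[of _ 0])
    then show ?thesis using R.prob_space \<delta> by simp
  next
    case 2
    then show ?thesis using measure_nonneg[of "RS r" ?G] by linarith
  next
    case 3
    define X where "X = (1 / rate \<eta>) * ln (\<Delta>0 / \<epsilon>)"
    have k: "k = \<lceil>X\<rceil>"
      by (simp add: k_def num_steps_def X_def rate_def opS_def state_cov_eq[OF L_opt(1)] C0 Copt \<Delta>0_def
          sigma_R_def \<rho>_def Rm_def)
    have X0: "0 \<le> X" using 3 \<epsilon> rate_pos[OF \<eta>(1)] by (simp add: X_def)
    \<comment> \<open>\<open>nat\<close> does not truncate because X \<ge> 0; the value lies between
      X + 1 and X + 2, the window that \<open>good_probability\<close> allows for the number of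
      steps.\<close>
    have rk: "real (nat (k + 1)) = of_int \<lceil>X\<rceil> + 1" using X0 by (simp add: k)
    have "608 * w ^ 6 * z ^ 5 * \<eta> < 1"
      using \<eta>(2) wpos zpos by (simp add: step_const_eq field_simps)
    moreover have "608 * w ^ 6 * z ^ 3 * \<eta> \<le> 608 * w ^ 6 * z ^ 5 * \<eta>"
      using z(2) wpos \<eta>(1) by (intro mult_right_mono mult_left_mono power_increasing) auto
    ultimately have \<eta>2: "608 * w ^ 6 * (1 + Ct L0) ^ 3 * \<eta> \<le> 1" by (simp add: z(1))
    have \<eta>1: "\<eta> \<le> 1"
    proof -
      have "1 * 1 * 1 * \<eta> \<le> 608 * w ^ 6 * (1 + Ct L0) ^ 3 * \<eta>"
        using w_ge(1) z \<eta>(1) by (intro mult_mono one_le_power) auto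
      then show ?thesis using \<eta>2 by linarith
    qed
    have r2: "912 * dm * w ^ 8 * (1 + Ct L0) ^ 4 * r \<le> \<epsilon>"
    proof -
      have "912 * dm * w ^ 8 * z ^ 4 * r \<le> 912 * dm * w ^ 8 * z ^ 4 * (pr * \<epsilon>)"
        using dpos wpos zpos by (intro mult_left_mono r) simp
      also have "\<dots> = (912 * dm * w ^ 8 * z ^ 4 * pr) * \<epsilon>" by simp
      also have "\<dots> \<le> 1 * \<epsilon>"
        using radius_poly_bounds(2)[OF zpos] \<epsilon> unfolding pr_def by (intro mult_right_mono) auto
      finally show ?thesis by (simp add: z(1))
    qed
    have er: "0 < \<epsilon> * r" using \<epsilon> r by simp
    have "0 < pl * (1 / (\<epsilon> * r))" using pl er by simp
    then have l0: "0 < l" using l by (cases l) simp_all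
    have l2: "48 * dm * w ^ 4 * (1 + Ct L0) ^ 3 \<le> \<epsilon> * r * real l"
      using l er unfolding z(1)[symmetric] pl_eq[symmetric] by (simp add: field_simps)
    define T where "T = ln (max 1 (ln (1 / \<epsilon>))) + ln (1 / \<delta>) + ln (1 / \<eta>) + ln (real l)"
    have "0 \<le> ln (max 1 (ln (1 / \<epsilon>)))" "0 \<le> ln (1 / \<delta>)" "0 \<le> ln (1 / \<eta>)" "0 \<le> ln (real l)"
      using 3 \<delta> \<eta>(1) \<eta>1 l0 by (simp_all add: ln_ge_zero)
    then have T0: "0 \<le> T" by (simp add: T_def)
    have "sample_const z * kp z ^ (4 * l) * ((real l)\<^sup>2 / (\<epsilon>\<^sup>2 * r\<^sup>2)) * T
      \<le> sample_const z ^ (4 * l) * kp z ^ (4 * l) * ((real l)\<^sup>2 / (\<epsilon>\<^sup>2 * r\<^sup>2)) * T"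
      using sc kp l0 T0 by (intro mult_right_mono self_le_power) auto
    also have "\<dots> = h_s_of ps \<epsilon> \<delta> \<eta> r l"
      by (simp add: h_s_of_def ps_eq T_def power_mult_distrib)
    also have "\<dots> \<le> real N" by (rule N)
    finally have N2: "sample_const (1 + Ct L0) * kp (1 + Ct L0) ^ (4 * l) * ((real l)\<^sup>2 / (\<epsilon>\<^sup>2 * r\<^sup>2)) * T \<le> real N"
      by (simp only: z(1))
    have "1 - \<delta> \<le> measure (RS r) {\<omega> \<in> space (RS r). iterate N l r \<eta> L0 \<omega> (nat (k + 1)) \<in> U_ad P
        \<and> Ct (iterate N l r \<eta> L0 \<omega> (nat (k + 1))) - Ct Lopt < \<epsilon>}"
    proof (rule good_probability[OF L0 \<epsilon> _ \<delta> 3(2) \<eta>(1) \<eta>2 r(1) r2 l0 l2 N2[unfolded T_def]])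
      show "\<epsilon> \<le> Ct L0 - Ct Lopt" using 3(1) by (simp add: \<Delta>0_def)
      show "real (nat (k + 1)) \<le> 1 / rate \<eta> * ln ((Ct L0 - Ct Lopt) / \<epsilon>) + 2"
        unfolding rk X_def[symmetric, unfolded \<Delta>0_def] by linarith
      show "1 / rate \<eta> * ln ((Ct L0 - Ct Lopt) / \<epsilon>) + 1 \<le> real (nat (k + 1))"
        unfolding rk X_def[symmetric, unfolded \<Delta>0_def] by linarith
    qed
    also have "{\<omega> \<in> space (RS r). iterate N l r \<eta> L0 \<omega> (nat (k + 1)) \<in> U_ad P
        \<and> Ct (iterate N l r \<eta> L0 \<omega> (nat (k + 1))) - Ct Lopt < \<epsilon>} = ?G"
      using 3(1) by (auto simp: good C0 Copt \<Delta>0_def)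
    finally show ?thesis .
  qed
qed

end

theorem theorem2:
  shows "\<exists>(c :: real^model_param \<Rightarrow> real) (poly_r :: poly_fun) (poly_l :: poly_fun) (poly_s :: poly_fun).
    real_polynomial_function poly_r \<and>
    real_polynomial_function poly_l \<and>
    real_polynomial_function poly_s \<and>
    (\<forall>(D :: (real^'n) measure) (P :: ('n::finite, 'm::finite) params measure) (\<sigma>0 :: real) (K :: real).
       lq_problem D P \<and>
       moments_stabilizable D P \<and>
       pos_def (Sigma0 D) \<and>
       0 \<le> \<sigma>0 \<and> sub_gaussian D \<sigma>0 \<and> 0 < K \<and> as_bounded P K \<longrightarrow>
       0 < c (param_vec D P \<sigma>0 K system_params) \<and>
       (\<forall>L0 \<in> U_ad P.
          let C = cost D P;
              Lopt = L_opt D P;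
              \<eta>_max = c (param_vec D P \<sigma>0 K system_params) * (1 / (1 + C L0) ^ 5);
              pr = poly_at poly_r (param_vec D P \<sigma>0 K intrinsic_params) (1 / (1 + C L0));
              pl = poly_at poly_l (param_vec D P \<sigma>0 K intrinsic_params) (1 + C L0);
              ps = poly_at poly_s (param_vec D P \<sigma>0 K UNIV) (1 + C L0)
          in 0 < pr \<and> 0 < pl \<and> 0 < ps \<and>
             (\<forall>(\<epsilon> :: real) (\<delta> :: real) (\<eta> :: real) (r :: real) (l :: nat) (N :: nat).
                0 < \<epsilon> \<and> 0 < \<delta> \<and> 0 < \<eta> \<and> \<eta> < \<eta>_max \<and>
                0 < r \<and> r \<le> pr * \<epsilon> \<and>
                pl * (1 / (\<epsilon> * r)) \<le> real l \<and>
                h_s_of ps \<epsilon> \<delta> \<eta> r l \<le> real N \<longrightarrow>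
                (let k = num_steps D P L0 \<eta> \<epsilon>;
                     good = (\<lambda>\<omega> j. iterate N l r \<eta> L0 \<omega> j \<in> U_ad P \<and>
                                    C (iterate N l r \<eta> L0 \<omega> j) - C Lopt < \<epsilon>)
                 in 1 - \<delta> \<le> measure (run_space D P r)
                      {\<omega> \<in> space (run_space D P r).
                         (\<exists>j \<le> nat (k + 1). good \<omega> j) \<and>
                         (\<epsilon> \<le> C L0 - C Lopt \<longrightarrow> good \<omega> (nat (k + 1)))}))))"
proof (rule exI[of _ step_const], rule exI[of _ radius_poly], rule exI[of _ length_poly],
    rule exI[of _ sample_poly], intro conjI real_polynomial_function_thresholds allI impI, goal_cases)
  case (1 D P \<sigma>0 K)
  then interpret lq_sub_gaussian D P K \<sigma>0 by unfold_locales auto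
  show ?case unfolding step_const_eq using w_ge(1) by simp
next
  case (2 D P \<sigma>0 K)
  then interpret lq_sub_gaussian D P K \<sigma>0 by unfold_locales auto
  show ?case
    unfolding Let_def
  proof (intro ballI conjI allI impI, goal_cases)
    case (1 L0)
    then show ?case by (rule thresholds_pos(1))
  next
    case (2 L0)
    then show ?case by (rule thresholds_pos(2))
  next
    case (3 L0)
    then show ?case by (rule thresholds_pos(3))
  next
    case (4 L0 \<epsilon> \<delta> \<eta> r l N)
    then show ?case by (elim conjE) (rule policy_gradient_guarantee)
  qed
qed

end
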